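(* There is a 2-category $\mathbf{Tricat}(2)_2'$ with - 0-cells: those doubly degenerate tricategories with $\boxtimes=\otimes$, with monoid $I$ (the unit object of $\otimes$) and isomorphism $I\cong I$ the identity, with all dual pairs equal to $\mathbf I=(I,I,l,l^{-1})$, and with all isomorphisms given by unique coherence isomorphisms; - 1-cells: those (weak) functors with all dual pairs equal to $\mathbf I$ and all isomorphisms given by unique coherence isomorphisms; - 2-cells: those lax transformations with distinguished object $I$ and all constraints given by unique coherence isomorphisms.
   Context: Tricategories, weak functors and lax transformations are in Gurski's fully algebraic version of the Gordon–Power–Street definition. A tricategory is doubly degenerate if it has exactly one 0-cell and exactly one 1-cell. It then consists of: a monoidal category $(B,\otimes,U,a,l,r)$ (its one-object hom-bicategory: objects are 2-cells, morphisms are 3-cells, $\otimes$ is composition along the 1-cell); a monoidal functor $\boxtimes:B\times B\to B$ (composition); a monoid $I$ in $B$ with an isomorphism of monoids $I\cong U$ (units); dual pairs $(A,A^\cdot),(L,L^\cdot),(R,R^\cdot)$ with invertible units and counits and natural isomorphisms $A\otimes((X\boxtimes Y)\boxtimes Z)\cong(X\boxtimes(Y\boxtimes Z))\otimes A$, $L\otimes(I\boxtimes X)\cong X\otimes L$, $R\otimes(X\boxtimes I)\cong X\otimes R$ and similarly for the duals (the adjoint equivalences $\mathbf a,\mathbf l,\mathbf r$); and isomorphisms $\pi,\mu,\lambda,\rho$; all subject to the tricategory axioms. A weak functor $H:B\to B'$ consists of a monoidal functor $H$; dual pairs with objects $\chi,\iota$ and natural isomorphisms $\chi\otimes'(HX\boxtimes'HY)\cong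 H(X\boxtimes Y)\otimes'\chi$, $\iota\otimes'I'\cong HI\otimes'\iota$ (and duals); and isomorphisms $\omega,\gamma,\delta$; subject to the weak functor axioms. A lax transformation $H\Rightarrow K$ consists of a distinguished object $\alpha\in B'$, natural maps $\alpha\otimes'(U'\boxtimes'HX)\to(KX\boxtimes'U')\otimes'\alpha$, and constraints $\Pi,M$, subject to the transformation axioms; when $\alpha$ is the unit and $\boxtimes'=\otimes'$, the natural maps amount to components $HX\to KX$, which are not themselves constraints. A dual pair in a monoidal category consists of objects $X,X^\cdot$ with maps $\varepsilon:X\otimes X^\cdot\to I$, $\eta:I\to X^\cdot\otimes X$ satisfying the triangle identities. In any monoidal category with unit $I$, $\mathbf I$ denotes the dual pair $(I,I,l,l^{-1})$. "Unique coherence isomorphisms" are those canonically given by the structure constraints. Composition is that of the underlying monoidal functors and monoidal transformations, with the dual pairs again taken to be $\mathbf I$ and the constraints again taken to be the coherence isomorphisms. *)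

theory Defs
  imports Main "HOL-Library.FuncSet"
begin

section \<open>Monoidal categories and monoidal functors\<close>

record ('o, 'm) moncat =
  Ob :: "'o set"
  Ar :: "'m set"
  Dom :: "'m \<Rightarrow> 'o"
  Cod :: "'m \<Rightarrow> 'o"
  Idn :: "'o \<Rightarrow> 'm"
  Cmp :: "'m \<Rightarrow> 'm \<Rightarrow> 'm"  (infixl "\<cdot>\<index>" 65)
  TO :: "'o \<Rightarrow> 'o \<Rightarrow> 'o"  (infixr "\<otimes>\<index>" 70)
  TA :: "'m \<Rightarrow> 'm \<Rightarrow> 'm"  (infixr "\<oplus>\<index>" 70)
  Unt :: "'o"
  As :: "'o \<Rightarrow> 'o \<Rightarrow> 'o \<Rightarrow> 'm"
  Lu :: "'o \<Rightarrow> 'm"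
  Ru :: "'o \<Rightarrow> 'm"

text \<open>
  \<open>g \<cdot>\<^bsub>C\<^esub> f\<close> is ``\<open>g\<close> after \<open>f\<close>''; \<open>\<otimes>\<close> and \<open>\<oplus>\<close> are the object and the arrow part of the
  tensor functor (\<open>\<oplus>\<close> has nothing to do with direct sums).
\<close>

definition hom :: "('o, 'm) moncat \<Rightarrow> 'o \<Rightarrow> 'o \<Rightarrow> 'm set" where
  "hom C X Y = {f \<in> Ar C. Dom C f = X \<and> Cod C f = Y}"

definition is_inverse :: "('o, 'm) moncat \<Rightarrow> 'm \<Rightarrow> 'm \<Rightarrow> bool" where
  "is_inverse C f g \<longleftrightarrow> f \<in> Ar C \<and> g \<in> hom C (Cod C f) (Dom C f) \<and>
     g \<cdot>\<^bsub>C\<^esub> f = Idn C (Dom C f) \<and> f \<cdot>\<^bsub>C\<^esub> g = Idn C (Cod C f)"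

definition iso :: "('o, 'm) moncat \<Rightarrow> 'o \<Rightarrow> 'o \<Rightarrow> 'm set" where
  "iso C X Y = {f \<in> hom C X Y. \<exists>g. is_inverse C f g}"

definition iinv :: "('o, 'm) moncat \<Rightarrow> 'm \<Rightarrow> 'm" where
  "iinv C f = (THE g. is_inverse C f g)"

locale monoidal_category =
  fixes C :: "('o, 'm) moncat" (structure)
  assumes dom_cod: "f \<in> Ar C \<Longrightarrow> Dom C f \<in> Ob C \<and> Cod C f \<in> Ob C"
    and idn: "X \<in> Ob C \<Longrightarrow> Idn C X \<in> hom C X X"
    and cmp: "\<lbrakk>f \<in> hom C X Y; g \<in> hom C Y Z\<rbrakk> \<Longrightarrow> g \<cdot> f \<in> hom C X Z"
    and cmp_idn: "f \<in> hom C X Y \<Longrightarrow> f \<cdot> Idn C X = f \<and> Idn C Y \<cdot> f = f"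
    and cmp_assoc: "\<lbrakk>f \<in> hom C W X; g \<in> hom C X Y; h \<in> hom C Y Z\<rbrakk>
        \<Longrightarrow> (h \<cdot> g) \<cdot> f = h \<cdot> (g \<cdot> f)"
    and unit_ob: "Unt C \<in> Ob C"
    and tensor_ob: "\<lbrakk>X \<in> Ob C; Y \<in> Ob C\<rbrakk> \<Longrightarrow> X \<otimes> Y \<in> Ob C"
    and tensor_ar: "\<lbrakk>f \<in> hom C X X'; g \<in> hom C Y Y'\<rbrakk> \<Longrightarrow> f \<oplus> g \<in> hom C (X \<otimes> Y) (X' \<otimes> Y')"
    and tensor_idn: "\<lbrakk>X \<in> Ob C; Y \<in> Ob C\<rbrakk> \<Longrightarrow> Idn C X \<oplus> Idn C Y = Idn C (X \<otimes> Y)"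
    and tensor_cmp: "\<lbrakk>f \<in> hom C X X'; f' \<in> hom C X' X''; g \<in> hom C Y Y'; g' \<in> hom C Y' Y''\<rbrakk>
        \<Longrightarrow> (f' \<cdot> f) \<oplus> (g' \<cdot> g) = (f' \<oplus> g') \<cdot> (f \<oplus> g)"
    and assoc_iso: "\<lbrakk>X \<in> Ob C; Y \<in> Ob C; Z \<in> Ob C\<rbrakk>
        \<Longrightarrow> As C X Y Z \<in> iso C ((X \<otimes> Y) \<otimes> Z) (X \<otimes> (Y \<otimes> Z))"
    and lunit_iso: "X \<in> Ob C \<Longrightarrow> Lu C X \<in> iso C (Unt C \<otimes> X) X"
    and runit_iso: "X \<in> Ob C \<Longrightarrow> Ru C X \<in> iso C (X \<otimes> Unt C) X"
    and assoc_nat: "\<lbrakk>f \<in> hom C X X'; g \<in> hom C Y Y'; h \<in> hom C Z Z'\<rbrakk>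
        \<Longrightarrow> As C X' Y' Z' \<cdot> ((f \<oplus> g) \<oplus> h) = (f \<oplus> (g \<oplus> h)) \<cdot> As C X Y Z"
    and lunit_nat: "f \<in> hom C X Y \<Longrightarrow> Lu C Y \<cdot> (Idn C (Unt C) \<oplus> f) = f \<cdot> Lu C X"
    and runit_nat: "f \<in> hom C X Y \<Longrightarrow> Ru C Y \<cdot> (f \<oplus> Idn C (Unt C)) = f \<cdot> Ru C X"
    and pentagon: "\<lbrakk>W \<in> Ob C; X \<in> Ob C; Y \<in> Ob C; Z \<in> Ob C\<rbrakk>
        \<Longrightarrow> As C W X (Y \<otimes> Z) \<cdot> As C (W \<otimes> X) Y Z
          = (Idn C W \<oplus> As C X Y Z) \<cdot> (As C W (X \<otimes> Y) Z \<cdot> (As C W X Y \<oplus> Idn C Z))"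
    and triangle: "\<lbrakk>X \<in> Ob C; Y \<in> Ob C\<rbrakk>
        \<Longrightarrow> (Idn C X \<oplus> Lu C Y) \<cdot> As C X (Unt C) Y = Ru C X \<oplus> Idn C Y"

text \<open>
  HOL functions are total.  Operations are required to be \<open>undefined\<close> outside their domain, so that
  each mathematical structure is represented by exactly one record; equality of 1-cells and of
  2-cells below is then equality of the mathematical objects.
\<close>

definition extensional2 :: "'a set \<Rightarrow> ('a \<Rightarrow> 'a \<Rightarrow> 'b) \<Rightarrow> bool" where
  "extensional2 S f \<longleftrightarrow> (\<forall>x y. \<not> (x \<in> S \<and> y \<in> S) \<longrightarrow> f x y = undefined)"

definition moncat_extensional :: "('o, 'm) moncat \<Rightarrow> bool" where
  "moncat_extensional C \<longleftrightarrow>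
     Dom C \<in> extensional (Ar C) \<and> Cod C \<in> extensional (Ar C) \<and> Idn C \<in> extensional (Ob C) \<and>
     (\<forall>g f. \<not> (f \<in> Ar C \<and> g \<in> Ar C \<and> Cod C f = Dom C g) \<longrightarrow> g \<cdot>\<^bsub>C\<^esub> f = undefined) \<and>
     extensional2 (Ob C) (TO C) \<and> extensional2 (Ar C) (TA C) \<and>
     (\<forall>X Y Z. \<not> (X \<in> Ob C \<and> Y \<in> Ob C \<and> Z \<in> Ob C) \<longrightarrow> As C X Y Z = undefined) \<and>
     Lu C \<in> extensional (Ob C) \<and> Ru C \<in> extensional (Ob C)"

definition prod_cat :: "('o, 'm) moncat \<Rightarrow> ('p, 'n) moncat \<Rightarrow> ('o \<times> 'p, 'm \<times> 'n) moncat" where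
  "prod_cat C D = \<lparr>
     Ob = Ob C \<times> Ob D, Ar = Ar C \<times> Ar D,
     Dom = map_prod (Dom C) (Dom D), Cod = map_prod (Cod C) (Cod D),
     Idn = map_prod (Idn C) (Idn D),
     Cmp = (\<lambda>(g, g') (f, f'). (g \<cdot>\<^bsub>C\<^esub> f, g' \<cdot>\<^bsub>D\<^esub> f')),
     TO = (\<lambda>(X, X') (Y, Y'). (X \<otimes>\<^bsub>C\<^esub> Y, X' \<otimes>\<^bsub>D\<^esub> Y')),
     TA = (\<lambda>(f, f') (g, g'). (f \<oplus>\<^bsub>C\<^esub> g, f' \<oplus>\<^bsub>D\<^esub> g')),
     Unt = (Unt C, Unt D),
     As = (\<lambda>(X, X') (Y, Y') (Z, Z'). (As C X Y Z, As D X' Y' Z')),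
     Lu = map_prod (Lu C) (Lu D), Ru = map_prod (Ru C) (Ru D)\<rparr>"

definition one_cat :: "(unit, unit) moncat" where
  "one_cat = \<lparr>Ob = UNIV, Ar = UNIV, Dom = (\<lambda>_. ()), Cod = (\<lambda>_. ()), Idn = (\<lambda>_. ()),
     Cmp = (\<lambda>_ _. ()), TO = (\<lambda>_ _. ()), TA = (\<lambda>_ _. ()), Unt = (),
     As = (\<lambda>_ _ _. ()), Lu = (\<lambda>_. ()), Ru = (\<lambda>_. ())\<rparr>"

record ('o, 'm, 'p, 'n) monfun =
  FO :: "'o \<Rightarrow> 'p"
  FA :: "'m \<Rightarrow> 'n"
  FP :: "'o \<Rightarrow> 'o \<Rightarrow> 'n"
  FU :: "'n"

text \<open>Monoidal functors are strong: \<open>FP F X Y : FX \<otimes> FY \<rightarrow> F(X \<otimes> Y)\<close> and \<open>FU F : U \<rightarrow> FU\<close> are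
  isomorphisms.\<close>

locale monoidal_functor =
  fixes C :: "('o, 'm) moncat" and D :: "('p, 'n) moncat" and F :: "('o, 'm, 'p, 'n) monfun"
  assumes ext: "FO F \<in> extensional (Ob C)" "FA F \<in> extensional (Ar C)"
      "extensional2 (Ob C) (FP F)"
    and ob: "X \<in> Ob C \<Longrightarrow> FO F X \<in> Ob D"
    and ar: "f \<in> hom C X Y \<Longrightarrow> FA F f \<in> hom D (FO F X) (FO F Y)"
    and idn: "X \<in> Ob C \<Longrightarrow> FA F (Idn C X) = Idn D (FO F X)"
    and cmp: "\<lbrakk>f \<in> hom C X Y; g \<in> hom C Y Z\<rbrakk> \<Longrightarrow> FA F (g \<cdot>\<^bsub>C\<^esub> f) = FA F g \<cdot>\<^bsub>D\<^esub> FA F f"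
    and phi_iso: "\<lbrakk>X \<in> Ob C; Y \<in> Ob C\<rbrakk>
        \<Longrightarrow> FP F X Y \<in> iso D (FO F X \<otimes>\<^bsub>D\<^esub> FO F Y) (FO F (X \<otimes>\<^bsub>C\<^esub> Y))"
    and phi0_iso: "FU F \<in> iso D (Unt D) (FO F (Unt C))"
    and phi_nat: "\<lbrakk>f \<in> hom C X X'; g \<in> hom C Y Y'\<rbrakk>
        \<Longrightarrow> FA F (f \<oplus>\<^bsub>C\<^esub> g) \<cdot>\<^bsub>D\<^esub> FP F X Y = FP F X' Y' \<cdot>\<^bsub>D\<^esub> (FA F f \<oplus>\<^bsub>D\<^esub> FA F g)"
    and phi_assoc: "\<lbrakk>X \<in> Ob C; Y \<in> Ob C; Z \<in> Ob C\<rbrakk>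
        \<Longrightarrow> FA F (As C X Y Z) \<cdot>\<^bsub>D\<^esub> (FP F (X \<otimes>\<^bsub>C\<^esub> Y) Z \<cdot>\<^bsub>D\<^esub> (FP F X Y \<oplus>\<^bsub>D\<^esub> Idn D (FO F Z)))
          = FP F X (Y \<otimes>\<^bsub>C\<^esub> Z) \<cdot>\<^bsub>D\<^esub> ((Idn D (FO F X) \<oplus>\<^bsub>D\<^esub> FP F Y Z) \<cdot>\<^bsub>D\<^esub>
              As D (FO F X) (FO F Y) (FO F Z))"
    and phi_lunit: "X \<in> Ob C
        \<Longrightarrow> FA F (Lu C X) \<cdot>\<^bsub>D\<^esub> (FP F (Unt C) X \<cdot>\<^bsub>D\<^esub> (FU F \<oplus>\<^bsub>D\<^esub> Idn D (FO F X))) = Lu D (FO F X)"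
    and phi_runit: "X \<in> Ob C
        \<Longrightarrow> FA F (Ru C X) \<cdot>\<^bsub>D\<^esub> (FP F X (Unt C) \<cdot>\<^bsub>D\<^esub> (Idn D (FO F X) \<oplus>\<^bsub>D\<^esub> FU F)) = Ru D (FO F X)"

definition id_fun :: "('o, 'm) moncat \<Rightarrow> ('o, 'm, 'o, 'm) monfun" where
  "id_fun C = \<lparr>
     FO = restrict (\<lambda>X. X) (Ob C), FA = restrict (\<lambda>f. f) (Ar C),
     FP = (\<lambda>X Y. if X \<in> Ob C \<and> Y \<in> Ob C then Idn C (X \<otimes>\<^bsub>C\<^esub> Y) else undefined),
     FU = Idn C (Unt C)\<rparr>"

definition comp_fun :: "('o, 'm) moncat \<Rightarrow> ('q, 'k) moncat \<Rightarrow> ('p, 'n, 'q, 'k) monfun \<Rightarrow>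
    ('o, 'm, 'p, 'n) monfun \<Rightarrow> ('o, 'm, 'q, 'k) monfun" where
  "comp_fun C E G F = \<lparr>
     FO = restrict (\<lambda>X. FO G (FO F X)) (Ob C), FA = restrict (\<lambda>f. FA G (FA F f)) (Ar C),
     FP = (\<lambda>X Y. if X \<in> Ob C \<and> Y \<in> Ob C
       then FA G (FP F X Y) \<cdot>\<^bsub>E\<^esub> FP G (FO F X) (FO F Y) else undefined),
     FU = FA G (FU F) \<cdot>\<^bsub>E\<^esub> FU G\<rparr>"

definition pair_fun :: "('o, 'm) moncat \<Rightarrow> ('o, 'm, 'p, 'n) monfun \<Rightarrow> ('o, 'm, 'q, 'k) monfun \<Rightarrow>
    ('o, 'm, 'p \<times> 'q, 'n \<times> 'k) monfun" where
  "pair_fun C F G = \<lparr>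
     FO = restrict (\<lambda>X. (FO F X, FO G X)) (Ob C), FA = restrict (\<lambda>f. (FA F f, FA G f)) (Ar C),
     FP = (\<lambda>X Y. if X \<in> Ob C \<and> Y \<in> Ob C then (FP F X Y, FP G X Y) else undefined),
     FU = (FU F, FU G)\<rparr>"

definition fst_fun :: "('o, 'm) moncat \<Rightarrow> ('p, 'n) moncat \<Rightarrow> ('o \<times> 'p, 'm \<times> 'n, 'o, 'm) monfun"
  where
  "fst_fun C D = \<lparr>
     FO = restrict fst (Ob C \<times> Ob D), FA = restrict fst (Ar C \<times> Ar D),
     FP = (\<lambda>X Y. if X \<in> Ob C \<times> Ob D \<and> Y \<in> Ob C \<times> Ob D
       then Idn C (fst X \<otimes>\<^bsub>C\<^esub> fst Y) else undefined),
     FU = Idn C (Unt C)\<rparr>"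

definition snd_fun :: "('o, 'm) moncat \<Rightarrow> ('p, 'n) moncat \<Rightarrow> ('o \<times> 'p, 'm \<times> 'n, 'p, 'n) monfun"
  where
  "snd_fun C D = \<lparr>
     FO = restrict snd (Ob C \<times> Ob D), FA = restrict snd (Ar C \<times> Ar D),
     FP = (\<lambda>X Y. if X \<in> Ob C \<times> Ob D \<and> Y \<in> Ob C \<times> Ob D
       then Idn D (snd X \<otimes>\<^bsub>D\<^esub> snd Y) else undefined),
     FU = Idn D (Unt D)\<rparr>"

text \<open>The constant functor \<open>C \<rightarrow> D\<close> at a monoid \<open>(X, m, e)\<close> of \<open>D\<close>, i.e. \<open>C \<rightarrow> 1 \<rightarrow> D\<close>.\<close>

definition const_fun :: "('o, 'm) moncat \<Rightarrow> ('p, 'n) moncat \<Rightarrow> 'p \<Rightarrow> 'n \<Rightarrow> 'n \<Rightarrow>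
    ('o, 'm, 'p, 'n) monfun" where
  "const_fun C D X m e = \<lparr>
     FO = restrict (\<lambda>_. X) (Ob C), FA = restrict (\<lambda>_. Idn D X) (Ar C),
     FP = (\<lambda>Y Z. if Y \<in> Ob C \<and> Z \<in> Ob C then m else undefined), FU = e\<rparr>"

definition monoid :: "('o, 'm) moncat \<Rightarrow> 'o \<Rightarrow> 'm \<Rightarrow> 'm \<Rightarrow> bool" where
  "monoid C X m e \<longleftrightarrow> X \<in> Ob C \<and> m \<in> hom C (X \<otimes>\<^bsub>C\<^esub> X) X \<and> e \<in> hom C (Unt C) X \<and>
     m \<cdot>\<^bsub>C\<^esub> (m \<oplus>\<^bsub>C\<^esub> Idn C X) = m \<cdot>\<^bsub>C\<^esub> ((Idn C X \<oplus>\<^bsub>C\<^esub> m) \<cdot>\<^bsub>C\<^esub> As C X X X) \<and>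
     m \<cdot>\<^bsub>C\<^esub> (e \<oplus>\<^bsub>C\<^esub> Idn C X) = Lu C X \<and> m \<cdot>\<^bsub>C\<^esub> (Idn C X \<oplus>\<^bsub>C\<^esub> e) = Ru C X"

definition monoid_iso :: "('o, 'm) moncat \<Rightarrow> 'o \<Rightarrow> 'm \<Rightarrow> 'm \<Rightarrow> 'o \<Rightarrow> 'm \<Rightarrow> 'm \<Rightarrow> 'm \<Rightarrow> bool" where
  "monoid_iso C X m e X' m' e' v \<longleftrightarrow> v \<in> iso C X X' \<and>
     v \<cdot>\<^bsub>C\<^esub> m = m' \<cdot>\<^bsub>C\<^esub> (v \<oplus>\<^bsub>C\<^esub> v) \<and> v \<cdot>\<^bsub>C\<^esub> e = e'"

section \<open>Pasting in a one-object bicategory\<close>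

text \<open>
  A composable string of 1-cells of the one-object bicategory given by \<open>C\<close> is a list of objects.
  It is written in the order of composition, so the 1-cell applied first comes last, and its
  composite \<open>tens\<close> is bracketed to the right.  A pasting cell \<open>(xs, f, ys)\<close> is a morphism
  \<open>f : tens xs \<rightarrow> tens ys\<close>.  \<open>paste C xs c ys\<close> whiskers the cell \<open>c\<close> by the strings \<open>xs\<close> and \<open>ys\<close>
  and \<open>chain C [c\<^sub>1, \<dots>, c\<^sub>n]\<close> is the vertical composite, \<open>c\<^sub>1\<close> first.
\<close>

type_synonym ('o, 'm) pcell = "'o list \<times> 'm \<times> 'o list"

fun tens :: "('o, 'm) moncat \<Rightarrow> 'o list \<Rightarrow> 'o" where
  "tens C [] = Unt C"
| "tens C [X] = X"
| "tens C (X # Y # Ys) = X \<otimes>\<^bsub>C\<^esub> tens C (Y # Ys)"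

text \<open>The coherence isomorphism \<open>tens (xs @ ys) \<rightarrow> tens xs \<otimes> tens ys\<close>.\<close>

fun split :: "('o, 'm) moncat \<Rightarrow> 'o list \<Rightarrow> 'o list \<Rightarrow> 'm" where
  "split C [] ys = iinv C (Lu C (tens C ys))"
| "split C [X] [] = iinv C (Ru C X)"
| "split C [X] (Y # ys) = Idn C (X \<otimes>\<^bsub>C\<^esub> tens C (Y # ys))"
| "split C (X # X' # xs) ys =
     iinv C (As C X (tens C (X' # xs)) (tens C ys)) \<cdot>\<^bsub>C\<^esub> (Idn C X \<oplus>\<^bsub>C\<^esub> split C (X' # xs) ys)"

fun paste :: "('o, 'm) moncat \<Rightarrow> 'o list \<Rightarrow> ('o, 'm) pcell \<Rightarrow> 'o list \<Rightarrow> ('o, 'm) pcell" where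
  "paste C xs (ms, f, ns) ys =
     (xs @ ms @ ys,
      iinv C (split C xs (ns @ ys)) \<cdot>\<^bsub>C\<^esub>
        ((Idn C (tens C xs) \<oplus>\<^bsub>C\<^esub>
           (iinv C (split C ns ys) \<cdot>\<^bsub>C\<^esub> ((f \<oplus>\<^bsub>C\<^esub> Idn C (tens C ys)) \<cdot>\<^bsub>C\<^esub> split C ms ys))) \<cdot>\<^bsub>C\<^esub>
         split C xs (ms @ ys)),
      xs @ ns @ ys)"

fun chain :: "('o, 'm) moncat \<Rightarrow> ('o, 'm) pcell list \<Rightarrow> ('o, 'm) pcell" where
  "chain C [c] = c"
| "chain C (c # d # cs) =
     (fst c, fst (snd (chain C (d # cs))) \<cdot>\<^bsub>C\<^esub> fst (snd c), snd (snd (chain C (d # cs))))"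

fun inv_cell :: "('o, 'm) moncat \<Rightarrow> ('o, 'm) pcell \<Rightarrow> ('o, 'm) pcell" where
  "inv_cell C (xs, f, ys) = (ys, iinv C f, xs)"

text \<open>
  \<open>fun_split\<close> is the constraint \<open>tens (map F xs) \<rightarrow> F (tens xs)\<close> of a monoidal functor, and
  \<open>fun_cell\<close> is the image of a pasting cell.
\<close>

fun fun_split :: "('o, 'm) moncat \<Rightarrow> ('p, 'n) moncat \<Rightarrow> ('o, 'm, 'p, 'n) monfun \<Rightarrow> 'o list \<Rightarrow> 'n"
  where
  "fun_split C D F [] = FU F"
| "fun_split C D F [X] = Idn D (FO F X)"
| "fun_split C D F (X # Y # Ys) =
     FP F X (tens C (Y # Ys)) \<cdot>\<^bsub>D\<^esub> (Idn D (FO F X) \<oplus>\<^bsub>D\<^esub> fun_split C D F (Y # Ys))"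

fun fun_cell :: "('o, 'm) moncat \<Rightarrow> ('p, 'n) moncat \<Rightarrow> ('o, 'm, 'p, 'n) monfun \<Rightarrow>
    ('o, 'm) pcell \<Rightarrow> ('p, 'n) pcell" where
  "fun_cell C D F (xs, f, ys) =
     (map (FO F) xs, iinv D (fun_split C D F ys) \<cdot>\<^bsub>D\<^esub> (FA F f \<cdot>\<^bsub>D\<^esub> fun_split C D F xs),
      map (FO F) ys)"

text \<open>For strings of equal lengths only.\<close>

fun pair_cell :: "('o, 'm) pcell \<Rightarrow> ('p, 'n) pcell \<Rightarrow> ('o \<times> 'p, 'm \<times> 'n) pcell" where
  "pair_cell (xs, f, ys) (xs', f', ys') = (zip xs xs', (f, f'), zip ys ys')"

text \<open>
  Given isomorphisms \<open>u\<^sub>i : X\<^sub>i \<rightarrow> U\<close>, \<open>collapse C [u\<^sub>1, \<dots>, u\<^sub>n] : tens [X\<^sub>1, \<dots>, X\<^sub>n] \<rightarrow> U\<close>; and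
  \<open>coh_cell C us vs\<close> is the isomorphism between the composites of two strings of objects that are
  identified with \<open>U\<close> by \<open>us\<close> and \<open>vs\<close>.  When every \<open>u\<^sub>i\<close> and \<open>v\<^sub>j\<close> is built from structure
  constraints, it is the coherence isomorphism between the two strings.
\<close>

fun collapse :: "('o, 'm) moncat \<Rightarrow> 'm list \<Rightarrow> 'm" where
  "collapse C [] = Idn C (Unt C)"
| "collapse C [u] = u"
| "collapse C (u # v # us) = Lu C (Unt C) \<cdot>\<^bsub>C\<^esub> (u \<oplus>\<^bsub>C\<^esub> collapse C (v # us))"

definition coh_cell :: "('o, 'm) moncat \<Rightarrow> 'm list \<Rightarrow> 'm list \<Rightarrow> ('o, 'm) pcell" where
  "coh_cell C us vs =
     (map (Dom C) us, iinv C (collapse C vs) \<cdot>\<^bsub>C\<^esub> collapse C us, map (Dom C) vs)"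

definition coh :: "('o, 'm) moncat \<Rightarrow> 'm list \<Rightarrow> 'm list \<Rightarrow> 'm" where
  "coh C us vs = fst (snd (coh_cell C us vs))"

definition units_cell :: "('o, 'm) moncat \<Rightarrow> nat \<Rightarrow> nat \<Rightarrow> ('o, 'm) pcell" where
  "units_cell C m n = coh_cell C (replicate m (Idn C (Unt C))) (replicate n (Idn C (Unt C)))"

definition id_cell :: "('o, 'm) moncat \<Rightarrow> 'o \<Rightarrow> ('o, 'm) pcell" where
  "id_cell C X = ([X], Idn C X, [X])"

definition swap_cell :: "('o, 'm) moncat \<Rightarrow> 'o \<Rightarrow> ('o, 'm) pcell" where
  "swap_cell C X = ([Unt C, X], iinv C (Ru C X) \<cdot>\<^bsub>C\<^esub> Lu C X, [X, Unt C])"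

section \<open>Transformations and adjoint equivalences between one-object bicategories\<close>

text \<open>
  A monoidal functor is a functor of one-object bicategories.  A lax transformation between two of
  them consists of an object \<open>A\<close> and a natural family \<open>A \<otimes> FX \<rightarrow> GX \<otimes> A\<close>.
\<close>

locale lax_trans =
  fixes C :: "('o, 'm) moncat" and D :: "('p, 'n) moncat"
    and F G :: "('o, 'm, 'p, 'n) monfun" and A :: 'p and n :: "'o \<Rightarrow> 'n"
  assumes ob: "A \<in> Ob D"
    and ext: "n \<in> extensional (Ob C)"
    and hom: "X \<in> Ob C \<Longrightarrow> n X \<in> hom D (A \<otimes>\<^bsub>D\<^esub> FO F X) (FO G X \<otimes>\<^bsub>D\<^esub> A)"
    and nat: "f \<in> hom C X Y
        \<Longrightarrow> (FA G f \<oplus>\<^bsub>D\<^esub> Idn D A) \<cdot>\<^bsub>D\<^esub> n X = n Y \<cdot>\<^bsub>D\<^esub> (Idn D A \<oplus>\<^bsub>D\<^esub> FA F f)"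
    and tensor: "\<lbrakk>X \<in> Ob C; Y \<in> Ob C\<rbrakk> \<Longrightarrow>
        chain D
          [paste D [] ([A, FO F X], n X, [FO G X, A]) [FO F Y],
           paste D [FO G X] ([A, FO F Y], n Y, [FO G Y, A]) [],
           paste D [] ([FO G X, FO G Y], FP G X Y, [FO G (X \<otimes>\<^bsub>C\<^esub> Y)]) [A]]
      = chain D
          [paste D [A] ([FO F X, FO F Y], FP F X Y, [FO F (X \<otimes>\<^bsub>C\<^esub> Y)]) [],
           ([A, FO F (X \<otimes>\<^bsub>C\<^esub> Y)], n (X \<otimes>\<^bsub>C\<^esub> Y), [FO G (X \<otimes>\<^bsub>C\<^esub> Y), A])]"
    and unit:
      "chain D
          [paste D [A] ([], FU F, [FO F (Unt C)]) [],
           ([A, FO F (Unt C)], n (Unt C), [FO G (Unt C), A])]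
      = paste D [] ([], FU G, [FO G (Unt C)]) [A]"

record ('o, 'm) dual_pair =
  dob :: 'o
  dob' :: 'o
  eps :: 'm
  eta :: 'm

definition eps_cell :: "('o, 'm) dual_pair \<Rightarrow> ('o, 'm) pcell" where
  "eps_cell P = ([dob P, dob' P], eps P, [])"

definition eta_cell :: "('o, 'm) dual_pair \<Rightarrow> ('o, 'm) pcell" where
  "eta_cell P = ([], eta P, [dob' P, dob P])"

definition is_dual_pair :: "('o, 'm) moncat \<Rightarrow> ('o, 'm) dual_pair \<Rightarrow> bool" where
  "is_dual_pair C P \<longleftrightarrow> dob P \<in> Ob C \<and> dob' P \<in> Ob C \<and>
     eps P \<in> hom C (dob P \<otimes>\<^bsub>C\<^esub> dob' P) (Unt C) \<and> eta P \<in> hom C (Unt C) (dob' P \<otimes>\<^bsub>C\<^esub> dob P) \<and>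
     chain C [paste C [dob P] (eta_cell P) [], paste C [] (eps_cell P) [dob P]]
       = id_cell C (dob P) \<and>
     chain C [paste C [] (eta_cell P) [dob' P], paste C [dob' P] (eps_cell P) []]
       = id_cell C (dob' P)"

definition unit_dual :: "('o, 'm) moncat \<Rightarrow> ('o, 'm) dual_pair" where
  "unit_dual C = \<lparr>dob = Unt C, dob' = Unt C, eps = Lu C (Unt C), eta = iinv C (Lu C (Unt C))\<rparr>"

text \<open>
  An adjoint equivalence \<open>F \<simeq> G\<close>: a dual pair with invertible unit and counit, together with natural
  isomorphisms \<open>A \<otimes> FX \<cong> GX \<otimes> A\<close> and \<open>A' \<otimes> GX \<cong> FX \<otimes> A'\<close>, such that the unit and the
  counit are modifications.
\<close>

record ('x, 'o, 'm) adj_eq =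
  pair :: "('o, 'm) dual_pair"
  nat :: "'x \<Rightarrow> 'm"
  nat' :: "'x \<Rightarrow> 'm"

abbreviation aob :: "('x, 'o, 'm) adj_eq \<Rightarrow> 'o" where "aob E \<equiv> dob (pair E)"
abbreviation aob' :: "('x, 'o, 'm) adj_eq \<Rightarrow> 'o" where "aob' E \<equiv> dob' (pair E)"

definition is_adj_eq :: "('o, 'm) moncat \<Rightarrow> ('p, 'n) moncat \<Rightarrow> ('o, 'm, 'p, 'n) monfun \<Rightarrow>
    ('o, 'm, 'p, 'n) monfun \<Rightarrow> ('o, 'p, 'n) adj_eq \<Rightarrow> bool" where
  "is_adj_eq C D F G E \<longleftrightarrow>
     is_dual_pair D (pair E) \<and>
     eps (pair E) \<in> iso D (aob E \<otimes>\<^bsub>D\<^esub> aob' E) (Unt D) \<and>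
     eta (pair E) \<in> iso D (Unt D) (aob' E \<otimes>\<^bsub>D\<^esub> aob E) \<and>
     lax_trans C D F G (aob E) (nat E) \<and>
     lax_trans C D G F (aob' E) (nat' E) \<and>
     (\<forall>X \<in> Ob C. nat E X \<in> iso D (aob E \<otimes>\<^bsub>D\<^esub> FO F X) (FO G X \<otimes>\<^bsub>D\<^esub> aob E)) \<and>
     (\<forall>X \<in> Ob C. nat' E X \<in> iso D (aob' E \<otimes>\<^bsub>D\<^esub> FO G X) (FO F X \<otimes>\<^bsub>D\<^esub> aob' E)) \<and>
     (\<forall>X \<in> Ob C.
        chain D
          [paste D [aob E] ([aob' E, FO G X], nat' E X, [FO F X, aob' E]) [],
           paste D [] ([aob E, FO F X], nat E X, [FO G X, aob E]) [aob' E],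
           paste D [FO G X] (eps_cell (pair E)) []]
        = paste D [] (eps_cell (pair E)) [FO G X]) \<and>
     (\<forall>X \<in> Ob C.
        chain D
          [paste D [] (eta_cell (pair E)) [FO F X],
           paste D [aob' E] ([aob E, FO F X], nat E X, [FO G X, aob E]) [],
           paste D [] ([aob' E, FO G X], nat' E X, [FO F X, aob' E]) [aob E]]
        = paste D [FO F X] (eta_cell (pair E)) [])"

section \<open>Doubly degenerate tricategories\<close>

text \<open>
  \<open>tri_iso\<close> is the monoid isomorphism \<open>I \<cong> U\<close>, where \<open>U\<close> is the unit of the monoidal category.  The
  indices of the naturality isomorphisms of \<open>tri_a\<close> are triples of objects.
\<close>

record ('o, 'm) dd_tricat =
  tri_cat :: "('o, 'm) moncat"
  tri_box :: "('o \<times> 'o, 'm \<times> 'm, 'o, 'm) monfun"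
  tri_I :: 'o
  tri_mult :: 'm
  tri_unit :: 'm
  tri_iso :: 'm
  tri_a :: "('o \<times> 'o \<times> 'o, 'o, 'm) adj_eq"
  tri_l :: "('o, 'o, 'm) adj_eq"
  tri_r :: "('o, 'o, 'm) adj_eq"
  tri_pi :: 'm
  tri_mu :: 'm
  tri_lam :: 'm
  tri_rho :: 'm

definition tbox :: "('o, 'm) dd_tricat \<Rightarrow> 'o \<Rightarrow> 'o \<Rightarrow> 'o" where
  "tbox T X Y = FO (tri_box T) (X, Y)"

text \<open>\<open>box_cell T c d\<close> is \<open>c \<boxtimes> d\<close>, for cells with domains of equal lengths and codomains of equal
  lengths; \<open>boxr\<close> and \<open>boxl\<close> are \<open>c \<boxtimes> 1\<close> and \<open>1 \<boxtimes> c\<close>.\<close>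

definition box_cell :: "('o, 'm) dd_tricat \<Rightarrow> ('o, 'm) pcell \<Rightarrow> ('o, 'm) pcell \<Rightarrow> ('o, 'm) pcell"
  where
  "box_cell T c d =
     fun_cell (prod_cat (tri_cat T) (tri_cat T)) (tri_cat T) (tri_box T) (pair_cell c d)"

definition boxr :: "('o, 'm) dd_tricat \<Rightarrow> ('o, 'm) pcell \<Rightarrow> ('o, 'm) pcell" where
  "boxr T c = box_cell T c (units_cell (tri_cat T) (length (fst c)) (length (snd (snd c))))"

definition boxl :: "('o, 'm) dd_tricat \<Rightarrow> ('o, 'm) pcell \<Rightarrow> ('o, 'm) pcell" where
  "boxl T c = box_cell T (units_cell (tri_cat T) (length (fst c)) (length (snd (snd c)))) c"

text \<open>\<open>U \<boxtimes> U \<rightarrow> U\<close>, and the interchange \<open>(U \<boxtimes> Y) \<otimes> (X \<boxtimes> U) \<rightarrow> (X \<boxtimes> U) \<otimes> (U \<boxtimes> Y)\<close>.\<close>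

definition uu_cell :: "('o, 'm) dd_tricat \<Rightarrow> ('o, 'm) pcell" where
  "uu_cell T = ([tbox T (Unt (tri_cat T)) (Unt (tri_cat T))], iinv (tri_cat T) (FU (tri_box T)),
     [Unt (tri_cat T)])"

definition interchange :: "('o, 'm) dd_tricat \<Rightarrow> 'o \<Rightarrow> 'o \<Rightarrow> ('o, 'm) pcell" where
  "interchange T X Y =
     box_cell T (swap_cell (tri_cat T) X) (inv_cell (tri_cat T) (swap_cell (tri_cat T) Y))"

definition a_cell :: "('o, 'm) dd_tricat \<Rightarrow> 'o \<Rightarrow> 'o \<Rightarrow> 'o \<Rightarrow> ('o, 'm) pcell" where
  "a_cell T X Y Z = ([aob (tri_a T), tbox T (tbox T X Y) Z], nat (tri_a T) (X, Y, Z),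
     [tbox T X (tbox T Y Z), aob (tri_a T)])"

definition a'_cell :: "('o, 'm) dd_tricat \<Rightarrow> 'o \<Rightarrow> 'o \<Rightarrow> 'o \<Rightarrow> ('o, 'm) pcell" where
  "a'_cell T X Y Z = ([aob' (tri_a T), tbox T X (tbox T Y Z)], nat' (tri_a T) (X, Y, Z),
     [tbox T (tbox T X Y) Z, aob' (tri_a T)])"

definition l_cell :: "('o, 'm) dd_tricat \<Rightarrow> 'o \<Rightarrow> ('o, 'm) pcell" where
  "l_cell T X = ([aob (tri_l T), tbox T (tri_I T) X], nat (tri_l T) X, [X, aob (tri_l T)])"

definition l'_cell :: "('o, 'm) dd_tricat \<Rightarrow> 'o \<Rightarrow> ('o, 'm) pcell" where
  "l'_cell T X = ([aob' (tri_l T), X], nat' (tri_l T) X, [tbox T (tri_I T) X, aob' (tri_l T)])"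

definition r'_cell :: "('o, 'm) dd_tricat \<Rightarrow> 'o \<Rightarrow> ('o, 'm) pcell" where
  "r'_cell T X = ([aob' (tri_r T), X], nat' (tri_r T) X, [tbox T X (tri_I T), aob' (tri_r T)])"

text \<open>
  The domains and codomains of the constraint modifications, whose components are
  \<open>\<pi> : (1 \<boxtimes> a) a (a \<boxtimes> 1) \<rightarrow> a a\<close>, \<open>\<mu> : (1 \<boxtimes> l) a (r\<^sup>\<cdot> \<boxtimes> 1) \<rightarrow> 1\<close>, \<open>\<lambda> : l \<boxtimes> 1 \<rightarrow> l a\<close> and
  \<open>\<rho> : 1 \<boxtimes> r\<^sup>\<cdot> \<rightarrow> a r\<^sup>\<cdot>\<close>, where the identity 2-cell \<open>1\<close> is the unit object \<open>U\<close>.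
\<close>

definition pi_cell :: "('o, 'm) dd_tricat \<Rightarrow> ('o, 'm) pcell" where
  "pi_cell T = (let U = Unt (tri_cat T); A = aob (tri_a T) in
     ([tbox T U A, A, tbox T A U], tri_pi T, [A, A]))"

definition mu_cell :: "('o, 'm) dd_tricat \<Rightarrow> ('o, 'm) pcell" where
  "mu_cell T = (let U = Unt (tri_cat T) in
     ([tbox T U (aob (tri_l T)), aob (tri_a T), tbox T (aob' (tri_r T)) U], tri_mu T, []))"

definition lam_cell :: "('o, 'm) dd_tricat \<Rightarrow> ('o, 'm) pcell" where
  "lam_cell T = (let U = Unt (tri_cat T) in
     ([tbox T (aob (tri_l T)) U], tri_lam T, [aob (tri_l T), aob (tri_a T)]))"

definition rho_cell :: "('o, 'm) dd_tricat \<Rightarrow> ('o, 'm) pcell" where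
  "rho_cell T = (let U = Unt (tri_cat T) in
     ([tbox T U (aob' (tri_r T))], tri_rho T, [aob (tri_a T), aob' (tri_r T)]))"

definition iso_cell :: "('o, 'm) moncat \<Rightarrow> ('o, 'm) pcell \<Rightarrow> bool" where
  "iso_cell C c \<longleftrightarrow> fst (snd c) \<in> iso C (tens C (fst c)) (tens C (snd (snd c)))"

definition const_I :: "('o, 'm) dd_tricat \<Rightarrow> ('p, 'n) moncat \<Rightarrow> ('p, 'n, 'o, 'm) monfun" where
  "const_I T C = const_fun C (tri_cat T) (tri_I T) (tri_mult T) (tri_unit T)"

definition const_U :: "('o, 'm) dd_tricat \<Rightarrow> ('p, 'n) moncat \<Rightarrow> ('p, 'n, 'o, 'm) monfun" where
  "const_U T C = const_fun C (tri_cat T) (Unt (tri_cat T)) (Lu (tri_cat T) (Unt (tri_cat T)))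
     (Idn (tri_cat T) (Unt (tri_cat T)))"

text \<open>\<open>X \<mapsto> FX \<boxtimes> GX\<close>.\<close>

definition box_fun :: "('o, 'm) dd_tricat \<Rightarrow> ('p, 'n) moncat \<Rightarrow> ('p, 'n, 'o, 'm) monfun \<Rightarrow>
    ('p, 'n, 'o, 'm) monfun \<Rightarrow> ('p, 'n, 'o, 'm) monfun" where
  "box_fun T C F G = comp_fun C (tri_cat T) (tri_box T) (pair_fun C F G)"

text \<open>
  In the following locales, which have no assumptions, \<open>xs \<lhd> c \<rhd> ys\<close> is the whiskering of \<open>c\<close>.  An
  equation whose name ends in \<open>mod\<close> says that the constraint is a modification, at the given objects.
\<close>

locale dd_tricat_data =
  fixes T :: "('o, 'm) dd_tricat"
begin

abbreviation B where "B \<equiv> tri_cat T"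
abbreviation box (infixl "\<boxtimes>" 72) where "X \<boxtimes> Y \<equiv> tbox T X Y"
abbreviation whisk ("_ \<lhd> _ \<rhd> _" [61, 61, 61] 60) where "xs \<lhd> c \<rhd> ys \<equiv> paste B xs c ys"
abbreviation U where "U \<equiv> Unt B"
abbreviation I where "I \<equiv> tri_I T"
abbreviation A where "A \<equiv> aob (tri_a T)"
abbreviation L where "L \<equiv> aob (tri_l T)"
abbreviation R' where "R' \<equiv> aob' (tri_r T)"
abbreviation i1 where "i1 \<equiv> id_cell B"
abbreviation sw where "sw \<equiv> swap_cell B"

definition pi_mod :: "'o \<Rightarrow> 'o \<Rightarrow> 'o \<Rightarrow> 'o \<Rightarrow> bool" where
  "pi_mod W X Y Z \<longleftrightarrow>
     chain B
       [[] \<lhd> pi_cell T \<rhd> [((W \<boxtimes> X) \<boxtimes> Y) \<boxtimes> Z],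
        [A] \<lhd> a_cell T (W \<boxtimes> X) Y Z \<rhd> [],
        [] \<lhd> a_cell T W X (Y \<boxtimes> Z) \<rhd> [A]]
   = chain B
       [[U \<boxtimes> A, A] \<lhd> box_cell T (a_cell T W X Y) (sw Z) \<rhd> [],
        [U \<boxtimes> A] \<lhd> a_cell T W (X \<boxtimes> Y) Z \<rhd> [A \<boxtimes> U],
        [] \<lhd> box_cell T (sw W) (a_cell T X Y Z) \<rhd> [A, A \<boxtimes> U],
        [W \<boxtimes> (X \<boxtimes> (Y \<boxtimes> Z))] \<lhd> pi_cell T \<rhd> []]"

definition mu_mod :: "'o \<Rightarrow> 'o \<Rightarrow> bool" where
  "mu_mod X Y \<longleftrightarrow>
     [] \<lhd> mu_cell T \<rhd> [X \<boxtimes> Y]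
   = chain B
       [[U \<boxtimes> L, A] \<lhd> box_cell T (r'_cell T X) (sw Y) \<rhd> [],
        [U \<boxtimes> L] \<lhd> a_cell T X I Y \<rhd> [R' \<boxtimes> U],
        [] \<lhd> box_cell T (sw X) (l_cell T Y) \<rhd> [A, R' \<boxtimes> U],
        [X \<boxtimes> Y] \<lhd> mu_cell T \<rhd> []]"

definition lam_mod :: "'o \<Rightarrow> 'o \<Rightarrow> bool" where
  "lam_mod X Y \<longleftrightarrow>
     chain B
       [[] \<lhd> lam_cell T \<rhd> [(I \<boxtimes> X) \<boxtimes> Y],
        [L] \<lhd> a_cell T I X Y \<rhd> [],
        [] \<lhd> l_cell T (X \<boxtimes> Y) \<rhd> [A]]
   = chain B
       [box_cell T (l_cell T X) (sw Y),
        [X \<boxtimes> Y] \<lhd> lam_cell T \<rhd> []]"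

definition rho_mod :: "'o \<Rightarrow> 'o \<Rightarrow> bool" where
  "rho_mod X Y \<longleftrightarrow>
     chain B
       [[] \<lhd> rho_cell T \<rhd> [X \<boxtimes> Y],
        [A] \<lhd> r'_cell T (X \<boxtimes> Y) \<rhd> [],
        [] \<lhd> a_cell T X Y I \<rhd> [R']]
   = chain B
       [box_cell T (sw X) (r'_cell T Y),
        [X \<boxtimes> (Y \<boxtimes> I)] \<lhd> rho_cell T \<rhd> []]"

text \<open>The nonabelian 4-cocycle condition, between the paths from \<open>(((kj)h)g)f\<close> to \<open>k(j(h(gf)))\<close>.\<close>

definition cocycle :: bool where
  "cocycle \<longleftrightarrow>
     chain B
       [[U \<boxtimes> (U \<boxtimes> A), U \<boxtimes> A, A] \<lhd> boxr T (pi_cell T) \<rhd> [],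
        [U \<boxtimes> (U \<boxtimes> A)] \<lhd> pi_cell T \<rhd> [A \<boxtimes> U],
        [] \<lhd> inv_cell B (a_cell T U U A) \<rhd> [A, A \<boxtimes> U],
        [A] \<lhd> box_cell T (uu_cell T) (i1 A) \<rhd> [A, A \<boxtimes> U],
        [A] \<lhd> pi_cell T \<rhd> []]
   = chain B
       [[U \<boxtimes> (U \<boxtimes> A), U \<boxtimes> A] \<lhd> a_cell T U A U \<rhd> [A \<boxtimes> U, (A \<boxtimes> U) \<boxtimes> U],
        [] \<lhd> boxl T (pi_cell T) \<rhd> [A, A \<boxtimes> U, (A \<boxtimes> U) \<boxtimes> U],
        [U \<boxtimes> A] \<lhd> pi_cell T \<rhd> [(A \<boxtimes> U) \<boxtimes> U],
        [U \<boxtimes> A, A] \<lhd> a_cell T A U U \<rhd> [],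
        [U \<boxtimes> A, A] \<lhd> box_cell T (i1 A) (uu_cell T) \<rhd> [A],
        [] \<lhd> pi_cell T \<rhd> [A]]"

text \<open>The left and right normalization axioms.\<close>

definition left_norm :: bool where
  "left_norm \<longleftrightarrow>
     [A] \<lhd> boxr T (mu_cell T) \<rhd> []
   = chain B
       [[] \<lhd> a_cell T U L U \<rhd> [A \<boxtimes> U, (R' \<boxtimes> U) \<boxtimes> U],
        [] \<lhd> boxl T (lam_cell T) \<rhd> [A, A \<boxtimes> U, (R' \<boxtimes> U) \<boxtimes> U],
        [U \<boxtimes> L] \<lhd> pi_cell T \<rhd> [(R' \<boxtimes> U) \<boxtimes> U],
        [U \<boxtimes> L, A] \<lhd> a_cell T R' U U \<rhd> [],
        [U \<boxtimes> L, A] \<lhd> box_cell T (i1 R') (uu_cell T) \<rhd> [A],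
        [] \<lhd> mu_cell T \<rhd> [A]]"

definition right_norm :: bool where
  "right_norm \<longleftrightarrow>
     [] \<lhd> boxl T (mu_cell T) \<rhd> [A]
   = chain B
       [[U \<boxtimes> (U \<boxtimes> L), U \<boxtimes> A] \<lhd> inv_cell B (a_cell T U R' U) \<rhd> [],
        [U \<boxtimes> (U \<boxtimes> L), U \<boxtimes> A, A] \<lhd> boxr T (rho_cell T) \<rhd> [],
        [U \<boxtimes> (U \<boxtimes> L)] \<lhd> pi_cell T \<rhd> [R' \<boxtimes> U],
        [] \<lhd> inv_cell B (a_cell T U U L) \<rhd> [A, R' \<boxtimes> U],
        [A] \<lhd> box_cell T (uu_cell T) (i1 L) \<rhd> [A, R' \<boxtimes> U],
        [A] \<lhd> mu_cell T \<rhd> []]"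

end

definition doubly_degenerate_tricategory :: "('o, 'm) dd_tricat \<Rightarrow> bool" where
  "doubly_degenerate_tricategory T \<longleftrightarrow>
    (let B = tri_cat T; B2 = prod_cat B B; B3 = prod_cat B B2;
         p1 = fst_fun B B2; p2 = comp_fun B3 B (fst_fun B B) (snd_fun B B2);
         p3 = comp_fun B3 B (snd_fun B B) (snd_fun B B2)
     in monoidal_category B \<and> moncat_extensional B \<and>
        monoidal_functor B2 B (tri_box T) \<and>
        monoid B (tri_I T) (tri_mult T) (tri_unit T) \<and>
        monoid_iso B (tri_I T) (tri_mult T) (tri_unit T) (Unt B) (Lu B (Unt B)) (Idn B (Unt B))
          (tri_iso T) \<and>
        is_adj_eq B3 B (box_fun T B3 (box_fun T B3 p1 p2) p3)
          (box_fun T B3 p1 (box_fun T B3 p2 p3)) (tri_a T) \<and>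
        is_adj_eq B B (box_fun T B (const_I T B) (id_fun B)) (id_fun B) (tri_l T) \<and>
        is_adj_eq B B (box_fun T B (id_fun B) (const_I T B)) (id_fun B) (tri_r T) \<and>
        iso_cell B (pi_cell T) \<and> iso_cell B (mu_cell T) \<and>
        iso_cell B (lam_cell T) \<and> iso_cell B (rho_cell T) \<and>
        (\<forall>W \<in> Ob B. \<forall>X \<in> Ob B. \<forall>Y \<in> Ob B. \<forall>Z \<in> Ob B. dd_tricat_data.pi_mod T W X Y Z) \<and>
        (\<forall>X \<in> Ob B. \<forall>Y \<in> Ob B. dd_tricat_data.mu_mod T X Y) \<and>
        (\<forall>X \<in> Ob B. \<forall>Y \<in> Ob B. dd_tricat_data.lam_mod T X Y) \<and>
        (\<forall>X \<in> Ob B. \<forall>Y \<in> Ob B. dd_tricat_data.rho_mod T X Y) \<and>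
        dd_tricat_data.cocycle T \<and> dd_tricat_data.left_norm T \<and> dd_tricat_data.right_norm T)"

section \<open>Weak functors\<close>

text \<open>
  The components of the constraints of a weak functor \<open>H\<close> are
  \<open>\<omega> : Ha \<chi> (\<chi> \<boxtimes> 1) \<rightarrow> \<chi> (1 \<boxtimes> \<chi>) a\<close>, \<open>\<gamma> : Hl \<chi> (\<iota> \<boxtimes> 1) \<rightarrow> l\<close> and
  \<open>\<delta> : Hr\<^sup>\<cdot> \<rightarrow> \<chi> (1 \<boxtimes> \<iota>) r\<^sup>\<cdot>\<close>.
\<close>

record ('o, 'm, 'p, 'n) dd_functor =
  wf_fun :: "('o, 'm, 'p, 'n) monfun"
  wf_chi :: "('o \<times> 'o, 'p, 'n) adj_eq"
  wf_iota :: "(unit, 'p, 'n) adj_eq"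
  wf_omega :: 'n
  wf_gamma :: 'n
  wf_delta :: 'n

definition chi_cell :: "('o, 'm) dd_tricat \<Rightarrow> ('p, 'n) dd_tricat \<Rightarrow> ('o, 'm, 'p, 'n) dd_functor \<Rightarrow>
    'o \<Rightarrow> 'o \<Rightarrow> ('p, 'n) pcell" where
  "chi_cell T T' F X Y =
     ([aob (wf_chi F), tbox T' (FO (wf_fun F) X) (FO (wf_fun F) Y)], nat (wf_chi F) (X, Y),
      [FO (wf_fun F) (tbox T X Y), aob (wf_chi F)])"

definition iota_cell :: "('o, 'm) dd_tricat \<Rightarrow> ('p, 'n) dd_tricat \<Rightarrow> ('o, 'm, 'p, 'n) dd_functor \<Rightarrow>
    ('p, 'n) pcell" where
  "iota_cell T T' F =
     ([aob (wf_iota F), tri_I T'], nat (wf_iota F) (), [FO (wf_fun F) (tri_I T), aob (wf_iota F)])"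

definition omega_cell :: "('o, 'm) dd_tricat \<Rightarrow> ('p, 'n) dd_tricat \<Rightarrow> ('o, 'm, 'p, 'n) dd_functor \<Rightarrow>
    ('p, 'n) pcell" where
  "omega_cell T T' F = (let U = Unt (tri_cat T'); \<chi> = aob (wf_chi F) in
     ([FO (wf_fun F) (aob (tri_a T)), \<chi>, tbox T' \<chi> U], wf_omega F,
      [\<chi>, tbox T' U \<chi>, aob (tri_a T')]))"

definition gamma_cell :: "('o, 'm) dd_tricat \<Rightarrow> ('p, 'n) dd_tricat \<Rightarrow> ('o, 'm, 'p, 'n) dd_functor \<Rightarrow>
    ('p, 'n) pcell" where
  "gamma_cell T T' F = (let U = Unt (tri_cat T') in
     ([FO (wf_fun F) (aob (tri_l T)), aob (wf_chi F), tbox T' (aob (wf_iota F)) U], wf_gamma F,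
      [aob (tri_l T')]))"

definition delta_cell :: "('o, 'm) dd_tricat \<Rightarrow> ('p, 'n) dd_tricat \<Rightarrow> ('o, 'm, 'p, 'n) dd_functor \<Rightarrow>
    ('p, 'n) pcell" where
  "delta_cell T T' F = (let U = Unt (tri_cat T') in
     ([FO (wf_fun F) (aob' (tri_r T))], wf_delta F,
      [aob (wf_chi F), tbox T' U (aob (wf_iota F)), aob' (tri_r T')]))"

locale dd_functor_data =
  fixes T :: "('o, 'm) dd_tricat" and T' :: "('p, 'n) dd_tricat"
    and F :: "('o, 'm, 'p, 'n) dd_functor"
begin

abbreviation B where "B \<equiv> tri_cat T"
abbreviation B' where "B' \<equiv> tri_cat T'"
abbreviation box (infixl "\<boxtimes>" 72) where "X \<boxtimes> Y \<equiv> tbox T X Y"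
abbreviation box' (infixl "\<boxtimes>''" 72) where "X \<boxtimes>' Y \<equiv> tbox T' X Y"
abbreviation whisk ("_ \<lhd> _ \<rhd> _" [61, 61, 61] 60) where "xs \<lhd> c \<rhd> ys \<equiv> paste B' xs c ys"
abbreviation U where "U \<equiv> Unt B"
abbreviation U' where "U' \<equiv> Unt B'"
abbreviation I where "I \<equiv> tri_I T"
abbreviation I' where "I' \<equiv> tri_I T'"
abbreviation A where "A \<equiv> aob (tri_a T)"
abbreviation L where "L \<equiv> aob (tri_l T)"
abbreviation Rd where "Rd \<equiv> aob' (tri_r T)"
abbreviation A' where "A' \<equiv> aob (tri_a T')"
abbreviation L' where "L' \<equiv> aob (tri_l T')"
abbreviation Rd' where "Rd' \<equiv> aob' (tri_r T')"
abbreviation H where "H \<equiv> FO (wf_fun F)"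
abbreviation Hc where "Hc \<equiv> fun_cell B B' (wf_fun F)"
abbreviation \<chi> where "\<chi> \<equiv> aob (wf_chi F)"
abbreviation \<iota> where "\<iota> \<equiv> aob (wf_iota F)"
abbreviation i1 where "i1 \<equiv> id_cell B'"
abbreviation sw where "sw \<equiv> swap_cell B'"
abbreviation inverse where "inverse \<equiv> inv_cell B'"
abbreviation \<chi>c where "\<chi>c \<equiv> chi_cell T T' F"
abbreviation \<iota>c where "\<iota>c \<equiv> iota_cell T T' F"
abbreviation \<omega> where "\<omega> \<equiv> omega_cell T T' F"
abbreviation \<gamma> where "\<gamma> \<equiv> gamma_cell T T' F"
abbreviation \<delta> where "\<delta> \<equiv> delta_cell T T' F"

text \<open>\<open>HU \<rightarrow> U'\<close>.\<close>

definition hu_cell :: "('p, 'n) pcell" where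
  "hu_cell = ([H U], iinv B' (FU (wf_fun F)), [U'])"

definition omega_mod :: "'o \<Rightarrow> 'o \<Rightarrow> 'o \<Rightarrow> bool" where
  "omega_mod X Y Z \<longleftrightarrow>
     chain B'
       [[] \<lhd> \<omega> \<rhd> [(H X \<boxtimes>' H Y) \<boxtimes>' H Z],
        [\<chi>, U' \<boxtimes>' \<chi>] \<lhd> a_cell T' (H X) (H Y) (H Z) \<rhd> [],
        [\<chi>] \<lhd> box_cell T' (sw (H X)) (\<chi>c Y Z) \<rhd> [A'],
        [] \<lhd> \<chi>c X (Y \<boxtimes> Z) \<rhd> [U' \<boxtimes>' \<chi>, A']]
   = chain B'
       [[H A, \<chi>] \<lhd> box_cell T' (\<chi>c X Y) (sw (H Z)) \<rhd> [],
        [H A] \<lhd> \<chi>c (X \<boxtimes> Y) Z \<rhd> [\<chi> \<boxtimes>' U'],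
        [] \<lhd> Hc (a_cell T X Y Z) \<rhd> [\<chi>, \<chi> \<boxtimes>' U'],
        [H (X \<boxtimes> (Y \<boxtimes> Z))] \<lhd> \<omega> \<rhd> []]"

definition gamma_mod :: "'o \<Rightarrow> bool" where
  "gamma_mod X \<longleftrightarrow>
     chain B'
       [[] \<lhd> \<gamma> \<rhd> [I' \<boxtimes>' H X],
        l_cell T' (H X)]
   = chain B'
       [[H L, \<chi>] \<lhd> box_cell T' \<iota>c (sw (H X)) \<rhd> [],
        [H L] \<lhd> \<chi>c I X \<rhd> [\<iota> \<boxtimes>' U'],
        [] \<lhd> Hc (l_cell T X) \<rhd> [\<chi>, \<iota> \<boxtimes>' U'],
        [H X] \<lhd> \<gamma> \<rhd> []]"

definition delta_mod :: "'o \<Rightarrow> bool" where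
  "delta_mod X \<longleftrightarrow>
     chain B'
       [[] \<lhd> \<delta> \<rhd> [H X],
        [\<chi>, U' \<boxtimes>' \<iota>] \<lhd> r'_cell T' (H X) \<rhd> [],
        [\<chi>] \<lhd> box_cell T' (sw (H X)) \<iota>c \<rhd> [Rd'],
        [] \<lhd> \<chi>c X I \<rhd> [U' \<boxtimes>' \<iota>, Rd']]
   = chain B'
       [Hc (r'_cell T X),
        [H (X \<boxtimes> I)] \<lhd> \<delta> \<rhd> []]"

text \<open>The associativity axiom, between paths from \<open>((HkHh)Hg)Hf\<close> to \<open>H(k(h(gf)))\<close>.\<close>

definition assoc_axiom :: bool where
  "assoc_axiom \<longleftrightarrow>
     chain B'
       [[] \<lhd> Hc (pi_cell T) \<rhd> [\<chi>, \<chi> \<boxtimes>' U', (\<chi> \<boxtimes>' U') \<boxtimes>' U'],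
        [H A] \<lhd> \<omega> \<rhd> [(\<chi> \<boxtimes>' U') \<boxtimes>' U'],
        [H A, \<chi>, U' \<boxtimes>' \<chi>] \<lhd> a_cell T' \<chi> U' U' \<rhd> [],
        [H A, \<chi>, U' \<boxtimes>' \<chi>] \<lhd> box_cell T' (i1 \<chi>) (uu_cell T') \<rhd> [A'],
        [H A, \<chi>] \<lhd> interchange T' \<chi> \<chi> \<rhd> [A'],
        [] \<lhd> \<omega> \<rhd> [U' \<boxtimes>' \<chi>, A'],
        [\<chi>, U' \<boxtimes>' \<chi>, A'] \<lhd> box_cell T' (inverse (uu_cell T')) (i1 \<chi>) \<rhd> [A'],
        [\<chi>, U' \<boxtimes>' \<chi>] \<lhd> a_cell T' U' U' \<chi> \<rhd> [A']]
   = chain B'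
       [[H (U \<boxtimes> A), H A] \<lhd> inverse (\<chi>c A U) \<rhd> [\<chi> \<boxtimes>' U', (\<chi> \<boxtimes>' U') \<boxtimes>' U'],
        [H (U \<boxtimes> A), H A, \<chi>] \<lhd> box_cell T' (i1 (H A)) hu_cell \<rhd> [\<chi> \<boxtimes>' U', (\<chi> \<boxtimes>' U') \<boxtimes>' U'],
        [H (U \<boxtimes> A), H A, \<chi>] \<lhd> boxr T' \<omega> \<rhd> [],
        [H (U \<boxtimes> A)] \<lhd> \<omega> \<rhd> [(U' \<boxtimes>' \<chi>) \<boxtimes>' U', A' \<boxtimes>' U'],
        [H (U \<boxtimes> A), \<chi>, U' \<boxtimes>' \<chi>] \<lhd> a_cell T' U' \<chi> U' \<rhd> [A' \<boxtimes>' U'],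
        [] \<lhd> inverse (\<chi>c U A) \<rhd> [U' \<boxtimes>' \<chi>, U' \<boxtimes>' (\<chi> \<boxtimes>' U'), A', A' \<boxtimes>' U'],
        [\<chi>] \<lhd> box_cell T' hu_cell (i1 (H A)) \<rhd> [U' \<boxtimes>' \<chi>, U' \<boxtimes>' (\<chi> \<boxtimes>' U'), A', A' \<boxtimes>' U'],
        [\<chi>] \<lhd> boxl T' \<omega> \<rhd> [A', A' \<boxtimes>' U'],
        [\<chi>, U' \<boxtimes>' \<chi>, U' \<boxtimes>' (U' \<boxtimes>' \<chi>)] \<lhd> pi_cell T' \<rhd> []]"

text \<open>The unit axiom, between paths from \<open>HgHf\<close> to \<open>H(gf)\<close>.\<close>

definition unit_axiom :: bool where
  "unit_axiom \<longleftrightarrow>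
     chain B'
       [[H (U \<boxtimes> L), H A, \<chi>] \<lhd> boxr T' (inverse \<delta>) \<rhd> [],
        [H (U \<boxtimes> L), H A, \<chi>] \<lhd> box_cell T' (i1 (H Rd)) (inverse hu_cell) \<rhd> [],
        [H (U \<boxtimes> L), H A] \<lhd> \<chi>c Rd U \<rhd> [],
        [] \<lhd> Hc (mu_cell T) \<rhd> [\<chi>]]
   = chain B'
       [[H (U \<boxtimes> L)] \<lhd> \<omega> \<rhd> [(U' \<boxtimes>' \<iota>) \<boxtimes>' U', Rd' \<boxtimes>' U'],
        [H (U \<boxtimes> L), \<chi>, U' \<boxtimes>' \<chi>] \<lhd> a_cell T' U' \<iota> U' \<rhd> [Rd' \<boxtimes>' U'],
        [] \<lhd> inverse (\<chi>c U L) \<rhd> [U' \<boxtimes>' \<chi>, U' \<boxtimes>' (\<iota> \<boxtimes>' U'), A', Rd' \<boxtimes>' U'],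
        [\<chi>] \<lhd> box_cell T' hu_cell (i1 (H L)) \<rhd> [U' \<boxtimes>' \<chi>, U' \<boxtimes>' (\<iota> \<boxtimes>' U'), A', Rd' \<boxtimes>' U'],
        [\<chi>] \<lhd> boxl T' \<gamma> \<rhd> [A', Rd' \<boxtimes>' U'],
        [\<chi>] \<lhd> mu_cell T' \<rhd> []]"

end

definition weak_functor :: "('o, 'm) dd_tricat \<Rightarrow> ('p, 'n) dd_tricat \<Rightarrow>
    ('o, 'm, 'p, 'n) dd_functor \<Rightarrow> bool" where
  "weak_functor T T' F \<longleftrightarrow>
    (let B = tri_cat T; B' = tri_cat T'; B2 = prod_cat B B; H = wf_fun F
     in monoidal_functor B B' H \<and>
        is_adj_eq B2 B'
          (box_fun T' B2 (comp_fun B2 B' H (fst_fun B B)) (comp_fun B2 B' H (snd_fun B B)))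
          (comp_fun B2 B' H (tri_box T)) (wf_chi F) \<and>
        is_adj_eq one_cat B' (const_I T' one_cat) (comp_fun one_cat B' H (const_I T one_cat))
          (wf_iota F) \<and>
        iso_cell B' (omega_cell T T' F) \<and> iso_cell B' (gamma_cell T T' F) \<and>
        iso_cell B' (delta_cell T T' F) \<and>
        (\<forall>X \<in> Ob B. \<forall>Y \<in> Ob B. \<forall>Z \<in> Ob B. dd_functor_data.omega_mod T T' F X Y Z) \<and>
        (\<forall>X \<in> Ob B. dd_functor_data.gamma_mod T T' F X) \<and>
        (\<forall>X \<in> Ob B. dd_functor_data.delta_mod T T' F X) \<and>
        dd_functor_data.assoc_axiom T T' F \<and> dd_functor_data.unit_axiom T T' F)"

section \<open>Lax transformations\<close>

text \<open>
  The natural maps are \<open>\<alpha> \<otimes> (U \<boxtimes> HX) \<rightarrow> (KX \<boxtimes> U) \<otimes> \<alpha>\<close>; the components of the (invertible)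
  constraints of a lax transformation \<open>H \<Rightarrow> K\<close> are
  \<open>\<Pi> : (\<chi>\<^sub>K \<boxtimes> 1) a\<^sup>\<cdot> (1 \<boxtimes> \<alpha>) a (\<alpha> \<boxtimes> 1) \<rightarrow> \<alpha> (1 \<boxtimes> \<chi>\<^sub>H) a\<close> and
  \<open>M : (\<iota>\<^sub>K \<boxtimes> 1) l\<^sup>\<cdot> \<rightarrow> \<alpha> (1 \<boxtimes> \<iota>\<^sub>H) r\<^sup>\<cdot>\<close>.
\<close>

record ('o, 'p, 'n) dd_trans =
  lt_ob :: 'p
  lt_nat :: "'o \<Rightarrow> 'n"
  lt_Pi :: 'n
  lt_M :: 'n

definition alpha_cell :: "('p, 'n) dd_tricat \<Rightarrow> ('o, 'm, 'p, 'n) dd_functor \<Rightarrow>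
    ('o, 'm, 'p, 'n) dd_functor \<Rightarrow> ('o, 'p, 'n) dd_trans \<Rightarrow> 'o \<Rightarrow> ('p, 'n) pcell" where
  "alpha_cell T' F G t X =
     ([lt_ob t, tbox T' (Unt (tri_cat T')) (FO (wf_fun F) X)], lt_nat t X,
      [tbox T' (FO (wf_fun G) X) (Unt (tri_cat T')), lt_ob t])"

definition Pi_cell :: "('p, 'n) dd_tricat \<Rightarrow> ('o, 'm, 'p, 'n) dd_functor \<Rightarrow>
    ('o, 'm, 'p, 'n) dd_functor \<Rightarrow> ('o, 'p, 'n) dd_trans \<Rightarrow> ('p, 'n) pcell" where
  "Pi_cell T' F G t = (let U = Unt (tri_cat T'); \<alpha> = lt_ob t; A = aob (tri_a T') in
     ([tbox T' (aob (wf_chi G)) U, aob' (tri_a T'), tbox T' U \<alpha>, A, tbox T' \<alpha> U], lt_Pi t,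
      [\<alpha>, tbox T' U (aob (wf_chi F)), A]))"

definition M_cell :: "('p, 'n) dd_tricat \<Rightarrow> ('o, 'm, 'p, 'n) dd_functor \<Rightarrow>
    ('o, 'm, 'p, 'n) dd_functor \<Rightarrow> ('o, 'p, 'n) dd_trans \<Rightarrow> ('p, 'n) pcell" where
  "M_cell T' F G t = (let U = Unt (tri_cat T') in
     ([tbox T' (aob (wf_iota G)) U, aob' (tri_l T')], lt_M t,
      [lt_ob t, tbox T' U (aob (wf_iota F)), aob' (tri_r T')]))"

locale dd_trans_data =
  fixes T :: "('o, 'm) dd_tricat" and T' :: "('p, 'n) dd_tricat"
    and F G :: "('o, 'm, 'p, 'n) dd_functor" and t :: "('o, 'p, 'n) dd_trans"
begin

abbreviation B where "B \<equiv> tri_cat T'"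
abbreviation tbox0 (infixl "\<boxtimes>\<^sub>0" 72) where "X \<boxtimes>\<^sub>0 Y \<equiv> tbox T X Y"
abbreviation box (infixl "\<boxtimes>" 72) where "X \<boxtimes> Y \<equiv> tbox T' X Y"
abbreviation whisk ("_ \<lhd> _ \<rhd> _" [61, 61, 61] 60) where "xs \<lhd> c \<rhd> ys \<equiv> paste B xs c ys"
abbreviation bc where "bc \<equiv> box_cell T'"
abbreviation U where "U \<equiv> Unt B"
abbreviation I where "I \<equiv> tri_I T'"
abbreviation A where "A \<equiv> aob (tri_a T')"
abbreviation Ad where "Ad \<equiv> aob' (tri_a T')"
abbreviation L where "L \<equiv> aob (tri_l T')"
abbreviation Ld where "Ld \<equiv> aob' (tri_l T')"
abbreviation Rd where "Rd \<equiv> aob' (tri_r T')"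
abbreviation H where "H \<equiv> FO (wf_fun F)"
abbreviation K where "K \<equiv> FO (wf_fun G)"
abbreviation \<alpha> where "\<alpha> \<equiv> lt_ob t"
abbreviation \<chi>H where "\<chi>H \<equiv> aob (wf_chi F)"
abbreviation \<chi>K where "\<chi>K \<equiv> aob (wf_chi G)"
abbreviation \<iota>H where "\<iota>H \<equiv> aob (wf_iota F)"
abbreviation \<iota>K where "\<iota>K \<equiv> aob (wf_iota G)"
abbreviation KA where "KA \<equiv> K (aob (tri_a T))"
abbreviation HL where "HL \<equiv> H (aob (tri_l T))"
abbreviation KL where "KL \<equiv> K (aob (tri_l T))"
abbreviation KRd where "KRd \<equiv> K (aob' (tri_r T))"
abbreviation i1 where "i1 \<equiv> id_cell B"
abbreviation sw where "sw \<equiv> swap_cell B"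
abbreviation inverse where "inverse \<equiv> inv_cell B"
abbreviation uu where "uu \<equiv> uu_cell T'"
abbreviation \<alpha>c where "\<alpha>c \<equiv> alpha_cell T' F G t"
abbreviation Pc where "Pc \<equiv> Pi_cell T' F G t"
abbreviation Mc where "Mc \<equiv> M_cell T' F G t"
abbreviation \<pi> where "\<pi> \<equiv> pi_cell T'"
abbreviation ac where "ac \<equiv> a_cell T'"
abbreviation adc where "adc \<equiv> a'_cell T'"

definition Pi_mod :: "'o \<Rightarrow> 'o \<Rightarrow> bool" where
  "Pi_mod X Y \<longleftrightarrow>
     chain B
       [[] \<lhd> Pc \<rhd> [(U \<boxtimes> H X) \<boxtimes> H Y],
        [\<alpha>, U \<boxtimes> \<chi>H] \<lhd> ac U (H X) (H Y) \<rhd> [],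
        [\<alpha>] \<lhd> bc (sw U) (chi_cell T T' F X Y) \<rhd> [A],
        [] \<lhd> \<alpha>c (X \<boxtimes>\<^sub>0 Y) \<rhd> [U \<boxtimes> \<chi>H, A]]
   = chain B
       [[\<chi>K \<boxtimes> U, Ad, U \<boxtimes> \<alpha>, A] \<lhd> bc (\<alpha>c X) (sw (H Y)) \<rhd> [],
        [\<chi>K \<boxtimes> U, Ad, U \<boxtimes> \<alpha>] \<lhd> ac (K X) U (H Y) \<rhd> [\<alpha> \<boxtimes> U],
        [\<chi>K \<boxtimes> U, Ad] \<lhd> bc (sw (K X)) (\<alpha>c Y) \<rhd> [A, \<alpha> \<boxtimes> U],
        [\<chi>K \<boxtimes> U] \<lhd> adc (K X) (K Y) U \<rhd> [U \<boxtimes> \<alpha>, A, \<alpha> \<boxtimes> U],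
        [] \<lhd> bc (chi_cell T T' G X Y) (sw U) \<rhd> [Ad, U \<boxtimes> \<alpha>, A, \<alpha> \<boxtimes> U],
        [K (X \<boxtimes>\<^sub>0 Y) \<boxtimes> U] \<lhd> Pc \<rhd> []]"

definition M_mod :: bool where
  "M_mod \<longleftrightarrow>
     chain B
       [[] \<lhd> Mc \<rhd> [U],
        [\<alpha>, U \<boxtimes> \<iota>H] \<lhd> r'_cell T' U \<rhd> [],
        [\<alpha>] \<lhd> bc (sw U) (iota_cell T T' F) \<rhd> [Rd],
        [] \<lhd> \<alpha>c (tri_I T) \<rhd> [U \<boxtimes> \<iota>H, Rd]]
   = chain B
       [[\<iota>K \<boxtimes> U] \<lhd> l'_cell T' U \<rhd> [],
        [] \<lhd> bc (iota_cell T T' G) (sw U) \<rhd> [Ld],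
        [K (tri_I T) \<boxtimes> U] \<lhd> Mc \<rhd> []]"

text \<open>
  The mates \<open>a (a\<^sup>\<cdot> \<boxtimes> 1) \<rightarrow> a\<^sup>\<cdot> (1 \<boxtimes> a) a\<close> and \<open>(a \<boxtimes> 1) a\<^sup>\<cdot> a\<^sup>\<cdot> \<rightarrow> a\<^sup>\<cdot> (1 \<boxtimes> a\<^sup>\<cdot>)\<close> of (the inverse of)
  \<open>\<pi>\<close>, and \<open>a\<^sup>\<cdot> (1 \<boxtimes> l\<^sup>\<cdot>) \<rightarrow> r\<^sup>\<cdot> \<boxtimes> 1\<close> of the inverse of \<open>\<mu>\<close>.
\<close>

definition pi_mate1 :: "('p, 'n) pcell" where
  "pi_mate1 = chain B
     [[] \<lhd> eta_cell (pair (tri_a T')) \<rhd> [A, Ad \<boxtimes> U],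
      [Ad] \<lhd> inverse \<pi> \<rhd> [Ad \<boxtimes> U],
      [Ad, U \<boxtimes> A, A] \<lhd> boxr T' (eps_cell (pair (tri_a T'))) \<rhd> []]"

definition pi_mate2 :: "('p, 'n) pcell" where
  "pi_mate2 = chain B
     [[] \<lhd> eta_cell (pair (tri_a T')) \<rhd> [A \<boxtimes> U, Ad, Ad],
      [Ad] \<lhd> boxl T' (eta_cell (pair (tri_a T'))) \<rhd> [A, A \<boxtimes> U, Ad, Ad],
      [Ad, U \<boxtimes> Ad] \<lhd> \<pi> \<rhd> [Ad, Ad],
      [Ad, U \<boxtimes> Ad, A] \<lhd> eps_cell (pair (tri_a T')) \<rhd> [Ad],
      [Ad, U \<boxtimes> Ad] \<lhd> eps_cell (pair (tri_a T')) \<rhd> []]"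

definition mu_mate :: "('p, 'n) pcell" where
  "mu_mate = chain B
     [[Ad, U \<boxtimes> Ld] \<lhd> inverse (mu_cell T') \<rhd> [],
      [Ad] \<lhd> boxl T' (inverse (eta_cell (pair (tri_l T')))) \<rhd> [A, Rd \<boxtimes> U],
      [] \<lhd> inverse (eta_cell (pair (tri_a T'))) \<rhd> [Rd \<boxtimes> U]]"

text \<open>The associativity axiom, between paths from \<open>((\<alpha>Hh)Hg)Hf\<close> to \<open>K(h(gf))\<alpha>\<close>.\<close>

definition trans_assoc_axiom :: bool where
  "trans_assoc_axiom \<longleftrightarrow>
     chain B
       [[KA \<boxtimes> U, \<chi>K \<boxtimes> U, Ad, U \<boxtimes> \<alpha>, A] \<lhd> boxr T' Pc \<rhd> [],
        [KA \<boxtimes> U] \<lhd> Pc \<rhd> [(U \<boxtimes> \<chi>H) \<boxtimes> U, A \<boxtimes> U],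
        [KA \<boxtimes> U, \<alpha>, U \<boxtimes> \<chi>H] \<lhd> ac U \<chi>H U \<rhd> [A \<boxtimes> U]]
   = chain B
       [[KA \<boxtimes> U, \<chi>K \<boxtimes> U, Ad, U \<boxtimes> \<alpha>] \<lhd> ac \<chi>K U U
          \<rhd> [Ad \<boxtimes> U, (U \<boxtimes> \<alpha>) \<boxtimes> U, A \<boxtimes> U, (\<alpha> \<boxtimes> U) \<boxtimes> U],
        [KA \<boxtimes> U, \<chi>K \<boxtimes> U, Ad, U \<boxtimes> \<alpha>] \<lhd> bc (i1 \<chi>K) uu
          \<rhd> [A, Ad \<boxtimes> U, (U \<boxtimes> \<alpha>) \<boxtimes> U, A \<boxtimes> U, (\<alpha> \<boxtimes> U) \<boxtimes> U],
        [KA \<boxtimes> U, \<chi>K \<boxtimes> U, Ad] \<lhd> interchange T' \<chi>K \<alpha>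
          \<rhd> [A, Ad \<boxtimes> U, (U \<boxtimes> \<alpha>) \<boxtimes> U, A \<boxtimes> U, (\<alpha> \<boxtimes> U) \<boxtimes> U],
        [KA \<boxtimes> U, \<chi>K \<boxtimes> U, Ad] \<lhd> bc (i1 \<chi>K) (inverse uu)
          \<rhd> [U \<boxtimes> \<alpha>, A, Ad \<boxtimes> U, (U \<boxtimes> \<alpha>) \<boxtimes> U, A \<boxtimes> U, (\<alpha> \<boxtimes> U) \<boxtimes> U],
        [KA \<boxtimes> U, \<chi>K \<boxtimes> U] \<lhd> adc \<chi>K U U
          \<rhd> [U \<boxtimes> \<alpha>, A, Ad \<boxtimes> U, (U \<boxtimes> \<alpha>) \<boxtimes> U, A \<boxtimes> U, (\<alpha> \<boxtimes> U) \<boxtimes> U],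
        [] \<lhd> boxr T' (omega_cell T T' G)
          \<rhd> [Ad, U \<boxtimes> \<alpha>, A, Ad \<boxtimes> U, (U \<boxtimes> \<alpha>) \<boxtimes> U, A \<boxtimes> U, (\<alpha> \<boxtimes> U) \<boxtimes> U],
        [\<chi>K \<boxtimes> U, (U \<boxtimes> \<chi>K) \<boxtimes> U, A \<boxtimes> U, Ad, U \<boxtimes> \<alpha>] \<lhd> pi_mate1
          \<rhd> [(U \<boxtimes> \<alpha>) \<boxtimes> U, A \<boxtimes> U, (\<alpha> \<boxtimes> U) \<boxtimes> U],
        [\<chi>K \<boxtimes> U, (U \<boxtimes> \<chi>K) \<boxtimes> U, A \<boxtimes> U, Ad] \<lhd> bc (inverse uu) (i1 \<alpha>)
          \<rhd> [Ad, U \<boxtimes> A, A, (U \<boxtimes> \<alpha>) \<boxtimes> U, A \<boxtimes> U, (\<alpha> \<boxtimes> U) \<boxtimes> U],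
        [\<chi>K \<boxtimes> U, (U \<boxtimes> \<chi>K) \<boxtimes> U, A \<boxtimes> U, Ad] \<lhd> inverse (adc U U \<alpha>)
          \<rhd> [U \<boxtimes> A, A, (U \<boxtimes> \<alpha>) \<boxtimes> U, A \<boxtimes> U, (\<alpha> \<boxtimes> U) \<boxtimes> U],
        [\<chi>K \<boxtimes> U, (U \<boxtimes> \<chi>K) \<boxtimes> U] \<lhd> pi_mate2
          \<rhd> [U \<boxtimes> (U \<boxtimes> \<alpha>), U \<boxtimes> A, A, (U \<boxtimes> \<alpha>) \<boxtimes> U, A \<boxtimes> U, (\<alpha> \<boxtimes> U) \<boxtimes> U],
        [\<chi>K \<boxtimes> U] \<lhd> inverse (adc U \<chi>K U)
          \<rhd> [U \<boxtimes> Ad, U \<boxtimes> (U \<boxtimes> \<alpha>), U \<boxtimes> A, A, (U \<boxtimes> \<alpha>) \<boxtimes> U, A \<boxtimes> U, (\<alpha> \<boxtimes> U) \<boxtimes> U],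
        [\<chi>K \<boxtimes> U, Ad, U \<boxtimes> (\<chi>K \<boxtimes> U), U \<boxtimes> Ad, U \<boxtimes> (U \<boxtimes> \<alpha>), U \<boxtimes> A] \<lhd> ac U \<alpha> U
          \<rhd> [A \<boxtimes> U, (\<alpha> \<boxtimes> U) \<boxtimes> U],
        [\<chi>K \<boxtimes> U, Ad] \<lhd> boxl T' Pc \<rhd> [A, A \<boxtimes> U, (\<alpha> \<boxtimes> U) \<boxtimes> U],
        [\<chi>K \<boxtimes> U, Ad, U \<boxtimes> \<alpha>, U \<boxtimes> (U \<boxtimes> \<chi>H)] \<lhd> \<pi> \<rhd> [(\<alpha> \<boxtimes> U) \<boxtimes> U],
        [\<chi>K \<boxtimes> U, Ad, U \<boxtimes> \<alpha>, U \<boxtimes> (U \<boxtimes> \<chi>H), A] \<lhd> ac \<alpha> U U \<rhd> [],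
        [\<chi>K \<boxtimes> U, Ad, U \<boxtimes> \<alpha>, U \<boxtimes> (U \<boxtimes> \<chi>H), A] \<lhd> bc (i1 \<alpha>) uu \<rhd> [A],
        [\<chi>K \<boxtimes> U, Ad, U \<boxtimes> \<alpha>] \<lhd> inverse (ac U U \<chi>H) \<rhd> [\<alpha> \<boxtimes> U, A],
        [\<chi>K \<boxtimes> U, Ad, U \<boxtimes> \<alpha>, A] \<lhd> bc uu (i1 \<chi>H) \<rhd> [\<alpha> \<boxtimes> U, A],
        [\<chi>K \<boxtimes> U, Ad, U \<boxtimes> \<alpha>, A] \<lhd> interchange T' \<alpha> \<chi>H \<rhd> [A],
        [] \<lhd> Pc \<rhd> [U \<boxtimes> \<chi>H, A],
        [\<alpha>, U \<boxtimes> \<chi>H, A] \<lhd> bc (inverse uu) (i1 \<chi>H) \<rhd> [A],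
        [\<alpha>, U \<boxtimes> \<chi>H] \<lhd> ac U U \<chi>H \<rhd> [A],
        [\<alpha>, U \<boxtimes> \<chi>H, U \<boxtimes> (U \<boxtimes> \<chi>H)] \<lhd> inverse \<pi> \<rhd> [],
        [\<alpha>] \<lhd> boxl T' (inverse (omega_cell T T' F)) \<rhd> [A, A \<boxtimes> U],
        [] \<lhd> \<alpha>c (aob (tri_a T)) \<rhd> [U \<boxtimes> \<chi>H, U \<boxtimes> (\<chi>H \<boxtimes> U), A, A \<boxtimes> U]]"

text \<open>
  The two unit axioms, between paths from \<open>\<alpha>Hf\<close> to \<open>Kf\<alpha>\<close> and to \<open>K(fI)\<alpha>\<close>.  Naturality of \<open>l\<close> and
  \<open>r\<^sup>\<cdot>\<close> at \<open>\<alpha>\<close> concerns \<open>I \<boxtimes> \<alpha>\<close> and \<open>\<alpha> \<boxtimes> I\<close>; \<open>tri_iso\<close> mediates between these and \<open>U \<boxtimes> \<alpha>\<close>, \<open>\<alpha> \<boxtimes> U\<close>.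
\<close>

definition i_cell :: "('p, 'n) pcell" where
  "i_cell = ([I], tri_iso T', [U])"

definition trans_lunit_axiom :: bool where
  "trans_lunit_axiom \<longleftrightarrow>
     [KL \<boxtimes> U] \<lhd> Pc \<rhd> [(U \<boxtimes> \<iota>H) \<boxtimes> U, Rd \<boxtimes> U]
   = chain B
       [[KL \<boxtimes> U, \<chi>K \<boxtimes> U, Ad, U \<boxtimes> \<alpha>, A] \<lhd> boxr T' (inverse Mc) \<rhd> [],
        [KL \<boxtimes> U, \<chi>K \<boxtimes> U, Ad, U \<boxtimes> \<alpha>] \<lhd> ac \<iota>K U U \<rhd> [Ld \<boxtimes> U],
        [KL \<boxtimes> U, \<chi>K \<boxtimes> U, Ad, U \<boxtimes> \<alpha>] \<lhd> bc (i1 \<iota>K) uu \<rhd> [A, Ld \<boxtimes> U],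
        [KL \<boxtimes> U, \<chi>K \<boxtimes> U, Ad] \<lhd> interchange T' \<iota>K \<alpha> \<rhd> [A, Ld \<boxtimes> U],
        [KL \<boxtimes> U, \<chi>K \<boxtimes> U, Ad] \<lhd> bc (i1 \<iota>K) (inverse uu) \<rhd> [U \<boxtimes> \<alpha>, A, Ld \<boxtimes> U],
        [KL \<boxtimes> U, \<chi>K \<boxtimes> U] \<lhd> adc \<iota>K U U \<rhd> [U \<boxtimes> \<alpha>, A, Ld \<boxtimes> U],
        [] \<lhd> boxr T' (gamma_cell T T' G) \<rhd> [Ad, U \<boxtimes> \<alpha>, A, Ld \<boxtimes> U],
        [] \<lhd> lam_cell T' \<rhd> [Ad, U \<boxtimes> \<alpha>, A, Ld \<boxtimes> U],
        [L] \<lhd> eps_cell (pair (tri_a T')) \<rhd> [U \<boxtimes> \<alpha>, A, Ld \<boxtimes> U],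
        [L] \<lhd> bc (inverse i_cell) (i1 \<alpha>) \<rhd> [A, Ld \<boxtimes> U],
        [] \<lhd> l_cell T' \<alpha> \<rhd> [A, Ld \<boxtimes> U],
        [\<alpha>] \<lhd> inverse (lam_cell T') \<rhd> [Ld \<boxtimes> U],
        [\<alpha>] \<lhd> boxr T' (eps_cell (pair (tri_l T'))) \<rhd> [],
        [\<alpha>] \<lhd> inverse (mu_cell T') \<rhd> [],
        [\<alpha>] \<lhd> boxl T' (inverse (gamma_cell T T' F)) \<rhd> [A, Rd \<boxtimes> U],
        [\<alpha>, U \<boxtimes> HL, U \<boxtimes> \<chi>H] \<lhd> inverse (ac U \<iota>H U) \<rhd> [Rd \<boxtimes> U],
        [] \<lhd> \<alpha>c (aob (tri_l T)) \<rhd> [U \<boxtimes> \<chi>H, A, (U \<boxtimes> \<iota>H) \<boxtimes> U, Rd \<boxtimes> U]]"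

definition trans_runit_axiom :: bool where
  "trans_runit_axiom \<longleftrightarrow>
     chain B
       [[] \<lhd> Pc \<rhd> [U \<boxtimes> \<iota>H, Rd],
        [\<alpha>, U \<boxtimes> \<chi>H, A] \<lhd> bc (inverse uu) (i1 \<iota>H) \<rhd> [Rd],
        [\<alpha>, U \<boxtimes> \<chi>H] \<lhd> ac U U \<iota>H \<rhd> [Rd],
        [\<alpha>, U \<boxtimes> \<chi>H, U \<boxtimes> (U \<boxtimes> \<iota>H)] \<lhd> inverse (rho_cell T') \<rhd> [],
        [\<alpha>] \<lhd> boxl T' (inverse (delta_cell T T' F)) \<rhd> [],
        \<alpha>c (aob' (tri_r T))]
   = chain B
       [[\<chi>K \<boxtimes> U, Ad, U \<boxtimes> \<alpha>, A] \<lhd> inverse (interchange T' \<alpha> \<iota>H) \<rhd> [Rd],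
        [\<chi>K \<boxtimes> U, Ad, U \<boxtimes> \<alpha>, A, U \<boxtimes> \<iota>H] \<lhd> bc (i1 \<alpha>) (inverse i_cell) \<rhd> [Rd],
        [\<chi>K \<boxtimes> U, Ad, U \<boxtimes> \<alpha>, A, U \<boxtimes> \<iota>H] \<lhd> inverse (r'_cell T' \<alpha>) \<rhd> [],
        [\<chi>K \<boxtimes> U, Ad, U \<boxtimes> \<alpha>, A] \<lhd> bc (inverse uu) (i1 \<iota>H) \<rhd> [Rd, \<alpha>],
        [\<chi>K \<boxtimes> U, Ad, U \<boxtimes> \<alpha>] \<lhd> ac U U \<iota>H \<rhd> [Rd, \<alpha>],
        [\<chi>K \<boxtimes> U, Ad, U \<boxtimes> \<alpha>, U \<boxtimes> (U \<boxtimes> \<iota>H)] \<lhd> inverse (rho_cell T') \<rhd> [\<alpha>],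
        [\<chi>K \<boxtimes> U, Ad] \<lhd> boxl T' (inverse Mc) \<rhd> [\<alpha>],
        [\<chi>K \<boxtimes> U] \<lhd> adc U \<iota>K U \<rhd> [U \<boxtimes> Ld, \<alpha>],
        [\<chi>K \<boxtimes> U, (U \<boxtimes> \<iota>K) \<boxtimes> U] \<lhd> mu_mate \<rhd> [\<alpha>],
        [] \<lhd> boxr T' (inverse (delta_cell T T' G)) \<rhd> [\<alpha>]]"

end

definition lax_transformation :: "('o, 'm) dd_tricat \<Rightarrow> ('p, 'n) dd_tricat \<Rightarrow>
    ('o, 'm, 'p, 'n) dd_functor \<Rightarrow> ('o, 'm, 'p, 'n) dd_functor \<Rightarrow> ('o, 'p, 'n) dd_trans \<Rightarrow> bool"
  where
  "lax_transformation T T' F G t \<longleftrightarrow>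
    (let B = tri_cat T; B' = tri_cat T'
     in lax_trans B B' (box_fun T' B (const_U T' B) (wf_fun F))
          (box_fun T' B (wf_fun G) (const_U T' B)) (lt_ob t) (lt_nat t) \<and>
        iso_cell B' (Pi_cell T' F G t) \<and> iso_cell B' (M_cell T' F G t) \<and>
        (\<forall>X \<in> Ob B. \<forall>Y \<in> Ob B. dd_trans_data.Pi_mod T T' F G t X Y) \<and>
        dd_trans_data.M_mod T T' F G t \<and>
        dd_trans_data.trans_assoc_axiom T T' F G t \<and>
        dd_trans_data.trans_lunit_axiom T T' F G t \<and>
        dd_trans_data.trans_runit_axiom T T' F G t)"

section \<open>The restricted cells\<close>

text \<open>The coherence isomorphism \<open>U \<otimes> X \<rightarrow> Y \<otimes> U\<close> determined by \<open>f : X \<rightarrow> Y\<close>.\<close>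

definition coh_nat :: "('o, 'm) moncat \<Rightarrow> 'o \<Rightarrow> 'o \<Rightarrow> 'm \<Rightarrow> 'm" where
  "coh_nat C X Y f = iinv C (Ru C Y) \<cdot>\<^bsub>C\<^esub> (f \<cdot>\<^bsub>C\<^esub> Lu C X)"

text \<open>
  The functor \<open>\<boxtimes>\<close> is \<open>\<otimes>\<close>, but its monoidal constraints \<open>\<phi>\<close> (the interchange, which encodes a
  braiding) and \<open>\<phi>0\<close> remain data.  All dual pairs are \<open>\<^bold>I\<close>, and all other isomorphisms are the
  coherence isomorphisms of the monoidal category \<open>C\<close>.
\<close>

definition canonical_tricat ::
    "('o, 'm) moncat \<Rightarrow> ('o \<times> 'o \<Rightarrow> 'o \<times> 'o \<Rightarrow> 'm) \<Rightarrow> 'm \<Rightarrow> ('o, 'm) dd_tricat" where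
  "canonical_tricat C \<phi> \<phi>0 = (let U = Unt C; i = Idn C U; u = Lu C U in \<lparr>
     tri_cat = C,
     tri_box = \<lparr>FO = restrict (\<lambda>(X, Y). X \<otimes>\<^bsub>C\<^esub> Y) (Ob C \<times> Ob C),
                FA = restrict (\<lambda>(f, g). f \<oplus>\<^bsub>C\<^esub> g) (Ar C \<times> Ar C),
                FP = \<phi>, FU = \<phi>0\<rparr>,
     tri_I = U, tri_mult = u, tri_unit = i, tri_iso = i,
     tri_a = \<lparr>pair = unit_dual C,
       nat = restrict (\<lambda>(X, Y, Z).
         coh_nat C ((X \<otimes>\<^bsub>C\<^esub> Y) \<otimes>\<^bsub>C\<^esub> Z) (X \<otimes>\<^bsub>C\<^esub> (Y \<otimes>\<^bsub>C\<^esub> Z)) (As C X Y Z)) (Ob C \<times> Ob C \<times> Ob C),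
       nat' = restrict (\<lambda>(X, Y, Z).
         coh_nat C (X \<otimes>\<^bsub>C\<^esub> (Y \<otimes>\<^bsub>C\<^esub> Z)) ((X \<otimes>\<^bsub>C\<^esub> Y) \<otimes>\<^bsub>C\<^esub> Z) (iinv C (As C X Y Z)))
           (Ob C \<times> Ob C \<times> Ob C)\<rparr>,
     tri_l = \<lparr>pair = unit_dual C,
       nat = restrict (\<lambda>X. coh_nat C (U \<otimes>\<^bsub>C\<^esub> X) X (Lu C X)) (Ob C),
       nat' = restrict (\<lambda>X. coh_nat C X (U \<otimes>\<^bsub>C\<^esub> X) (iinv C (Lu C X))) (Ob C)\<rparr>,
     tri_r = \<lparr>pair = unit_dual C,
       nat = restrict (\<lambda>X. coh_nat C (X \<otimes>\<^bsub>C\<^esub> U) X (Ru C X)) (Ob C),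
       nat' = restrict (\<lambda>X. coh_nat C X (X \<otimes>\<^bsub>C\<^esub> U) (iinv C (Ru C X))) (Ob C)\<rparr>,
     tri_pi = coh C [u, i, u] [i, i],
     tri_mu = coh C [u, i, u] [],
     tri_lam = coh C [u] [i, i],
     tri_rho = coh C [u] [i, i]\<rparr>)"

definition T2_Ob :: "('o, 'm) dd_tricat set" where
  "T2_Ob = {T. doubly_degenerate_tricategory T \<and>
     T = canonical_tricat (tri_cat T) (FP (tri_box T)) (FU (tri_box T))}"

text \<open>
  The weak functor data whose dual pairs are \<open>\<^bold>I\<close> and whose isomorphisms are the coherence
  isomorphisms built from the constraints of the monoidal functor \<open>H\<close> and of the target.
\<close>

definition canonical_functor :: "('o, 'm) dd_tricat \<Rightarrow> ('p, 'n) dd_tricat \<Rightarrow>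
    ('o, 'm, 'p, 'n) monfun \<Rightarrow> ('o, 'm, 'p, 'n) dd_functor" where
  "canonical_functor T T' H =
    (let B = tri_cat T; C = tri_cat T'; U = Unt C; i = Idn C U; u = Lu C U;
         h = iinv C (FU H) in \<lparr>
     wf_fun = H,
     wf_chi = \<lparr>pair = unit_dual C,
       nat = restrict (\<lambda>(X, Y). coh_nat C (FO H X \<otimes>\<^bsub>C\<^esub> FO H Y) (FO H (X \<otimes>\<^bsub>B\<^esub> Y)) (FP H X Y))
         (Ob B \<times> Ob B),
       nat' = restrict (\<lambda>(X, Y).
         coh_nat C (FO H (X \<otimes>\<^bsub>B\<^esub> Y)) (FO H X \<otimes>\<^bsub>C\<^esub> FO H Y) (iinv C (FP H X Y)))
           (Ob B \<times> Ob B)\<rparr>,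
     wf_iota = \<lparr>pair = unit_dual C,
       nat = (\<lambda>_. coh_nat C U (FO H (Unt B)) (FU H)),
       nat' = (\<lambda>_. coh_nat C (FO H (Unt B)) U h)\<rparr>,
     wf_omega = coh C [h, i, u] [i, u, i],
     wf_gamma = coh C [h, i, u] [i],
     wf_delta = coh C [h] [i, u, i]\<rparr>)"

definition T2_Hom :: "('o, 'm) dd_tricat \<Rightarrow> ('o, 'm) dd_tricat \<Rightarrow> ('o, 'm, 'o, 'm) dd_functor set"
  where
  "T2_Hom T T' = {F. weak_functor T T' F \<and> F = canonical_functor T T' (wf_fun F)}"

text \<open>
  For \<open>\<alpha> = U\<close> and \<open>\<boxtimes> = \<otimes>\<close> the natural maps \<open>U \<otimes> (U \<otimes> HX) \<rightarrow> (KX \<otimes> U) \<otimes> U\<close> amount to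
  components \<open>HX \<rightarrow> KX\<close>: \<open>canonical_trans\<close> takes the components \<open>s\<close>, and \<open>component\<close> recovers them.
\<close>

definition canonical_trans :: "('o, 'm) dd_tricat \<Rightarrow> ('p, 'n) dd_tricat \<Rightarrow>
    ('o, 'm, 'p, 'n) dd_functor \<Rightarrow> ('o, 'm, 'p, 'n) dd_functor \<Rightarrow> ('o \<Rightarrow> 'n) \<Rightarrow>
    ('o, 'p, 'n) dd_trans" where
  "canonical_trans T T' F G s =
    (let B = tri_cat T; C = tri_cat T'; U = Unt C; i = Idn C U; u = Lu C U;
         H = FO (wf_fun F); K = FO (wf_fun G) in \<lparr>
     lt_ob = U,
     lt_nat = restrict (\<lambda>X. coh_nat C (U \<otimes>\<^bsub>C\<^esub> H X) (K X \<otimes>\<^bsub>C\<^esub> U) (coh_nat C (H X) (K X) (s X)))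
       (Ob B),
     lt_Pi = coh C [u, i, u, i, u] [i, u, i],
     lt_M = coh C [u, i] [i, u, i]\<rparr>)"

definition component :: "('p, 'n) dd_tricat \<Rightarrow> ('o, 'm, 'p, 'n) dd_functor \<Rightarrow>
    ('o, 'm, 'p, 'n) dd_functor \<Rightarrow> ('o, 'p, 'n) dd_trans \<Rightarrow> 'o \<Rightarrow> 'n" where
  "component T' F G t X =
    (let C = tri_cat T'; U = Unt C; H = FO (wf_fun F); K = FO (wf_fun G)
     in Ru C (K X) \<cdot>\<^bsub>C\<^esub> (Ru C (K X \<otimes>\<^bsub>C\<^esub> U) \<cdot>\<^bsub>C\<^esub>
          (lt_nat t X \<cdot>\<^bsub>C\<^esub> (iinv C (Lu C (U \<otimes>\<^bsub>C\<^esub> H X)) \<cdot>\<^bsub>C\<^esub> iinv C (Lu C (H X))))))"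

definition T2_Hom2 :: "('o, 'm) dd_tricat \<Rightarrow> ('o, 'm) dd_tricat \<Rightarrow> ('o, 'm, 'o, 'm) dd_functor \<Rightarrow>
    ('o, 'm, 'o, 'm) dd_functor \<Rightarrow> ('o, 'o, 'm) dd_trans set" where
  "T2_Hom2 T T' F G = {t. lax_transformation T T' F G t \<and> lt_ob t = Unt (tri_cat T') \<and>
     lt_Pi t = lt_Pi (canonical_trans T T' F G (component T' F G t)) \<and>
     lt_M t = lt_M (canonical_trans T T' F G (component T' F G t))}"

definition T2_id1 :: "('o, 'm) dd_tricat \<Rightarrow> ('o, 'm, 'o, 'm) dd_functor" where
  "T2_id1 T = canonical_functor T T (id_fun (tri_cat T))"

definition T2_comp1 :: "('o, 'm) dd_tricat \<Rightarrow> ('o, 'm) dd_tricat \<Rightarrow> ('o, 'm) dd_tricat \<Rightarrow>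
    ('o, 'm, 'o, 'm) dd_functor \<Rightarrow> ('o, 'm, 'o, 'm) dd_functor \<Rightarrow> ('o, 'm, 'o, 'm) dd_functor"
  where
  "T2_comp1 T T' T'' G F =
     canonical_functor T T'' (comp_fun (tri_cat T) (tri_cat T'') (wf_fun G) (wf_fun F))"

definition T2_id2 :: "('o, 'm) dd_tricat \<Rightarrow> ('o, 'm) dd_tricat \<Rightarrow> ('o, 'm, 'o, 'm) dd_functor \<Rightarrow>
    ('o, 'o, 'm) dd_trans" where
  "T2_id2 T T' F = canonical_trans T T' F F (\<lambda>X. Idn (tri_cat T') (FO (wf_fun F) X))"

definition T2_vcomp :: "('o, 'm) dd_tricat \<Rightarrow> ('o, 'm) dd_tricat \<Rightarrow>
    ('o, 'm, 'o, 'm) dd_functor \<Rightarrow> ('o, 'm, 'o, 'm) dd_functor \<Rightarrow> ('o, 'm, 'o, 'm) dd_functor \<Rightarrow>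
    ('o, 'o, 'm) dd_trans \<Rightarrow> ('o, 'o, 'm) dd_trans \<Rightarrow> ('o, 'o, 'm) dd_trans" where
  "T2_vcomp T T' F G H t s =
     canonical_trans T T' F H
       (\<lambda>X. component T' G H t X \<cdot>\<^bsub>tri_cat T'\<^esub> component T' F G s X)"

text \<open>For \<open>s : F \<Rightarrow> F'\<close> from \<open>T\<close> to \<open>T'\<close> and \<open>t : G \<Rightarrow> G'\<close> from \<open>T'\<close> to \<open>T''\<close>.\<close>

definition T2_hcomp :: "('o, 'm) dd_tricat \<Rightarrow> ('o, 'm) dd_tricat \<Rightarrow> ('o, 'm) dd_tricat \<Rightarrow>
    ('o, 'm, 'o, 'm) dd_functor \<Rightarrow> ('o, 'm, 'o, 'm) dd_functor \<Rightarrow>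
    ('o, 'm, 'o, 'm) dd_functor \<Rightarrow> ('o, 'm, 'o, 'm) dd_functor \<Rightarrow>
    ('o, 'o, 'm) dd_trans \<Rightarrow> ('o, 'o, 'm) dd_trans \<Rightarrow> ('o, 'o, 'm) dd_trans" where
  "T2_hcomp T T' T'' F F' G G' t s =
     canonical_trans T T'' (T2_comp1 T T' T'' G F) (T2_comp1 T T' T'' G' F')
       (\<lambda>X. component T'' G G' t (FO (wf_fun F') X) \<cdot>\<^bsub>tri_cat T''\<^esub>
            FA (wf_fun G) (component T' F F' s X))"

section \<open>2-categories\<close>

text \<open>
  \<open>Hom2 A B f g\<close> is the set of 2-cells \<open>f \<Rightarrow> g : A \<rightarrow> B\<close>.  \<open>comp1 A B C g f\<close> is \<open>g f\<close> for \<open>f : A \<rightarrow> B\<close>,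
  \<open>g : B \<rightarrow> C\<close>; \<open>vcomp A B f g h t s\<close> is the composite of \<open>s : f \<Rightarrow> g\<close> and \<open>t : g \<Rightarrow> h\<close>; and
  \<open>hcomp A B C f f' g g' t s : g f \<Rightarrow> g' f'\<close> for \<open>s : f \<Rightarrow> f'\<close>, \<open>t : g \<Rightarrow> g'\<close>.
\<close>

locale two_category =
  fixes Obj :: "'a set"
    and Hom :: "'a \<Rightarrow> 'a \<Rightarrow> 'b set"
    and Hom2 :: "'a \<Rightarrow> 'a \<Rightarrow> 'b \<Rightarrow> 'b \<Rightarrow> 'c set"
    and id1 :: "'a \<Rightarrow> 'b"
    and comp1 :: "'a \<Rightarrow> 'a \<Rightarrow> 'a \<Rightarrow> 'b \<Rightarrow> 'b \<Rightarrow> 'b"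
    and id2 :: "'a \<Rightarrow> 'a \<Rightarrow> 'b \<Rightarrow> 'c"
    and vcomp :: "'a \<Rightarrow> 'a \<Rightarrow> 'b \<Rightarrow> 'b \<Rightarrow> 'b \<Rightarrow> 'c \<Rightarrow> 'c \<Rightarrow> 'c"
    and hcomp :: "'a \<Rightarrow> 'a \<Rightarrow> 'a \<Rightarrow> 'b \<Rightarrow> 'b \<Rightarrow> 'b \<Rightarrow> 'b \<Rightarrow> 'c \<Rightarrow> 'c \<Rightarrow> 'c"
  assumes id1: "A \<in> Obj \<Longrightarrow> id1 A \<in> Hom A A"
    and comp1: "\<lbrakk>A \<in> Obj; B \<in> Obj; C \<in> Obj; f \<in> Hom A B; g \<in> Hom B C\<rbrakk>
        \<Longrightarrow> comp1 A B C g f \<in> Hom A C"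
    and comp1_id: "\<lbrakk>A \<in> Obj; B \<in> Obj; f \<in> Hom A B\<rbrakk>
        \<Longrightarrow> comp1 A A B f (id1 A) = f \<and> comp1 A B B (id1 B) f = f"
    and comp1_assoc: "\<lbrakk>A \<in> Obj; B \<in> Obj; C \<in> Obj; D \<in> Obj;
        f \<in> Hom A B; g \<in> Hom B C; h \<in> Hom C D\<rbrakk>
        \<Longrightarrow> comp1 A B D (comp1 B C D h g) f = comp1 A C D h (comp1 A B C g f)"
    and id2: "\<lbrakk>A \<in> Obj; B \<in> Obj; f \<in> Hom A B\<rbrakk> \<Longrightarrow> id2 A B f \<in> Hom2 A B f f"
    and vcomp: "\<lbrakk>A \<in> Obj; B \<in> Obj; f \<in> Hom A B; g \<in> Hom A B; h \<in> Hom A B;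
        s \<in> Hom2 A B f g; t \<in> Hom2 A B g h\<rbrakk> \<Longrightarrow> vcomp A B f g h t s \<in> Hom2 A B f h"
    and vcomp_id: "\<lbrakk>A \<in> Obj; B \<in> Obj; f \<in> Hom A B; g \<in> Hom A B; s \<in> Hom2 A B f g\<rbrakk>
        \<Longrightarrow> vcomp A B f f g s (id2 A B f) = s \<and> vcomp A B f g g (id2 A B g) s = s"
    and vcomp_assoc: "\<lbrakk>A \<in> Obj; B \<in> Obj; f \<in> Hom A B; g \<in> Hom A B; h \<in> Hom A B; k \<in> Hom A B;
        s \<in> Hom2 A B f g; t \<in> Hom2 A B g h; u \<in> Hom2 A B h k\<rbrakk>
        \<Longrightarrow> vcomp A B f g k (vcomp A B g h k u t) s = vcomp A B f h k u (vcomp A B f g h t s)"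
    and hcomp: "\<lbrakk>A \<in> Obj; B \<in> Obj; C \<in> Obj;
        f \<in> Hom A B; f' \<in> Hom A B; g \<in> Hom B C; g' \<in> Hom B C;
        s \<in> Hom2 A B f f'; t \<in> Hom2 B C g g'\<rbrakk>
        \<Longrightarrow> hcomp A B C f f' g g' t s \<in> Hom2 A C (comp1 A B C g f) (comp1 A B C g' f')"
    and hcomp_id2: "\<lbrakk>A \<in> Obj; B \<in> Obj; C \<in> Obj; f \<in> Hom A B; g \<in> Hom B C\<rbrakk>
        \<Longrightarrow> hcomp A B C f f g g (id2 B C g) (id2 A B f) = id2 A C (comp1 A B C g f)"
    and interchange: "\<lbrakk>A \<in> Obj; B \<in> Obj; C \<in> Obj;
        f \<in> Hom A B; f' \<in> Hom A B; f'' \<in> Hom A B; g \<in> Hom B C; g' \<in> Hom B C; g'' \<in> Hom B C;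
        s \<in> Hom2 A B f f'; s' \<in> Hom2 A B f' f''; t \<in> Hom2 B C g g'; t' \<in> Hom2 B C g' g''\<rbrakk>
        \<Longrightarrow> hcomp A B C f f'' g g'' (vcomp B C g g' g'' t' t) (vcomp A B f f' f'' s' s)
          = vcomp A C (comp1 A B C g f) (comp1 A B C g' f') (comp1 A B C g'' f'')
              (hcomp A B C f' f'' g' g'' t' s') (hcomp A B C f f' g g' t s)"
    and hcomp_id1: "\<lbrakk>A \<in> Obj; B \<in> Obj; f \<in> Hom A B; f' \<in> Hom A B; s \<in> Hom2 A B f f'\<rbrakk>
        \<Longrightarrow> hcomp A A B (id1 A) (id1 A) f f' s (id2 A A (id1 A)) = s
          \<and> hcomp A B B f f' (id1 B) (id1 B) (id2 B B (id1 B)) s = s"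
    and hcomp_assoc: "\<lbrakk>A \<in> Obj; B \<in> Obj; C \<in> Obj; D \<in> Obj;
        f \<in> Hom A B; f' \<in> Hom A B; g \<in> Hom B C; g' \<in> Hom B C; h \<in> Hom C D; h' \<in> Hom C D;
        s \<in> Hom2 A B f f'; t \<in> Hom2 B C g g'; u \<in> Hom2 C D h h'\<rbrakk>
        \<Longrightarrow> hcomp A B D f f' (comp1 B C D h g) (comp1 B C D h' g') (hcomp B C D g g' h h' u t) s
          = hcomp A C D (comp1 A B C g f) (comp1 A B C g' f') h h' u (hcomp A B C f f' g g' t s)"

end

theory Submission
  imports Defs
begin

text \<open>
  Letting a string of 1-cells act on an object by iterated tensoring turns pasting into literal
  composition, and the action at the unit object determines a cell, so equations between pasting
  composites can be read off from their actions. In the situation at hand every string occurring in an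
  axiom consists of objects with a chosen isomorphism to the unit, together with at most two free
  objects. Transported along these isomorphisms a constraint cell becomes an identity and a naturality
  cell becomes the morphism it carries; an axiom all of whose cells are constraints therefore holds
  automatically, and one with a naturality cell becomes an equation between morphisms. What survives
  is that canonical data on \<open>H\<close> is a weak functor iff \<open>H\<close> is monoidal and its
  tensor constraint is a monoidal transformation with respect to the interchange maps, and that
  canonical data on a family \<open>s\<close> is a lax transformation iff \<open>s\<close> is a monoidal
  natural transformation. Both conditions are stable under composition.
\<close>

text \<open>Strings in the axioms contain objects such as
  \<open>U \<boxtimes> (U \<boxtimes> A)\<close> and \<open>H A\<close>, which are isomorphic to the
  unit but not equal to it, so a constraint cannot simply be declared an identity. The remedy is to
  carry the isomorphism along: each such object comes with a chosen map to the unit, and the choice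
  propagates by \<open>merge\<close> through \<boxtimes> and by \<open>tr\<close> through
  \<open>H\<close>. A cell compatible with the chosen maps at both ends is unique, so an equation
  between two pastings of compatible cells needs no calculation, only a derivation that each side is
  compatible. The obstacle is that \<boxtimes> keeps its own monoidal constraint, the interchange,
  which is data and encodes a braiding. It is controlled through unit laws: one pair expresses that
  \<boxtimes> is a monoidal functor, the other pair is extracted from the axioms that
  \<open>l\<close> and \<open>r\<close> are adjoint equivalences. The latter also force the unit
  constraint of \<boxtimes> to be the inverse of \<open>Lu U\<close>.\<close>

context monoidal_category
begin

section \<open>Calculus in a monoidal category and Kelly's unit laws\<close>

definition invertible :: "'m \<Rightarrow> bool" where
  "invertible f \<longleftrightarrow> (\<exists>g. is_inverse C f g)"

lemma dom_ob [simp]: "f \<in> Ar C \<Longrightarrow> Dom C f \<in> Ob C"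
  and cod_ob [simp]: "f \<in> Ar C \<Longrightarrow> Cod C f \<in> Ob C"
  using dom_cod by auto

lemma idn_ar [simp]: "X \<in> Ob C \<Longrightarrow> Idn C X \<in> Ar C"
  and idn_dom [simp]: "X \<in> Ob C \<Longrightarrow> Dom C (Idn C X) = X"
  and idn_cod [simp]: "X \<in> Ob C \<Longrightarrow> Cod C (Idn C X) = X"
  using idn unfolding hom_def by auto

lemma cmp_ar [simp]: "\<lbrakk>f \<in> Ar C; g \<in> Ar C; Dom C g = Cod C f\<rbrakk> \<Longrightarrow> g \<cdot> f \<in> Ar C"
  and cmp_dom [simp]: "\<lbrakk>f \<in> Ar C; g \<in> Ar C; Dom C g = Cod C f\<rbrakk> \<Longrightarrow> Dom C (g \<cdot> f) = Dom C f"
  and cmp_cod [simp]: "\<lbrakk>f \<in> Ar C; g \<in> Ar C; Dom C g = Cod C f\<rbrakk> \<Longrightarrow> Cod C (g \<cdot> f) = Cod C g"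
  using cmp[of f "Dom C f" "Cod C f" g "Cod C g"] unfolding hom_def by auto

lemma idn_left [simp]: "\<lbrakk>f \<in> Ar C; Cod C f = Y\<rbrakk> \<Longrightarrow> Idn C Y \<cdot> f = f"
  and idn_right [simp]: "\<lbrakk>f \<in> Ar C; Dom C f = X\<rbrakk> \<Longrightarrow> f \<cdot> Idn C X = f"
  using cmp_idn unfolding hom_def by auto

lemma assoc [simp]:
  "\<lbrakk>f \<in> Ar C; g \<in> Ar C; h \<in> Ar C; Dom C g = Cod C f; Dom C h = Cod C g\<rbrakk>
    \<Longrightarrow> (h \<cdot> g) \<cdot> f = h \<cdot> (g \<cdot> f)"
  using cmp_assoc unfolding hom_def by auto

lemma tens_ob [simp]: "\<lbrakk>X \<in> Ob C; Y \<in> Ob C\<rbrakk> \<Longrightarrow> X \<otimes> Y \<in> Ob C"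
  by (rule tensor_ob)

lemma unt_ob [simp]: "Unt C \<in> Ob C"
  by (rule unit_ob)

lemma tens_ar [simp]: "\<lbrakk>f \<in> Ar C; g \<in> Ar C\<rbrakk> \<Longrightarrow> f \<oplus> g \<in> Ar C"
  and tens_dom [simp]: "\<lbrakk>f \<in> Ar C; g \<in> Ar C\<rbrakk> \<Longrightarrow> Dom C (f \<oplus> g) = Dom C f \<otimes> Dom C g"
  and tens_cod [simp]: "\<lbrakk>f \<in> Ar C; g \<in> Ar C\<rbrakk> \<Longrightarrow> Cod C (f \<oplus> g) = Cod C f \<otimes> Cod C g"
  using tensor_ar[of f "Dom C f" "Cod C f" g "Dom C g" "Cod C g"] unfolding hom_def by auto

lemma tens_idn [simp]: "\<lbrakk>X \<in> Ob C; Y \<in> Ob C\<rbrakk> \<Longrightarrow> Idn C X \<oplus> Idn C Y = Idn C (X \<otimes> Y)"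
  by (rule tensor_idn)

lemma xchg:
  "\<lbrakk>f \<in> Ar C; f' \<in> Ar C; g \<in> Ar C; g' \<in> Ar C; Dom C f' = Cod C f; Dom C g' = Cod C g\<rbrakk>
    \<Longrightarrow> (f' \<oplus> g') \<cdot> (f \<oplus> g) = (f' \<cdot> f) \<oplus> (g' \<cdot> g)"
  using tensor_cmp[of f "Dom C f" "Cod C f" f' "Cod C f'" g "Dom C g" "Cod C g" g' "Cod C g'"]
  unfolding hom_def by auto

lemma xchg_assoc:
  "\<lbrakk>f \<in> Ar C; f' \<in> Ar C; g \<in> Ar C; g' \<in> Ar C; Dom C f' = Cod C f; Dom C g' = Cod C g;
    k \<in> Ar C; Cod C k = Dom C f \<otimes> Dom C g\<rbrakk>
    \<Longrightarrow> (f' \<oplus> g') \<cdot> ((f \<oplus> g) \<cdot> k) = ((f' \<cdot> f) \<oplus> (g' \<cdot> g)) \<cdot> k"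
  by (simp add: assoc[symmetric] xchg del: assoc)

lemma inverse_unique:
  assumes "is_inverse C f g" "is_inverse C f g'" shows "g = g'"
proof -
  have h: "f \<in> Ar C" "g \<in> Ar C" "Dom C g = Cod C f" "Cod C g = Dom C f" "g \<cdot> f = Idn C (Dom C f)"
    "g' \<in> Ar C" "Dom C g' = Cod C f" "Cod C g' = Dom C f" "f \<cdot> g' = Idn C (Cod C f)"
    using assms unfolding is_inverse_def hom_def by auto
  have "g \<cdot> (f \<cdot> g') = (g \<cdot> f) \<cdot> g'"
    using h by (intro assoc[symmetric]) simp_all
  then show ?thesis using h by simp
qed

lemma iinv_eqI: "is_inverse C f g \<Longrightarrow> iinv C f = g"
  unfolding iinv_def using inverse_unique by blast

lemma is_inverse_iinv: "invertible f \<Longrightarrow> is_inverse C f (iinv C f)"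
  unfolding invertible_def using iinv_eqI by auto

lemma invertible_ar: "invertible f \<Longrightarrow> f \<in> Ar C"
  by (auto simp: invertible_def is_inverse_def)

lemma iinv_ar [simp]: "invertible f \<Longrightarrow> iinv C f \<in> Ar C"
  and iinv_dom [simp]: "invertible f \<Longrightarrow> Dom C (iinv C f) = Cod C f"
  and iinv_cod [simp]: "invertible f \<Longrightarrow> Cod C (iinv C f) = Dom C f"
  and iinv_left [simp]: "invertible f \<Longrightarrow> iinv C f \<cdot> f = Idn C (Dom C f)"
  and iinv_right [simp]: "invertible f \<Longrightarrow> f \<cdot> iinv C f = Idn C (Cod C f)"
  using is_inverse_iinv unfolding is_inverse_def hom_def by auto

lemma iinv_left' [simp]: "\<lbrakk>invertible f; g \<in> Ar C; Cod C g = Dom C f\<rbrakk> \<Longrightarrow> iinv C f \<cdot> (f \<cdot> g) = g"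
  by (simp add: assoc[symmetric] invertible_ar del: assoc)

lemma iinv_right' [simp]: "\<lbrakk>invertible f; g \<in> Ar C; Cod C g = Cod C f\<rbrakk> \<Longrightarrow> f \<cdot> (iinv C f \<cdot> g) = g"
  by (simp add: assoc[symmetric] invertible_ar del: assoc)

lemma is_inverseI:
  "\<lbrakk>f \<in> Ar C; g \<in> Ar C; Dom C g = Cod C f; Cod C g = Dom C f; g \<cdot> f = Idn C (Dom C f);
    f \<cdot> g = Idn C (Cod C f)\<rbrakk> \<Longrightarrow> is_inverse C f g"
  unfolding is_inverse_def hom_def by auto

lemma inverse_idn: "X \<in> Ob C \<Longrightarrow> is_inverse C (Idn C X) (Idn C X)"
  by (rule is_inverseI) auto

lemma inverse_cmp:
  "\<lbrakk>invertible f; invertible g; Dom C g = Cod C f\<rbrakk>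
    \<Longrightarrow> is_inverse C (g \<cdot> f) (iinv C f \<cdot> iinv C g)"
  by (rule is_inverseI) (auto simp: invertible_ar)

lemma inverse_tens:
  "\<lbrakk>invertible f; invertible g\<rbrakk> \<Longrightarrow> is_inverse C (f \<oplus> g) (iinv C f \<oplus> iinv C g)"
  by (rule is_inverseI) (auto simp: invertible_ar xchg)

lemma inverse_iinv: "invertible f \<Longrightarrow> is_inverse C (iinv C f) f"
  by (rule is_inverseI) (auto simp: invertible_ar)

lemma invertible_idn [simp]: "X \<in> Ob C \<Longrightarrow> invertible (Idn C X)"
  and invertible_cmp [simp]: "\<lbrakk>invertible f; invertible g; Dom C g = Cod C f\<rbrakk> \<Longrightarrow> invertible (g \<cdot> f)"
  and invertible_tens [simp]: "\<lbrakk>invertible f; invertible g\<rbrakk> \<Longrightarrow> invertible (f \<oplus> g)"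
  and invertible_iinv [simp]: "invertible f \<Longrightarrow> invertible (iinv C f)"
  unfolding invertible_def[of "Idn C X"] invertible_def[of "g \<cdot> f"]
    invertible_def[of "f \<oplus> g"] invertible_def[of "iinv C f"]
  using inverse_idn inverse_cmp inverse_tens inverse_iinv by blast+

lemma iinv_idn [simp]: "X \<in> Ob C \<Longrightarrow> iinv C (Idn C X) = Idn C X"
  and iinv_cmp: "\<lbrakk>invertible f; invertible g; Dom C g = Cod C f\<rbrakk>
    \<Longrightarrow> iinv C (g \<cdot> f) = iinv C f \<cdot> iinv C g"
  and iinv_iinv [simp]: "invertible f \<Longrightarrow> iinv C (iinv C f) = f"
  by (auto intro!: iinv_eqI inverse_idn inverse_cmp inverse_tens inverse_iinv)

lemma iso_iff: "f \<in> iso C X Y \<longleftrightarrow> invertible f \<and> Dom C f = X \<and> Cod C f = Y"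
  by (auto simp: iso_def hom_def invertible_def is_inverse_def)

lemma hom_iff: "f \<in> hom C X Y \<longleftrightarrow> f \<in> Ar C \<and> Dom C f = X \<and> Cod C f = Y"
  by (auto simp: hom_def)

lemma as_invertible [simp]: "\<lbrakk>X \<in> Ob C; Y \<in> Ob C; Z \<in> Ob C\<rbrakk> \<Longrightarrow> invertible (As C X Y Z)"
  and as_ar [simp]: "\<lbrakk>X \<in> Ob C; Y \<in> Ob C; Z \<in> Ob C\<rbrakk> \<Longrightarrow> As C X Y Z \<in> Ar C"
  and as_dom [simp]: "\<lbrakk>X \<in> Ob C; Y \<in> Ob C; Z \<in> Ob C\<rbrakk> \<Longrightarrow> Dom C (As C X Y Z) = (X \<otimes> Y) \<otimes> Z"
  and as_cod [simp]: "\<lbrakk>X \<in> Ob C; Y \<in> Ob C; Z \<in> Ob C\<rbrakk> \<Longrightarrow> Cod C (As C X Y Z) = X \<otimes> (Y \<otimes> Z)"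
  using assoc_iso[of X Y Z] by (auto simp: iso_iff invertible_ar)

lemma lu_invertible [simp]: "X \<in> Ob C \<Longrightarrow> invertible (Lu C X)"
  and lu_ar [simp]: "X \<in> Ob C \<Longrightarrow> Lu C X \<in> Ar C"
  and lu_dom [simp]: "X \<in> Ob C \<Longrightarrow> Dom C (Lu C X) = Unt C \<otimes> X"
  and lu_cod [simp]: "X \<in> Ob C \<Longrightarrow> Cod C (Lu C X) = X"
  using lunit_iso[of X] by (auto simp: iso_iff invertible_ar)

lemma ru_invertible [simp]: "X \<in> Ob C \<Longrightarrow> invertible (Ru C X)"
  and ru_ar [simp]: "X \<in> Ob C \<Longrightarrow> Ru C X \<in> Ar C"
  and ru_dom [simp]: "X \<in> Ob C \<Longrightarrow> Dom C (Ru C X) = X \<otimes> Unt C"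
  and ru_cod [simp]: "X \<in> Ob C \<Longrightarrow> Cod C (Ru C X) = X"
  using runit_iso[of X] by (auto simp: iso_iff invertible_ar)

lemma as_nat:
  "\<lbrakk>f \<in> Ar C; g \<in> Ar C; h \<in> Ar C; Cod C f = X; Cod C g = Y; Cod C h = Z\<rbrakk>
    \<Longrightarrow> As C X Y Z \<cdot> ((f \<oplus> g) \<oplus> h) = (f \<oplus> (g \<oplus> h)) \<cdot> As C (Dom C f) (Dom C g) (Dom C h)"
  using assoc_nat[of f "Dom C f" X g "Dom C g" Y h "Dom C h" Z] by (simp add: hom_iff)

lemma ias_nat:
  assumes "f \<in> Ar C" "g \<in> Ar C" "h \<in> Ar C" "Cod C f = X" "Cod C g = Y" "Cod C h = Z"
  shows "iinv C (As C X Y Z) \<cdot> (f \<oplus> (g \<oplus> h))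
    = ((f \<oplus> g) \<oplus> h) \<cdot> iinv C (As C (Dom C f) (Dom C g) (Dom C h))"
proof -
  note [simp] = assms(1-3) and [simp] = assms(4-6)[symmetric]
  let ?a = "As C (Dom C f) (Dom C g) (Dom C h)"
  have "iinv C (As C X Y Z) \<cdot> ((f \<oplus> (g \<oplus> h)) \<cdot> (?a \<cdot> iinv C ?a))
      = iinv C (As C X Y Z) \<cdot> (As C X Y Z \<cdot> ((f \<oplus> g) \<oplus> h)) \<cdot> iinv C ?a"
    unfolding as_nat[OF assms] by simp
  then show ?thesis by simp
qed

lemma lu_nat: "\<lbrakk>f \<in> Ar C; Cod C f = Y\<rbrakk> \<Longrightarrow> Lu C Y \<cdot> (Idn C (Unt C) \<oplus> f) = f \<cdot> Lu C (Dom C f)"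
  using lunit_nat[of f "Dom C f" Y] by (simp add: hom_iff)

lemma ru_nat: "\<lbrakk>f \<in> Ar C; Cod C f = Y\<rbrakk> \<Longrightarrow> Ru C Y \<cdot> (f \<oplus> Idn C (Unt C)) = f \<cdot> Ru C (Dom C f)"
  using runit_nat[of f "Dom C f" Y] by (simp add: hom_iff)

lemma precomp:
  "\<lbrakk>g \<cdot> f = g' \<cdot> f'; f \<in> Ar C; g \<in> Ar C; f' \<in> Ar C; g' \<in> Ar C; Dom C g = Cod C f; Dom C g' = Cod C f';
    k \<in> Ar C; Cod C k = Dom C f; Dom C f' = Dom C f\<rbrakk> \<Longrightarrow> g \<cdot> (f \<cdot> k) = g' \<cdot> (f' \<cdot> k)"
  by (metis assoc)

lemma precomp1:
  "\<lbrakk>g \<cdot> f = h; f \<in> Ar C; g \<in> Ar C; Dom C g = Cod C f; k \<in> Ar C; Cod C k = Dom C f\<rbrakk>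
    \<Longrightarrow> g \<cdot> (f \<cdot> k) = h \<cdot> k"
  by (metis assoc)

lemma cancel_left:
  assumes "g \<cdot> f = g \<cdot> f'" "invertible g" "f \<in> Ar C" "f' \<in> Ar C" "Cod C f = Dom C g" "Cod C f' = Dom C g"
  shows "f = f'"
  using arg_cong[OF assms(1), of "\<lambda>x. iinv C g \<cdot> x"] assms(2-) by simp

lemma cancel_right:
  assumes "f \<cdot> g = f' \<cdot> g" "invertible g" "f \<in> Ar C" "f' \<in> Ar C" "Dom C f = Cod C g" "Dom C f' = Cod C g"
  shows "f = f'"
  using arg_cong[OF assms(1), of "\<lambda>x. x \<cdot> iinv C g"] assms(2-) by (simp add: invertible_ar)

text \<open>\<open>Ru\<close> is a natural isomorphism from tensoring with the unit to the identity,
  so tensoring with the unit loses nothing. Unit laws below are proved after such a tensoring, and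
  cells are recovered from their actions in the same way.\<close>

lemma tensU_faithful:
  assumes "f \<oplus> Idn C (Unt C) = g \<oplus> Idn C (Unt C)" "f \<in> Ar C" "g \<in> Ar C"
    "Dom C f = Dom C g" "Cod C f = Cod C g"
  shows "f = g"
proof (rule cancel_right[where g = "Ru C (Dom C f)"])
  show "f \<cdot> Ru C (Dom C f) = g \<cdot> Ru C (Dom C f)"
    using ru_nat[of f "Cod C f"] ru_nat[of g "Cod C f"] assms by simp
qed (use assms in simp_all)

lemma Utens_faithful:
  assumes "Idn C (Unt C) \<oplus> f = Idn C (Unt C) \<oplus> g" "f \<in> Ar C" "g \<in> Ar C"
    "Dom C f = Dom C g" "Cod C f = Cod C g"
  shows "f = g"
proof (rule cancel_right[where g = "Lu C (Dom C f)"])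
  show "f \<cdot> Lu C (Dom C f) = g \<cdot> Lu C (Dom C f)"
    using lu_nat[of f "Cod C f"] lu_nat[of g "Cod C f"] assms by simp
qed (use assms in simp_all)

lemma triangle': "\<lbrakk>X \<in> Ob C; Y \<in> Ob C\<rbrakk>
    \<Longrightarrow> (Idn C X \<oplus> Lu C Y) \<cdot> As C X (Unt C) Y = Ru C X \<oplus> Idn C Y"
  by (rule triangle)

text \<open>Naturality of \<open>Lu\<close> at the arrow \<open>Lu C X\<close>, with the invertible
  \<open>Lu C X\<close> cancelled on the left.\<close>

lemma lu_lu: "X \<in> Ob C \<Longrightarrow> Lu C (Unt C \<otimes> X) = Idn C (Unt C) \<oplus> Lu C X"
  by (rule cancel_left[where g = "Lu C X"]) (simp_all add: lu_nat)

text \<open>Kelly's argument that this triangle follows from the axioms. After tensoring with the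
  unit on the left and precomposing with the invertible \<open>?a\<close>, both sides agree by the
  pentagon at \<open>U, U, X, Y\<close>, the triangle at \<open>(U, X \<otimes> Y)\<close> and
  \<open>(U, X)\<close>, and naturality of the associator.\<close>

lemma lu_tens:
  assumes [simp]: "X \<in> Ob C" "Y \<in> Ob C"
  shows "Lu C (X \<otimes> Y) \<cdot> As C (Unt C) X Y = Lu C X \<oplus> Idn C Y"
proof -
  let ?U = "Unt C"
  let ?i = "Idn C"
  let ?a = "As C ?U (?U \<otimes> X) Y \<cdot> (As C ?U ?U X \<oplus> ?i Y)"
  have "(?i ?U \<oplus> (Lu C (X \<otimes> Y) \<cdot> As C ?U X Y)) \<cdot> ?a
      = (?i ?U \<oplus> Lu C (X \<otimes> Y)) \<cdot> ((?i ?U \<oplus> As C ?U X Y) \<cdot> ?a)"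
    by (simp add: xchg_assoc)
  also have "\<dots> = (?i ?U \<oplus> Lu C (X \<otimes> Y)) \<cdot> (As C ?U ?U (X \<otimes> Y) \<cdot> As C (?U \<otimes> ?U) X Y)"
    by (simp add: pentagon)
  also have "\<dots> = (Ru C ?U \<oplus> ?i (X \<otimes> Y)) \<cdot> As C (?U \<otimes> ?U) X Y"
    by (simp add: assoc[symmetric] triangle' del: assoc)
  also have "\<dots> = As C ?U X Y \<cdot> ((Ru C ?U \<oplus> ?i X) \<oplus> ?i Y)"
    using as_nat[of "Ru C ?U" "?i X" "?i Y" ?U X Y] by simp
  also have "(Ru C ?U \<oplus> ?i X) \<oplus> ?i Y = ((?i ?U \<oplus> Lu C X) \<oplus> ?i Y) \<cdot> (As C ?U ?U X \<oplus> ?i Y)"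
    by (simp add: xchg triangle')
  also have "As C ?U X Y \<cdot> (((?i ?U \<oplus> Lu C X) \<oplus> ?i Y) \<cdot> (As C ?U ?U X \<oplus> ?i Y))
      = (?i ?U \<oplus> (Lu C X \<oplus> ?i Y)) \<cdot> ?a"
    by (rule trans[OF precomp[OF as_nat]]) simp_all
  finally have "?i ?U \<oplus> (Lu C (X \<otimes> Y) \<cdot> As C ?U X Y) = ?i ?U \<oplus> (Lu C X \<oplus> ?i Y)"
    by (rule cancel_right) simp_all
  then show ?thesis
    by (rule Utens_faithful) simp_all
qed

text \<open>The mirror image of \<open>lu_tens\<close>: tensor with the unit on the right and use
  the pentagon at \<open>X, Y, U, U\<close>, with the triangle at \<open>(Y, U)\<close> and
  \<open>(X \<otimes> Y, U)\<close>.\<close>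

lemma ru_tens:
  assumes [simp]: "X \<in> Ob C" "Y \<in> Ob C"
  shows "(Idn C X \<oplus> Ru C Y) \<cdot> As C X Y (Unt C) = Ru C (X \<otimes> Y)"
proof -
  let ?U = "Unt C"
  let ?i = "Idn C"
  have "((?i X \<oplus> Ru C Y) \<cdot> As C X Y ?U) \<oplus> ?i ?U
      = ((?i X \<oplus> Ru C Y) \<oplus> ?i ?U) \<cdot> (As C X Y ?U \<oplus> ?i ?U)"
    by (simp add: xchg)
  also have "\<dots> = iinv C (As C X Y ?U) \<cdot> ((As C X Y ?U \<cdot> ((?i X \<oplus> Ru C Y) \<oplus> ?i ?U)) \<cdot> (As C X Y ?U \<oplus> ?i ?U))"
    by simp
  also have "\<dots> = iinv C (As C X Y ?U) \<cdot> ((?i X \<oplus> (Ru C Y \<oplus> ?i ?U)) \<cdot> (As C X (Y \<otimes> ?U) ?U \<cdot> (As C X Y ?U \<oplus> ?i ?U)))"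
    by (subst as_nat) simp_all
  also have "Ru C Y \<oplus> ?i ?U = (?i Y \<oplus> Lu C ?U) \<cdot> As C Y ?U ?U"
    by (simp add: triangle')
  also have "(?i X \<oplus> ((?i Y \<oplus> Lu C ?U) \<cdot> As C Y ?U ?U)) = (?i X \<oplus> (?i Y \<oplus> Lu C ?U)) \<cdot> (?i X \<oplus> As C Y ?U ?U)"
    by (simp add: xchg)
  also have "((?i X \<oplus> (?i Y \<oplus> Lu C ?U)) \<cdot> (?i X \<oplus> As C Y ?U ?U)) \<cdot> (As C X (Y \<otimes> ?U) ?U \<cdot> (As C X Y ?U \<oplus> ?i ?U))
     = (?i X \<oplus> (?i Y \<oplus> Lu C ?U)) \<cdot> (As C X Y (?U \<otimes> ?U) \<cdot> As C (X \<otimes> Y) ?U ?U)"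
    by (simp add: pentagon)
  also have "\<dots> = As C X Y ?U \<cdot> ((?i (X \<otimes> Y) \<oplus> Lu C ?U) \<cdot> As C (X \<otimes> Y) ?U ?U)"
    using precomp[OF as_nat[of "?i X" "?i Y" "Lu C ?U" X Y ?U], of "As C (X \<otimes> Y) ?U ?U"] by simp
  also have "iinv C (As C X Y ?U) \<cdot> \<dots> = Ru C (X \<otimes> Y) \<oplus> ?i ?U"
    by (simp add: triangle')
  finally show ?thesis
    by (rule tensU_faithful) simp_all
qed

text \<open>After tensoring with the unit both sides equal
  \<open>(Idn U \<oplus> Lu U) \<cdot> As U U U\<close>, one by \<open>lu_tens\<close> and
  \<open>lu_lu\<close>, the other by the triangle. It reconciles \<open>collapse\<close>, which
  absorbs units by \<open>Lu\<close>, with \<open>coh_nat\<close>, which ends in an inverse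
  \<open>Ru\<close>.\<close>

lemma lu_unit: "Lu C (Unt C) = Ru C (Unt C)"
proof -
  let ?U = "Unt C"
  have "Lu C ?U \<oplus> Idn C ?U = Lu C (?U \<otimes> ?U) \<cdot> As C ?U ?U ?U"
    by (simp add: lu_tens)
  also have "\<dots> = Ru C ?U \<oplus> Idn C ?U"
    by (simp add: lu_lu triangle')
  finally show ?thesis
    by (rule tensU_faithful) simp_all
qed

end

text \<open>The recursion pattern of \<open>split\<close>: a singleton meets the empty list through
  \<open>Ru\<close> and a nonempty list through an identity, so these are separate cases.\<close>

lemma split_induct [case_names Nil Single_Nil Single_Cons Cons]:
  assumes "\<And>ys. P [] ys" "\<And>X. P [X] []" "\<And>X Y ys. P [X] (Y # ys)"
    "\<And>X X' xs ys. P (X' # xs) ys \<Longrightarrow> P (X # X' # xs) ys"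
  shows "P xs ys"
proof (induction xs rule: induct_list012)
  case (2 X)
  show ?case using assms(2,3) by (cases ys) auto
qed (use assms in auto)

section \<open>The action of strings and cells on objects\<close>

context monoidal_category
begin

text \<open>The object \<open>Y\<close> closes the right-bracketed product, so concatenation becomes
  composition on the nose, whereas \<open>tens\<close> respects it only up to
  \<open>split\<close>.\<close>

primrec act :: "'o list \<Rightarrow> 'o \<Rightarrow> 'o" where
  "act [] Y = Y"
| "act (X # Xs) Y = X \<otimes> act Xs Y"

primrec whisker :: "'o list \<Rightarrow> 'm \<Rightarrow> 'm" where
  "whisker [] f = f"
| "whisker (X # Xs) f = Idn C X \<oplus> whisker Xs f"

text \<open>
  The coherence map from \<open>act Xs Y\<close> to \<open>tens C Xs \<otimes> Y\<close>; conjugating by it makes the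
  action of cells strictly compatible with concatenation.
\<close>

fun sp :: "'o list \<Rightarrow> 'o \<Rightarrow> 'm" where
  "sp [] Y = iinv C (Lu C Y)"
| "sp [X] Y = Idn C (X \<otimes> Y)"
| "sp (X # X' # Xs) Y = iinv C (As C X (tens C (X' # Xs)) Y) \<cdot> (Idn C X \<oplus> sp (X' # Xs) Y)"

definition cell_act :: "('o, 'm) pcell \<Rightarrow> 'o \<Rightarrow> 'm" where
  "cell_act c Y = iinv C (sp (snd (snd c)) Y) \<cdot>
     ((fst (snd c) \<oplus> Idn C Y) \<cdot> sp (fst c) Y)"

lemma act_append: "act (xs @ ys) Y = act xs (act ys Y)"
  by (induction xs) auto

lemma act_ob [simp]: "\<lbrakk>set xs \<subseteq> Ob C; Y \<in> Ob C\<rbrakk> \<Longrightarrow> act xs Y \<in> Ob C"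
  by (induction xs) auto

lemma tens_list_ob [simp]: "set xs \<subseteq> Ob C \<Longrightarrow> tens C xs \<in> Ob C"
  by (induction xs rule: induct_list012) auto

lemma whisker_ar [simp]: "\<lbrakk>set xs \<subseteq> Ob C; f \<in> Ar C\<rbrakk> \<Longrightarrow> whisker xs f \<in> Ar C"
  and whisker_dom [simp]: "\<lbrakk>set xs \<subseteq> Ob C; f \<in> Ar C\<rbrakk> \<Longrightarrow> Dom C (whisker xs f) = act xs (Dom C f)"
  and whisker_cod [simp]: "\<lbrakk>set xs \<subseteq> Ob C; f \<in> Ar C\<rbrakk> \<Longrightarrow> Cod C (whisker xs f) = act xs (Cod C f)"
  by (induction xs) auto

lemma whisker_cmp: "\<lbrakk>set xs \<subseteq> Ob C; f \<in> Ar C; g \<in> Ar C; Dom C g = Cod C f\<rbrakk>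
    \<Longrightarrow> whisker xs (g \<cdot> f) = whisker xs g \<cdot> whisker xs f"
  by (induction xs) (auto simp: xchg)

lemma sp_props:
  "\<lbrakk>set xs \<subseteq> Ob C; Y \<in> Ob C\<rbrakk> \<Longrightarrow> invertible (sp xs Y) \<and> sp xs Y \<in> Ar C \<and>
     Dom C (sp xs Y) = act xs Y \<and> Cod C (sp xs Y) = tens C xs \<otimes> Y"
  by (induction xs Y rule: sp.induct) auto

lemma sp_invertible [simp]: "\<lbrakk>set xs \<subseteq> Ob C; Y \<in> Ob C\<rbrakk> \<Longrightarrow> invertible (sp xs Y)"
  and sp_ar [simp]: "\<lbrakk>set xs \<subseteq> Ob C; Y \<in> Ob C\<rbrakk> \<Longrightarrow> sp xs Y \<in> Ar C"
  and sp_dom [simp]: "\<lbrakk>set xs \<subseteq> Ob C; Y \<in> Ob C\<rbrakk> \<Longrightarrow> Dom C (sp xs Y) = act xs Y"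
  and sp_cod [simp]: "\<lbrakk>set xs \<subseteq> Ob C; Y \<in> Ob C\<rbrakk> \<Longrightarrow> Cod C (sp xs Y) = tens C xs \<otimes> Y"
  using sp_props by auto

text \<open>Every ingredient of \<open>sp\<close>, an inverse \<open>Lu\<close> or an inverse
  associator, is natural in the object acted on; the induction assembles these squares.\<close>

lemma sp_nat:
  assumes "set xs \<subseteq> Ob C" and [simp]: "f \<in> Ar C"
  shows "(Idn C (tens C xs) \<oplus> f) \<cdot> sp xs (Dom C f) = sp xs (Cod C f) \<cdot> whisker xs f"
  using assms(1)
proof (induction xs rule: induct_list012)
  case 1
  have "Lu C (Cod C f) \<cdot> ((Idn C (Unt C) \<oplus> f) \<cdot> iinv C (Lu C (Dom C f))) = f"
    by (simp add: precomp[OF lu_nat])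
  then have "Lu C (Cod C f) \<cdot> ((Idn C (Unt C) \<oplus> f) \<cdot> iinv C (Lu C (Dom C f)))
      = Lu C (Cod C f) \<cdot> (iinv C (Lu C (Cod C f)) \<cdot> f)"
    by simp
  then have "(Idn C (Unt C) \<oplus> f) \<cdot> iinv C (Lu C (Dom C f)) = iinv C (Lu C (Cod C f)) \<cdot> f"
    by (rule cancel_left) simp_all
  then show ?case
    by simp
next
  case (2 X)
  then show ?case by simp
next
  case (3 X X' Xs)
  let ?P = "tens C (X' # Xs)" and ?s = "sp (X' # Xs) (Dom C f)" and ?s' = "sp (X' # Xs) (Cod C f)"
    and ?w = "whisker (X' # Xs) f"
  have [simp]: "X \<in> Ob C" "?P \<in> Ob C" "X' \<in> Ob C" "set Xs \<subseteq> Ob C"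
    using 3 tens_list_ob[of "X' # Xs"] by (auto simp del: tens.simps)
  have [simp]: "?w \<in> Ar C" "Dom C ?w = act (X' # Xs) (Dom C f)" "Cod C ?w = act (X' # Xs) (Cod C f)"
    "?s \<in> Ar C" "?s' \<in> Ar C" "Dom C ?s = act (X' # Xs) (Dom C f)" "Cod C ?s = ?P \<otimes> Dom C f"
    "Dom C ?s' = act (X' # Xs) (Cod C f)" "Cod C ?s' = ?P \<otimes> Cod C f"
    using whisker_ar[of "X' # Xs" f] whisker_dom[of "X' # Xs" f] whisker_cod[of "X' # Xs" f]
      sp_props[of "X' # Xs" "Dom C f"] sp_props[of "X' # Xs" "Cod C f"]
    by (simp_all del: tens.simps sp.simps act.simps whisker.simps)
  note [simp del] = tens.simps sp.simps act.simps whisker.simps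
  have IH: "(Idn C ?P \<oplus> f) \<cdot> ?s = ?s' \<cdot> ?w"
    using 3 by auto
  have "(Idn C (X \<otimes> ?P) \<oplus> f) \<cdot> (iinv C (As C X ?P (Dom C f)) \<cdot> (Idn C X \<oplus> ?s))
     = iinv C (As C X ?P (Cod C f)) \<cdot> ((Idn C X \<oplus> (Idn C ?P \<oplus> f)) \<cdot> (Idn C X \<oplus> ?s))"
    by (simp add: precomp[OF ias_nat])
  also have "(Idn C X \<oplus> (Idn C ?P \<oplus> f)) \<cdot> (Idn C X \<oplus> ?s) = (Idn C X \<oplus> ?s') \<cdot> (Idn C X \<oplus> ?w)"
    by (simp add: xchg IH)
  finally show ?case
    by (simp add: tens.simps(3) sp.simps(3) whisker.simps(2)[of X "X' # Xs"])
qed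

lemma split_props:
  "\<lbrakk>set xs \<subseteq> Ob C; set ys \<subseteq> Ob C\<rbrakk> \<Longrightarrow> invertible (split C xs ys) \<and> split C xs ys \<in> Ar C \<and>
     Dom C (split C xs ys) = tens C (xs @ ys) \<and> Cod C (split C xs ys) = tens C xs \<otimes> tens C ys"
  by (induction xs ys rule: split_induct) auto

lemma split_invertible [simp]: "\<lbrakk>set xs \<subseteq> Ob C; set ys \<subseteq> Ob C\<rbrakk> \<Longrightarrow> invertible (split C xs ys)"
  and split_ar [simp]: "\<lbrakk>set xs \<subseteq> Ob C; set ys \<subseteq> Ob C\<rbrakk> \<Longrightarrow> split C xs ys \<in> Ar C"
  and split_dom [simp]: "\<lbrakk>set xs \<subseteq> Ob C; set ys \<subseteq> Ob C\<rbrakk> \<Longrightarrow> Dom C (split C xs ys) = tens C (xs @ ys)"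
  and split_cod [simp]: "\<lbrakk>set xs \<subseteq> Ob C; set ys \<subseteq> Ob C\<rbrakk>
    \<Longrightarrow> Cod C (split C xs ys) = tens C xs \<otimes> tens C ys"
  using split_props by auto

text \<open>The pentagon solved for inverses. \<open>split\<close> and \<open>sp\<close> both
  introduce inverted associators, and this is the arrangement in which they meet in the inductive
  step of \<open>sp_append\<close>.\<close>

lemma ipentagon:
  assumes [simp]: "X \<in> Ob C" "P \<in> Ob C" "Q \<in> Ob C" "Y \<in> Ob C"
  shows "As C (X \<otimes> P) Q Y \<cdot> ((iinv C (As C X P Q) \<oplus> Idn C Y) \<cdot> iinv C (As C X (P \<otimes> Q) Y))
     = iinv C (As C X P (Q \<otimes> Y)) \<cdot> (Idn C X \<oplus> As C P Q Y)"
proof -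
  let ?r = "As C X (P \<otimes> Q) Y \<cdot> (As C X P Q \<oplus> Idn C Y)"
  have "As C X P (Q \<otimes> Y) \<cdot> (As C (X \<otimes> P) Q Y \<cdot> ((iinv C (As C X P Q) \<oplus> Idn C Y) \<cdot> iinv C (As C X (P \<otimes> Q) Y)))
    = (As C X P (Q \<otimes> Y) \<cdot> As C (X \<otimes> P) Q Y) \<cdot> ((iinv C (As C X P Q) \<oplus> Idn C Y) \<cdot> iinv C (As C X (P \<otimes> Q) Y))"
    by simp
  also have "\<dots> = Idn C X \<oplus> As C P Q Y"
    by (simp add: pentagon xchg_assoc)
  also have "\<dots> = As C X P (Q \<otimes> Y) \<cdot> (iinv C (As C X P (Q \<otimes> Y)) \<cdot> (Idn C X \<oplus> As C P Q Y))"
    by simp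
  finally show ?thesis
    by (rule cancel_left) simp_all
qed

text \<open>The coherence fact on which the whole action rests: grouping the full string and then
  splitting it agrees with grouping \<open>ys\<close> and \<open>xs\<close> in turn. Along the
  recursion of \<open>split\<close>, the empty string needs \<open>lu_tens\<close>, a singleton
  before the empty string needs the triangle, and the inductive step needs the pentagon.\<close>

lemma sp_append:
  "\<lbrakk>set xs \<subseteq> Ob C; set ys \<subseteq> Ob C; Y \<in> Ob C\<rbrakk> \<Longrightarrow>
    As C (tens C xs) (tens C ys) Y \<cdot> ((split C xs ys \<oplus> Idn C Y) \<cdot> sp (xs @ ys) Y)
      = (Idn C (tens C xs) \<oplus> sp ys Y) \<cdot> sp xs (act ys Y)"
proof (induction xs ys rule: split_induct)
  case (Nil ys)
  let ?U = "Unt C" let ?t = "tens C ys"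
  note [simp] = Nil
  have "As C ?U ?t Y \<cdot> (iinv C (Lu C ?t) \<oplus> Idn C Y) = iinv C (Lu C (?t \<otimes> Y))"
    by (rule cancel_left[where g = "Lu C (?t \<otimes> Y)"]) (simp_all add: precomp1[OF lu_tens] xchg)
  moreover have "(Idn C ?U \<oplus> sp ys Y) \<cdot> iinv C (Lu C (act ys Y)) = iinv C (Lu C (?t \<otimes> Y)) \<cdot> sp ys Y"
    by (rule cancel_left[where g = "Lu C (?t \<otimes> Y)"]) (simp_all add: precomp[OF lu_nat])
  ultimately show ?case
    using precomp[of "As C ?U ?t Y" "iinv C (Lu C ?t) \<oplus> Idn C Y" "iinv C (Lu C (?t \<otimes> Y))" "Idn C (?t \<otimes> Y)" "sp ys Y"]
    by simp
next
  case (Single_Nil X)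
  then have [simp]: "X \<in> Ob C" "Y \<in> Ob C" by auto
  have "As C X (Unt C) Y \<cdot> (iinv C (Ru C X) \<oplus> Idn C Y) = (Idn C X \<oplus> iinv C (Lu C Y))"
    by (rule cancel_left[where g = "Idn C X \<oplus> Lu C Y"]) (simp_all add: precomp1[OF triangle'] xchg)
  then show ?case by simp
next
  case (Single_Cons X Z zs)
  let ?P = "tens C (Z # zs)"
  have [simp]: "X \<in> Ob C" "?P \<in> Ob C" "Y \<in> Ob C" 
    "sp (Z # zs) Y \<in> Ar C" "Dom C (sp (Z # zs) Y) = act (Z # zs) Y"
    "Cod C (sp (Z # zs) Y) = ?P \<otimes> Y" "act (Z # zs) Y \<in> Ob C"
    using Single_Cons tens_list_ob[of "Z # zs"] sp_props[of "Z # zs" Y] act_ob[of "Z # zs" Y]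
    by (simp_all del: tens.simps sp.simps act.simps)
  note [simp del] = tens.simps sp.simps act.simps split.simps
  show ?case
    by (simp add: tens.simps(2) sp.simps(2,3) split.simps(3))
next
  case (Cons X X' xs ys)
  let ?P = "tens C (X' # xs)" let ?Q = "tens C ys" let ?s = "split C (X' # xs) ys"
  let ?r = "X' # xs @ ys"
  have [simp]: "X \<in> Ob C" "?P \<in> Ob C" "?Q \<in> Ob C" "Y \<in> Ob C" "X' \<in> Ob C" "set xs \<subseteq> Ob C" "set ys \<subseteq> Ob C"
    using Cons by auto
  have [simp]: "invertible ?s" "?s \<in> Ar C" "Dom C ?s = tens C ?r" "Cod C ?s = ?P \<otimes> ?Q"
    "tens C ?r \<in> Ob C" "sp ?r Y \<in> Ar C" "Dom C (sp ?r Y) = act ?r Y" "Cod C (sp ?r Y) = tens C ?r \<otimes> Y"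
    using split_props[of "X' # xs" ys] tens_list_ob[of ?r] sp_props[of ?r Y]
    by (simp_all del: tens.simps sp.simps act.simps split.simps)
  note [simp del] = tens.simps sp.simps act.simps split.simps
  have IH: "As C ?P ?Q Y \<cdot> ((?s \<oplus> Idn C Y) \<cdot> sp ?r Y) = (Idn C ?P \<oplus> sp ys Y) \<cdot> sp (X' # xs) (act ys Y)"
    using Cons by auto
  have "As C (X \<otimes> ?P) ?Q Y \<cdot>
     (((iinv C (As C X ?P ?Q) \<cdot> (Idn C X \<oplus> ?s)) \<oplus> Idn C Y) \<cdot>
       (iinv C (As C X (tens C ?r) Y) \<cdot> (Idn C X \<oplus> sp ?r Y)))
    = As C (X \<otimes> ?P) ?Q Y \<cdot> ((iinv C (As C X ?P ?Q) \<oplus> Idn C Y) \<cdot>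
       ((((Idn C X \<oplus> ?s) \<oplus> Idn C Y) \<cdot> iinv C (As C X (tens C ?r) Y)) \<cdot> (Idn C X \<oplus> sp ?r Y)))"
    by (simp add: xchg_assoc)
  also have "((Idn C X \<oplus> ?s) \<oplus> Idn C Y) \<cdot> iinv C (As C X (tens C ?r) Y)
     = iinv C (As C X (?P \<otimes> ?Q) Y) \<cdot> (Idn C X \<oplus> (?s \<oplus> Idn C Y))"
    by (subst ias_nat) simp_all
  also have "As C (X \<otimes> ?P) ?Q Y \<cdot> ((iinv C (As C X ?P ?Q) \<oplus> Idn C Y) \<cdot>
      ((iinv C (As C X (?P \<otimes> ?Q) Y) \<cdot> (Idn C X \<oplus> (?s \<oplus> Idn C Y))) \<cdot> (Idn C X \<oplus> sp ?r Y)))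
    = (As C (X \<otimes> ?P) ?Q Y \<cdot> ((iinv C (As C X ?P ?Q) \<oplus> Idn C Y) \<cdot> iinv C (As C X (?P \<otimes> ?Q) Y))) \<cdot>
       (Idn C X \<oplus> ((?s \<oplus> Idn C Y) \<cdot> sp ?r Y))"
    by (simp add: xchg)
  also have "\<dots> = iinv C (As C X ?P (?Q \<otimes> Y)) \<cdot> (Idn C X \<oplus> (As C ?P ?Q Y \<cdot> ((?s \<oplus> Idn C Y) \<cdot> sp ?r Y)))"
    by (subst ipentagon) (simp_all add: xchg)
  also have "\<dots> = (iinv C (As C X ?P (?Q \<otimes> Y)) \<cdot> (Idn C X \<oplus> (Idn C ?P \<oplus> sp ys Y))) \<cdot> (Idn C X \<oplus> sp (X' # xs) (act ys Y))"
    unfolding IH by (simp add: xchg)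
  also have "iinv C (As C X ?P (?Q \<otimes> Y)) \<cdot> (Idn C X \<oplus> (Idn C ?P \<oplus> sp ys Y))
     = (Idn C (X \<otimes> ?P) \<oplus> sp ys Y) \<cdot> iinv C (As C X ?P (act ys Y))"
    by (subst ias_nat) simp_all
  finally show ?case
    by (simp add: tens.simps sp.simps split.simps)
qed

lemma cell_act_eqI:
  assumes "set xs \<subseteq> Ob C" "set ys \<subseteq> Ob C" "Y \<in> Ob C" "v \<in> Ar C" "Cod C v = act ys Y"
    and "sp ys Y \<cdot> v = (f \<oplus> Idn C Y) \<cdot> sp xs Y"
  shows "cell_act (xs, f, ys) Y = v"
  using assms by (simp add: cell_act_def assms(6)[symmetric])

lemma cell_act_char:
  assumes "set xs \<subseteq> Ob C" "set ys \<subseteq> Ob C" "Y \<in> Ob C" "f \<in> hom C (tens C xs) (tens C ys)"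
  shows "sp ys Y \<cdot> cell_act (xs, f, ys) Y = (f \<oplus> Idn C Y) \<cdot> sp xs Y"
  using assms by (simp add: cell_act_def hom_iff)

lemma cell_act_hom:
  assumes "set xs \<subseteq> Ob C" "set ys \<subseteq> Ob C" "Y \<in> Ob C" "f \<in> hom C (tens C xs) (tens C ys)"
  shows "cell_act (xs, f, ys) Y \<in> hom C (act xs Y) (act ys Y)"
  using assms by (simp add: cell_act_def hom_iff)

text \<open>The cell touches only the string and \<open>k\<close> only the object acted on, so they
  commute by interchange; \<open>sp_nat\<close> carries \<open>k\<close> across the conjugating
  maps.\<close>

lemma cell_act_nat:
  assumes "set xs \<subseteq> Ob C" "set ys \<subseteq> Ob C" "f \<in> hom C (tens C xs) (tens C ys)"
    and "k \<in> hom C Y Z"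
  shows "whisker ys k \<cdot> cell_act (xs, f, ys) Y = cell_act (xs, f, ys) Z \<cdot> whisker xs k"
proof -
  have [simp]: "Y \<in> Ob C" "Z \<in> Ob C" and k: "k \<in> Ar C" "Dom C k = Y" "Cod C k = Z"
    and f: "f \<in> Ar C" "Dom C f = tens C xs" "Cod C f = tens C ys"
    using assms(3,4) by (auto simp: hom_iff)
  note [simp] = assms(1,2) k f
  note h = cell_act_hom[OF assms(1,2) _ assms(3), unfolded hom_iff]
  have [simp]: "cell_act (xs, f, ys) Y \<in> Ar C" "cell_act (xs, f, ys) Z \<in> Ar C"
     "Dom C (cell_act (xs, f, ys) Y) = act xs Y" "Cod C (cell_act (xs, f, ys) Y) = act ys Y"
     "Dom C (cell_act (xs, f, ys) Z) = act xs Z" "Cod C (cell_act (xs, f, ys) Z) = act ys Z"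
    using h[of Y] h[of Z] by auto
  have "sp ys Z \<cdot> (whisker ys k \<cdot> cell_act (xs, f, ys) Y) = (Idn C (tens C ys) \<oplus> k) \<cdot> (sp ys Y \<cdot> cell_act (xs, f, ys) Y)"
    using precomp[OF sp_nat[of ys k], of "cell_act (xs, f, ys) Y"] by simp
  also have "\<dots> = (f \<oplus> Idn C Z) \<cdot> ((Idn C (tens C xs) \<oplus> k) \<cdot> sp xs Y)"
    by (subst cell_act_char) (use assms in \<open>simp_all add: xchg_assoc\<close>)
  also have "\<dots> = (f \<oplus> Idn C Z) \<cdot> (sp xs Z \<cdot> whisker xs k)"
    using sp_nat[of xs k] by simp
  also have "\<dots> = sp ys Z \<cdot> (cell_act (xs, f, ys) Z \<cdot> whisker xs k)"
    using cell_act_char[OF assms(1,2) _ assms(3), of Z] by (simp add: assoc[symmetric] del: assoc)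
  finally show ?thesis
    by (rule cancel_left) simp_all
qed

text \<open>At both ends \<open>sp_append\<close> trades \<open>split\<close> for an associator, and
  naturality of the associator leaves \<open>f\<close> beside an identity on everything to its
  right.\<close>

lemma cell_act_paste_right:
  assumes [simp]: "set ms \<subseteq> Ob C" "set ns \<subseteq> Ob C" "set ys \<subseteq> Ob C" "Y \<in> Ob C"
    and f: "f \<in> hom C (tens C ms) (tens C ns)"
  shows "cell_act (ms @ ys, iinv C (split C ns ys) \<cdot> ((f \<oplus> Idn C (tens C ys)) \<cdot> split C ms ys), ns @ ys) Y
     = cell_act (ms, f, ns) (act ys Y)"
proof -
  let ?v = "cell_act (ms, f, ns) (act ys Y)" let ?t = "tens C ys"
  have [simp]: "f \<in> Ar C" "Dom C f = tens C ms" "Cod C f = tens C ns" using f by (auto simp: hom_iff)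
  have [simp]: "?v \<in> Ar C" "Dom C ?v = act ms (act ys Y)" "Cod C ?v = act ns (act ys Y)"
    using cell_act_hom[OF _ _ _ f, of "act ys Y"] by (auto simp: hom_iff)
  let ?g = "iinv C (split C ns ys) \<cdot> ((f \<oplus> Idn C (tens C ys)) \<cdot> split C ms ys)"
  have "(As C (tens C ns) ?t Y \<cdot> ((split C ns ys \<oplus> Idn C Y) \<cdot> sp (ns @ ys) Y)) \<cdot> ?v
     = (Idn C (tens C ns) \<oplus> sp ys Y) \<cdot> (sp ns (act ys Y) \<cdot> ?v)"
    by (simp add: sp_append act_append)
  also have "\<dots> = (f \<oplus> (Idn C ?t \<oplus> Idn C Y)) \<cdot> ((Idn C (tens C ms) \<oplus> sp ys Y) \<cdot> sp ms (act ys Y))"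
    by (subst cell_act_char[OF _ _ _ f]) (simp_all add: xchg_assoc)
  also have "\<dots> = ((f \<oplus> (Idn C ?t \<oplus> Idn C Y)) \<cdot> As C (tens C ms) ?t Y) \<cdot> ((split C ms ys \<oplus> Idn C Y) \<cdot> sp (ms @ ys) Y)"
    by (subst sp_append[symmetric]) (simp_all add: act_append)
  also have "(f \<oplus> (Idn C ?t \<oplus> Idn C Y)) \<cdot> As C (tens C ms) ?t Y = As C (tens C ns) ?t Y \<cdot> ((f \<oplus> Idn C ?t) \<oplus> Idn C Y)"
    by (subst as_nat) simp_all
  also have "(As C (tens C ns) ?t Y \<cdot> ((f \<oplus> Idn C ?t) \<oplus> Idn C Y)) \<cdot> ((split C ms ys \<oplus> Idn C Y) \<cdot> sp (ms @ ys) Y)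
     = As C (tens C ns) ?t Y \<cdot> ((split C ns ys \<oplus> Idn C Y) \<cdot> ((?g \<oplus> Idn C Y) \<cdot> sp (ms @ ys) Y))"
    by (simp add: xchg_assoc)
  finally have "(As C (tens C ns) ?t Y \<cdot> (split C ns ys \<oplus> Idn C Y)) \<cdot> (sp (ns @ ys) Y \<cdot> ?v)
     = (As C (tens C ns) ?t Y \<cdot> (split C ns ys \<oplus> Idn C Y)) \<cdot> ((?g \<oplus> Idn C Y) \<cdot> sp (ms @ ys) Y)"
    by (simp add: act_append)
  then have "sp (ns @ ys) Y \<cdot> ?v = (?g \<oplus> Idn C Y) \<cdot> sp (ms @ ys) Y"
    by (rule cancel_left) (simp_all add: act_append)
  then show ?thesis
    by (intro cell_act_eqI) (simp_all add: act_append)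
qed

text \<open>As for the right-hand version, except that \<open>f\<close> now sits behind the string
  \<open>xs\<close>, so \<open>sp_nat\<close> is used as well to pull its action out through
  \<open>sp xs\<close>.\<close>

lemma cell_act_paste_left:
  assumes [simp]: "set ms \<subseteq> Ob C" "set ns \<subseteq> Ob C" "set xs \<subseteq> Ob C" "Y \<in> Ob C"
    and f: "f \<in> hom C (tens C ms) (tens C ns)"
  shows "cell_act (xs @ ms, iinv C (split C xs ns) \<cdot> ((Idn C (tens C xs) \<oplus> f) \<cdot> split C xs ms), xs @ ns) Y
     = whisker xs (cell_act (ms, f, ns) Y)"
proof -
  let ?v = "cell_act (ms, f, ns) Y" let ?t = "tens C xs"
  have [simp]: "f \<in> Ar C" "Dom C f = tens C ms" "Cod C f = tens C ns" using f by (auto simp: hom_iff)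
  have [simp]: "?v \<in> Ar C" "Dom C ?v = act ms Y" "Cod C ?v = act ns Y"
    using cell_act_hom[OF _ _ _ f, of "Y"] by (auto simp: hom_iff)
  let ?g = "iinv C (split C xs ns) \<cdot> ((Idn C ?t \<oplus> f) \<cdot> split C xs ms)"
  have "(As C ?t (tens C ns) Y \<cdot> ((split C xs ns \<oplus> Idn C Y) \<cdot> sp (xs @ ns) Y)) \<cdot> whisker xs ?v
     = (Idn C ?t \<oplus> sp ns Y) \<cdot> (sp xs (act ns Y) \<cdot> whisker xs ?v)"
    by (simp add: sp_append act_append)
  also have "\<dots> = (Idn C ?t \<oplus> (sp ns Y \<cdot> ?v)) \<cdot> sp xs (act ms Y)"
    unfolding sp_nat[of xs ?v, simplified, symmetric] by (simp add: xchg_assoc)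
  also have "\<dots> = (Idn C ?t \<oplus> (f \<oplus> Idn C Y)) \<cdot> ((Idn C ?t \<oplus> sp ms Y) \<cdot> sp xs (act ms Y))"
    by (subst cell_act_char[OF _ _ _ f]) (simp_all add: xchg_assoc)
  also have "\<dots> = ((Idn C ?t \<oplus> (f \<oplus> Idn C Y)) \<cdot> As C ?t (tens C ms) Y) \<cdot> ((split C xs ms \<oplus> Idn C Y) \<cdot> sp (xs @ ms) Y)"
    by (subst sp_append[symmetric]) (simp_all add: act_append)
  also have "(Idn C ?t \<oplus> (f \<oplus> Idn C Y)) \<cdot> As C ?t (tens C ms) Y = As C ?t (tens C ns) Y \<cdot> ((Idn C ?t \<oplus> f) \<oplus> Idn C Y)"
    by (subst as_nat) simp_all
  also have "(As C ?t (tens C ns) Y \<cdot> ((Idn C ?t \<oplus> f) \<oplus> Idn C Y)) \<cdot> ((split C xs ms \<oplus> Idn C Y) \<cdot> sp (xs @ ms) Y)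
     = As C ?t (tens C ns) Y \<cdot> ((split C xs ns \<oplus> Idn C Y) \<cdot> ((?g \<oplus> Idn C Y) \<cdot> sp (xs @ ms) Y))"
    by (simp add: xchg_assoc)
  finally have "(As C ?t (tens C ns) Y \<cdot> (split C xs ns \<oplus> Idn C Y)) \<cdot> (sp (xs @ ns) Y \<cdot> whisker xs ?v)
     = (As C ?t (tens C ns) Y \<cdot> (split C xs ns \<oplus> Idn C Y)) \<cdot> ((?g \<oplus> Idn C Y) \<cdot> sp (xs @ ms) Y)"
    by (simp add: act_append)
  then have "sp (xs @ ns) Y \<cdot> whisker xs ?v = (?g \<oplus> Idn C Y) \<cdot> sp (xs @ ms) Y"
    by (rule cancel_left) (simp_all add: act_append)
  then show ?thesis
    by (intro cell_act_eqI) (simp_all add: act_append)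
qed

definition cell :: "('o, 'm) pcell \<Rightarrow> bool" where
  "cell c \<longleftrightarrow> set (fst c) \<subseteq> Ob C \<and> set (snd (snd c)) \<subseteq> Ob C \<and>
     fst (snd c) \<in> hom C (tens C (fst c)) (tens C (snd (snd c)))"

lemma cell_iff: "cell (xs, f, ys) \<longleftrightarrow> set xs \<subseteq> Ob C \<and> set ys \<subseteq> Ob C \<and> f \<in> hom C (tens C xs) (tens C ys)"
  by (simp add: cell_def)

lemma fst_paste [simp]: "fst (paste C xs c ys) = xs @ fst c @ ys"
  and snd_paste [simp]: "snd (snd (paste C xs c ys)) = xs @ snd (snd c) @ ys"
  by (cases c; simp)+

lemma cell_paste:
  assumes "set xs \<subseteq> Ob C" "set ys \<subseteq> Ob C" "cell c"
  shows "cell (paste C xs c ys)"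
  using assms by (cases c) (simp add: cell_iff hom_iff)

lemma cell_act_paste:
  assumes "set xs \<subseteq> Ob C" "set ys \<subseteq> Ob C" "cell c" "Y \<in> Ob C"
  shows "cell_act (paste C xs c ys) Y = whisker xs (cell_act c (act ys Y))"
proof (cases c)
  case (fields ms f ns)
  note h = assms(1,2,4) assms(3)[unfolded fields cell_iff]
  let ?g = "iinv C (split C ns ys) \<cdot> ((f \<oplus> Idn C (tens C ys)) \<cdot> split C ms ys)"
  have "?g \<in> hom C (tens C (ms @ ys)) (tens C (ns @ ys))"
    using h by (simp add: hom_iff)
  then have "cell_act (paste C xs c ys) Y = whisker xs (cell_act (ms @ ys, ?g, ns @ ys) Y)"
    unfolding fields paste.simps using h by (intro cell_act_paste_left) auto
  then show ?thesis
    using h cell_act_paste_right[of ms ns ys Y f] by (simp add: fields)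
qed

lemma cell_act_type:
  assumes "cell c" "Y \<in> Ob C"
  shows "cell_act c Y \<in> Ar C" "Dom C (cell_act c Y) = act (fst c) Y"
    "Cod C (cell_act c Y) = act (snd (snd c)) Y"
  using cell_act_hom[of "fst c" "snd (snd c)" Y "fst (snd c)"] assms by (auto simp: cell_def hom_iff)

text \<open>The action at the unit is \<open>f \<oplus> Idn U\<close> conjugated by the invertible
  \<open>sp\<close>; cancelling \<open>sp\<close> and applying \<open>tensU_faithful\<close>
  recovers \<open>f\<close>.\<close>

lemma cell_act_faithful:
  assumes "cell c" "cell d" "fst c = fst d" "snd (snd c) = snd (snd d)"
    "cell_act c (Unt C) = cell_act d (Unt C)"
  shows "c = d"
proof (cases c)
  case (fields xs f ys)
  obtain g where d: "d = (xs, g, ys)" using assms(3,4) fields by (cases d) auto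
  note h = assms(1,2)[unfolded fields d cell_iff]
  have "f \<oplus> Idn C (Unt C) = g \<oplus> Idn C (Unt C)"
  proof (rule cancel_right)
    show "(f \<oplus> Idn C (Unt C)) \<cdot> sp xs (Unt C) = (g \<oplus> Idn C (Unt C)) \<cdot> sp xs (Unt C)"
      using cell_act_char[of xs ys "Unt C" f] cell_act_char[of xs ys "Unt C" g] h assms(5) fields d by simp
  qed (use h in \<open>auto simp: hom_iff\<close>)
  then show ?thesis
    using tensU_faithful[of f g] h fields d by (simp add: hom_iff)
qed

lemma cell_chain:
  assumes "cell c" "cell (chain C (d # cs))" "snd (snd c) = fst (chain C (d # cs))"
  shows "cell (chain C (c # d # cs))"
  using assms by (simp add: cell_def hom_iff)

text \<open>The \<open>sp\<close> of the intermediate string occurs next to its inverse and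
  cancels.\<close>

lemma cell_act_chain:
  assumes "cell c" "cell (chain C (d # cs))" "snd (snd c) = fst (chain C (d # cs))" "Y \<in> Ob C"
  shows "cell_act (chain C (c # d # cs)) Y = cell_act (chain C (d # cs)) Y \<cdot> cell_act c Y"
  using assms
  by (simp add: cell_def hom_iff cell_act_def tens_idn[symmetric] xchg_assoc del: tens_idn)

end

section \<open>Normalising strings of trivialised and genuine objects\<close>

text \<open>
  \<open>Tr u\<close> stands for an object trivialised by \<open>u\<close> into the unit, \<open>Re X\<close> for a
  genuine object.
\<close>

datatype ('o, 'm) item = Tr 'm | Re 'o

primrec reals :: "('o, 'm) item list \<Rightarrow> 'o list" where
  "reals [] = []"
| "reals (x # xs) = (case x of Tr u \<Rightarrow> reals xs | Re X \<Rightarrow> X # reals xs)"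

lemma reals_append [simp]: "reals (xs @ ys) = reals xs @ reals ys"
  by (induction xs) (auto split: item.split)

lemma reals_map_Tr [simp]: "reals (map Tr us) = []"
  by (induction us) auto

context monoidal_category
begin

primrec iob :: "('o, 'm) item \<Rightarrow> 'o" where
  "iob (Tr u) = Dom C u"
| "iob (Re X) = X"

primrec ok :: "('o, 'm) item \<Rightarrow> bool" where
  "ok (Tr u) \<longleftrightarrow> invertible u \<and> Cod C u = Unt C"
| "ok (Re X) \<longleftrightarrow> X \<in> Ob C"

primrec nrm :: "('o, 'm) item list \<Rightarrow> 'o \<Rightarrow> 'm" where
  "nrm [] Y = Idn C Y"
| "nrm (x # xs) Y = (case x of Tr u \<Rightarrow> Lu C (act (reals xs) Y) \<cdot> (u \<oplus> nrm xs Y)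
     | Re X \<Rightarrow> Idn C X \<oplus> nrm xs Y)"

text \<open>The square says what a cell becomes once all trivialised objects have been removed.
  \<open>v\<close> is a family over all \<open>Y\<close>, although its member at the unit already
  determines the cell, because whiskering on the right evaluates it at other objects.\<close>

definition val :: "('o, 'm) item list \<Rightarrow> ('o, 'm) pcell \<Rightarrow> ('o, 'm) item list \<Rightarrow> ('o \<Rightarrow> 'm) \<Rightarrow> bool"
  where
  "val us c vs v \<longleftrightarrow> list_all ok us \<and> list_all ok vs \<and> cell c \<and> fst c = map iob us \<and>
     snd (snd c) = map iob vs \<and>
     (\<forall>Y \<in> Ob C. v Y \<in> hom C (act (reals us) Y) (act (reals vs) Y) \<and>
        nrm vs Y \<cdot> cell_act c Y = v Y \<cdot> nrm us Y)"

lemma ok_iob: "ok x \<Longrightarrow> iob x \<in> Ob C"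
  by (cases x) (auto simp: invertible_ar)

lemma oks_iob [simp]: "list_all ok xs \<Longrightarrow> set (map iob xs) \<subseteq> Ob C"
  by (induction xs) (auto simp: ok_iob)

lemma oks_iob' [simp]: "list_all ok xs \<Longrightarrow> iob ` set xs \<subseteq> Ob C"
  using oks_iob by simp

lemma oks_reals [simp]: "list_all ok xs \<Longrightarrow> set (reals xs) \<subseteq> Ob C"
  by (induction xs) (auto split: item.split)

lemma nrm_props:
  "\<lbrakk>list_all ok xs; Y \<in> Ob C\<rbrakk> \<Longrightarrow> invertible (nrm xs Y) \<and> nrm xs Y \<in> Ar C \<and>
     Dom C (nrm xs Y) = act (map iob xs) Y \<and> Cod C (nrm xs Y) = act (reals xs) Y"
proof (induction xs)
  case (Cons x xs)
  then show ?case by (cases x) (auto simp: invertible_ar)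
qed simp

lemma nrm_invertible [simp]: "\<lbrakk>list_all ok xs; Y \<in> Ob C\<rbrakk> \<Longrightarrow> invertible (nrm xs Y)"
  and nrm_ar [simp]: "\<lbrakk>list_all ok xs; Y \<in> Ob C\<rbrakk> \<Longrightarrow> nrm xs Y \<in> Ar C"
  and nrm_dom [simp]: "\<lbrakk>list_all ok xs; Y \<in> Ob C\<rbrakk> \<Longrightarrow> Dom C (nrm xs Y) = act (map iob xs) Y"
  and nrm_cod [simp]: "\<lbrakk>list_all ok xs; Y \<in> Ob C\<rbrakk> \<Longrightarrow> Cod C (nrm xs Y) = act (reals xs) Y"
  using nrm_props by auto

lemma nrm_nat:
  assumes "list_all ok xs" and [simp]: "f \<in> Ar C"
  shows "nrm xs (Cod C f) \<cdot> whisker (map iob xs) f = whisker (reals xs) f \<cdot> nrm xs (Dom C f)"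
  using assms(1)
proof (induction xs)
  case (Cons x xs)
  then have IH: "nrm xs (Cod C f) \<cdot> whisker (map iob xs) f = whisker (reals xs) f \<cdot> nrm xs (Dom C f)"
    and [simp]: "list_all ok xs" and x: "ok x" by auto
  show ?case
  proof (cases x)
    case (Tr u)
    then have [simp]: "invertible u" "u \<in> Ar C" "Cod C u = Unt C" using x by (auto simp: invertible_ar)
    let ?w = "whisker (reals xs) f"
    have "u \<oplus> (?w \<cdot> nrm xs (Dom C f)) = (Idn C (Unt C) \<oplus> ?w) \<cdot> (u \<oplus> nrm xs (Dom C f))"
      by (simp add: xchg)
    then have "Lu C (act (reals xs) (Cod C f)) \<cdot> (u \<oplus> (?w \<cdot> nrm xs (Dom C f)))
        = ?w \<cdot> (Lu C (act (reals xs) (Dom C f)) \<cdot> (u \<oplus> nrm xs (Dom C f)))"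
      by (simp add: precomp[OF lu_nat])
    then show ?thesis
      by (simp add: Tr xchg IH)
  next
    case (Re X)
    then show ?thesis using x by (simp add: xchg IH)
  qed
qed simp

lemma nrm_append:
  "\<lbrakk>list_all ok xs; list_all ok ys; Y \<in> Ob C\<rbrakk>
    \<Longrightarrow> nrm (xs @ ys) Y = nrm xs (act (reals ys) Y) \<cdot> whisker (map iob xs) (nrm ys Y)"
proof (induction xs)
  case (Cons x xs)
  then have "ok x" "list_all ok xs" by auto
  then show ?case
    using Cons by (cases x) (auto simp: act_append xchg invertible_ar)
qed simp

text \<open>\<open>nrm\<close> is invertible, so the value at the unit fixes the action at the unit,
  and this fixes the cell by \<open>cell_act_faithful\<close>.\<close>

lemma val_unique:
  assumes "val us c vs v" "val us d vs w" "v (Unt C) = w (Unt C)"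
  shows "c = d"
proof (rule cell_act_faithful)
  note h = assms(1,2)[unfolded val_def]
  show "cell c" "cell d" "fst c = fst d" "snd (snd c) = snd (snd d)" using h by auto
  have "nrm vs (Unt C) \<cdot> cell_act c (Unt C) = nrm vs (Unt C) \<cdot> cell_act d (Unt C)"
    using h assms(3) by auto
  then show "cell_act c (Unt C) = cell_act d (Unt C)"
    by (rule cancel_left) (use h in \<open>auto simp: cell_act_type\<close>)
qed

text \<open>The invertible \<open>nrm us Y\<close> cancels. This is the converse half of the
  dictionary: an equation between pastings can be read back as an equation between
  morphisms.\<close>

lemma val_det:
  assumes "val us c vs v" "val us c vs w" "Y \<in> Ob C"
  shows "v Y = w Y"
proof (rule cancel_right)
  show "v Y \<cdot> nrm us Y = w Y \<cdot> nrm us Y" using assms unfolding val_def by metis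
qed (use assms in \<open>auto simp: val_def hom_iff\<close>)

lemma val_chain:
  assumes "val us c vs v" "val vs (chain C (d # cs)) ws w"
  shows "val us (chain C (c # d # cs)) ws (\<lambda>Y. w Y \<cdot> v Y)"
proof -
  let ?e = "chain C (d # cs)"
  note h = assms[unfolded val_def]
  have c: "cell (chain C (c # d # cs))" by (rule cell_chain) (use h in auto)
  have "nrm ws Y \<cdot> cell_act (chain C (c # d # cs)) Y = (w Y \<cdot> v Y) \<cdot> nrm us Y" if Y: "Y \<in> Ob C" for Y
  proof -
    have t: "v Y \<in> hom C (act (reals us) Y) (act (reals vs) Y)" "nrm vs Y \<cdot> cell_act c Y = v Y \<cdot> nrm us Y"
      "w Y \<in> hom C (act (reals vs) Y) (act (reals ws) Y)" "nrm ws Y \<cdot> cell_act ?e Y = w Y \<cdot> nrm vs Y"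
      using h Y by auto
    note [simp] = cell_act_type[of c Y] cell_act_type[of ?e Y]
    have "nrm ws Y \<cdot> (cell_act ?e Y \<cdot> cell_act c Y) = w Y \<cdot> (nrm vs Y \<cdot> cell_act c Y)"
      by (rule precomp) (use h t Y in \<open>simp_all add: hom_iff\<close>)
    then show ?thesis
      using h Y t by (subst cell_act_chain) (auto simp: hom_iff)
  qed
  then show ?thesis
    using h c unfolding val_def by (auto simp: hom_iff)
qed

text \<open>\<open>nrm\<close> of a concatenation factors by \<open>nrm_append\<close>. Normalising
  the tail commutes with the cell by \<open>cell_act_nat\<close>; normalising the head commutes with
  all the rest by \<open>nrm_nat\<close>.\<close>

lemma val_paste:
  assumes "val us c vs v" "list_all ok xs" "list_all ok ys"
  shows "val (xs @ us @ ys) (paste C (map iob xs) c (map iob ys)) (xs @ vs @ ys)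
     (\<lambda>Y. whisker (reals xs) (v (act (reals ys) Y)))"
proof -
  note h = assms[unfolded val_def]
  have u: "list_all ok us" and w: "list_all ok vs" and c: "cell c"
    and cd: "fst c = map iob us" "snd (snd c) = map iob vs" using h by auto
  have "nrm (xs @ vs @ ys) Y \<cdot> cell_act (paste C (map iob xs) c (map iob ys)) Y
     = whisker (reals xs) (v (act (reals ys) Y)) \<cdot> nrm (xs @ us @ ys) Y" if [simp]: "Y \<in> Ob C" for Y
  proof -
    let ?R = "act (reals ys) Y" and ?Z = "act (map iob ys) Y"
    note [simp] = u w assms(2,3) c cd
    have [simp]: "?R \<in> Ob C" "?Z \<in> Ob C"
      using act_ob[of "map iob ys" Y] act_ob[of "reals ys" Y] by (auto simp del: act_ob)
    have t: "v ?R \<in> Ar C" "Dom C (v ?R) = act (reals us) ?R" "Cod C (v ?R) = act (reals vs) ?R"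
      "nrm vs ?R \<cdot> cell_act c ?R = v ?R \<cdot> nrm us ?R"
      using h by (auto simp: hom_iff)
    note [simp] = t(1-3) cell_act_type[OF c]
    have ceq: "c = (map iob us, fst (snd c), map iob vs)"
      using cd by (cases c) simp
    have n: "whisker (map iob vs) (nrm ys Y) \<cdot> cell_act c ?Z = cell_act c ?R \<cdot> whisker (map iob us) (nrm ys Y)"
      by (rule cell_act_nat[of "map iob us" "map iob vs" "fst (snd c)" "nrm ys Y" ?Z ?R, folded ceq])
        (use c cd in \<open>simp_all add: cell_def hom_iff\<close>)
    have "nrm (vs @ ys) Y \<cdot> cell_act c ?Z = nrm vs ?R \<cdot> (whisker (map iob vs) (nrm ys Y) \<cdot> cell_act c ?Z)"
      by (simp add: nrm_append)
    also have "\<dots> = (nrm vs ?R \<cdot> cell_act c ?R) \<cdot> whisker (map iob us) (nrm ys Y)"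
      unfolding n by simp
    also have "\<dots> = v ?R \<cdot> nrm (us @ ys) Y"
      unfolding t(4) by (simp add: nrm_append)
    finally have 1: "nrm (vs @ ys) Y \<cdot> cell_act c ?Z = v ?R \<cdot> nrm (us @ ys) Y" .
    \<comment> \<open>The inner part of the square, taken as a single arrow so that
      \<open>nrm_nat\<close> can carry it past \<open>nrm xs\<close>.\<close>
    let ?f = "nrm (vs @ ys) Y \<cdot> cell_act c ?Z"
    have [simp]: "?f \<in> Ar C" "Dom C ?f = act (map iob (us @ ys)) Y" "Cod C ?f = act (reals (vs @ ys)) Y"
      by (simp_all add: act_append)
    have "nrm (xs @ vs @ ys) Y \<cdot> cell_act (paste C (map iob xs) c (map iob ys)) Y
      = nrm xs (act (reals (vs @ ys)) Y) \<cdot> (whisker (map iob xs) (nrm (vs @ ys) Y) \<cdot> whisker (map iob xs) (cell_act c ?Z))"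
      by (subst cell_act_paste) (simp_all add: nrm_append[of xs "vs @ ys"] act_append)
    also have "\<dots> = nrm xs (Cod C ?f) \<cdot> whisker (map iob xs) ?f"
      by (subst whisker_cmp[symmetric]) (simp_all add: act_append)
    also have "\<dots> = whisker (reals xs) ?f \<cdot> nrm xs (Dom C ?f)"
      by (rule nrm_nat) simp_all
    also have "\<dots> = (whisker (reals xs) (v ?R) \<cdot> whisker (reals xs) (nrm (us @ ys) Y)) \<cdot> nrm xs (act (map iob (us @ ys)) Y)"
      unfolding 1[symmetric] by (simp add: 1 whisker_cmp act_append)
    also have "\<dots> = whisker (reals xs) (v ?R) \<cdot> (nrm xs (act (reals (us @ ys)) Y) \<cdot> whisker (map iob xs) (nrm (us @ ys) Y))"
      using nrm_nat[of xs "nrm (us @ ys) Y"] by (simp add: act_append)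
    finally show ?thesis
      by (simp add: nrm_append[of xs "us @ ys"])
  qed
  moreover have "cell (paste C (map iob xs) c (map iob ys))"
    by (rule cell_paste) (use assms(2,3) c in simp_all)
  ultimately show ?thesis
    using h unfolding val_def by (auto simp: hom_iff act_append)
qed

section \<open>Coherent cells\<close>

definition triv :: "'o \<Rightarrow> 'm \<Rightarrow> bool" where
  "triv X u \<longleftrightarrow> invertible u \<and> Dom C u = X \<and> Cod C u = Unt C"

text \<open>As \<open>collapse C vs\<close> is invertible, the last clause forces the morphism to be
  that of \<open>coh_cell C us vs\<close>. The trivialisations may be arbitrary isomorphisms to the
  unit, so that inverses of \<open>FU H\<close> and images under \<open>H\<close> are
  covered.\<close>

definition coherent :: "'m list \<Rightarrow> ('o, 'm) pcell \<Rightarrow> 'm list \<Rightarrow> bool" where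
  "coherent us c vs \<longleftrightarrow> list_all2 triv (fst c) us \<and> list_all2 triv (snd (snd c)) vs \<and> cell c \<and>
     collapse C vs \<cdot> fst (snd c) = collapse C us"

lemma trivs_iff: "list_all2 triv xs us \<longleftrightarrow> list_all ok (map Tr us) \<and> xs = map iob (map Tr us)"
  by (induction xs us rule: list_induct2') (auto simp: triv_def)

lemma collapse_props:
  "list_all2 triv xs us \<Longrightarrow> set xs \<subseteq> Ob C \<and> invertible (collapse C us) \<and> collapse C us \<in> Ar C \<and>
     Dom C (collapse C us) = tens C xs \<and> Cod C (collapse C us) = Unt C"
proof (induction us arbitrary: xs rule: induct_list012)
  case (2 u)
  then show ?case by (auto simp: list_all2_Cons2 triv_def invertible_ar)
next
  case (3 u v us)
  then obtain x y ys where xs: "xs = x # y # ys" "triv x u" "list_all2 triv (y # ys) (v # us)"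
    by (auto simp: list_all2_Cons2)
  then show ?case using 3(2)[OF xs(3)] by (auto simp: triv_def invertible_ar)
qed auto

text \<open>Compares two ways of absorbing a trivialised string into \<open>Y\<close>: entry by
  entry, or after collapsing the string to a single unit. Each inductive step merges two units by
  \<open>lu_tens\<close>.\<close>

lemma nrm_collapse:
  assumes "Y \<in> Ob C"
  shows "list_all2 triv xs us \<Longrightarrow> nrm (map Tr us) Y = Lu C Y \<cdot> ((collapse C us \<oplus> Idn C Y) \<cdot> sp xs Y)"
proof (induction us arbitrary: xs rule: induct_list012)
  case 1
  then show ?case using assms by simp
next
  case (2 u)
  then show ?case using assms by (auto simp: list_all2_Cons2 triv_def invertible_ar)
next
  case (3 u v us)
  then obtain x y ys where xs: "xs = x # y # ys" "triv x u" and t: "list_all2 triv (y # ys) (v # us)"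
    by (auto simp: list_all2_Cons2)
  let ?c = "collapse C (v # us)" and ?P = "tens C (y # ys)" and ?s = "sp (y # ys) Y" and ?U = "Unt C"
  have [simp]: "Y \<in> Ob C" "x \<in> Ob C" "u \<in> Ar C" "Dom C u = x" "Cod C u = ?U"
    using assms xs(2) by (auto simp: triv_def invertible_ar)
  have [simp]: "?P \<in> Ob C" "?s \<in> Ar C" "Dom C ?s = act (y # ys) Y" "Cod C ?s = ?P \<otimes> Y" "act (y # ys) Y \<in> Ob C"
    "?c \<in> Ar C" "Dom C ?c = ?P" "Cod C ?c = ?U"
    using collapse_props[OF t] sp_props[of "y # ys" Y] tens_list_ob[of "y # ys"] act_ob[of "y # ys" Y]
    by (simp_all del: collapse.simps tens.simps sp.simps act.simps)
  note [simp del] = collapse.simps tens.simps sp.simps act.simps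
  have IH: "nrm (map Tr (v # us)) Y = Lu C Y \<cdot> ((?c \<oplus> Idn C Y) \<cdot> ?s)" by (rule 3(2)[OF t])
  have "nrm (map Tr (u # v # us)) Y = Lu C Y \<cdot> (u \<oplus> nrm (map Tr (v # us)) Y)"
    using reals_map_Tr[of "v # us"] by (simp add: act.simps)
  also have "\<dots> = Lu C Y \<cdot> ((Idn C ?U \<oplus> Lu C Y) \<cdot> ((u \<oplus> (?c \<oplus> Idn C Y)) \<cdot> (Idn C x \<oplus> ?s)))"
    unfolding IH by (simp add: xchg)
  \<comment> \<open>\<open>Idn U \<oplus> Lu Y\<close> is \<open>Lu (U \<otimes> Y)\<close> by
    \<open>lu_lu\<close>, and \<open>lu_tens\<close> rewrites that as
    \<open>Lu U \<oplus> Idn Y\<close> after an inverse associator. The two units next to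
    \<open>Y\<close> thus become one.\<close>
  also have "\<dots> = Lu C Y \<cdot> (((Lu C ?U \<oplus> Idn C Y) \<cdot> iinv C (As C ?U ?U Y)) \<cdot> ((u \<oplus> (?c \<oplus> Idn C Y)) \<cdot> (Idn C x \<oplus> ?s)))"
    by (simp add: lu_tens[symmetric] lu_lu)
  also have "\<dots> = Lu C Y \<cdot> ((Lu C ?U \<oplus> Idn C Y) \<cdot> (((u \<oplus> ?c) \<oplus> Idn C Y) \<cdot> (iinv C (As C x ?P Y) \<cdot> (Idn C x \<oplus> ?s))))"
    using precomp[OF ias_nat[of u ?c "Idn C Y" ?U ?U Y], of "Idn C x \<oplus> ?s"] by simp
  also have "\<dots> = Lu C Y \<cdot> ((collapse C (u # v # us) \<oplus> Idn C Y) \<cdot> sp xs Y)"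
    by (simp add: xs(1) collapse.simps(3) sp.simps(3) xchg_assoc)
  finally show ?case .
qed

text \<open>By \<open>nrm_collapse\<close> the square with identity value is the equation of
  collapses tensored with \<open>Y\<close>, and at the unit this tensoring can be undone. Closure of
  coherent cells under chaining and pasting is then inherited from \<open>val\<close>.\<close>

lemma coherent_iff_val: "coherent us c vs \<longleftrightarrow> val (map Tr us) c (map Tr vs) (Idn C)"
proof -
  { assume h: "list_all2 triv (fst c) us" "list_all2 triv (snd (snd c)) vs" "cell c"
    note p = collapse_props[OF h(1)] collapse_props[OF h(2)]
    have o: "set (fst c) \<subseteq> Ob C" "set (snd (snd c)) \<subseteq> Ob C" and f: "fst (snd c) \<in> Ar C"
      "Dom C (fst (snd c)) = tens C (fst c)" "Cod C (fst (snd c)) = tens C (snd (snd c))"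
      using h(3) unfolding cell_def hom_iff by auto
    have n: "nrm (map Tr vs) Y \<cdot> cell_act c Y
        = Lu C Y \<cdot> (((collapse C vs \<cdot> fst (snd c)) \<oplus> Idn C Y) \<cdot> sp (fst c) Y)" if "Y \<in> Ob C" for Y
      using o f p that
      by (simp add: nrm_collapse[OF that h(2)] cell_act_def xchg_assoc)
    have "collapse C vs \<cdot> fst (snd c) = collapse C us"
      if e: "nrm (map Tr vs) (Unt C) \<cdot> cell_act c (Unt C) = Idn C (Unt C) \<cdot> nrm (map Tr us) (Unt C)"
    proof -
      have ok: "list_all ok (map Tr us)" using h(1) trivs_iff by auto
      have "Lu C (Unt C) \<cdot> (((collapse C vs \<cdot> fst (snd c)) \<oplus> Idn C (Unt C)) \<cdot> sp (fst c) (Unt C))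
         = Lu C (Unt C) \<cdot> ((collapse C us \<oplus> Idn C (Unt C)) \<cdot> sp (fst c) (Unt C))"
        using e o f p ok unfolding n[OF unt_ob] nrm_collapse[OF unt_ob h(1)] by simp
      then have "((collapse C vs \<cdot> fst (snd c)) \<oplus> Idn C (Unt C)) \<cdot> sp (fst c) (Unt C)
         = (collapse C us \<oplus> Idn C (Unt C)) \<cdot> sp (fst c) (Unt C)"
        by (rule cancel_left) (use o f p in simp_all)
      then have "(collapse C vs \<cdot> fst (snd c)) \<oplus> Idn C (Unt C) = collapse C us \<oplus> Idn C (Unt C)"
        by (rule cancel_right) (use o f p in simp_all)
      then show ?thesis
        by (rule tensU_faithful) (use o f p in simp_all)
    qed
    moreover have "nrm (map Tr vs) Y \<cdot> cell_act c Y = Idn C Y \<cdot> nrm (map Tr us) Y"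
      if "collapse C vs \<cdot> fst (snd c) = collapse C us" "Y \<in> Ob C" for Y
      using that(2) o p unfolding n[OF that(2)] nrm_collapse[OF that(2) h(1)] that(1) by simp
    ultimately have "collapse C vs \<cdot> fst (snd c) = collapse C us \<longleftrightarrow>
      (\<forall>Y \<in> Ob C. nrm (map Tr vs) Y \<cdot> cell_act c Y = Idn C Y \<cdot> nrm (map Tr us) Y)"
      by auto }
  note * = this
  show ?thesis
  proof
    assume "coherent us c vs"
    then show "val (map Tr us) c (map Tr vs) (Idn C)"
      using * unfolding coherent_def val_def by (auto simp: trivs_iff hom_iff)
  next
    assume a: "val (map Tr us) c (map Tr vs) (Idn C)"
    then have "list_all2 triv (fst c) us" "list_all2 triv (snd (snd c)) vs" "cell c"
      unfolding val_def by (auto simp: trivs_iff)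
    with * a show "coherent us c vs"
      unfolding coherent_def val_def by auto
  qed
qed

lemma coherent_unique: "\<lbrakk>coherent us c vs; coherent us d vs\<rbrakk> \<Longrightarrow> c = d"
  unfolding coherent_iff_val by (rule val_unique) auto

text \<open>Puts variables in place of the lists, so that a rule can be applied by resolution when
  its lists match only after simplification.\<close>

lemma coherent_conv: "\<lbrakk>coherent us c vs; us' = us; vs' = vs\<rbrakk> \<Longrightarrow> coherent us' c vs'"
  by simp

lemma coherent_single: "coherent us c vs \<Longrightarrow> coherent us (chain C [c]) vs"
  by simp

lemma val_cong: "\<lbrakk>val us c vs v; \<And>Y. Y \<in> Ob C \<Longrightarrow> v Y = w Y\<rbrakk> \<Longrightarrow> val us c vs w"
  unfolding val_def by auto

lemma coherent_chain:
  "\<lbrakk>coherent us c vs; coherent vs (chain C (d # cs)) ws\<rbrakk> \<Longrightarrow> coherent us (chain C (c # d # cs)) ws"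
  unfolding coherent_iff_val by (drule (1) val_chain) (auto elim: val_cong)

text \<open>The concatenations are stated as premises: where a list is still schematic
  \<open>refl\<close> instantiates it, and where it is already fixed \<open>simp\<close> compares
  it.\<close>

lemma coherent_paste:
  assumes "list_all2 triv xs us" "coherent ms c ns" "list_all2 triv ys vs"
    "ms' = us @ ms @ vs" "ns' = us @ ns @ vs"
  shows "coherent ms' (paste C xs c ys) ns'"
  using val_paste[of "map Tr ms" c "map Tr ns" "Idn C" "map Tr us" "map Tr vs"] assms
  unfolding coherent_iff_val trivs_iff by simp

text \<open>The morphism of a coherent cell is one collapse followed by the inverse of another;
  hence it is invertible, and its inverse has the same form with the two ends exchanged.\<close>

lemma coherent_inv:
  assumes "coherent us c vs"
  shows "coherent vs (inv_cell C c) us"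
proof (cases c)
  case (fields xs f ys)
  note h = assms[unfolded fields coherent_def cell_def hom_iff, simplified]
  note p = collapse_props[of xs us] collapse_props[of ys vs]
  have e: "collapse C vs \<cdot> f = collapse C us" using h by simp
  have "iinv C (collapse C vs) \<cdot> (collapse C vs \<cdot> f) = f"
    by (rule iinv_left') (use h p in auto)
  note f = this[unfolded e, symmetric]
  have i: "invertible f" unfolding f using h p by simp
  have "collapse C us \<cdot> iinv C f = collapse C vs"
    using h p unfolding f by (simp add: iinv_cmp)
  then show ?thesis
    using h i by (simp add: fields coherent_def cell_def hom_iff)
qed

lemma coherent_coh_cell:
  assumes "list_all2 triv xs us" "list_all2 triv ys vs"
  shows "coherent us (xs, coh C us vs, ys) vs"
  using assms collapse_props[OF assms(1)] collapse_props[OF assms(2)]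
  by (auto simp: coherent_def coh_def coh_cell_def cell_def hom_iff trivs_iff)

lemma coherent_iso_cell:
  assumes "coherent us c vs" shows "iso_cell C c"
proof (cases c)
  case (fields xs f ys)
  note h = assms[unfolded fields coherent_def cell_def hom_iff, simplified]
  note p = collapse_props[of xs us] collapse_props[of ys vs]
  have e: "collapse C vs \<cdot> f = collapse C us" using h by simp
  have "iinv C (collapse C vs) \<cdot> (collapse C vs \<cdot> f) = f"
    by (rule iinv_left') (use h p in auto)
  then have "invertible f" unfolding e using h p invertible_cmp by (metis iinv_dom invertible_iinv)
  then show ?thesis using h by (simp add: fields iso_cell_def iso_iff)
qed

text \<open>The case of one genuine entry at either end, a composite such as
  \<open>(X \<otimes> Y) \<otimes> Z\<close> counting as one entry. The value is then carried by a
  single morphism \<open>g\<close>, and vertical composition of cells is composition of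
  these.\<close>

definition val1 :: "('o, 'm) item list \<Rightarrow> ('o, 'm) pcell \<Rightarrow> ('o, 'm) item list \<Rightarrow> 'm \<Rightarrow> bool" where
  "val1 us c vs g \<longleftrightarrow> g \<in> Ar C \<and> reals us = [Dom C g] \<and> reals vs = [Cod C g] \<and>
     val us c vs (\<lambda>Y. g \<oplus> Idn C Y)"

lemma val1_unique: "\<lbrakk>val1 us c vs g; val1 us d vs g\<rbrakk> \<Longrightarrow> c = d"
  unfolding val1_def by (auto intro: val_unique)

lemma val1_eqI: "\<lbrakk>val1 us c vs g; val1 us d vs k; g = k\<rbrakk> \<Longrightarrow> c = d"
  using val1_unique by blast

lemma val1_conv: "\<lbrakk>val1 us c vs g; us' = us; vs' = vs\<rbrakk> \<Longrightarrow> val1 us' c vs' g"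
  by simp

lemma val1_single: "val1 us c vs g \<Longrightarrow> val1 us (chain C [c]) vs g"
  by simp

lemma val1_chain:
  "\<lbrakk>val1 us c vs g; val1 vs (chain C (d # cs)) ws k\<rbrakk> \<Longrightarrow> val1 us (chain C (c # d # cs)) ws (k \<cdot> g)"
  unfolding val1_def by (auto simp: xchg simp del: chain.simps intro!: val_cong[OF val_chain])

lemma val1_paste:
  assumes "list_all2 triv xs as" "val1 us c vs g" "list_all2 triv ys bs"
    "us' = map Tr as @ us @ map Tr bs" "vs' = map Tr as @ vs @ map Tr bs"
  shows "val1 us' (paste C xs c ys) vs' g"
  using val_paste[of us c vs "\<lambda>Y. g \<oplus> Idn C Y" "map Tr as" "map Tr bs"] assms
  unfolding val1_def trivs_iff by auto

text \<open>\<open>val_paste\<close> evaluates the identity family of the constraint at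
  \<open>X \<otimes> Y\<close>, so beside a genuine object the constraint still contributes only an
  identity.\<close>

lemma val1_coherent_left:
  assumes "coherent us c vs" "X \<in> Ob C" "us' = map Tr us @ [Re X]" "vs' = map Tr vs @ [Re X]"
  shows "val1 us' (paste C [] c [X]) vs' (Idn C X)"
  using val_paste[of "map Tr us" c "map Tr vs" "Idn C" "[]" "[Re X]"] assms
  unfolding val1_def coherent_iff_val by (auto elim: val_cong)

lemma val1_coherent_right:
  assumes "X \<in> Ob C" "coherent us c vs" "us' = Re X # map Tr us" "vs' = Re X # map Tr vs"
  shows "val1 us' (paste C [X] c []) vs' (Idn C X)"
  using val_paste[of "map Tr us" c "map Tr vs" "Idn C" "[Re X]" "[]"] assms
  unfolding val1_def coherent_iff_val by (auto elim: val_cong)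

text \<open>A naturality cell moves a trivialised object from the left of a genuine one to its
  right. It is absorbed by \<open>Lu\<close> before the move and by \<open>Ru\<close> after it, and
  \<open>e\<close> compares the two absorptions. The triangle at the target and
  \<open>lu_tens\<close> at the source extend \<open>e\<close> to the action on every
  \<open>Y\<close>.\<close>

lemma val1_swap:
  assumes a: "triv A a" "triv A' a'" and g: "g \<in> hom C X X'" and f: "f \<in> hom C (A \<otimes> X) (X' \<otimes> A')"
    and e: "Ru C X' \<cdot> ((Idn C X' \<oplus> a') \<cdot> f) = g \<cdot> (Lu C X \<cdot> (a \<oplus> Idn C X))"
  shows "val1 [Tr a, Re X] ([A, X], f, [X', A']) [Re X', Tr a'] g"
proof -
  have [simp]: "invertible a" "a \<in> Ar C" "Dom C a = A" "Cod C a = Unt C" "invertible a'" "a' \<in> Ar C" "Dom C a' = A'"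
    "Cod C a' = Unt C" "A \<in> Ob C" "A' \<in> Ob C"
    using a dom_ob[of a] dom_ob[of a'] by (auto simp: triv_def invertible_ar simp del: dom_ob)
  have [simp]: "g \<in> Ar C" "Dom C g = X" "Cod C g = X'" "X \<in> Ob C" "X' \<in> Ob C"
    "f \<in> Ar C" "Dom C f = A \<otimes> X" "Cod C f = X' \<otimes> A'"
    using f g by (auto simp: hom_iff)
  have "nrm [Re X', Tr a'] Y \<cdot> cell_act ([A, X], f, [X', A']) Y = (g \<oplus> Idn C Y) \<cdot> nrm [Tr a, Re X] Y"
    if [simp]: "Y \<in> Ob C" for Y
  proof -
    let ?i = "Idn C" and ?U = "Unt C"
    have 1: "As C X' ?U Y \<cdot> ((?i X' \<oplus> a') \<oplus> ?i Y) = (?i X' \<oplus> (a' \<oplus> ?i Y)) \<cdot> As C X' A' Y"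
      by (simp add: as_nat)
    have 2: "iinv C (As C ?U X Y) \<cdot> (a \<oplus> ?i (X \<otimes> Y)) = ((a \<oplus> ?i X) \<oplus> ?i Y) \<cdot> iinv C (As C A X Y)"
      using ias_nat[of a "?i X" "?i Y" ?U X Y] by simp
    have "nrm [Re X', Tr a'] Y \<cdot> cell_act ([A, X], f, [X', A']) Y
       = (?i X' \<oplus> Lu C Y) \<cdot> (((?i X' \<oplus> (a' \<oplus> ?i Y)) \<cdot> As C X' A' Y) \<cdot> ((f \<oplus> ?i Y) \<cdot> iinv C (As C A X Y)))"
      by (simp add: cell_act_def iinv_cmp xchg_assoc)
    also have "\<dots> = ((?i X' \<oplus> Lu C Y) \<cdot> As C X' ?U Y) \<cdot> ((((?i X' \<oplus> a') \<cdot> f) \<oplus> ?i Y) \<cdot> iinv C (As C A X Y))"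
      unfolding 1[symmetric] by (simp add: xchg_assoc)
    also have "\<dots> = ((Ru C X' \<cdot> ((?i X' \<oplus> a') \<cdot> f)) \<oplus> ?i Y) \<cdot> iinv C (As C A X Y)"
      by (simp add: triangle' xchg_assoc)
    also have "\<dots> = (g \<oplus> ?i Y) \<cdot> ((Lu C X \<oplus> ?i Y) \<cdot> (((a \<oplus> ?i X) \<oplus> ?i Y) \<cdot> iinv C (As C A X Y)))"
      unfolding e by (simp add: xchg_assoc)
    also have "\<dots> = (g \<oplus> ?i Y) \<cdot> (((Lu C X \<oplus> ?i Y) \<cdot> iinv C (As C ?U X Y)) \<cdot> (a \<oplus> ?i (X \<otimes> Y)))"
      using 2 by simp
    also have "(Lu C X \<oplus> ?i Y) \<cdot> iinv C (As C ?U X Y) = Lu C (X \<otimes> Y)"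
      by (simp add: lu_tens[symmetric])
    finally show ?thesis by simp
  qed
  then show ?thesis
    unfolding val1_def val_def by (simp add: cell_def hom_iff)
qed

end

text \<open>Typing conditions only. They can be checked for composites such as
  \<open>(X, Y) \<mapsto> H X \<boxtimes> H Y\<close> without first establishing that these are
  monoidal, and they suffice to translate lax transformations in
  \<open>lax_trans_iff\<close>.\<close>

definition functor_data :: "('o, 'm) moncat \<Rightarrow> ('p, 'n) moncat \<Rightarrow> ('o, 'm, 'p, 'n) monfun \<Rightarrow> bool" where
  "functor_data C D F \<longleftrightarrow>
     (\<forall>X \<in> Ob C. FO F X \<in> Ob D) \<and>
     (\<forall>X Y. \<forall>f \<in> hom C X Y. FA F f \<in> hom D (FO F X) (FO F Y)) \<and>
     (\<forall>X \<in> Ob C. \<forall>Y \<in> Ob C. FP F X Y \<in> hom D (FO F X \<otimes>\<^bsub>D\<^esub> FO F Y) (FO F (X \<otimes>\<^bsub>C\<^esub> Y))) \<and>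
     FU F \<in> hom D (Unt D) (FO F (Unt C))"

definition source_data :: "('o, 'm) moncat \<Rightarrow> bool" where
  "source_data C \<longleftrightarrow> Unt C \<in> Ob C \<and> (\<forall>X \<in> Ob C. \<forall>Y \<in> Ob C. X \<otimes>\<^bsub>C\<^esub> Y \<in> Ob C) \<and>
     (\<forall>f \<in> Ar C. Dom C f \<in> Ob C \<and> Cod C f \<in> Ob C)"

text \<open>No extensionality is demanded of \<open>s\<close>: families are compared on objects of
  the source, and \<open>canonical_trans\<close> restricts them when it stores them.\<close>

definition mon_trans :: "('o, 'm) moncat \<Rightarrow> ('p, 'n) moncat \<Rightarrow> ('o, 'm, 'p, 'n) monfun \<Rightarrow>
    ('o, 'm, 'p, 'n) monfun \<Rightarrow> ('o \<Rightarrow> 'n) \<Rightarrow> bool" where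
  "mon_trans C D F G s \<longleftrightarrow>
     (\<forall>X \<in> Ob C. s X \<in> hom D (FO F X) (FO G X)) \<and>
     (\<forall>X Y. \<forall>f \<in> hom C X Y. FA G f \<cdot>\<^bsub>D\<^esub> s X = s Y \<cdot>\<^bsub>D\<^esub> FA F f) \<and>
     (\<forall>X \<in> Ob C. \<forall>Y \<in> Ob C.
        FP G X Y \<cdot>\<^bsub>D\<^esub> (s X \<oplus>\<^bsub>D\<^esub> s Y) = s (X \<otimes>\<^bsub>C\<^esub> Y) \<cdot>\<^bsub>D\<^esub> FP F X Y) \<and>
     s (Unt C) \<cdot>\<^bsub>D\<^esub> FU F = FU G"

lemma mon_transD:
  assumes "mon_trans C D F G s"
  shows "X \<in> Ob C \<Longrightarrow> s X \<in> hom D (FO F X) (FO G X)"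
    and "f \<in> hom C X Y \<Longrightarrow> FA G f \<cdot>\<^bsub>D\<^esub> s X = s Y \<cdot>\<^bsub>D\<^esub> FA F f"
    and "\<lbrakk>X \<in> Ob C; Y \<in> Ob C\<rbrakk>
      \<Longrightarrow> FP G X Y \<cdot>\<^bsub>D\<^esub> (s X \<oplus>\<^bsub>D\<^esub> s Y) = s (X \<otimes>\<^bsub>C\<^esub> Y) \<cdot>\<^bsub>D\<^esub> FP F X Y"
    and "s (Unt C) \<cdot>\<^bsub>D\<^esub> FU F = FU G"
  using assms unfolding mon_trans_def by blast+

section \<open>Lax transformations whose distinguished object is the unit\<close>

context monoidal_category
begin

lemma val_single: "val us c vs v \<Longrightarrow> val us (chain C [c]) vs v"
  by simp

lemma coh_nat_hom [simp]:
  assumes "g \<in> hom C X Y" shows "coh_nat C X Y g \<in> Ar C"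
    "Dom C (coh_nat C X Y g) = Unt C \<otimes> X" "Cod C (coh_nat C X Y g) = Y \<otimes> Unt C"
  using assms by (auto simp: coh_nat_def hom_iff)

lemma coh_nat_inj:
  assumes "g \<in> hom C X Y" "k \<in> hom C X Y" "coh_nat C X Y g = coh_nat C X Y k"
  shows "g = k"
proof -
  note h = assms(1,2)[unfolded hom_iff] and [simp] = dom_ob[of g] cod_ob[of g]
  have o: "X \<in> Ob C" "Y \<in> Ob C" using h dom_ob[of g] cod_ob[of g] by (auto simp del: dom_ob cod_ob)
  have "g \<cdot> Lu C X = k \<cdot> Lu C X"
    using assms(3) unfolding coh_nat_def by (rule cancel_left) (use h o in auto)
  then show ?thesis
    by (rule cancel_right) (use h o in auto)
qed

lemma iso_coh_nat: "g \<in> iso C X Y \<Longrightarrow> coh_nat C X Y g \<in> iso C (Unt C \<otimes> X) (Y \<otimes> Unt C)"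
  using cod_ob[of g] dom_ob[of g] by (auto simp: iso_iff coh_nat_def invertible_ar simp del: dom_ob cod_ob)

lemma swap_cell_eq: "X \<in> Ob C \<Longrightarrow> swap_cell C X = ([Unt C, X], coh_nat C X X (Idn C X), [X, Unt C])"
  by (simp add: swap_cell_def coh_nat_def)

lemma triv_unit: "triv (Unt C) (Idn C (Unt C))"
  by (simp add: triv_def)

lemma val1_coh_nat:
  assumes "g \<in> hom C X X'"
  shows "val1 [Tr (Idn C (Unt C)), Re X] ([Unt C, X], coh_nat C X X' g, [X', Unt C])
    [Re X', Tr (Idn C (Unt C))] g"
proof -
  have "X \<in> Ob C" "X' \<in> Ob C" "g \<in> Ar C" "Dom C g = X" "Cod C g = X'"
    using assms dom_ob[of g] cod_ob[of g] by (auto simp: hom_iff)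
  then show ?thesis
    using assms by (intro val1_swap triv_unit) (auto simp: hom_iff coh_nat_def)
qed

text \<open>At trivialised objects a naturality cell becomes a constraint as soon as
  \<open>g\<close> respects the trivialisations. Naturality of \<open>Lu\<close> and
  \<open>Ru\<close> reduces the claim to that condition, with \<open>lu_unit\<close> identifying the
  two unitors at the unit.\<close>

lemma coherent_coh_nat:
  assumes "g \<in> hom C X Y" "triv X p" "triv Y q" "q \<cdot> g = p"
  shows "coherent [Idn C (Unt C), p] ([Unt C, X], coh_nat C X Y g, [Y, Unt C]) [q, Idn C (Unt C)]"
proof -
  have [simp]: "g \<in> Ar C" "Dom C g = X" "Cod C g = Y" "X \<in> Ob C" "Y \<in> Ob C"
    "invertible p" "Dom C p = X" "Cod C p = Unt C" "invertible q" "Dom C q = Y" "Cod C q = Unt C"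
    "p \<in> Ar C" "q \<in> Ar C"
    using assms dom_ob[of g] cod_ob[of g] by (auto simp: hom_iff triv_def invertible_ar)
  have "Lu C (Unt C) \<cdot> ((q \<oplus> Idn C (Unt C)) \<cdot> coh_nat C X Y g) = q \<cdot> (g \<cdot> Lu C X)"
    unfolding lu_unit coh_nat_def by (simp add: precomp[OF ru_nat])
  also have "\<dots> = p \<cdot> Lu C X"
    by (simp add: assms(4)[symmetric])
  also have "\<dots> = Lu C (Unt C) \<cdot> (Idn C (Unt C) \<oplus> p)"
    by (simp add: lu_nat)
  finally show ?thesis
    using assms by (simp add: coherent_def cell_def hom_iff triv_unit)
qed

lemma coherent_id_cell: "triv X u \<Longrightarrow> coherent [u] (id_cell C X) [u]"
  using dom_ob[of u] by (auto simp: coherent_def id_cell_def cell_def hom_iff triv_def invertible_ar)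

lemma coherent_swap_cell:
  assumes "triv X u" shows "coherent [Idn C (Unt C), u] (swap_cell C X) [u, Idn C (Unt C)]"
proof -
  have "X \<in> Ob C" using assms dom_ob[of u] by (auto simp: triv_def invertible_ar)
  then show ?thesis
    using assms by (simp add: swap_cell_eq) (rule coherent_coh_nat, auto simp: hom_iff triv_def invertible_ar)
qed

lemma trivs_units: "list_all2 triv (replicate n (Unt C)) (replicate n (Idn C (Unt C)))"
  by (induction n) (auto simp: triv_unit)

lemma coherent_units_cell:
  "coherent (replicate m (Idn C (Unt C))) (units_cell C m n) (replicate n (Idn C (Unt C)))"
  using coherent_coh_cell[OF trivs_units[of m] trivs_units[of n]]
  by (simp add: units_cell_def coh_def coh_cell_def)

lemma coherent_eps: "coherent [Idn C (Unt C), Idn C (Unt C)] (eps_cell (unit_dual C)) []"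
  by (simp add: coherent_def eps_cell_def unit_dual_def triv_unit cell_def hom_iff)

lemma coherent_eta: "coherent [] (eta_cell (unit_dual C)) [Idn C (Unt C), Idn C (Unt C)]"
  by (simp add: coherent_def eta_cell_def unit_dual_def triv_unit cell_def hom_iff)

text \<open>Two genuine entries become one, so the value is not of the \<open>val1\<close> form:
  grouping the two objects leaves an inverse associator behind.\<close>

lemma val_functor_pair:
  assumes "g \<in> hom C (X \<otimes> Y) Z" "X \<in> Ob C" "Y \<in> Ob C"
  shows "val [Re X, Re Y] ([X, Y], g, [Z]) [Re Z] (\<lambda>W. (g \<oplus> Idn C W) \<cdot> iinv C (As C X Y W))"
proof -
  have "Z \<in> Ob C" "g \<in> Ar C" "Dom C g = X \<otimes> Y" "Cod C g = Z"
    using assms cod_ob[of g] by (auto simp: hom_iff)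
  then show ?thesis
    using assms by (simp add: val_def cell_def cell_act_def hom_iff)
qed

lemma val_functor_unit:
  assumes "g \<in> hom C (Unt C) Z"
  shows "val [] ([], g, [Z]) [Re Z] (\<lambda>W. (g \<oplus> Idn C W) \<cdot> iinv C (Lu C W))"
proof -
  have "Z \<in> Ob C" "g \<in> Ar C" "Dom C g = Unt C" "Cod C g = Z"
    using assms cod_ob[of g] by (auto simp: hom_iff)
  then show ?thesis
    using assms by (simp add: val_def cell_def cell_act_def hom_iff)
qed

text \<open>The two pastings have values \<open>(q \<cdot> (s \<oplus> t)) \<oplus> Idn C W\<close>
  and \<open>(r \<cdot> p) \<oplus> Idn C W\<close>, each preceded by the same inverse associator.
  Cancelling it at \<open>W = U\<close> gives one direction by \<open>val_det\<close>, and
  \<open>val_unique\<close> gives the other.\<close>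

lemma lax_trans_tensor_iff:
  assumes "s \<in> hom C X X'" "t \<in> hom C Y Y'" "p \<in> hom C (X \<otimes> Y) Z" "q \<in> hom C (X' \<otimes> Y') Z'"
    "r \<in> hom C Z Z'" and o: "X \<in> Ob C" "Y \<in> Ob C" "X' \<in> Ob C" "Y' \<in> Ob C"
  shows "chain C
          [paste C [] ([Unt C, X], coh_nat C X X' s, [X', Unt C]) [Y],
           paste C [X'] ([Unt C, Y], coh_nat C Y Y' t, [Y', Unt C]) [],
           paste C [] ([X', Y'], q, [Z']) [Unt C]]
      = chain C
          [paste C [Unt C] ([X, Y], p, [Z]) [],
           ([Unt C, Z], coh_nat C Z Z' r, [Z', Unt C])]
     \<longleftrightarrow> q \<cdot> (s \<oplus> t) = r \<cdot> p" (is "?L = ?R \<longleftrightarrow> _")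
proof -
  let ?U = "Tr (Idn C (Unt C))"
  note [simp] = o
  have [simp]: "s \<in> Ar C" "Dom C s = X" "Cod C s = X'" "t \<in> Ar C" "Dom C t = Y" "Cod C t = Y'"
    "p \<in> Ar C" "Dom C p = X \<otimes> Y" "Cod C p = Z" "q \<in> Ar C" "Dom C q = X' \<otimes> Y'" "Cod C q = Z'"
    "r \<in> Ar C" "Dom C r = Z" "Cod C r = Z'" "Z \<in> Ob C" "Z' \<in> Ob C"
    using assms cod_ob[of p] cod_ob[of q] by (auto simp: hom_iff simp del: cod_ob)
  have n: "val [?U, Re A] ([Unt C, A], coh_nat C A B f, [B, Unt C]) [Re B, ?U] (\<lambda>W. f \<oplus> Idn C W)"
    if "f \<in> hom C A B" for A B f
    using val1_coh_nat[OF that] unfolding val1_def by blast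
  have L1: "val [?U, Re X, Re Y] (paste C [] ([Unt C, X], coh_nat C X X' s, [X', Unt C]) [Y])
      [Re X', ?U, Re Y] (\<lambda>W. s \<oplus> Idn C (Y \<otimes> W))"
    using val_paste[OF n[OF assms(1)], of "[]" "[Re Y]"] by (simp del: paste.simps)
  have L2: "val [Re X', ?U, Re Y] (paste C [X'] ([Unt C, Y], coh_nat C Y Y' t, [Y', Unt C]) [])
      [Re X', Re Y', ?U] (\<lambda>W. Idn C X' \<oplus> (t \<oplus> Idn C W))"
    using val_paste[OF n[OF assms(2)], of "[Re X']" "[]"] by (simp del: paste.simps)
  have L3: "val [Re X', Re Y', ?U] (paste C [] ([X', Y'], q, [Z']) [Unt C]) [Re Z', ?U]
      (\<lambda>W. (q \<oplus> Idn C W) \<cdot> iinv C (As C X' Y' W))"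
    using val_paste[OF val_functor_pair[OF assms(4) o(3,4)], of "[]" "[?U]"] by (simp del: paste.simps)
  note L = val_chain[OF L1 val_chain[OF L2 val_single[OF L3]]]
  have R1: "val [?U, Re X, Re Y] (paste C [Unt C] ([X, Y], p, [Z]) []) [?U, Re Z]
      (\<lambda>W. (p \<oplus> Idn C W) \<cdot> iinv C (As C X Y W))"
    using val_paste[OF val_functor_pair[OF assms(3) o(1,2)], of "[?U]" "[]"] by (simp del: paste.simps)
  note R = val_chain[OF R1 val_single[OF n[OF assms(5)]]]
  \<comment> \<open>\<open>s\<close> and \<open>t\<close> act in different brackets; naturality of
    the inverse associator gathers them into \<open>s \<oplus> t\<close>.\<close>
  have vL: "(((q \<oplus> Idn C W) \<cdot> iinv C (As C X' Y' W)) \<cdot> (Idn C X' \<oplus> (t \<oplus> Idn C W))) \<cdot> (s \<oplus> Idn C (Y \<otimes> W))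
      = ((q \<cdot> (s \<oplus> t)) \<oplus> Idn C W) \<cdot> iinv C (As C X Y W)" if [simp]: "W \<in> Ob C" for W
    using ias_nat[of s t "Idn C W" X' Y' W] by (simp add: xchg xchg_assoc)
  have vR: "(r \<oplus> Idn C W) \<cdot> ((p \<oplus> Idn C W) \<cdot> iinv C (As C X Y W))
      = ((r \<cdot> p) \<oplus> Idn C W) \<cdot> iinv C (As C X Y W)" if [simp]: "W \<in> Ob C" for W
    by (simp add: xchg_assoc)
  show ?thesis
  proof
    assume e: "?L = ?R"
    have "((q \<cdot> (s \<oplus> t)) \<oplus> Idn C (Unt C)) \<cdot> iinv C (As C X Y (Unt C))
        = ((r \<cdot> p) \<oplus> Idn C (Unt C)) \<cdot> iinv C (As C X Y (Unt C))"
      using val_det[OF L R[folded e] unt_ob] vL[OF unt_ob] vR[OF unt_ob] by simp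
    then have "(q \<cdot> (s \<oplus> t)) \<oplus> Idn C (Unt C) = (r \<cdot> p) \<oplus> Idn C (Unt C)"
      by (rule cancel_right) simp_all
    then show "q \<cdot> (s \<oplus> t) = r \<cdot> p"
      by (rule tensU_faithful) simp_all
  next
    assume "q \<cdot> (s \<oplus> t) = r \<cdot> p"
    then show "?L = ?R"
      using vL[OF unt_ob] vR[OF unt_ob] by (intro val_unique[OF L R]) simp
  qed
qed

lemma lax_trans_unit_iff:
  assumes "p \<in> hom C (Unt C) Z" "q \<in> hom C (Unt C) Z'" "r \<in> hom C Z Z'"
  shows "chain C [paste C [Unt C] ([], p, [Z]) [], ([Unt C, Z], coh_nat C Z Z' r, [Z', Unt C])]
      = paste C [] ([], q, [Z']) [Unt C] \<longleftrightarrow> r \<cdot> p = q" (is "?L = ?R \<longleftrightarrow> _")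
proof -
  let ?U = "Tr (Idn C (Unt C))"
  have [simp]: "p \<in> Ar C" "Dom C p = Unt C" "Cod C p = Z" "q \<in> Ar C" "Dom C q = Unt C" "Cod C q = Z'"
    "r \<in> Ar C" "Dom C r = Z" "Cod C r = Z'" "Z \<in> Ob C" "Z' \<in> Ob C"
    using assms cod_ob[of p] cod_ob[of q] by (auto simp: hom_iff simp del: cod_ob)
  have n: "val [?U, Re Z] ([Unt C, Z], coh_nat C Z Z' r, [Z', Unt C]) [Re Z', ?U] (\<lambda>W. r \<oplus> Idn C W)"
    using val1_coh_nat[OF assms(3)] unfolding val1_def by blast
  have L1: "val [?U] (paste C [Unt C] ([], p, [Z]) []) [?U, Re Z] (\<lambda>W. (p \<oplus> Idn C W) \<cdot> iinv C (Lu C W))"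
    using val_paste[OF val_functor_unit[OF assms(1)], of "[?U]" "[]"] by (simp del: paste.simps)
  note L = val_chain[OF L1 val_single[OF n]]
  have R: "val [?U] ?R [Re Z', ?U] (\<lambda>W. (q \<oplus> Idn C W) \<cdot> iinv C (Lu C W))"
    using val_paste[OF val_functor_unit[OF assms(2)], of "[]" "[?U]"] by (simp del: paste.simps)
  have vL: "(r \<oplus> Idn C W) \<cdot> ((p \<oplus> Idn C W) \<cdot> iinv C (Lu C W))
      = ((r \<cdot> p) \<oplus> Idn C W) \<cdot> iinv C (Lu C W)" if [simp]: "W \<in> Ob C" for W
    by (simp add: xchg_assoc)
  show ?thesis
  proof
    assume e: "?L = ?R"
    have "((r \<cdot> p) \<oplus> Idn C (Unt C)) \<cdot> iinv C (Lu C (Unt C)) = (q \<oplus> Idn C (Unt C)) \<cdot> iinv C (Lu C (Unt C))"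
      using val_det[OF L R[folded e] unt_ob] vL[OF unt_ob] by simp
    then have "(r \<cdot> p) \<oplus> Idn C (Unt C) = q \<oplus> Idn C (Unt C)"
      by (rule cancel_right) simp_all
    then show "r \<cdot> p = q"
      by (rule tensU_faithful) simp_all
  next
    assume "r \<cdot> p = q"
    then show "?L = ?R"
      using vL[OF unt_ob] by (intro val_unique[OF L R]) simp
  qed
qed

text \<open>Naturality of \<open>Ru\<close> on one side and of \<open>Lu\<close> on the other turns
  each side into \<open>coh_nat\<close> of a composite, and \<open>coh_nat\<close> is
  injective.\<close>

lemma coh_nat_nat_iff:
  assumes "s \<in> hom C X Y" "s' \<in> hom C X' Y'" "f \<in> hom C X X'" "g \<in> hom C Y Y'"
  shows "(g \<oplus> Idn C (Unt C)) \<cdot> coh_nat C X Y s = coh_nat C X' Y' s' \<cdot> (Idn C (Unt C) \<oplus> f)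
     \<longleftrightarrow> g \<cdot> s = s' \<cdot> f"
proof -
  have [simp]: "s \<in> Ar C" "Dom C s = X" "Cod C s = Y" "s' \<in> Ar C" "Dom C s' = X'" "Cod C s' = Y'"
    "f \<in> Ar C" "Dom C f = X" "Cod C f = X'" "g \<in> Ar C" "Dom C g = Y" "Cod C g = Y'"
    "X \<in> Ob C" "Y \<in> Ob C" "X' \<in> Ob C" "Y' \<in> Ob C"
    using assms dom_ob[of s] dom_ob[of s'] cod_ob[of s] cod_ob[of s'] by (auto simp: hom_iff simp del: dom_ob cod_ob)
  have "Ru C Y' \<cdot> ((g \<oplus> Idn C (Unt C)) \<cdot> coh_nat C X Y s) = (g \<cdot> s) \<cdot> Lu C X"
    by (simp add: coh_nat_def precomp[OF ru_nat])
  then have 1: "(g \<oplus> Idn C (Unt C)) \<cdot> coh_nat C X Y s = coh_nat C X Y' (g \<cdot> s)"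
    unfolding coh_nat_def
    by (intro cancel_left[where g = "Ru C Y'" and f = "(g \<oplus> Idn C (Unt C)) \<cdot> (iinv C (Ru C Y) \<cdot> (s \<cdot> Lu C X))", rotated]) simp_all
  have 2: "coh_nat C X' Y' s' \<cdot> (Idn C (Unt C) \<oplus> f) = coh_nat C X Y' (s' \<cdot> f)"
    by (simp add: coh_nat_def lu_nat)
  show ?thesis
    unfolding 1 2 by (auto dest!: coh_nat_inj[rotated 2] simp: hom_iff)
qed

text \<open>Each clause of \<open>lax_trans\<close> corresponds to one clause of
  \<open>mon_trans\<close>. The translation serves in both directions: to extract laws from the
  adjoint equivalences of a given tricategory or functor, and to build new ones.\<close>

lemma lax_trans_iff:
  fixes S :: "('p, 'n) moncat"
  assumes S: "source_data S" and F: "functor_data S C F" and G: "functor_data S C G"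
    and s: "\<forall>X \<in> Ob S. s X \<in> hom C (FO F X) (FO G X)"
  shows "lax_trans S C F G (Unt C) (restrict (\<lambda>X. coh_nat C (FO F X) (FO G X) (s X)) (Ob S))
    \<longleftrightarrow> mon_trans S C F G s"
proof -
  note d = S[unfolded source_data_def] F[unfolded functor_data_def] G[unfolded functor_data_def] s
  let ?n = "restrict (\<lambda>X. coh_nat C (FO F X) (FO G X) (s X)) (Ob S)"
  have nat: "(FA G f \<oplus> Idn C (Unt C)) \<cdot> ?n X = ?n Y \<cdot> (Idn C (Unt C) \<oplus> FA F f)
      \<longleftrightarrow> FA G f \<cdot> s X = s Y \<cdot> FA F f" if "f \<in> hom S X Y" for f X Y
  proof -
    have "X \<in> Ob S" "Y \<in> Ob S" using that S unfolding source_data_def hom_def by auto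
    then show ?thesis
      using that d by (simp only: restrict_apply if_True) (intro coh_nat_nat_iff; blast)
  qed
  have tensor: "chain C
          [paste C [] ([Unt C, FO F X], ?n X, [FO G X, Unt C]) [FO F Y],
           paste C [FO G X] ([Unt C, FO F Y], ?n Y, [FO G Y, Unt C]) [],
           paste C [] ([FO G X, FO G Y], FP G X Y, [FO G (X \<otimes>\<^bsub>S\<^esub> Y)]) [Unt C]]
      = chain C
          [paste C [Unt C] ([FO F X, FO F Y], FP F X Y, [FO F (X \<otimes>\<^bsub>S\<^esub> Y)]) [],
           ([Unt C, FO F (X \<otimes>\<^bsub>S\<^esub> Y)], ?n (X \<otimes>\<^bsub>S\<^esub> Y), [FO G (X \<otimes>\<^bsub>S\<^esub> Y), Unt C])]
      \<longleftrightarrow> FP G X Y \<cdot> (s X \<oplus> s Y) = s (X \<otimes>\<^bsub>S\<^esub> Y) \<cdot> FP F X Y"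
    if "X \<in> Ob S" "Y \<in> Ob S" for X Y
  proof -
    have "X \<otimes>\<^bsub>S\<^esub> Y \<in> Ob S" using that d by blast
    then show ?thesis
      using that d by (simp only: restrict_apply if_True) (intro lax_trans_tensor_iff; blast)
  qed
  have unit: "chain C [paste C [Unt C] ([], FU F, [FO F (Unt S)]) [],
           ([Unt C, FO F (Unt S)], ?n (Unt S), [FO G (Unt S), Unt C])]
      = paste C [] ([], FU G, [FO G (Unt S)]) [Unt C] \<longleftrightarrow> s (Unt S) \<cdot> FU F = FU G"
  proof -
    have "Unt S \<in> Ob S" using d by blast
    then show ?thesis
      using d by (simp only: restrict_apply if_True) (intro lax_trans_unit_iff; blast)
  qed
  have hom: "?n X \<in> hom C (Unt C \<otimes> FO F X) (FO G X \<otimes> Unt C)" if "X \<in> Ob S" for X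
    using s that by (simp add: hom_iff)
  show ?thesis
  proof
    assume l: "lax_trans S C F G (Unt C) ?n"
    show "mon_trans S C F G s"
      unfolding mon_trans_def
      using s lax_trans.nat[OF l] lax_trans.tensor[OF l] lax_trans.unit[OF l] nat tensor unit by blast
  next
    assume m: "mon_trans S C F G s"
    show "lax_trans S C F G (Unt C) ?n"
      by unfold_locales (use m hom nat tensor unit in \<open>auto simp only: mon_trans_def restrict_extensional unt_ob\<close>)
  qed
qed

lemma mon_trans_inverse:
  fixes S :: "('p, 'n) moncat"
  assumes S: "source_data S" and F: "functor_data S C F" and G: "functor_data S C G"
    and m: "mon_trans S C F G s" and i: "\<forall>X \<in> Ob S. invertible (s X)"
  shows "mon_trans S C G F (\<lambda>X. iinv C (s X))"
proof -
  note d = S[unfolded source_data_def] F[unfolded functor_data_def] G[unfolded functor_data_def]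
    m[unfolded mon_trans_def]
  have t: "s X \<in> Ar C" "Dom C (s X) = FO F X" "Cod C (s X) = FO G X" "invertible (s X)"
    "FO F X \<in> Ob C" "FO G X \<in> Ob C" if "X \<in> Ob S" for X
    using d i that by (auto simp: hom_iff)
  have "FA F f \<cdot> iinv C (s X) = iinv C (s Y) \<cdot> FA G f" if f: "f \<in> hom S X Y" for f X Y
  proof -
    have [simp]: "X \<in> Ob S" "Y \<in> Ob S"  using f S unfolding source_data_def hom_def by auto
    note [simp] = t[OF \<open>X \<in> Ob S\<close>] t[OF \<open>Y \<in> Ob S\<close>]
    have [simp]: "FA F f \<in> Ar C" "Dom C (FA F f) = FO F X" "Cod C (FA F f) = FO F Y"
      "FA G f \<in> Ar C" "Dom C (FA G f) = FO G X" "Cod C (FA G f) = FO G Y"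
      using f d by (auto simp: hom_iff)
    have e: "FA G f \<cdot> s X = s Y \<cdot> FA F f" using f d by blast
    have "s Y \<cdot> (FA F f \<cdot> iinv C (s X)) = (FA G f \<cdot> s X) \<cdot> iinv C (s X)"
      unfolding e by simp
    also have "\<dots> = s Y \<cdot> (iinv C (s Y) \<cdot> FA G f)" by simp
    finally show ?thesis by (rule cancel_left) simp_all
  qed
  moreover have "FP F X Y \<cdot> (iinv C (s X) \<oplus> iinv C (s Y)) = iinv C (s (X \<otimes>\<^bsub>S\<^esub> Y)) \<cdot> FP G X Y"
    if X: "X \<in> Ob S" and Y: "Y \<in> Ob S" for X Y
  proof -
    have XY: "X \<otimes>\<^bsub>S\<^esub> Y \<in> Ob S" using X Y d by blast
    note [simp] = t[OF X] t[OF Y] t[OF XY]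
    have [simp]: "FP F X Y \<in> Ar C" "Dom C (FP F X Y) = FO F X \<otimes> FO F Y" "Cod C (FP F X Y) = FO F (X \<otimes>\<^bsub>S\<^esub> Y)"
      "FP G X Y \<in> Ar C" "Dom C (FP G X Y) = FO G X \<otimes> FO G Y" "Cod C (FP G X Y) = FO G (X \<otimes>\<^bsub>S\<^esub> Y)"
      using X Y d by (auto simp: hom_iff)
    have e: "FP G X Y \<cdot> (s X \<oplus> s Y) = s (X \<otimes>\<^bsub>S\<^esub> Y) \<cdot> FP F X Y" using X Y d by blast
    have "s (X \<otimes>\<^bsub>S\<^esub> Y) \<cdot> (FP F X Y \<cdot> (iinv C (s X) \<oplus> iinv C (s Y)))
        = (FP G X Y \<cdot> (s X \<oplus> s Y)) \<cdot> (iinv C (s X) \<oplus> iinv C (s Y))"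
      unfolding e by simp
    also have "\<dots> = s (X \<otimes>\<^bsub>S\<^esub> Y) \<cdot> (iinv C (s (X \<otimes>\<^bsub>S\<^esub> Y)) \<cdot> FP G X Y)" by (simp add: xchg)
    finally show ?thesis by (rule cancel_left) simp_all
  qed
  moreover have "iinv C (s (Unt S)) \<cdot> FU G = FU F"
  proof -
    have U: "Unt S \<in> Ob S" using d by blast
    note [simp] = t[OF U]
    have [simp]: "FU F \<in> Ar C" "Dom C (FU F) = Unt C" "Cod C (FU F) = FO F (Unt S)"
      using d by (auto simp: hom_iff)
    have e: "s (Unt S) \<cdot> FU F = FU G" using d by blast
    show ?thesis unfolding e[symmetric] by simp
  qed
  ultimately show ?thesis
    using t by (simp add: mon_trans_def hom_iff)
qed

text \<open>Unit and counit are coherent for the identity trivialisation. The triangle composites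
  and the identity cell are therefore coherent with the same lists and coincide.\<close>

lemma unit_dual_pair: "is_dual_pair C (unit_dual C)"
proof -
  have U: "dob (unit_dual C) = Unt C" "dob' (unit_dual C) = Unt C"
    "eps (unit_dual C) \<in> hom C (Unt C \<otimes> Unt C) (Unt C)" "eta (unit_dual C) \<in> hom C (Unt C) (Unt C \<otimes> Unt C)"
    by (simp_all add: unit_dual_def hom_iff)
  let ?i = "Idn C (Unt C)"
  have T: "list_all2 triv [Unt C] [?i]" "list_all2 triv [] []" by (simp_all add: triv_unit)
  have 1: "coherent [?i] (paste C [Unt C] (eta_cell (unit_dual C)) []) [?i, ?i, ?i]"
    "coherent [?i] (paste C [] (eta_cell (unit_dual C)) [Unt C]) [?i, ?i, ?i]"
    by (rule coherent_paste[OF T(1) coherent_eta T(2)] coherent_paste[OF T(2) coherent_eta T(1)]; simp)+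
  have 2: "coherent [?i, ?i, ?i] (paste C [] (eps_cell (unit_dual C)) [Unt C]) [?i]"
    "coherent [?i, ?i, ?i] (paste C [Unt C] (eps_cell (unit_dual C)) []) [?i]"
    by (rule coherent_paste[OF T(2) coherent_eps T(1)] coherent_paste[OF T(1) coherent_eps T(2)]; simp)+
  have "chain C [paste C [Unt C] (eta_cell (unit_dual C)) [], paste C [] (eps_cell (unit_dual C)) [Unt C]]
      = id_cell C (Unt C)"
    by (rule coherent_unique[OF coherent_chain[OF 1(1) coherent_single[OF 2(1)]]])
      (rule coherent_id_cell, rule triv_unit)
  moreover have "chain C [paste C [] (eta_cell (unit_dual C)) [Unt C], paste C [Unt C] (eps_cell (unit_dual C)) []]
      = id_cell C (Unt C)"
    by (rule coherent_unique[OF coherent_chain[OF 1(2) coherent_single[OF 2(2)]]])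
      (rule coherent_id_cell, rule triv_unit)
  ultimately show ?thesis
    unfolding is_dual_pair_def using U by (simp del: chain.simps paste.simps)
qed

text \<open>The counit and the unit are constraints, so in the two modification conditions only
  \<open>s X\<close> and its inverse contribute to the value, and they cancel.\<close>

lemma canonical_adj_eq:
  fixes S :: "('p, 'n) moncat"
  assumes S: "source_data S" and F: "functor_data S C F" and G: "functor_data S C G"
    and m: "mon_trans S C F G s" and i: "\<forall>X \<in> Ob S. invertible (s X)"
  shows "is_adj_eq S C F G \<lparr>pair = unit_dual C,
    nat = restrict (\<lambda>X. coh_nat C (FO F X) (FO G X) (s X)) (Ob S),
    nat' = restrict (\<lambda>X. coh_nat C (FO G X) (FO F X) (iinv C (s X))) (Ob S)\<rparr>"
proof -
  note m' = mon_trans_inverse[OF assms]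
  have t: "s X \<in> iso C (FO F X) (FO G X)" "iinv C (s X) \<in> iso C (FO G X) (FO F X)"
    "s X \<in> hom C (FO F X) (FO G X)" "iinv C (s X) \<in> hom C (FO G X) (FO F X)"
    "invertible (s X)" "Dom C (s X) = FO F X" "Cod C (s X) = FO G X" "FO F X \<in> Ob C" "FO G X \<in> Ob C"
    if "X \<in> Ob S" for X
    using m i that F G by (auto simp: mon_trans_def hom_iff iso_iff functor_data_def)
  have l: "lax_trans S C F G (Unt C) (restrict (\<lambda>X. coh_nat C (FO F X) (FO G X) (s X)) (Ob S))"
    using lax_trans_iff[OF S F G] m by (simp add: mon_trans_def)
  have l': "lax_trans S C G F (Unt C) (restrict (\<lambda>X. coh_nat C (FO G X) (FO F X) (iinv C (s X))) (Ob S))"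
    using lax_trans_iff[OF S G F, of "\<lambda>X. iinv C (s X)"] m' by (simp add: mon_trans_def)
  let ?i = "Idn C (Unt C)" and ?P = "unit_dual C"
  have T: "list_all2 triv [Unt C] [?i]" "list_all2 triv [] []" by (simp_all add: triv_unit)
  have e: "chain C
          [paste C [Unt C] ([Unt C, FO G X], coh_nat C (FO G X) (FO F X) (iinv C (s X)), [FO F X, Unt C]) [],
           paste C [] ([Unt C, FO F X], coh_nat C (FO F X) (FO G X) (s X), [FO G X, Unt C]) [Unt C],
           paste C [FO G X] (eps_cell ?P) []]
        = paste C [] (eps_cell ?P) [FO G X]" (is "?l1 = ?r1")
    and e': "chain C
          [paste C [] (eta_cell ?P) [FO F X],
           paste C [Unt C] ([Unt C, FO F X], coh_nat C (FO F X) (FO G X) (s X), [FO G X, Unt C]) [],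
           paste C [] ([Unt C, FO G X], coh_nat C (FO G X) (FO F X) (iinv C (s X)), [FO F X, Unt C]) [Unt C]]
        = paste C [FO F X] (eta_cell ?P) []" (is "?l2 = ?r2")
    if X: "X \<in> Ob S" for X
  proof -
    note n = val1_coh_nat[OF t(3)[OF X]] val1_coh_nat[OF t(4)[OF X]]
    have 1: "val1 [Tr ?i, Tr ?i, Re (FO G X)] ?l1 [Re (FO G X)] ((Idn C (FO G X) \<cdot> s X) \<cdot> iinv C (s X))"
      by (rule val1_chain, rule val1_paste[OF T(1) n(2) T(2)], simp, simp,
          rule val1_chain, rule val1_paste[OF T(2) n(1) T(1)], simp, simp,
          rule val1_single, rule val1_coherent_right[OF t(9)[OF X] coherent_eps]) simp_all
    have 2: "val1 [Tr ?i, Tr ?i, Re (FO G X)] ?r1 [Re (FO G X)] (Idn C (FO G X))"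
      by (rule val1_coherent_left[OF coherent_eps t(9)[OF X]]) simp_all
    show "?l1 = ?r1"
      using val1_unique[OF 1] 2 t[OF X] by (simp add: invertible_ar del: chain.simps paste.simps)
    have 3: "val1 [Re (FO F X)] ?l2 [Re (FO F X), Tr ?i, Tr ?i] ((iinv C (s X) \<cdot> s X) \<cdot> Idn C (FO F X))"
      by (rule val1_chain, rule val1_coherent_left[OF coherent_eta t(8)[OF X]], simp, simp,
          rule val1_chain, rule val1_paste[OF T(1) n(1) T(2)], simp, simp,
          rule val1_single, rule val1_paste[OF T(2) n(2) T(1)]) simp_all
    have 4: "val1 [Re (FO F X)] ?r2 [Re (FO F X), Tr ?i, Tr ?i] (Idn C (FO F X))"
      by (rule val1_coherent_right[OF t(8)[OF X] coherent_eta]) simp_all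
    show "?l2 = ?r2"
      using val1_unique[OF 3] 4 t[OF X] by (simp add: invertible_ar del: chain.simps paste.simps)
  qed
  have P: "dob ?P = Unt C" "dob' ?P = Unt C" "eps ?P \<in> iso C (Unt C \<otimes> Unt C) (Unt C)"
    "eta ?P \<in> iso C (Unt C) (Unt C \<otimes> Unt C)"
    by (simp_all add: unit_dual_def iso_iff)
  show ?thesis
    unfolding is_adj_eq_def
    using l l' e e' P t unit_dual_pair iso_coh_nat by (simp del: chain.simps paste.simps)
qed

end

section \<open>Typing data of product, composite and constant functors\<close>

lemma prod_cat_sel [simp]:
  "Ob (prod_cat C D) = Ob C \<times> Ob D" "Ar (prod_cat C D) = Ar C \<times> Ar D"
  "Dom (prod_cat C D) = map_prod (Dom C) (Dom D)" "Cod (prod_cat C D) = map_prod (Cod C) (Cod D)"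
  "Idn (prod_cat C D) = map_prod (Idn C) (Idn D)"
  "(X, X') \<otimes>\<^bsub>prod_cat C D\<^esub> (Y, Y') = (X \<otimes>\<^bsub>C\<^esub> Y, X' \<otimes>\<^bsub>D\<^esub> Y')"
  "(f, f') \<oplus>\<^bsub>prod_cat C D\<^esub> (g, g') = (f \<oplus>\<^bsub>C\<^esub> g, f' \<oplus>\<^bsub>D\<^esub> g')"
  "Unt (prod_cat C D) = (Unt C, Unt D)"
  "Lu (prod_cat C D) = map_prod (Lu C) (Lu D)" "Ru (prod_cat C D) = map_prod (Ru C) (Ru D)"
  by (simp_all add: prod_cat_def)

lemma hom_prod_cat: "(f, f') \<in> hom (prod_cat C D) (X, X') (Y, Y') \<longleftrightarrow> f \<in> hom C X Y \<and> f' \<in> hom D X' Y'"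
  by (auto simp: hom_def)

lemma source_data_prod:
  assumes "source_data C" "source_data D" shows "source_data (prod_cat C D)"
  using assms unfolding source_data_def by (auto simp: hom_prod_cat)

lemma (in monoidal_category) source_data: "source_data C"
  by (auto simp: source_data_def hom_iff)

lemma source_data_one: "source_data one_cat"
  by (simp add: source_data_def one_cat_def)

lemma functor_data_comp:
  assumes "monoidal_category D" "functor_data S C F" "functor_data C D G" "source_data S"
  shows "functor_data S D (comp_fun S D G F)"
proof -
  interpret D: monoidal_category D by fact
  note d = assms(2,3)[unfolded functor_data_def] assms(4)[unfolded source_data_def]
  have "FA G (FP F X Y) \<cdot>\<^bsub>D\<^esub> FP G (FO F X) (FO F Y) \<in> hom D (FO G (FO F X) \<otimes>\<^bsub>D\<^esub> FO G (FO F Y)) (FO G (FO F (X \<otimes>\<^bsub>S\<^esub> Y)))"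
    if "X \<in> Ob S" "Y \<in> Ob S" for X Y
    by (rule D.cmp[where Y = "FO G (FO F X \<otimes>\<^bsub>C\<^esub> FO F Y)"]) (use d that in blast)+
  moreover have "FA G (FU F) \<cdot>\<^bsub>D\<^esub> FU G \<in> hom D (Unt D) (FO G (FO F (Unt S)))"
    by (rule D.cmp[where Y = "FO G (Unt C)"]) (use d in blast)+
  moreover have "FA (comp_fun S D G F) f \<in> hom D (FO (comp_fun S D G F) X) (FO (comp_fun S D G F) Y)"
    if f: "f \<in> hom S X Y" for f X Y
  proof -
    have "f \<in> Ar S" "X \<in> Ob S" "Y \<in> Ob S" using f d by (auto simp: hom_def)
    moreover have "FA G (FA F f) \<in> hom D (FO G (FO F X)) (FO G (FO F Y))" using d f by blast
    ultimately show ?thesis by (simp add: comp_fun_def)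
  qed
  ultimately show ?thesis
    using d unfolding functor_data_def by (auto simp: comp_fun_def)
qed

lemma functor_data_pair:
  assumes "functor_data S C F" "functor_data S D G" "source_data S"
  shows "functor_data S (prod_cat C D) (pair_fun S F G)"
  using assms unfolding functor_data_def source_data_def pair_fun_def hom_def by auto

lemma functor_data_fst:
  assumes "monoidal_category C" "source_data C" "source_data D" shows "functor_data (prod_cat C D) C (fst_fun C D)"
  using monoidal_category.idn[OF assms(1)] assms(2,3)
  unfolding functor_data_def source_data_def fst_fun_def hom_def by auto

lemma functor_data_snd:
  assumes "monoidal_category D" "source_data C" "source_data D" shows "functor_data (prod_cat C D) D (snd_fun C D)"
  using monoidal_category.idn[OF assms(1)] assms(2,3)
  unfolding functor_data_def source_data_def snd_fun_def hom_def by auto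

lemma functor_data_id:
  assumes "monoidal_category C" shows "functor_data C C (id_fun C)"
proof -
  interpret monoidal_category C by fact
  show ?thesis unfolding functor_data_def id_fun_def by (auto simp: hom_iff)
qed

lemma functor_data_const:
  assumes "monoidal_category D" "source_data C" "monoid D X m e" shows "functor_data C D (const_fun C D X m e)"
  using monoidal_category.idn[OF assms(1)] assms(2,3)
  unfolding functor_data_def source_data_def const_fun_def hom_def monoid_def by auto

lemma (in monoidal_functor) functor_data: "functor_data C D F"
  using ob ar phi_iso phi0_iso unfolding functor_data_def iso_def by blast

text \<open>Once \<open>lu_lu\<close> rewrites \<open>Idn U \<oplus> Lu U\<close>, associativity is
  \<open>lu_tens\<close> at the unit; the right unit law is \<open>lu_unit\<close>.\<close>

lemma (in monoidal_category) unit_monoid: "monoid C (Unt C) (Lu C (Unt C)) (Idn C (Unt C))"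
  using lu_tens[of "Unt C" "Unt C"]
  by (simp add: monoid_def hom_iff lu_unit[symmetric] lu_lu[symmetric])

text \<open>This is \<open>collapse C [u, v]\<close>, the trivialisation of a tensor product. For
  canonical tricategories it also trivialises \<open>X \<boxtimes> Y\<close>.\<close>

definition (in monoidal_category) merge :: "'m \<Rightarrow> 'm \<Rightarrow> 'm" where
  "merge u v = Lu C (Unt C) \<cdot> (u \<oplus> v)"

section \<open>Canonical tricategories: laws of the interchange and boxed cells\<close>

locale canonical = monoidal_category C for C :: "('o, 'm) moncat" (structure) +
  fixes T :: "('o, 'm) dd_tricat"
  assumes T2: "T \<in> T2_Ob" and tri_cat [simp]: "tri_cat T = C"
begin

lemma T_eq: "T = canonical_tricat C (FP (tri_box T)) (FU (tri_box T))"
  using T2 by (simp add: T2_Ob_def)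

lemma dd: "doubly_degenerate_tricategory T"
  using T2 by (simp add: T2_Ob_def)

text \<open>\<open>T_eq\<close> has \<open>T\<close> on both sides and would loop as a rewrite rule,
  so it is applied under one selector at a time.\<close>

lemma T_sel [simp]:
  "tri_I T = Unt C" "tri_mult T = Lu C (Unt C)" "tri_unit T = Idn C (Unt C)" "tri_iso T = Idn C (Unt C)"
  "pair (tri_a T) = unit_dual C" "pair (tri_l T) = unit_dual C" "pair (tri_r T) = unit_dual C"
  "dob (unit_dual C) = Unt C" "dob' (unit_dual C) = Unt C"
  using T_eq[THEN arg_cong, of tri_I] T_eq[THEN arg_cong, of tri_mult] T_eq[THEN arg_cong, of tri_unit]
    T_eq[THEN arg_cong, of tri_iso] T_eq[THEN arg_cong, of "\<lambda>T. pair (tri_a T)"]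
    T_eq[THEN arg_cong, of "\<lambda>T. pair (tri_l T)"] T_eq[THEN arg_cong, of "\<lambda>T. pair (tri_r T)"]
  by (simp_all add: canonical_tricat_def Let_def unit_dual_def)

lemma box_ob [simp]: "\<lbrakk>X \<in> Ob C; Y \<in> Ob C\<rbrakk> \<Longrightarrow> FO (tri_box T) (X, Y) = X \<otimes> Y"
  and box_ar [simp]: "\<lbrakk>f \<in> Ar C; g \<in> Ar C\<rbrakk> \<Longrightarrow> FA (tri_box T) (f, g) = f \<oplus> g"
  using T_eq[THEN arg_cong, of "\<lambda>T. FO (tri_box T)"] T_eq[THEN arg_cong, of "\<lambda>T. FA (tri_box T)"]
  by (simp_all add: canonical_tricat_def Let_def)

lemma tbox [simp]: "\<lbrakk>X \<in> Ob C; Y \<in> Ob C\<rbrakk> \<Longrightarrow> tbox T X Y = X \<otimes> Y"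
  by (simp add: tbox_def)

lemma nat_sel [simp]:
  "\<lbrakk>X \<in> Ob C; Y \<in> Ob C; Z \<in> Ob C\<rbrakk> \<Longrightarrow> nat (tri_a T) (X, Y, Z)
    = coh_nat C ((X \<otimes> Y) \<otimes> Z) (X \<otimes> (Y \<otimes> Z)) (As C X Y Z)"
  "\<lbrakk>X \<in> Ob C; Y \<in> Ob C; Z \<in> Ob C\<rbrakk> \<Longrightarrow> nat' (tri_a T) (X, Y, Z)
    = coh_nat C (X \<otimes> (Y \<otimes> Z)) ((X \<otimes> Y) \<otimes> Z) (iinv C (As C X Y Z))"
  "X \<in> Ob C \<Longrightarrow> nat (tri_l T) X = coh_nat C (Unt C \<otimes> X) X (Lu C X)"
  "X \<in> Ob C \<Longrightarrow> nat' (tri_l T) X = coh_nat C X (Unt C \<otimes> X) (iinv C (Lu C X))"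
  "X \<in> Ob C \<Longrightarrow> nat (tri_r T) X = coh_nat C (X \<otimes> Unt C) X (Ru C X)"
  "X \<in> Ob C \<Longrightarrow> nat' (tri_r T) X = coh_nat C X (X \<otimes> Unt C) (iinv C (Ru C X))"
  using T_eq[THEN arg_cong, of "\<lambda>T. nat (tri_a T)"] T_eq[THEN arg_cong, of "\<lambda>T. nat' (tri_a T)"]
    T_eq[THEN arg_cong, of "\<lambda>T. nat (tri_l T)"] T_eq[THEN arg_cong, of "\<lambda>T. nat' (tri_l T)"]
    T_eq[THEN arg_cong, of "\<lambda>T. nat (tri_r T)"] T_eq[THEN arg_cong, of "\<lambda>T. nat' (tri_r T)"]
  by (simp_all add: canonical_tricat_def Let_def)

lemma constraint_sel:
  "tri_pi T = coh C [Lu C (Unt C), Idn C (Unt C), Lu C (Unt C)] [Idn C (Unt C), Idn C (Unt C)]"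
  "tri_mu T = coh C [Lu C (Unt C), Idn C (Unt C), Lu C (Unt C)] []"
  "tri_lam T = coh C [Lu C (Unt C)] [Idn C (Unt C), Idn C (Unt C)]"
  "tri_rho T = coh C [Lu C (Unt C)] [Idn C (Unt C), Idn C (Unt C)]"
  using T_eq[THEN arg_cong, of tri_pi] T_eq[THEN arg_cong, of tri_mu] T_eq[THEN arg_cong, of tri_lam]
    T_eq[THEN arg_cong, of tri_rho]
  by (simp_all add: canonical_tricat_def Let_def)

lemma extensional: "moncat_extensional C"
  and box_functor: "monoidal_functor (prod_cat C C) C (tri_box T)"
  and l_adj: "is_adj_eq C C (box_fun T C (const_I T C) (id_fun C)) (id_fun C) (tri_l T)"
  and r_adj: "is_adj_eq C C (box_fun T C (id_fun C) (const_I T C)) (id_fun C) (tri_r T)"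
  using dd unfolding doubly_degenerate_tricategory_def Let_def by auto

text \<open>The interchange \<open>(X \<otimes> X') \<otimes> (Y \<otimes> Y') \<rightarrow> (X
  \<otimes> Y) \<otimes> (X' \<otimes> Y')\<close>. With \<open>X\<close> and \<open>Y'\<close> the
  unit it is, up to unitors, a map from \<open>X' \<otimes> Y\<close> to
  \<open>Y \<otimes> X'\<close>, the braiding.\<close>

definition ic :: "'o \<Rightarrow> 'o \<Rightarrow> 'o \<Rightarrow> 'o \<Rightarrow> 'm" where
  "ic X X' Y Y' = FP (tri_box T) (X, X') (Y, Y')"

definition ic0 :: "'m" where
  "ic0 = FU (tri_box T)"

lemma ic_invertible [simp]: "\<lbrakk>X \<in> Ob C; X' \<in> Ob C; Y \<in> Ob C; Y' \<in> Ob C\<rbrakk> \<Longrightarrow> invertible (ic X X' Y Y')"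
  and ic_ar [simp]: "\<lbrakk>X \<in> Ob C; X' \<in> Ob C; Y \<in> Ob C; Y' \<in> Ob C\<rbrakk> \<Longrightarrow> ic X X' Y Y' \<in> Ar C"
  and ic_dom [simp]: "\<lbrakk>X \<in> Ob C; X' \<in> Ob C; Y \<in> Ob C; Y' \<in> Ob C\<rbrakk>
    \<Longrightarrow> Dom C (ic X X' Y Y') = (X \<otimes> X') \<otimes> (Y \<otimes> Y')"
  and ic_cod [simp]: "\<lbrakk>X \<in> Ob C; X' \<in> Ob C; Y \<in> Ob C; Y' \<in> Ob C\<rbrakk>
    \<Longrightarrow> Cod C (ic X X' Y Y') = (X \<otimes> Y) \<otimes> (X' \<otimes> Y')"
  using monoidal_functor.phi_iso[OF box_functor, of "(X, X')" "(Y, Y')"]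
  by (auto simp: ic_def iso_iff invertible_ar)

lemma ic0_invertible [simp]: "invertible ic0"
  and ic0_ar [simp]: "ic0 \<in> Ar C"
  and ic0_dom [simp]: "Dom C ic0 = Unt C"
  and ic0_cod [simp]: "Cod C ic0 = Unt C \<otimes> Unt C"
  using monoidal_functor.phi0_iso[OF box_functor] by (auto simp: ic0_def iso_iff invertible_ar)

lemma ic_nat:
  assumes "f \<in> Ar C" "f' \<in> Ar C" "g \<in> Ar C" "g' \<in> Ar C"
    "Cod C f = X" "Cod C f' = X'" "Cod C g = Y" "Cod C g' = Y'"
  shows "ic X X' Y Y' \<cdot> ((f \<oplus> f') \<oplus> (g \<oplus> g'))
    = ((f \<oplus> g) \<oplus> (f' \<oplus> g')) \<cdot> ic (Dom C f) (Dom C f') (Dom C g) (Dom C g')"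
  using monoidal_functor.phi_nat[OF box_functor, of "(f, f')" "(Dom C f, Dom C f')" "(X, X')"
      "(g, g')" "(Dom C g, Dom C g')" "(Y, Y')"] assms
  by (simp add: hom_prod_cat hom_iff ic_def)

lemma ic_lunit:
  assumes [simp]: "X \<in> Ob C" "X' \<in> Ob C"
  shows "(Lu C X \<oplus> Lu C X') \<cdot> (ic (Unt C) (Unt C) X X' \<cdot> (ic0 \<oplus> Idn C (X \<otimes> X'))) = Lu C (X \<otimes> X')"
  using monoidal_functor.phi_lunit[OF box_functor, of "(X, X')"] by (simp add: ic_def ic0_def)

lemma ic_runit:
  assumes [simp]: "X \<in> Ob C" "X' \<in> Ob C"
  shows "(Ru C X \<oplus> Ru C X') \<cdot> (ic X X' (Unt C) (Unt C) \<cdot> (Idn C (X \<otimes> X') \<oplus> ic0)) = Ru C (X \<otimes> X')"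
  using monoidal_functor.phi_runit[OF box_functor, of "(X, X')"] by (simp add: ic_def ic0_def)

lemma functor_data_box:
  assumes "functor_data S C F" "functor_data S C G" "source_data S"
  shows "functor_data S C (box_fun T S F G)"
  unfolding box_fun_def tri_cat
  by (rule functor_data_comp[OF monoidal_category_axioms functor_data_pair[OF assms]
        monoidal_functor.functor_data[OF box_functor] assms(3)])

lemma box_fun_ob [simp]: "\<lbrakk>functor_data S C F; functor_data S C G; X \<in> Ob S\<rbrakk>
    \<Longrightarrow> FO (box_fun T S F G) X = FO F X \<otimes> FO G X"
  by (simp add: box_fun_def comp_fun_def pair_fun_def functor_data_def)

lemma box_fun_ar [simp]: "\<lbrakk>functor_data S C F; functor_data S C G; f \<in> hom S X Y\<rbrakk>
    \<Longrightarrow> FA (box_fun T S F G) f = FA F f \<oplus> FA G f"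
  unfolding functor_data_def by (auto simp: box_fun_def comp_fun_def pair_fun_def hom_def)

lemma box_fun_FP [simp]: "\<lbrakk>functor_data S C F; functor_data S C G; X \<in> Ob S; Y \<in> Ob S\<rbrakk>
    \<Longrightarrow> FP (box_fun T S F G) X Y = (FP F X Y \<oplus> FP G X Y) \<cdot> ic (FO F X) (FO G X) (FO F Y) (FO G Y)"
  unfolding functor_data_def by (auto simp: box_fun_def comp_fun_def pair_fun_def hom_def ic_def)

lemma box_fun_FU [simp]: "\<lbrakk>functor_data S C F; functor_data S C G\<rbrakk>
    \<Longrightarrow> FU (box_fun T S F G) = (FU F \<oplus> FU G) \<cdot> ic0"
  unfolding functor_data_def by (auto simp: box_fun_def comp_fun_def pair_fun_def hom_def ic0_def)

lemma functor_data_const_I: "source_data S \<Longrightarrow> functor_data S C (const_I T S)"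
  unfolding const_I_def by (simp add: functor_data_const monoidal_category_axioms unit_monoid)

text \<open>That \<open>l\<close> and \<open>r\<close> are adjoint equivalences says more than
  naturality: the tensor and unit clauses of their lax transformations translate, by
  \<open>lax_trans_iff\<close>, into monoidality of \<open>Lu\<close> and \<open>Ru\<close> with
  respect to the interchange.\<close>

lemma l_trans: "mon_trans C C (box_fun T C (const_I T C) (id_fun C)) (id_fun C) (Lu C)"
  and r_trans: "mon_trans C C (box_fun T C (id_fun C) (const_I T C)) (id_fun C) (Ru C)"
proof -
  note I = functor_data_const_I[OF source_data] and id = functor_data_id[OF monoidal_category_axioms]
  have s: "FO (id_fun C) X = X" "FO (const_I T C) X = Unt C" if "X \<in> Ob C" for X
    using that by (simp_all add: id_fun_def const_I_def const_fun_def)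
  have l: "lax_trans C C (box_fun T C (const_I T C) (id_fun C)) (id_fun C) (Unt C) (nat (tri_l T))"
    and r: "lax_trans C C (box_fun T C (id_fun C) (const_I T C)) (id_fun C) (Unt C) (nat (tri_r T))"
    using l_adj r_adj by (simp_all add: is_adj_eq_def)
  have "nat (tri_l T) = restrict (\<lambda>X. coh_nat C (FO (box_fun T C (const_I T C) (id_fun C)) X) (FO (id_fun C) X) (Lu C X)) (Ob C)"
    "nat (tri_r T) = restrict (\<lambda>X. coh_nat C (FO (box_fun T C (id_fun C) (const_I T C)) X) (FO (id_fun C) X) (Ru C X)) (Ob C)"
    by (rule extensionalityI[OF lax_trans.ext[OF l] restrict_extensional], simp add: I id s)
      (rule extensionalityI[OF lax_trans.ext[OF r] restrict_extensional], simp add: I id s)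
  note e = this
  show "mon_trans C C (box_fun T C (const_I T C) (id_fun C)) (id_fun C) (Lu C)"
    using l unfolding e
    by (subst (asm) lax_trans_iff) (auto simp: source_data functor_data_box I id s hom_iff)
  show "mon_trans C C (box_fun T C (id_fun C) (const_I T C)) (id_fun C) (Ru C)"
    using r unfolding e
    by (subst (asm) lax_trans_iff) (auto simp: source_data functor_data_box I id s hom_iff)
qed

text \<open>The unit clause of \<open>l_trans\<close> reads \<open>Lu U \<cdot> ic0 = Idn U\<close>,
  so the unit constraint of \<boxtimes> is determined although it was given as data.\<close>

lemma ic0_eq: "ic0 = iinv C (Lu C (Unt C))"
proof -
  note I = functor_data_const_I[OF source_data] and id = functor_data_id[OF monoidal_category_axioms]
  have "Lu C (Unt C) \<cdot> ((Idn C (Unt C) \<oplus> Idn C (Unt C)) \<cdot> ic0) = Idn C (Unt C)"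
    using l_trans by (simp add: mon_trans_def I id) (simp add: id_fun_def const_I_def const_fun_def)
  then have "Lu C (Unt C) \<cdot> ic0 = Lu C (Unt C) \<cdot> iinv C (Lu C (Unt C))"
    by simp
  then show ?thesis by (rule cancel_left) simp_all
qed

text \<open>The unit law of \<boxtimes> as a monoidal functor, with \<open>ic0\<close>, now known,
  moved to the other side.\<close>

lemma ic_UUXY:
  assumes [simp]: "X \<in> Ob C" "Y \<in> Ob C"
  shows "(Lu C X \<oplus> Lu C Y) \<cdot> ic (Unt C) (Unt C) X Y = Lu C (X \<otimes> Y) \<cdot> (Lu C (Unt C) \<oplus> Idn C (X \<otimes> Y))"
  unfolding ic_lunit[OF assms, symmetric] ic0_eq by (simp add: xchg)

lemma ic_XYUU:
  assumes [simp]: "X \<in> Ob C" "Y \<in> Ob C"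
  shows "(Ru C X \<oplus> Ru C Y) \<cdot> ic X Y (Unt C) (Unt C) = Ru C (X \<otimes> Y) \<cdot> (Idn C (X \<otimes> Y) \<oplus> Lu C (Unt C))"
  unfolding ic_runit[OF assms, symmetric] ic0_eq by (simp add: xchg)

text \<open>The tensor clause of \<open>l_trans\<close>. Here the units stand in alternate
  positions, an arrangement that the unit laws of a monoidal functor do not address.\<close>

lemma ic_UXUY:
  assumes [simp]: "X \<in> Ob C" "Y \<in> Ob C"
  shows "Lu C (X \<otimes> Y) \<cdot> ((Lu C (Unt C) \<oplus> Idn C (X \<otimes> Y)) \<cdot> ic (Unt C) X (Unt C) Y) = Lu C X \<oplus> Lu C Y"
proof -
  note I = functor_data_const_I[OF source_data] and id = functor_data_id[OF monoidal_category_axioms]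
  have "FP (id_fun C) X Y \<cdot> (Lu C X \<oplus> Lu C Y) = Lu C (X \<otimes> Y) \<cdot> FP (box_fun T C (const_I T C) (id_fun C)) X Y"
    using l_trans assms unfolding mon_trans_def by blast
  then show ?thesis
    by (simp add: I id) (simp add: id_fun_def const_I_def const_fun_def)
qed

lemma ic_XUYU:
  assumes [simp]: "X \<in> Ob C" "Y \<in> Ob C"
  shows "Ru C (X \<otimes> Y) \<cdot> ((Idn C (X \<otimes> Y) \<oplus> Lu C (Unt C)) \<cdot> ic X (Unt C) Y (Unt C)) = Ru C X \<oplus> Ru C Y"
proof -
  note I = functor_data_const_I[OF source_data] and id = functor_data_id[OF monoidal_category_axioms]
  have "FP (id_fun C) X Y \<cdot> (Ru C X \<oplus> Ru C Y) = Ru C (X \<otimes> Y) \<cdot> FP (box_fun T C (id_fun C) (const_I T C)) X Y"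
    using r_trans assms unfolding mon_trans_def by blast
  then show ?thesis
    by (simp add: I id) (simp add: id_fun_def const_I_def const_fun_def)
qed

lemma merge_props:
  assumes "triv X u" "triv Y v" shows "triv (X \<otimes> Y) (merge u v)"
  using assms by (auto simp: triv_def merge_def invertible_ar)

lemma triv_ob: "triv X u \<Longrightarrow> X \<in> Ob C"
  using dom_ob[of u] by (auto simp: triv_def invertible_ar)

lemma triv_box: "\<lbrakk>triv X u; triv Y v\<rbrakk> \<Longrightarrow> triv (tbox T X Y) (merge u v)"
  using merge_props[of X u Y v] by (simp add: triv_ob)

text \<open>The source of the entries \<open>Lu C (Unt C)\<close> in the canonical constraint data:
  they trivialise \<open>U \<boxtimes> U\<close>.\<close>

lemma merge_units [simp]: "merge (Idn C (Unt C)) (Idn C (Unt C)) = Lu C (Unt C)"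
  by (simp add: merge_def)

lemma triv_units:
  "triv (tri_I T) (Idn C (Unt C))" "triv (aob (tri_a T)) (Idn C (Unt C))" "triv (aob' (tri_a T)) (Idn C (Unt C))"
  "triv (aob (tri_l T)) (Idn C (Unt C))" "triv (aob' (tri_l T)) (Idn C (Unt C))"
  "triv (aob (tri_r T)) (Idn C (Unt C))" "triv (aob' (tri_r T)) (Idn C (Unt C))"
  by (simp_all add: triv_unit)

lemma tens_zip:
  "length xs = length xs' \<Longrightarrow> tens (prod_cat C D) (zip xs xs') = (tens C xs, tens D xs')"
proof (induction xs arbitrary: xs' rule: induct_list012)
  case (2 x) then show ?case by (cases xs') auto
next
  case (3 x y xs)
  then obtain x' y' ys where "xs' = x' # y' # ys" "length xs = length ys" by (auto simp: length_Suc_conv Suc_length_conv)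
  then show ?case using "3.IH"(2)[of "y' # ys"] by simp
qed auto

text \<open>Naturality moves all trivialisations past the interchange and leaves it at four units,
  where \<open>ic_UUXY\<close> absorbs it. For empty strings the constraint is \<open>ic0\<close>,
  and the claim is \<open>ic0_eq\<close>.\<close>

lemma box_split:
  "\<lbrakk>list_all2 triv xs us; list_all2 triv xs' us'; length us = length us'\<rbrakk> \<Longrightarrow>
     fun_split (prod_cat C C) C (tri_box T) (zip xs xs') \<in> iso C (tens C (map (FO (tri_box T)) (zip xs xs'))) (tens C xs \<otimes> tens C xs')
     \<and> merge (collapse C us) (collapse C us') \<cdot> fun_split (prod_cat C C) C (tri_box T) (zip xs xs') = collapse C (map2 merge us us')
     \<and> list_all2 triv (map (FO (tri_box T)) (zip xs xs')) (map2 merge us us')"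
proof (induction us arbitrary: xs xs' us' rule: induct_list012)
  case 1
  then show ?case by (simp add: ic0_def[symmetric] iso_iff) (simp add: ic0_eq)
next
  case (2 u)
  then obtain u' where "us' = [u']" by (cases us') auto
  with 2 obtain x x' where "xs = [x]" "xs' = [x']" "us' = [u']" "triv x u" "triv x' u'"
    by (auto simp: list_all2_Cons2)
  then show ?case using triv_ob[of x u] triv_ob[of x' u'] merge_props[of x u x' u']
    by (simp add: iso_iff) (simp add: triv_def invertible_ar)
next
  case (3 u v us)
  then obtain x y ys x' y' ys' u' v' us0 where e: "xs = x # y # ys" "xs' = x' # y' # ys'" "us' = u' # v' # us0"
    and t: "triv x u" "triv x' u'" "list_all2 triv (y # ys) (v # us)" "list_all2 triv (y' # ys') (v' # us0)"
      "length (v # us) = length (v' # us0)"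
    by (auto simp: list_all2_Cons2 length_Suc_conv Suc_length_conv)
  let ?fs = "fun_split (prod_cat C C) C (tri_box T) (zip (y # ys) (y' # ys'))"
  let ?Z = "map (FO (tri_box T)) (zip (y # ys) (y' # ys'))"
  let ?P = "tens C (y # ys)" and ?P' = "tens C (y' # ys')" and ?c = "collapse C (v # us)" and ?c' = "collapse C (v' # us0)"
  let ?U = "Unt C" let ?u = "Lu C ?U"
  have l: "length (y # ys) = length (y' # ys')"
    using t(3,4)[THEN list_all2_lengthD] t(5) by simp
  have IH: "?fs \<in> iso C (tens C ?Z) (?P \<otimes> ?P')" "merge ?c ?c' \<cdot> ?fs = collapse C (map2 merge (v # us) (v' # us0))"
    "list_all2 triv ?Z (map2 merge (v # us) (v' # us0))"
    using "3.IH"(2)[OF t(3-5)] by blast+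
  note c = collapse_props[OF t(3)] collapse_props[OF t(4)]
  have [simp]: "x \<in> Ob C" "x' \<in> Ob C" using t triv_ob by auto
  have [simp]: "u \<in> Ar C" "Dom C u = x" "Cod C u = ?U" "u' \<in> Ar C" "Dom C u' = x'" "Cod C u' = ?U"
    using t(1,2) by (auto simp: triv_def invertible_ar)
  have [simp]: "?fs \<in> Ar C" "Dom C ?fs = tens C ?Z" "Cod C ?fs = ?P \<otimes> ?P'" "invertible ?fs"
    using IH(1) by (auto simp: iso_iff invertible_ar simp del: fun_split.simps)
  have [simp]: "?P \<in> Ob C" "?P' \<in> Ob C" "?c \<in> Ar C" "Dom C ?c = ?P" "Cod C ?c = ?U" "?c' \<in> Ar C" "Dom C ?c' = ?P'" "Cod C ?c' = ?U"
    using c tens_list_ob[of "y # ys"] tens_list_ob[of "y' # ys'"] by (simp_all del: tens.simps collapse.simps)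
  have fs: "fun_split (prod_cat C C) C (tri_box T) (zip xs xs') = ic x x' ?P ?P' \<cdot> (Idn C (x \<otimes> x') \<oplus> ?fs)"
    using tens_zip[OF l, of C] by (simp add: e ic_def)
  note [simp del] = fun_split.simps tens.simps collapse.simps zip_Cons_Cons list.map
  have "merge (collapse C (u # v # us)) (collapse C (u' # v' # us0)) \<cdot> (ic x x' ?P ?P' \<cdot> (Idn C (x \<otimes> x') \<oplus> ?fs))
      = ?u \<cdot> ((?u \<oplus> ?u) \<cdot> (((u \<oplus> ?c) \<oplus> (u' \<oplus> ?c')) \<cdot> (ic x x' ?P ?P' \<cdot> (Idn C (x \<otimes> x') \<oplus> ?fs))))"
    by (simp add: merge_def xchg_assoc collapse.simps(3))
  also have "((u \<oplus> ?c) \<oplus> (u' \<oplus> ?c')) \<cdot> (ic x x' ?P ?P' \<cdot> (Idn C (x \<otimes> x') \<oplus> ?fs))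
      = ic ?U ?U ?U ?U \<cdot> (((u \<oplus> u') \<oplus> (?c \<oplus> ?c')) \<cdot> (Idn C (x \<otimes> x') \<oplus> ?fs))"
    by (subst precomp[OF ic_nat]) (simp_all)
  also have "?u \<cdot> ((?u \<oplus> ?u) \<cdot> (ic ?U ?U ?U ?U \<cdot> (((u \<oplus> u') \<oplus> (?c \<oplus> ?c')) \<cdot> (Idn C (x \<otimes> x') \<oplus> ?fs))))
      = ?u \<cdot> (((?u \<oplus> ?u) \<cdot> ic ?U ?U ?U ?U) \<cdot> (((u \<oplus> u') \<oplus> (?c \<oplus> ?c')) \<cdot> (Idn C (x \<otimes> x') \<oplus> ?fs)))"
    by (simp)
  \<comment> \<open>\<open>ic_UUXY\<close> at the unit gives \<open>Lu (U \<otimes> U)\<close> after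
    \<open>?u\<close> tensored with an identity; \<open>lu_lu\<close> makes the former
    \<open>Idn U \<oplus> ?u\<close>, and the two combine.\<close>
  also have "(?u \<oplus> ?u) \<cdot> ic ?U ?U ?U ?U = ?u \<oplus> ?u"
    unfolding ic_UUXY[OF unt_ob unt_ob] by (simp add: lu_lu xchg)
  also have "?u \<cdot> ((?u \<oplus> ?u) \<cdot> (((u \<oplus> u') \<oplus> (?c \<oplus> ?c')) \<cdot> (Idn C (x \<otimes> x') \<oplus> ?fs)))
      = ?u \<cdot> (merge u u' \<oplus> (merge ?c ?c' \<cdot> ?fs))"
    by (simp add: merge_def xchg_assoc xchg)
  also have "\<dots> = collapse C (map2 merge (u # v # us) (u' # v' # us0))"
    unfolding IH(2) by (simp add: collapse.simps(3) zip_Cons_Cons list.map)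
  finally have 1: "merge (collapse C us'') (collapse C us') \<cdot> fun_split (prod_cat C C) C (tri_box T) (zip xs xs')
      = collapse C (map2 merge us'' us')" if "us'' = u # v # us" for us''
    unfolding fs that using e(3) by simp
  have "tens C (map (FO (tri_box T)) (zip xs xs')) = (x \<otimes> x') \<otimes> tens C ?Z"
    by (simp add: e tens.simps(3) zip_Cons_Cons list.map)
  moreover have "tens C xs = x \<otimes> ?P" "tens C xs' = x' \<otimes> ?P'" by (simp_all add: e tens.simps(3))
  ultimately have 2: "fun_split (prod_cat C C) C (tri_box T) (zip xs xs') \<in> iso C (tens C (map (FO (tri_box T)) (zip xs xs'))) (tens C xs \<otimes> tens C xs')"
    unfolding fs by (simp add: iso_iff)
  show ?case
    using 1[OF refl] 2 IH(3) merge_props[OF t(1,2)] by (simp add: e zip_Cons_Cons list.map)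
qed

text \<open>\<open>box_split\<close> is used at both ends; between them the two cells act in
  separate tensor factors, where each is coherent by assumption. The equal lengths let the strings
  be paired entry by entry.\<close>

lemma coherent_box:
  assumes "coherent us c vs" "coherent us' d vs'" "length us = length us'" "length vs = length vs'"
    "ws = map2 merge us us'" "zs = map2 merge vs vs'"
  shows "coherent ws (box_cell T c d) zs"
proof (cases c; cases d)
  fix xs f ys xs' g ys'
  assume c: "c = (xs, f, ys)" and d: "d = (xs', g, ys')"
  note h = assms(1,2)[unfolded c d coherent_def cell_def hom_iff, simplified]
  let ?x = "fun_split (prod_cat C C) C (tri_box T) (zip xs xs')"
  let ?y = "fun_split (prod_cat C C) C (tri_box T) (zip ys ys')"
  have X: "?x \<in> iso C (tens C (map (FO (tri_box T)) (zip xs xs'))) (tens C xs \<otimes> tens C xs')"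
     "merge (collapse C us) (collapse C us') \<cdot> ?x = collapse C ws"
     "list_all2 triv (map (FO (tri_box T)) (zip xs xs')) ws"
    and Y: "?y \<in> iso C (tens C (map (FO (tri_box T)) (zip ys ys'))) (tens C ys \<otimes> tens C ys')"
     "merge (collapse C vs) (collapse C vs') \<cdot> ?y = collapse C zs"
     "list_all2 triv (map (FO (tri_box T)) (zip ys ys')) zs"
    using box_split[of xs us xs' us'] box_split[of ys vs ys' vs'] h assms(3-6) by auto
  have p: "collapse C us \<in> Ar C" "Dom C (collapse C us) = tens C xs" "Cod C (collapse C us) = Unt C"
    "collapse C us' \<in> Ar C" "Dom C (collapse C us') = tens C xs'" "Cod C (collapse C us') = Unt C"
    "collapse C vs \<in> Ar C" "Dom C (collapse C vs) = tens C ys" "Cod C (collapse C vs) = Unt C"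
    "collapse C vs' \<in> Ar C" "Dom C (collapse C vs') = tens C ys'" "Cod C (collapse C vs') = Unt C"
    using collapse_props[of xs us] collapse_props[of xs' us'] collapse_props[of ys vs] collapse_props[of ys' vs'] h
    by auto
  have x: "?x \<in> Ar C" "Dom C ?x = tens C (map (FO (tri_box T)) (zip xs xs'))" "Cod C ?x = tens C xs \<otimes> tens C xs'"
    and y: "invertible ?y" "?y \<in> Ar C" "Dom C ?y = tens C (map (FO (tri_box T)) (zip ys ys'))" "Cod C ?y = tens C ys \<otimes> tens C ys'"
    using X(1) Y(1) by (auto simp: iso_iff invertible_ar)
  have b: "box_cell T c d = (map (FO (tri_box T)) (zip xs xs'), iinv C ?y \<cdot> ((f \<oplus> g) \<cdot> ?x), map (FO (tri_box T)) (zip ys ys'))"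
    using h by (simp add: box_cell_def c d)
  have "collapse C zs \<cdot> (iinv C ?y \<cdot> ((f \<oplus> g) \<cdot> ?x)) = merge (collapse C vs \<cdot> f) (collapse C vs' \<cdot> g) \<cdot> ?x"
    unfolding Y(2)[symmetric] using h p x y by (simp add: merge_def xchg_assoc)
  also have "\<dots> = collapse C ws"
    using h X(2) by simp
  finally have e: "collapse C zs \<cdot> (iinv C ?y \<cdot> ((f \<oplus> g) \<cdot> ?x)) = collapse C ws" .
  show ?thesis
    unfolding b coherent_def cell_def
    using e X(3) Y(3) h x y collapse_props[OF X(3)] collapse_props[OF Y(3)] by (simp add: hom_iff)
qed

text \<open>The common form of the naturality constraints of canonical data: the distinguished
  object is literally the unit, and \<open>g\<close> is the bare morphism that
  \<open>coh_nat\<close> wraps in unitors.\<close>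

definition natcell :: "'o \<Rightarrow> 'm \<Rightarrow> 'o \<Rightarrow> ('o, 'm) pcell \<Rightarrow> bool" where
  "natcell X g Y c \<longleftrightarrow> g \<in> hom C X Y \<and> c = ([Unt C, X], coh_nat C X Y g, [Y, Unt C])"

lemma natcell_val1: "natcell X g Y c \<Longrightarrow> val1 [Tr (Idn C (Unt C)), Re X] c [Re Y, Tr (Idn C (Unt C))] g"
  by (simp add: natcell_def val1_coh_nat)

lemma natcell_swap: "X \<in> Ob C \<Longrightarrow> natcell X (Idn C X) X (swap_cell C X)"
  by (simp add: natcell_def swap_cell_eq hom_iff)

lemma natcell_coherent: "\<lbrakk>natcell X g Y c; triv X p; triv Y q; q \<cdot> g = p\<rbrakk>
   \<Longrightarrow> coherent [Idn C (Unt C), p] c [q, Idn C (Unt C)]"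
  using coherent_coh_nat unfolding natcell_def by blast

lemma natcells:
  "\<lbrakk>X \<in> Ob C; Y \<in> Ob C; Z \<in> Ob C\<rbrakk>
    \<Longrightarrow> natcell ((X \<otimes> Y) \<otimes> Z) (As C X Y Z) (X \<otimes> (Y \<otimes> Z)) (a_cell T X Y Z)"
  "\<lbrakk>X \<in> Ob C; Y \<in> Ob C; Z \<in> Ob C\<rbrakk>
    \<Longrightarrow> natcell (X \<otimes> (Y \<otimes> Z)) (iinv C (As C X Y Z)) ((X \<otimes> Y) \<otimes> Z) (a'_cell T X Y Z)"
  "X \<in> Ob C \<Longrightarrow> natcell (Unt C \<otimes> X) (Lu C X) X (l_cell T X)"
  "X \<in> Ob C \<Longrightarrow> natcell X (iinv C (Lu C X)) (Unt C \<otimes> X) (l'_cell T X)"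
  "X \<in> Ob C \<Longrightarrow> natcell X (iinv C (Ru C X)) (X \<otimes> Unt C) (r'_cell T X)"
  by (simp_all add: natcell_def a_cell_def a'_cell_def l_cell_def l'_cell_def r'_cell_def hom_iff)

text \<open>The interchange enters at the source with units as its first pair and, inverted, at the
  target with units as its second pair; \<open>ic_UUXY\<close> and \<open>ic_XYUU\<close> absorb it.
  The distinguished object becomes \<open>U \<otimes> U\<close>, trivialised by
  \<open>Lu\<close>.\<close>

lemma val1_box:
  assumes "natcell X g X' c" "natcell Y k Y' d"
  shows "val1 [Tr (Lu C (Unt C)), Re (X \<otimes> Y)] (box_cell T c d) [Re (X' \<otimes> Y'), Tr (Lu C (Unt C))] (g \<oplus> k)"
proof -
  let ?U = "Unt C" and ?i = "Idn C"
  have g: "g \<in> Ar C" "Dom C g = X" "Cod C g = X'" "k \<in> Ar C" "Dom C k = Y" "Cod C k = Y'"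
    and c: "c = ([?U, X], coh_nat C X X' g, [X', ?U])" and d: "d = ([?U, Y], coh_nat C Y Y' k, [Y', ?U])"
    using assms by (auto simp: natcell_def hom_iff)
  have [simp]: "X \<in> Ob C" "X' \<in> Ob C" "Y \<in> Ob C" "Y' \<in> Ob C" using dom_ob[of g] cod_ob[of g] dom_ob[of k] cod_ob[of k] g
    by (auto simp del: dom_ob cod_ob)
  note [simp] = g
  let ?f = "coh_nat C X X' g" and ?f' = "coh_nat C Y Y' k"
  have [simp]: "?f \<in> Ar C" "Dom C ?f = ?U \<otimes> X" "Cod C ?f = X' \<otimes> ?U" "?f' \<in> Ar C" "Dom C ?f' = ?U \<otimes> Y" "Cod C ?f' = Y' \<otimes> ?U"
    by (simp_all add: hom_iff)
  have b: "box_cell T c d = ([?U \<otimes> ?U, X \<otimes> Y], iinv C (ic X' Y' ?U ?U) \<cdot> ((?f \<oplus> ?f') \<cdot> ic ?U ?U X Y), [X' \<otimes> Y', ?U \<otimes> ?U])"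
    by (simp add: box_cell_def c d ic_def[symmetric])
  have 1: "Ru C (X' \<otimes> Y') \<cdot> ((?i (X' \<otimes> Y') \<oplus> Lu C ?U) \<cdot> (iinv C (ic X' Y' ?U ?U) \<cdot> w)) = (Ru C X' \<oplus> Ru C Y') \<cdot> w"
    if "w \<in> Ar C" "Cod C w = (X' \<otimes> ?U) \<otimes> (Y' \<otimes> ?U)" for w
    using that precomp[OF ic_XYUU[of X' Y'], of "iinv C (ic X' Y' ?U ?U) \<cdot> w"] by simp
  have 2: "Ru C X' \<cdot> ?f = g \<cdot> Lu C X" "Ru C Y' \<cdot> ?f' = k \<cdot> Lu C Y"
    by (simp_all add: coh_nat_def)
  have "Ru C (X' \<otimes> Y') \<cdot> ((?i (X' \<otimes> Y') \<oplus> Lu C ?U) \<cdot> (iinv C (ic X' Y' ?U ?U) \<cdot> ((?f \<oplus> ?f') \<cdot> ic ?U ?U X Y)))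
      = ((Ru C X' \<cdot> ?f) \<oplus> (Ru C Y' \<cdot> ?f')) \<cdot> ic ?U ?U X Y"
    by (subst 1) (simp_all add: xchg_assoc)
  also have "\<dots> = (g \<oplus> k) \<cdot> ((Lu C X \<oplus> Lu C Y) \<cdot> ic ?U ?U X Y)"
    unfolding 2 by (simp add: xchg_assoc)
  also have "\<dots> = (g \<oplus> k) \<cdot> (Lu C (X \<otimes> Y) \<cdot> (Lu C ?U \<oplus> ?i (X \<otimes> Y)))"
    unfolding ic_UUXY[OF \<open>X \<in> Ob C\<close> \<open>Y \<in> Ob C\<close>] ..
  finally have e: "Ru C (X' \<otimes> Y') \<cdot> ((?i (X' \<otimes> Y') \<oplus> Lu C ?U) \<cdot> (iinv C (ic X' Y' ?U ?U) \<cdot> ((?f \<oplus> ?f') \<cdot> ic ?U ?U X Y)))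
      = (g \<oplus> k) \<cdot> (Lu C (X \<otimes> Y) \<cdot> (Lu C ?U \<oplus> ?i (X \<otimes> Y)))" .
  show ?thesis
    unfolding b by (rule val1_swap) (use e in \<open>auto simp: hom_iff triv_def\<close>)
qed

text \<open>Stated with \<open>merge i i\<close> rather than \<open>Lu C (Unt C)\<close>, since this
  is the form in which \<open>triv_box\<close> and \<open>coherent_box\<close> produce
  trivialisations, and the rules have to match by unification.\<close>

lemma coherent_constraints:
  fixes i defines "i \<equiv> Idn C (Unt C)"
  shows "coherent [merge i i, i, merge i i] (pi_cell T) [i, i]"
    "coherent [merge i i, i, merge i i] (mu_cell T) []"
    "coherent [merge i i] (lam_cell T) [i, i]"
    "coherent [merge i i] (rho_cell T) [i, i]"
    "coherent [merge i i] (uu_cell T) [i]"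
    "coherent [i] ([tri_I T], tri_iso T, [Unt C]) [i]"
    "coherent [i, i] (eps_cell (pair (tri_a T))) []"
    "coherent [] (eta_cell (pair (tri_a T))) [i, i]"
    "coherent [i, i] (eps_cell (pair (tri_l T))) []"
    "coherent [] (eta_cell (pair (tri_l T))) [i, i]"
proof -
  have t: "triv (Unt C \<otimes> Unt C) (Lu C (Unt C))" "triv (Unt C) i"
    by (simp_all add: triv_def i_def)
  show "coherent [merge i i, i, merge i i] (pi_cell T) [i, i]"
    "coherent [merge i i, i, merge i i] (mu_cell T) []"
    "coherent [merge i i] (lam_cell T) [i, i]"
    "coherent [merge i i] (rho_cell T) [i, i]"
    using t unfolding i_def
    by (simp_all add: pi_cell_def mu_cell_def lam_cell_def rho_cell_def constraint_sel coherent_coh_cell Let_def)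
  show "coherent [merge i i] (uu_cell T) [i]" "coherent [i] ([tri_I T], tri_iso T, [Unt C]) [i]"
    using t by (simp_all add: i_def coherent_def uu_cell_def cell_def hom_iff ic0_def[symmetric] ic0_eq)
qed (simp_all add: i_def coherent_eps coherent_eta)

text \<open>Naturality leaves the associator at three units only, which the triangle removes because
  \<open>Lu\<close> and \<open>Ru\<close> coincide at the unit.\<close>

lemma merge_assoc:
  assumes "triv X x" "triv Y y" "triv Z z"
  shows "merge x (merge y z) \<cdot> As C X Y Z = merge (merge x y) z"
proof -
  have [simp]: "x \<in> Ar C" "Dom C x = X" "Cod C x = Unt C" "y \<in> Ar C" "Dom C y = Y" "Cod C y = Unt C"
    "z \<in> Ar C" "Dom C z = Z" "Cod C z = Unt C" "X \<in> Ob C" "Y \<in> Ob C" "Z \<in> Ob C"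
    using assms triv_ob by (auto simp: triv_def invertible_ar)
  let ?U = "Unt C"
  have "merge x (merge y z) \<cdot> As C X Y Z = Lu C ?U \<cdot> ((Idn C ?U \<oplus> Lu C ?U) \<cdot> ((x \<oplus> (y \<oplus> z)) \<cdot> As C X Y Z))"
    by (simp add: merge_def xchg_assoc)
  also have "\<dots> = Lu C ?U \<cdot> (((Idn C ?U \<oplus> Lu C ?U) \<cdot> As C ?U ?U ?U) \<cdot> ((x \<oplus> y) \<oplus> z))"
    using as_nat[of x y z ?U ?U ?U] by simp
  also have "\<dots> = merge (merge x y) z"
    by (simp add: triangle' lu_unit[symmetric] merge_def xchg)
  finally show ?thesis .
qed

lemma merge_left_unit: "triv X x \<Longrightarrow> merge (Idn C (Unt C)) x = x \<cdot> Lu C X"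
  and merge_right_unit: "triv X x \<Longrightarrow> merge x (Idn C (Unt C)) = x \<cdot> Ru C X"
proof -
  assume "triv X x"
  then have x: "x \<in> Ar C" "Dom C x = X" "Cod C x = Unt C" by (auto simp: triv_def invertible_ar)
  then show "merge (Idn C (Unt C)) x = x \<cdot> Lu C X" by (simp add: merge_def lu_nat)
  show "merge x (Idn C (Unt C)) = x \<cdot> Ru C X" using x by (simp add: merge_def lu_unit ru_nat)
qed

text \<open>The axioms also take these naturality cells at structural objects such as
  \<open>U\<close>, \<open>A\<close> or \<chi>. There they are constraints; the compatibility
  required is \<open>merge_assoc\<close> or a unit law for \<open>merge\<close>.\<close>

lemma coherent_natcells:
  fixes i defines "i \<equiv> Idn C (Unt C)"
  shows "\<lbrakk>triv X x; triv Y y; triv Z z\<rbrakk>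
      \<Longrightarrow> coherent [i, merge (merge x y) z] (a_cell T X Y Z) [merge x (merge y z), i]"
    "\<lbrakk>triv X x; triv Y y; triv Z z\<rbrakk>
      \<Longrightarrow> coherent [i, merge x (merge y z)] (a'_cell T X Y Z) [merge (merge x y) z, i]"
    "triv X x \<Longrightarrow> coherent [i, merge i x] (l_cell T X) [x, i]"
    "triv X x \<Longrightarrow> coherent [i, x] (l'_cell T X) [merge i x, i]"
    "triv X x \<Longrightarrow> coherent [i, x] (r'_cell T X) [merge x i, i]"
proof -
  note [simp] = triv_ob
  assume x: "triv X x"
  then have [simp]: "x \<in> Ar C" "Dom C x = X" "Cod C x = Unt C" "X \<in> Ob C" by (auto simp: triv_def invertible_ar)
  note m = merge_props[OF triv_unit x] merge_props[OF x triv_unit]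
  show "coherent [i, merge i x] (l_cell T X) [x, i]"
    unfolding i_def by (rule natcell_coherent[OF natcells(3) m(1) x]) (simp_all add: merge_left_unit[OF x])
  show "coherent [i, x] (l'_cell T X) [merge i x, i]"
    unfolding i_def by (rule natcell_coherent[OF natcells(4) x m(1)]) (simp_all add: merge_left_unit[OF x])
  show "coherent [i, x] (r'_cell T X) [merge x i, i]"
    unfolding i_def by (rule natcell_coherent[OF natcells(5) x m(2)]) (simp_all add: merge_right_unit[OF x])
  assume y: "triv Y y" and z: "triv Z z"
  have [simp]: "Y \<in> Ob C" "Z \<in> Ob C" using y z by auto
  note n = merge_props[OF merge_props[OF x y] z] merge_props[OF x merge_props[OF y z]]
  have [simp]: "merge x (merge y z) \<in> Ar C" "Dom C (merge x (merge y z)) = X \<otimes> (Y \<otimes> Z)"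
    using n(2) by (auto simp: triv_def invertible_ar)
  show "coherent [i, merge (merge x y) z] (a_cell T X Y Z) [merge x (merge y z), i]"
    unfolding i_def by (rule natcell_coherent[OF natcells(1) n]) (simp_all add: merge_assoc[OF x y z])
  show "coherent [i, merge x (merge y z)] (a'_cell T X Y Z) [merge (merge x y) z, i]"
    unfolding i_def by (rule natcell_coherent[OF natcells(2) n(2,1)]) (simp_all add: merge_assoc[OF x y z, symmetric])
qed

lemma coherent_boxr:
  assumes "coherent us c vs" "ws = map2 merge us (replicate (length us) (Idn C (Unt C)))"
    "zs = map2 merge vs (replicate (length vs) (Idn C (Unt C)))"
  shows "coherent ws (boxr T c) zs"
proof -
  have "length (fst c) = length us" "length (snd (snd c)) = length vs"
    using assms(1) by (auto simp: coherent_def dest: list_all2_lengthD)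
  then show ?thesis
    unfolding boxr_def tri_cat by (simp only:) (rule coherent_box[OF assms(1) coherent_units_cell]; use assms in simp)
qed

lemma coherent_boxl:
  assumes "coherent us c vs" "ws = map2 merge (replicate (length us) (Idn C (Unt C))) us"
    "zs = map2 merge (replicate (length vs) (Idn C (Unt C))) vs"
  shows "coherent ws (boxl T c) zs"
proof -
  have "length (fst c) = length us" "length (snd (snd c)) = length vs"
    using assms(1) by (auto simp: coherent_def dest: list_all2_lengthD)
  then show ?thesis
    unfolding boxl_def tri_cat by (simp only:) (rule coherent_box[OF coherent_units_cell assms(1)]; use assms in simp)
qed

text \<open>Between trivialised objects the braiding is invisible: the interchange is a box of a
  swap and an inverse swap, and both are coherent.\<close>

lemma coherent_interchange:
  assumes "triv X x" "triv Y y"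
  shows "coherent [merge (Idn C (Unt C)) y, merge x (Idn C (Unt C))] (interchange T X Y)
    [merge x (Idn C (Unt C)), merge (Idn C (Unt C)) y]"
  unfolding interchange_def tri_cat
  by (rule coherent_box[OF coherent_swap_cell[OF assms(1)] coherent_inv[OF coherent_swap_cell[OF assms(2)]]]) simp_all

end

text \<open>The condition on \<chi> in monoidal form. By \<open>braided_iff\<close> it says that
  \<open>H\<close> respects the interchange maps, and with them the braiding they encode.\<close>

definition braided :: "('o, 'm) dd_tricat \<Rightarrow> ('p, 'n) dd_tricat \<Rightarrow> ('o, 'm, 'p, 'n) monfun \<Rightarrow> bool" where
  "braided T T' H \<longleftrightarrow>
    (let B = tri_cat T; B' = tri_cat T'; B2 = prod_cat B B
     in monoidal_functor B B' H \<and>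
        mon_trans B2 B'
          (box_fun T' B2 (comp_fun B2 B' H (fst_fun B B)) (comp_fun B2 B' H (snd_fun B B)))
          (comp_fun B2 B' H (tri_box T)) (\<lambda>(X, Y). FP H X Y))"

section \<open>Canonical weak functors\<close>

locale canonical_pair = S: canonical B T + D: canonical B' T'
  for B :: "('o, 'm) moncat" and T and B' :: "('p, 'n) moncat" and T'

locale canonical_functor_data = canonical_pair B T B' T' + H: monoidal_functor B B' H
  for B :: "('o, 'm) moncat" and T and B' :: "('p, 'n) moncat" (structure) and T' and H
begin

lemma FO_ob [simp]: "X \<in> Ob B \<Longrightarrow> FO H X \<in> Ob B'"
  by (rule H.ob)

lemma FA_ar [simp]: "f \<in> Ar B \<Longrightarrow> FA H f \<in> Ar B'"
  and FA_dom [simp]: "f \<in> Ar B \<Longrightarrow> Dom B' (FA H f) = FO H (Dom B f)"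
  and FA_cod [simp]: "f \<in> Ar B \<Longrightarrow> Cod B' (FA H f) = FO H (Cod B f)"
  using H.ar[of f "Dom B f" "Cod B f"] by (auto simp: S.hom_iff D.hom_iff)

lemma FA_idn [simp]: "X \<in> Ob B \<Longrightarrow> FA H (Idn B X) = Idn B' (FO H X)"
  by (rule H.idn)

lemma FA_cmp: "\<lbrakk>f \<in> Ar B; g \<in> Ar B; Dom B g = Cod B f\<rbrakk> \<Longrightarrow> FA H (g \<cdot>\<^bsub>B\<^esub> f) = FA H g \<cdot> FA H f"
  using H.cmp[of f "Dom B f" "Cod B f" g "Cod B g"] by (simp add: S.hom_iff)

lemma FA_inverse: assumes "S.invertible f" shows "is_inverse B' (FA H f) (FA H (iinv B f))"
  using assms S.invertible_ar[OF assms]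
  by (intro D.is_inverseI) (simp_all add: FA_cmp[symmetric])

lemma FA_invertible [simp]: "S.invertible f \<Longrightarrow> D.invertible (FA H f)"
  using FA_inverse unfolding D.invertible_def by blast

lemma FA_iinv: "S.invertible f \<Longrightarrow> FA H (iinv B f) = iinv B' (FA H f)"
  using FA_inverse D.iinv_eqI by metis

lemma FP_invertible [simp]: "\<lbrakk>X \<in> Ob B; Y \<in> Ob B\<rbrakk> \<Longrightarrow> D.invertible (FP H X Y)"
  and FP_ar [simp]: "\<lbrakk>X \<in> Ob B; Y \<in> Ob B\<rbrakk> \<Longrightarrow> FP H X Y \<in> Ar B'"
  and FP_dom [simp]: "\<lbrakk>X \<in> Ob B; Y \<in> Ob B\<rbrakk> \<Longrightarrow> Dom B' (FP H X Y) = FO H X \<otimes> FO H Y"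
  and FP_cod [simp]: "\<lbrakk>X \<in> Ob B; Y \<in> Ob B\<rbrakk> \<Longrightarrow> Cod B' (FP H X Y) = FO H (X \<otimes>\<^bsub>B\<^esub> Y)"
  using H.phi_iso[of X Y] by (auto simp: D.iso_iff D.invertible_ar)

lemma FU_invertible [simp]: "D.invertible (FU H)"
  and FU_ar [simp]: "FU H \<in> Ar B'"
  and FU_dom [simp]: "Dom B' (FU H) = Unt B'"
  and FU_cod [simp]: "Cod B' (FU H) = FO H (Unt B)"
  using H.phi0_iso by (auto simp: D.iso_iff D.invertible_ar)

lemma FP_nat:
  "\<lbrakk>f \<in> Ar B; g \<in> Ar B; Cod B f = X; Cod B g = Y\<rbrakk>
    \<Longrightarrow> FP H X Y \<cdot> (FA H f \<oplus> FA H g) = FA H (f \<oplus>\<^bsub>B\<^esub> g) \<cdot> FP H (Dom B f) (Dom B g)"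
  using H.phi_nat[of f "Dom B f" X g "Dom B g" Y] by (simp add: S.hom_iff)

lemma FP_lunit:
  assumes [simp]: "X \<in> Ob B"
  shows "FA H (Lu B X) \<cdot> FP H (Unt B) X = Lu B' (FO H X) \<cdot> (iinv B' (FU H) \<oplus> Idn B' (FO H X))"
  unfolding H.phi_lunit[OF assms, symmetric] by (simp add: D.xchg)

lemma FP_runit:
  assumes [simp]: "X \<in> Ob B"
  shows "FA H (Ru B X) \<cdot> FP H X (Unt B) = Ru B' (FO H X) \<cdot> (Idn B' (FO H X) \<oplus> iinv B' (FU H))"
  unfolding H.phi_runit[OF assms, symmetric] by (simp add: D.xchg)

text \<open>The trivialisation of \<open>H X\<close> induced by a trivialisation of \<open>X\<close>.\<close>

definition tr :: "'m \<Rightarrow> 'n" where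
  "tr u = iinv B' (FU H) \<cdot> FA H u"

lemma tr_unit [simp]: "tr (Idn B (Unt B)) = iinv B' (FU H)"
  by (simp add: tr_def)

lemma triv_tr: "S.triv X u \<Longrightarrow> D.triv (FO H X) (tr u)"
  by (auto simp: S.triv_def D.triv_def tr_def S.invertible_ar)

lemma triv_h: "D.triv (FO H (Unt B)) (iinv B' (FU H))"
  by (simp add: D.triv_def)

text \<open>Naturality of \<open>FP\<close> reduces the claim to \<open>FP H U U\<close>, where the
  left unit law of \<open>H\<close> and naturality of \<open>Lu\<close> finish it.\<close>

lemma tr_merge:
  assumes "S.triv X u" "S.triv Y v"
  shows "tr (S.merge u v) \<cdot> FP H X Y = D.merge (tr u) (tr v)"
proof -
  let ?U = "Unt B" and ?h = "iinv B' (FU H)"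
  have [simp]: "u \<in> Ar B" "Dom B u = X" "Cod B u = ?U" "v \<in> Ar B" "Dom B v = Y" "Cod B v = ?U" "X \<in> Ob B" "Y \<in> Ob B"
    using assms S.triv_ob by (auto simp: S.triv_def S.invertible_ar)
  have "tr (S.merge u v) \<cdot> FP H X Y = ?h \<cdot> (FA H (Lu B ?U) \<cdot> (FA H (u \<oplus>\<^bsub>B\<^esub> v) \<cdot> FP H X Y))"
    by (simp add: tr_def S.merge_def FA_cmp)
  also have "FA H (u \<oplus>\<^bsub>B\<^esub> v) \<cdot> FP H X Y = FP H ?U ?U \<cdot> (FA H u \<oplus> FA H v)"
    by (simp add: FP_nat)
  also have "FA H (Lu B ?U) \<cdot> (FP H ?U ?U \<cdot> (FA H u \<oplus> FA H v))
      = Lu B' (FO H ?U) \<cdot> ((?h \<oplus> Idn B' (FO H ?U)) \<cdot> (FA H u \<oplus> FA H v))"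
    by (subst D.precomp[OF FP_lunit]) simp_all
  also have "?h \<cdot> \<dots> = (?h \<cdot> Lu B' (FO H ?U)) \<cdot> ((?h \<oplus> Idn B' (FO H ?U)) \<cdot> (FA H u \<oplus> FA H v))"
    by simp
  also have "?h \<cdot> Lu B' (FO H ?U) = Lu B' (Unt B') \<cdot> (Idn B' (Unt B') \<oplus> ?h)"
    by (simp add: D.lu_nat)
  finally show ?thesis
    by (simp add: D.merge_def tr_def D.xchg)
qed

text \<open>Induction along \<open>fun_split\<close>: each step is \<open>tr_merge\<close> for the
  head and the collapsed tail.\<close>

lemma H_split:
  "list_all2 S.triv xs us \<Longrightarrow>
     fun_split B B' H xs \<in> iso B' (tens B' (map (FO H) xs)) (FO H (tens B xs)) \<and>
     tr (collapse B us) \<cdot> fun_split B B' H xs = collapse B' (map tr us)"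
proof (induction us arbitrary: xs rule: induct_list012)
  case 1
  then show ?case by (simp add: D.iso_iff)
next
  case (2 u)
  then obtain x where "xs = [x]" "S.triv x u" by (auto simp: list_all2_Cons2)
  then show ?case using triv_tr[of x u] S.triv_ob[of x u]
    by (simp add: D.iso_iff) (simp add: D.triv_def D.invertible_ar)
next
  case (3 u v us)
  then obtain x y ys where e: "xs = x # y # ys" and t: "S.triv x u" "list_all2 S.triv (y # ys) (v # us)"
    by (auto simp: list_all2_Cons2)
  let ?fs = "fun_split B B' H (y # ys)" and ?P = "tens B (y # ys)" and ?c = "collapse B (v # us)"
  note IH = "3.IH"(2)[OF t(2)]
  note c = S.collapse_props[OF t(2)]
  have [simp]: "x \<in> Ob B" "?P \<in> Ob B" using t(1) S.triv_ob c S.tens_list_ob[of "y # ys"] by auto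
  have [simp]: "?fs \<in> Ar B'" "Dom B' ?fs = tens B' (map (FO H) (y # ys))" "Cod B' ?fs = FO H ?P" "D.invertible ?fs"
    using IH by (auto simp: D.iso_iff D.invertible_ar simp del: fun_split.simps)
  have C: "S.triv ?P ?c" using c by (simp add: S.triv_def)
  note [simp del] = fun_split.simps tens.simps collapse.simps list.map
  have "tr (S.merge u ?c) \<cdot> (FP H x ?P \<cdot> (Idn B' (FO H x) \<oplus> ?fs))
     = (tr (S.merge u ?c) \<cdot> FP H x ?P) \<cdot> (Idn B' (FO H x) \<oplus> ?fs)"
    using triv_tr[OF S.merge_props[OF t(1) C]] by (simp add: D.triv_def D.invertible_ar)
  also have "\<dots> = D.merge (tr u) (tr ?c \<cdot> ?fs)"
    using triv_tr[OF t(1)] triv_tr[OF C]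
    unfolding tr_merge[OF t(1) C] by (simp add: D.merge_def D.triv_def D.invertible_ar D.xchg)
  also have "\<dots> = collapse B' (map tr (u # v # us))"
    using IH by (simp add: D.merge_def collapse.simps(3) list.map)
  finally show ?case
    by (simp add: e fun_split.simps(3) collapse.simps(3) S.merge_def tens.simps(3) list.map)
      (simp add: D.iso_iff tens.simps(3) list.map)
qed

lemma coherent_fun_cell:
  assumes "S.coherent us c vs" "ws = map tr us" "zs = map tr vs"
  shows "D.coherent ws (fun_cell B B' H c) zs"
proof (cases c)
  case (fields xs f ys)
  note h = assms(1)[unfolded fields S.coherent_def S.cell_def S.hom_iff, simplified]
  note p = S.collapse_props[of xs us] S.collapse_props[of ys vs] H_split[of xs us] H_split[of ys vs]
  have t: "list_all2 D.triv (map (FO H) xs) ws" "list_all2 D.triv (map (FO H) ys) zs"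
    using h assms(2,3) triv_tr by (auto simp: list.rel_map elim: list_all2_mono)
  let ?x = "fun_split B B' H xs" and ?y = "fun_split B B' H ys"
  have [simp]: "?x \<in> Ar B'" "Dom B' ?x = tens B' (map (FO H) xs)" "Cod B' ?x = FO H (tens B xs)"
    "?y \<in> Ar B'" "D.invertible ?y" "Dom B' ?y = tens B' (map (FO H) ys)" "Cod B' ?y = FO H (tens B ys)"
    using p h by (auto simp: D.iso_iff D.invertible_ar)
  have [simp]: "f \<in> Ar B" "Dom B f = tens B xs" "Cod B f = tens B ys" using h by auto
  have [simp]: "collapse B vs \<in> Ar B" "Dom B (collapse B vs) = tens B ys" "Cod B (collapse B vs) = Unt B"
    using S.collapse_props[of ys vs] h by auto
  have e: "tr (collapse B vs) \<cdot> ?y = collapse B' zs" "tr (collapse B us) \<cdot> ?x = collapse B' ws"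
    using p h assms(2,3) by auto
  have "collapse B' zs \<cdot> (iinv B' ?y \<cdot> (FA H f \<cdot> ?x))
      = (tr (collapse B vs) \<cdot> ?y) \<cdot> (iinv B' ?y \<cdot> (FA H f \<cdot> ?x))"
    by (simp only: e)
  also have "\<dots> = tr (collapse B vs \<cdot>\<^bsub>B\<^esub> f) \<cdot> ?x"
    by (simp add: tr_def FA_cmp)
  also have "\<dots> = collapse B' ws"
    using h e by simp
  finally have "collapse B' zs \<cdot> (iinv B' ?y \<cdot> (FA H f \<cdot> ?x)) = collapse B' ws" .
  then show ?thesis
    using t D.collapse_props[OF t(1)] D.collapse_props[OF t(2)]
    by (simp add: fields D.coherent_def D.cell_def D.hom_iff)
qed

text \<open>\<open>H\<close> turns the distinguished unit into \<open>H U\<close>, trivialised by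
  the inverse of \<open>FU H\<close>. The constraint maps \<open>FP H U X\<close> at the source and
  the inverse of \<open>FP H Y U\<close> at the target are absorbed by the two unit laws of
  \<open>H\<close>.\<close>

lemma val1_fun_cell:
  assumes "S.natcell X g Y c"
  shows "D.val1 [Tr (iinv B' (FU H)), Re (FO H X)] (fun_cell B B' H c) [Re (FO H Y), Tr (iinv B' (FU H))] (FA H g)"
proof -
  let ?h = "iinv B' (FU H)" and ?U = "Unt B"
  let ?g = "coh_nat B X Y g"
  have c: "c = ([?U, X], ?g, [Y, ?U])" and g: "g \<in> hom B X Y"
    using assms by (auto simp: S.natcell_def)
  then have [simp]: "g \<in> Ar B" "Dom B g = X" "Cod B g = Y" "X \<in> Ob B" "Y \<in> Ob B"
    using S.dom_ob[of g] S.cod_ob[of g] by (auto simp: S.hom_iff)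
  note [simp] = S.coh_nat_hom[OF g]
  have f: "fun_cell B B' H c = ([FO H ?U, FO H X], iinv B' (FP H Y ?U) \<cdot> (FA H ?g \<cdot> FP H ?U X), [FO H Y, FO H ?U])"
    by (simp add: c)
  have 1: "Ru B' (FO H Y) \<cdot> ((Idn B' (FO H Y) \<oplus> ?h) \<cdot> (iinv B' (FP H Y ?U) \<cdot> w)) = FA H (Ru B Y) \<cdot> w"
    if "w \<in> Ar B'" "Cod B' w = FO H (Y \<otimes>\<^bsub>B\<^esub> ?U)" for w
    using that D.precomp[OF FP_runit[of Y], of "iinv B' (FP H Y ?U) \<cdot> w"] by simp
  have 2: "Ru B Y \<cdot>\<^bsub>B\<^esub> ?g = g \<cdot>\<^bsub>B\<^esub> Lu B X"
    by (simp add: coh_nat_def)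
  have "Ru B' (FO H Y) \<cdot> ((Idn B' (FO H Y) \<oplus> ?h) \<cdot> (iinv B' (FP H Y ?U) \<cdot> (FA H ?g \<cdot> FP H ?U X)))
     = FA H (Ru B Y \<cdot>\<^bsub>B\<^esub> ?g) \<cdot> FP H ?U X"
    by (subst 1) (simp_all add: FA_cmp)
  also have "\<dots> = FA H g \<cdot> (FA H (Lu B X) \<cdot> FP H ?U X)"
    unfolding 2 by (simp add: FA_cmp)
  also have "\<dots> = FA H g \<cdot> (Lu B' (FO H X) \<cdot> (?h \<oplus> Idn B' (FO H X)))"
    by (simp add: FP_lunit)
  finally show ?thesis
    unfolding f by (intro D.val1_swap) (simp_all add: D.hom_iff D.triv_def)
qed

abbreviation "F \<equiv> canonical_functor T T' H"

lemma F_sel [simp]: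
  "wf_fun F = H" "pair (wf_chi F) = unit_dual B'" "pair (wf_iota F) = unit_dual B'"
  "\<lbrakk>X \<in> Ob B; Y \<in> Ob B\<rbrakk> \<Longrightarrow> nat (wf_chi F) (X, Y) = coh_nat B' (FO H X \<otimes> FO H Y) (FO H (X \<otimes>\<^bsub>B\<^esub> Y)) (FP H X Y)"
  "nat (wf_iota F) () = coh_nat B' (Unt B') (FO H (Unt B)) (FU H)"
  by (simp_all add: canonical_functor_def Let_def)

lemma F_constraint_sel:
  "wf_omega F = coh B' [iinv B' (FU H), Idn B' (Unt B'), Lu B' (Unt B')] [Idn B' (Unt B'), Lu B' (Unt B'), Idn B' (Unt B')]"
  "wf_gamma F = coh B' [iinv B' (FU H), Idn B' (Unt B'), Lu B' (Unt B')] [Idn B' (Unt B')]"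
  "wf_delta F = coh B' [iinv B' (FU H)] [Idn B' (Unt B'), Lu B' (Unt B'), Idn B' (Unt B')]"
  by (simp_all add: canonical_functor_def Let_def)

lemma triv_F_units:
  "D.triv (aob (wf_chi F)) (Idn B' (Unt B'))" "D.triv (aob (wf_iota F)) (Idn B' (Unt B'))"
  by (simp_all add: D.triv_unit)

lemma coherent_F_constraints:
  fixes i j defines "i \<equiv> Idn B' (Unt B')" and "j \<equiv> Idn B (Unt B)"
  shows "D.coherent [tr j, i, D.merge i i] (omega_cell T T' F) [i, D.merge i i, i]"
    "D.coherent [tr j, i, D.merge i i] (gamma_cell T T' F) [i]"
    "D.coherent [tr j] (delta_cell T T' F) [i, D.merge i i, i]"
    "D.coherent [tr j] (dd_functor_data.hu_cell T T' F) [i]"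
    "D.coherent [i, i] (iota_cell T T' F) [tr j, i]"
proof -
  have t: "D.triv (Unt B' \<otimes> Unt B') (Lu B' (Unt B'))" "D.triv (Unt B') i" "D.triv (FO H (Unt B)) (iinv B' (FU H))"
    by (simp_all add: D.triv_def i_def)
  show "D.coherent [tr j, i, D.merge i i] (omega_cell T T' F) [i, D.merge i i, i]"
    "D.coherent [tr j, i, D.merge i i] (gamma_cell T T' F) [i]"
    "D.coherent [tr j] (delta_cell T T' F) [i, D.merge i i, i]"
    using t unfolding i_def j_def
    by (simp_all add: omega_cell_def gamma_cell_def delta_cell_def F_constraint_sel D.coherent_coh_cell Let_def)
  show "D.coherent [tr j] (dd_functor_data.hu_cell T T' F) [i]"
    using t by (simp add: i_def j_def D.coherent_def dd_functor_data.hu_cell_def D.cell_def D.hom_iff)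
  show "D.coherent [i, i] (iota_cell T T' F) [tr j, i]"
    unfolding i_def j_def iota_cell_def
    using D.coherent_coh_nat[OF _ D.triv_unit triv_h, of "FU H"] by (simp add: D.hom_iff)
qed

lemma natcell_chi: "\<lbrakk>X \<in> Ob B; Y \<in> Ob B\<rbrakk>
    \<Longrightarrow> D.natcell (FO H X \<otimes> FO H Y) (FP H X Y) (FO H (X \<otimes>\<^bsub>B\<^esub> Y)) (chi_cell T T' F X Y)"
  by (simp add: D.natcell_def chi_cell_def D.hom_iff)

lemma natcell_iota: "D.natcell (Unt B') (FU H) (FO H (Unt B)) (iota_cell T T' F)"
  by (simp add: D.natcell_def iota_cell_def D.hom_iff)

lemma coherent_chi:
  assumes "S.triv X x" "S.triv Y y"
  shows "D.coherent [Idn B' (Unt B'), D.merge (tr x) (tr y)] (chi_cell T T' F X Y) [tr (S.merge x y), Idn B' (Unt B')]"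
  by (rule D.natcell_coherent[OF natcell_chi D.merge_props[OF triv_tr triv_tr] triv_tr[OF S.merge_props] tr_merge])
    (use assms S.triv_ob in auto)

text \<open>A syntax-directed calculus: the shape of a cell selects the rule, and unification finds
  the trivialisations of the strings. No underlying morphism is ever computed.\<close>

lemmas coherent_rules =
  D.coherent_chain D.coherent_single D.coherent_paste D.coherent_inv D.coherent_box D.coherent_boxl D.coherent_boxr
  D.coherent_interchange D.coherent_id_cell D.coherent_swap_cell
  D.coherent_constraints D.coherent_natcells coherent_F_constraints coherent_chi
  coherent_fun_cell S.coherent_constraints S.coherent_natcells
  list_all2_Nil[THEN iffD2, OF refl] list_all2_Cons[THEN iffD2, OF conjI]
  D.triv_box D.triv_units triv_F_units triv_tr S.triv_box S.triv_units S.triv_unit D.triv_unit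

lemma assoc_axiom: "dd_functor_data.assoc_axiom T T' F"
  unfolding dd_functor_data.assoc_axiom_def S.tri_cat D.tri_cat F_sel(1)
  \<comment> \<open>\<open>coherent_unique\<close> leaves the lists of trivialisations schematic.
    The derivation for the first side instantiates them, and the derivation for the second is
    checked against the result.\<close>
  by (rule D.coherent_unique, (rule coherent_rules refl | (simp; fail))+)

lemma unit_axiom: "dd_functor_data.unit_axiom T T' F"
  unfolding dd_functor_data.unit_axiom_def S.tri_cat D.tri_cat F_sel(1)
  by (rule D.coherent_unique, (rule coherent_rules refl | (simp; fail))+)

lemmas val1_rules = D.val1_chain D.val1_single D.val1_coherent_left D.val1_coherent_right D.val1_paste
  D.val1_box[THEN D.val1_conv] val1_fun_cell[THEN D.val1_conv] D.natcell_val1[THEN D.val1_conv]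
  D.natcell_swap D.natcells natcell_chi natcell_iota S.natcells

text \<open>Unification computes the values of both sides; comparing them is the associativity law
  of the monoidal functor \<open>H\<close>.\<close>

lemma omega_mod:
  assumes [simp]: "X \<in> Ob B" "Y \<in> Ob B" "Z \<in> Ob B"
  shows "dd_functor_data.omega_mod T T' F X Y Z"
  unfolding dd_functor_data.omega_mod_def S.tri_cat D.tri_cat F_sel(1)
  by (rule D.val1_eqI, (rule val1_rules coherent_rules refl | (simp; fail))+)
    (simp add: H.phi_assoc)

lemma gamma_mod:
  assumes [simp]: "X \<in> Ob B"
  shows "dd_functor_data.gamma_mod T T' F X"
  unfolding dd_functor_data.gamma_mod_def S.tri_cat D.tri_cat F_sel(1)
  by (rule D.val1_eqI, (rule val1_rules coherent_rules refl | (simp; fail))+)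
    (simp add: H.phi_lunit)

text \<open>The right unit law of \<open>H\<close>, first solved for the inverse of
  \<open>Ru\<close> because \<delta> concerns the dual of \<open>r\<close>.\<close>

lemma delta_mod:
  assumes [simp]: "X \<in> Ob B"
  shows "dd_functor_data.delta_mod T T' F X"
proof -
  \<comment> \<open>The value of the side that begins with \<delta>: the inverse unitor from
    \<open>r'\<close>, then \<open>FU\<close> from \<iota>, then \<open>FP\<close> from
    \<chi>.\<close>
  let ?e = "FP H X (Unt B) \<cdot> ((Idn B' (FO H X) \<oplus> FU H) \<cdot> iinv B' (Ru B' (FO H X)))"
  have "FA H (Ru B X) \<cdot> ?e = FA H (Ru B X) \<cdot> iinv B' (FA H (Ru B X))"
    by (simp add: D.precomp[OF FP_runit] D.xchg_assoc)
  then have e: "?e = FA H (iinv B (Ru B X))"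
    unfolding FA_iinv[OF S.ru_invertible[OF assms]] by (rule D.cancel_left) simp_all
  show ?thesis
    unfolding dd_functor_data.delta_mod_def S.tri_cat D.tri_cat F_sel(1)
    by (rule D.val1_eqI, (rule val1_rules coherent_rules refl | (simp; fail))+)
      (simp add: e)
qed

abbreviation "B2 \<equiv> prod_cat B B"
abbreviation "HH \<equiv> box_fun T' B2 (comp_fun B2 B' H (fst_fun B B)) (comp_fun B2 B' H (snd_fun B B))"
abbreviation "Hb \<equiv> comp_fun B2 B' H (tri_box T)"

lemmas source_B2 = source_data_prod[OF S.source_data S.source_data]
lemmas H_data = H.functor_data
lemmas Hfst = functor_data_comp[OF D.monoidal_category_axioms functor_data_fst[OF S.monoidal_category_axioms S.source_data S.source_data] H_data source_B2]
lemmas Hsnd = functor_data_comp[OF D.monoidal_category_axioms functor_data_snd[OF S.monoidal_category_axioms S.source_data S.source_data] H_data source_B2]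
lemmas HH_data = D.functor_data_box[OF Hfst Hsnd source_B2]
lemmas Hb_data = functor_data_comp[OF D.monoidal_category_axioms monoidal_functor.functor_data[OF S.box_functor] H_data source_B2]

lemma HH_ob: "\<lbrakk>X \<in> Ob B; Y \<in> Ob B\<rbrakk> \<Longrightarrow> FO HH (X, Y) = FO H X \<otimes> FO H Y"
  by (simp add: D.box_fun_ob[OF Hfst Hsnd]) (simp add: comp_fun_def fst_fun_def snd_fun_def)

lemma Hb_ob: "\<lbrakk>X \<in> Ob B; Y \<in> Ob B\<rbrakk> \<Longrightarrow> FO Hb (X, Y) = FO H (X \<otimes>\<^bsub>B\<^esub> Y)"
  by (simp add: comp_fun_def)

text \<open>Recognises domains and codomains as values of the functors \<open>HH\<close> and
  \<open>Hb\<close>, the shape to which \<open>canonical_adj_eq\<close> and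
  \<open>lax_trans_iff\<close> apply.\<close>

lemma chi_eq: "wf_chi F = \<lparr>pair = unit_dual B',
    nat = restrict (\<lambda>p. coh_nat B' (FO HH p) (FO Hb p) (case p of (X, Y) \<Rightarrow> FP H X Y)) (Ob B2),
    nat' = restrict (\<lambda>p. coh_nat B' (FO Hb p) (FO HH p) (iinv B' (case p of (X, Y) \<Rightarrow> FP H X Y))) (Ob B2)\<rparr>"
  by (rule adj_eq.equality)
    (auto simp: canonical_functor_def Let_def HH_ob Hb_ob intro!: restrict_ext)

lemma iota_adj: "is_adj_eq one_cat B' (const_I T' one_cat) (comp_fun one_cat B' H (const_I T one_cat)) (wf_iota F)"
proof -
  let ?G = "comp_fun one_cat B' H (const_I T one_cat)"
  note c = D.functor_data_const_I[OF source_data_one]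
  have g: "functor_data one_cat B' ?G"
    by (rule functor_data_comp[OF D.monoidal_category_axioms S.functor_data_const_I[OF source_data_one] H_data source_data_one])
  have o: "Ob one_cat = UNIV" "Ar one_cat = UNIV" by (simp_all add: one_cat_def)
  have 1: "wf_iota F = \<lparr>pair = unit_dual B',
    nat = restrict (\<lambda>p. coh_nat B' (FO (const_I T' one_cat) p) (FO ?G p) (FU H)) (Ob one_cat),
    nat' = restrict (\<lambda>p. coh_nat B' (FO ?G p) (FO (const_I T' one_cat) p) (iinv B' (FU H))) (Ob one_cat)\<rparr>"
    by (simp add: canonical_functor_def Let_def o) (simp add: const_I_def const_fun_def comp_fun_def o fun_eq_iff)
  \<comment> \<open>The unit constraint of \<open>H\<close> is a morphism of monoids from the unit
    to \<open>H U\<close>; over the one-object source this is the tensor clause.\<close>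
  have 2: "FA H (Lu B (Unt B)) \<cdot> (FP H (Unt B) (Unt B) \<cdot> (FU H \<oplus> FU H)) = FU H \<cdot> Lu B' (Unt B')"
    by (simp add: D.precomp[OF FP_lunit] D.xchg D.lu_nat)
  have "mon_trans one_cat B' (const_I T' one_cat) ?G (\<lambda>_. FU H)"
    unfolding mon_trans_def using 2
    by (simp add: const_I_def const_fun_def comp_fun_def o D.hom_iff)
  then show ?thesis
    unfolding 1 by (rule D.canonical_adj_eq[OF source_data_one c g]) simp
qed

text \<open>The condition is the one on \<open>wf_chi\<close>. All other parts of the definition
  have been derived above from monoidality of \<open>H\<close>.\<close>

lemma weak_functor_iff: "weak_functor T T' F \<longleftrightarrow> mon_trans B2 B' HH Hb (\<lambda>(X, Y). FP H X Y)"
proof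
  assume "weak_functor T T' F"
  then have "is_adj_eq B2 B' HH Hb (wf_chi F)"
    by (simp add: weak_functor_def Let_def)
  then have "lax_trans B2 B' HH Hb (Unt B') (restrict (\<lambda>p. coh_nat B' (FO HH p) (FO Hb p) (case p of (X, Y) \<Rightarrow> FP H X Y)) (Ob B2))"
    unfolding is_adj_eq_def chi_eq by simp
  then show "mon_trans B2 B' HH Hb (\<lambda>(X, Y). FP H X Y)"
    by (subst (asm) D.lax_trans_iff[OF source_B2 HH_data Hb_data]) (auto simp: HH_ob Hb_ob D.hom_iff)
next
  assume m: "mon_trans B2 B' HH Hb (\<lambda>(X, Y). FP H X Y)"
  have "is_adj_eq B2 B' HH Hb (wf_chi F)"
    unfolding chi_eq by (rule D.canonical_adj_eq[OF source_B2 HH_data Hb_data m]) auto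
  then show "weak_functor T T' F"
    using H.monoidal_functor_axioms iota_adj omega_mod gamma_mod delta_mod assoc_axiom unit_axiom
      coherent_F_constraints(1-3)[THEN D.coherent_iso_cell]
    by (simp add: weak_functor_def Let_def)
qed

lemma weak_functor_iff_braided: "weak_functor T T' F \<longleftrightarrow> braided T T' H"
  using weak_functor_iff H.monoidal_functor_axioms by (simp add: braided_def Let_def)

end

lemma (in monoidal_category) ru_coh_nat:
  "g \<in> hom C X Y \<Longrightarrow> Ru C Y \<cdot> coh_nat C X Y g = g \<cdot> Lu C X"
  using dom_ob[of g] cod_ob[of g] by (auto simp: coh_nat_def hom_iff)

section \<open>Canonical lax transformations\<close>

locale canonical_hom = F: canonical_functor_data B T B' T' H + G: canonical_functor_data B T B' T' K
  for B :: "('o, 'm) moncat" and T and B' :: "('p, 'n) moncat" (structure) and T' and H and K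
begin

abbreviation "P \<equiv> box_fun T' B (const_U T' B) H"
abbreviation "Q \<equiv> box_fun T' B K (const_U T' B)"
lemma const_U: "const_U T' B = const_I T' B"
  by (simp add: const_U_def const_I_def)

lemmas U_data = F.D.functor_data_const_I[OF F.S.source_data, folded const_U]
lemmas P_data = F.D.functor_data_box[OF U_data F.H_data F.S.source_data]
lemmas Q_data = F.D.functor_data_box[OF G.H_data U_data F.S.source_data]

lemma PQ_ob: "X \<in> Ob B \<Longrightarrow> FO P X = Unt B' \<otimes> FO H X" "X \<in> Ob B \<Longrightarrow> FO Q X = FO K X \<otimes> Unt B'"
  by (simp_all add: F.D.box_fun_ob[OF U_data F.H_data] F.D.box_fun_ob[OF G.H_data U_data])
    (simp_all add: const_U_def const_fun_def)

lemma PQ_ar: "f \<in> hom B X Y \<Longrightarrow> FA P f = Idn B' (Unt B') \<oplus> FA H f"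
  "f \<in> hom B X Y \<Longrightarrow> FA Q f = FA K f \<oplus> Idn B' (Unt B')"
  by (simp_all add: F.D.box_fun_ar[OF U_data F.H_data] F.D.box_fun_ar[OF G.H_data U_data])
    (simp_all add: const_U_def const_fun_def hom_def)

lemma PQ_FP:
  "\<lbrakk>X \<in> Ob B; Y \<in> Ob B\<rbrakk> \<Longrightarrow> FP P X Y = (Lu B' (Unt B') \<oplus> FP H X Y) \<cdot> F.D.ic (Unt B') (FO H X) (Unt B') (FO H Y)"
  "\<lbrakk>X \<in> Ob B; Y \<in> Ob B\<rbrakk> \<Longrightarrow> FP Q X Y = (FP K X Y \<oplus> Lu B' (Unt B')) \<cdot> F.D.ic (FO K X) (Unt B') (FO K Y) (Unt B')"
  by (simp_all add: F.D.box_fun_FP[OF U_data F.H_data] F.D.box_fun_FP[OF G.H_data U_data])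
    (simp_all add: const_U_def const_fun_def)

lemma PQ_FU:
  "FU P = (Idn B' (Unt B') \<oplus> FU H) \<cdot> iinv B' (Lu B' (Unt B'))"
  "FU Q = (FU K \<oplus> Idn B' (Unt B')) \<cdot> iinv B' (Lu B' (Unt B'))"
  by (simp_all add: F.D.box_fun_FU[OF U_data F.H_data] F.D.box_fun_FU[OF G.H_data U_data] F.D.ic0_eq)
    (simp_all add: const_U_def const_fun_def)

end

locale canonical_trans_data = canonical_hom B T B' T' H K
  for B :: "('o, 'm) moncat" and T and B' :: "('p, 'n) moncat" (structure) and T' and H and K +
  fixes s
  assumes s_hom: "X \<in> Ob B \<Longrightarrow> s X \<in> hom B' (FO H X) (FO K X)"
begin

text \<open>The natural maps of \<open>t\<close> are wrapped twice: this inner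
  \<open>coh_nat\<close> accounts for the units boxed into \<open>P\<close> and \<open>Q\<close>,
  the outer one for the distinguished object.\<close>

abbreviation "cs X \<equiv> coh_nat B' (FO H X) (FO K X) (s X)"
abbreviation "t \<equiv> canonical_trans T T' F.F G.F s"

lemma s_sel [simp]: "X \<in> Ob B \<Longrightarrow> s X \<in> Ar B'" "X \<in> Ob B \<Longrightarrow> Dom B' (s X) = FO H X"
  "X \<in> Ob B \<Longrightarrow> Cod B' (s X) = FO K X"
  using s_hom by (auto simp: F.D.hom_iff)

lemma cs_sel [simp]: "X \<in> Ob B \<Longrightarrow> cs X \<in> Ar B'" "X \<in> Ob B \<Longrightarrow> Dom B' (cs X) = Unt B' \<otimes> FO H X"
  "X \<in> Ob B \<Longrightarrow> Cod B' (cs X) = FO K X \<otimes> Unt B'"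
  using s_hom by auto

text \<open>Boxing with a unit puts the interchange with alternating units into the constraints of
  \<open>P\<close> and \<open>Q\<close>. After composing with the invertible \<open>Ru\<close>, the
  laws \<open>ic_XUYU\<close> and \<open>ic_UXUY\<close> absorb it, and both sides become sides of
  the equation for \<open>s\<close>, precomposed with the invertible \<open>?L\<close>.\<close>

lemma PQ_tensor_iff:
  assumes [simp]: "X \<in> Ob B" "Y \<in> Ob B"
  shows "FP Q X Y \<cdot> (cs X \<oplus> cs Y) = cs (X \<otimes>\<^bsub>B\<^esub> Y) \<cdot> FP P X Y
    \<longleftrightarrow> FP K X Y \<cdot> (s X \<oplus> s Y) = s (X \<otimes>\<^bsub>B\<^esub> Y) \<cdot> FP H X Y" (is "?l = ?r \<longleftrightarrow> ?l' = ?r'")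
proof -
  let ?U = "Unt B'" and ?XY = "X \<otimes>\<^bsub>B\<^esub> Y"
  let ?L = "Lu B' (FO H X) \<oplus> Lu B' (FO H Y)"
  have "Ru B' (FO K ?XY) \<cdot> (FP K X Y \<oplus> Lu B' ?U)
     = Ru B' (FO K ?XY) \<cdot> ((FP K X Y \<oplus> Idn B' ?U) \<cdot> (Idn B' (FO K X \<otimes> FO K Y) \<oplus> Lu B' ?U))"
    by (simp add: F.D.xchg)
  also have "\<dots> = FP K X Y \<cdot> (Ru B' (FO K X \<otimes> FO K Y) \<cdot> (Idn B' (FO K X \<otimes> FO K Y) \<oplus> Lu B' ?U))"
    by (simp add: F.D.precomp[OF F.D.ru_nat])
  finally have a: "Ru B' (FO K ?XY) \<cdot> (FP K X Y \<oplus> Lu B' ?U)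
     = FP K X Y \<cdot> (Ru B' (FO K X \<otimes> FO K Y) \<cdot> (Idn B' (FO K X \<otimes> FO K Y) \<oplus> Lu B' ?U))" .
  let ?ic = "F.D.ic (FO K X) ?U (FO K Y) ?U" and ?ic' = "F.D.ic ?U (FO H X) ?U (FO H Y)"
  have "Ru B' (FO K ?XY) \<cdot> ((FP K X Y \<oplus> Lu B' ?U) \<cdot> (?ic \<cdot> (cs X \<oplus> cs Y)))
     = (Ru B' (FO K ?XY) \<cdot> (FP K X Y \<oplus> Lu B' ?U)) \<cdot> (?ic \<cdot> (cs X \<oplus> cs Y))"
    by simp
  also have "\<dots> = FP K X Y \<cdot> ((Ru B' (FO K X \<otimes> FO K Y) \<cdot>
      ((Idn B' (FO K X \<otimes> FO K Y) \<oplus> Lu B' ?U) \<cdot> ?ic)) \<cdot> (cs X \<oplus> cs Y))"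
    unfolding a by simp
  also have "\<dots> = FP K X Y \<cdot> ((Ru B' (FO K X) \<oplus> Ru B' (FO K Y)) \<cdot> (cs X \<oplus> cs Y))"
    by (subst F.D.ic_XUYU) simp_all
  also have "\<dots> = FP K X Y \<cdot> ((s X \<oplus> s Y) \<cdot> ?L)"
    by (simp add: F.D.xchg F.D.ru_coh_nat s_hom)
  finally have l: "Ru B' (FO K ?XY) \<cdot> ?l = ?l' \<cdot> ?L"
    by (simp add: PQ_FP)
  have b: "Lu B' (FO H ?XY) \<cdot> (Lu B' ?U \<oplus> FP H X Y)
     = FP H X Y \<cdot> (Lu B' (FO H X \<otimes> FO H Y) \<cdot> (Lu B' ?U \<oplus> Idn B' (FO H X \<otimes> FO H Y)))"
  proof -
    have "Lu B' ?U \<oplus> FP H X Y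
       = (Idn B' ?U \<oplus> FP H X Y) \<cdot> (Lu B' ?U \<oplus> Idn B' (FO H X \<otimes> FO H Y))"
      by (simp add: F.D.xchg)
    then show ?thesis
      by (simp add: F.D.precomp[OF F.D.lu_nat])
  qed
  have "Ru B' (FO K ?XY) \<cdot> (cs ?XY \<cdot> ((Lu B' ?U \<oplus> FP H X Y) \<cdot> ?ic'))
      = (Ru B' (FO K ?XY) \<cdot> cs ?XY) \<cdot> ((Lu B' ?U \<oplus> FP H X Y) \<cdot> ?ic')"
    by simp
  also have "\<dots> = s ?XY \<cdot> ((Lu B' (FO H ?XY) \<cdot> (Lu B' ?U \<oplus> FP H X Y)) \<cdot> ?ic')"
    by (simp add: F.D.ru_coh_nat s_hom)
  also have "\<dots> = s ?XY \<cdot> (FP H X Y \<cdot> (Lu B' (FO H X \<otimes> FO H Y) \<cdot>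
      ((Lu B' ?U \<oplus> Idn B' (FO H X \<otimes> FO H Y)) \<cdot> ?ic')))"
    unfolding b by simp
  also have "\<dots> = s ?XY \<cdot> (FP H X Y \<cdot> ?L)"
    by (simp add: F.D.ic_UXUY)
  finally have r: "Ru B' (FO K ?XY) \<cdot> ?r = ?r' \<cdot> ?L"
    by (simp add: PQ_FP)
  have h: "?l \<in> Ar B'" "Cod B' ?l = FO K ?XY \<otimes> ?U" "?r \<in> Ar B'" "Cod B' ?r = FO K ?XY \<otimes> ?U"
    by (simp_all add: PQ_FP)
  show ?thesis
  proof
    assume "?l = ?r"
    then have "?l' \<cdot> ?L = ?r' \<cdot> ?L" using l r by simp
    then show "?l' = ?r'" by (rule F.D.cancel_right) simp_all
  next
    assume "?l' = ?r'"
    then have "Ru B' (FO K ?XY) \<cdot> ?l = Ru B' (FO K ?XY) \<cdot> ?r" using l r by simp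
    then show "?l = ?r" by (rule F.D.cancel_left) (use h in simp_all)
  qed
qed

lemma PQ_unit_iff: "cs (Unt B) \<cdot> FU P = FU Q \<longleftrightarrow> s (Unt B) \<cdot> FU H = FU K" (is "?l = ?r \<longleftrightarrow> ?l' = ?r'")
proof -
  let ?R = "Ru B' (FO K (Unt B))"
  have "?R \<cdot> ?l = (?R \<cdot> cs (Unt B)) \<cdot> FU P"
    by (simp add: PQ_FU)
  also have "\<dots> = s (Unt B) \<cdot> (Lu B' (FO H (Unt B)) \<cdot> FU P)"
    by (simp add: F.D.ru_coh_nat s_hom PQ_FU)
  also have "\<dots> = ?l'"
    by (simp add: PQ_FU F.D.precomp[OF F.D.lu_nat])
  finally have l: "?R \<cdot> ?l = ?l'" .
  have r: "?R \<cdot> ?r = ?r'"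
    by (simp add: PQ_FU F.D.precomp[OF F.D.ru_nat]) (simp add: F.D.lu_unit)
  show ?thesis
  proof
    assume "?l' = ?r'"
    then have "?R \<cdot> ?l = ?R \<cdot> ?r" using l r by simp
    then show "?l = ?r" by (rule F.D.cancel_left) (simp_all add: PQ_FU)
  qed (use l r in simp)
qed

lemma PQ_trans_iff: "mon_trans B B' P Q cs \<longleftrightarrow> mon_trans B B' H K s"
proof -
  have n: "FA Q f \<cdot> cs X = cs Y \<cdot> FA P f \<longleftrightarrow> FA K f \<cdot> s X = s Y \<cdot> FA H f"
    if f: "f \<in> hom B X Y" for f X Y
  proof -
    have "X \<in> Ob B" "Y \<in> Ob B" using f F.S.dom_ob F.S.cod_ob by (auto simp: F.S.hom_iff)
    then show ?thesis
      unfolding PQ_ar[OF f] using F.H.ar[OF f] G.H.ar[OF f] s_hom by (intro F.D.coh_nat_nat_iff) auto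
  qed
  show ?thesis
    unfolding mon_trans_def using n PQ_tensor_iff PQ_unit_iff s_hom
    by (simp add: PQ_ob F.D.hom_iff)
qed

lemma t_sel [simp]:
  "lt_ob t = Unt B'" "X \<in> Ob B \<Longrightarrow> lt_nat t X = coh_nat B' (Unt B' \<otimes> FO H X) (FO K X \<otimes> Unt B') (cs X)"
  by (simp_all add: canonical_trans_def Let_def)

lemma t_constraint_sel:
  "lt_Pi t = coh B' [Lu B' (Unt B'), Idn B' (Unt B'), Lu B' (Unt B'), Idn B' (Unt B'), Lu B' (Unt B')]
     [Idn B' (Unt B'), Lu B' (Unt B'), Idn B' (Unt B')]"
  "lt_M t = coh B' [Lu B' (Unt B'), Idn B' (Unt B')] [Idn B' (Unt B'), Lu B' (Unt B'), Idn B' (Unt B')]"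
  by (simp_all add: canonical_trans_def Let_def)

lemma t_nat_eq: "lt_nat t = restrict (\<lambda>X. coh_nat B' (FO P X) (FO Q X) (cs X)) (Ob B)"
  by (simp add: canonical_trans_def Let_def) (auto simp: PQ_ob intro!: restrict_ext)

lemma t_lax_trans_iff: "lax_trans B B' P Q (Unt B') (lt_nat t) \<longleftrightarrow> mon_trans B B' H K s"
  unfolding t_nat_eq PQ_trans_iff[symmetric]
  by (rule F.D.lax_trans_iff[OF F.S.source_data P_data Q_data]) (simp add: PQ_ob F.D.hom_iff)

lemma coherent_t_constraints:
  fixes i defines "i \<equiv> Idn B' (Unt B')"
  shows "F.D.coherent [F.D.merge i i, i, F.D.merge i i, i, F.D.merge i i] (Pi_cell T' F.F G.F t) [i, F.D.merge i i, i]"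
    "F.D.coherent [F.D.merge i i, i] (M_cell T' F.F G.F t) [i, F.D.merge i i, i]"
    "F.D.coherent [i] (dd_trans_data.i_cell T') [i]"
proof -
  have t: "F.D.triv (Unt B' \<otimes> Unt B') (Lu B' (Unt B'))" "F.D.triv (Unt B') i"
    by (simp_all add: F.D.triv_def i_def)
  show "F.D.coherent [F.D.merge i i, i, F.D.merge i i, i, F.D.merge i i] (Pi_cell T' F.F G.F t) [i, F.D.merge i i, i]"
    "F.D.coherent [F.D.merge i i, i] (M_cell T' F.F G.F t) [i, F.D.merge i i, i]"
    using t unfolding i_def
    by (simp_all add: Pi_cell_def M_cell_def t_constraint_sel F.D.coherent_coh_cell Let_def)
  show "F.D.coherent [i] (dd_trans_data.i_cell T') [i]"
    using F.D.coherent_constraints(6) unfolding i_def dd_trans_data.i_cell_def by simp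
qed

lemma triv_lt_ob: "F.D.triv (lt_ob t) (Idn B' (Unt B'))"
  by (simp add: F.D.triv_unit)

lemma natcell_alpha: "X \<in> Ob B \<Longrightarrow> F.D.natcell (Unt B' \<otimes> FO H X) (cs X) (FO K X \<otimes> Unt B') (alpha_cell T' F.F G.F t X)"
  by (simp add: F.D.natcell_def alpha_cell_def F.D.hom_iff)

context
  assumes m: "mon_trans B B' H K s"
begin

lemma s_nat: "\<lbrakk>f \<in> Ar B; Cod B f = Y\<rbrakk> \<Longrightarrow> FA K f \<cdot> s (Dom B f) = s Y \<cdot> FA H f"
  using m unfolding mon_trans_def by (auto simp: F.S.hom_iff)

lemma s_tensor: "\<lbrakk>X \<in> Ob B; Y \<in> Ob B\<rbrakk>
    \<Longrightarrow> FP K X Y \<cdot> (s X \<oplus> s Y) = s (X \<otimes>\<^bsub>B\<^esub> Y) \<cdot> FP H X Y"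
  using m unfolding mon_trans_def by auto

lemma s_unit: "s (Unt B) \<cdot> FU H = FU K"
  using m unfolding mon_trans_def by auto

text \<open>Naturality at \<open>x\<close> moves \<open>s\<close> to the unit, where its unit
  condition applies.\<close>

lemma tr_s:
  assumes "F.S.triv X x"
  shows "G.tr x \<cdot> s X = F.tr x"
proof -
  have [simp]: "x \<in> Ar B" "Dom B x = X" "Cod B x = Unt B" "X \<in> Ob B"
    using assms F.S.triv_ob by (auto simp: F.S.triv_def F.S.invertible_ar)
  have u: "iinv B' (FU K) \<cdot> s (Unt B) = iinv B' (FU H)"
    by (rule F.D.cancel_right[where g = "FU H"]) (simp_all add: s_unit)
  have "G.tr x \<cdot> s X = iinv B' (FU K) \<cdot> (FA K x \<cdot> s (Dom B x))"
    by (simp add: G.tr_def)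
  also have "\<dots> = (iinv B' (FU K) \<cdot> s (Unt B)) \<cdot> FA H x"
    unfolding s_nat[OF \<open>x \<in> Ar B\<close> \<open>Cod B x = Unt B\<close>] by simp
  finally show ?thesis unfolding u F.tr_def .
qed

text \<open>The transformation axioms also take the natural maps at structural objects. There they
  are constraints, because \<open>s\<close> respects trivialisations by \<open>tr_s\<close>; this is
  where monoidality of \<open>s\<close> enters those axioms.\<close>

lemma coherent_alpha:
  assumes "F.S.triv X x"
  shows "F.D.coherent [Idn B' (Unt B'), F.D.merge (Idn B' (Unt B')) (F.tr x)] (alpha_cell T' F.F G.F t X)
    [F.D.merge (G.tr x) (Idn B' (Unt B')), Idn B' (Unt B')]"
proof (rule F.D.natcell_coherent[OF natcell_alpha])
  show X: "X \<in> Ob B" using assms F.S.triv_ob by auto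
  note h = F.triv_tr[OF assms] G.triv_tr[OF assms]
  show "F.D.triv (Unt B' \<otimes> FO H X) (F.D.merge (Idn B' (Unt B')) (F.tr x))"
    "F.D.triv (FO K X \<otimes> Unt B') (F.D.merge (G.tr x) (Idn B' (Unt B')))"
    using h F.D.merge_props F.D.triv_unit by auto
  have [simp]: "G.tr x \<in> Ar B'" "Dom B' (G.tr x) = FO K X" "Cod B' (G.tr x) = Unt B'"
    using h(2) by (auto simp: F.D.triv_def F.D.invertible_ar)
  have "F.D.merge (G.tr x) (Idn B' (Unt B')) \<cdot> cs X = G.tr x \<cdot> (Ru B' (FO K X) \<cdot> cs X)"
    unfolding F.D.merge_right_unit[OF h(2)] using X by simp
  also have "\<dots> = (G.tr x \<cdot> s X) \<cdot> Lu B' (FO H X)"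
    using X by (simp add: F.D.ru_coh_nat s_hom)
  finally show "F.D.merge (G.tr x) (Idn B' (Unt B')) \<cdot> cs X = F.D.merge (Idn B' (Unt B')) (F.tr x)"
    unfolding tr_s[OF assms] F.D.merge_left_unit[OF h(1)] .
qed

lemmas t_coherent_rules = F.coherent_rules G.coherent_F_constraints G.coherent_chi
  G.coherent_fun_cell G.triv_F_units G.triv_tr coherent_t_constraints triv_lt_ob coherent_alpha[THEN F.D.coherent_conv]

text \<open>No genuine object occurs in this modification condition, so it is settled like an axiom
  between constraints.\<close>

lemma M_mod: "dd_trans_data.M_mod T T' F.F G.F t"
  unfolding dd_trans_data.M_mod_def F.S.tri_cat F.D.tri_cat F.F_sel(1) G.F_sel(1)
  by (rule F.D.coherent_unique, (rule t_coherent_rules refl | (simp; fail))+)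

lemma trans_lunit: "dd_trans_data.trans_lunit_axiom T T' F.F G.F t"
  unfolding dd_trans_data.trans_lunit_axiom_def F.S.tri_cat F.D.tri_cat F.F_sel(1) G.F_sel(1)
  by (rule F.D.coherent_unique, (rule t_coherent_rules refl | (simp; fail))+)

lemma trans_runit: "dd_trans_data.trans_runit_axiom T T' F.F G.F t"
  unfolding dd_trans_data.trans_runit_axiom_def dd_trans_data.mu_mate_def F.S.tri_cat F.D.tri_cat F.F_sel(1) G.F_sel(1)
  by (rule F.D.coherent_unique, (rule t_coherent_rules refl | (simp; fail))+)

lemma trans_assoc: "dd_trans_data.trans_assoc_axiom T T' F.F G.F t"
  unfolding dd_trans_data.trans_assoc_axiom_def dd_trans_data.pi_mate1_def dd_trans_data.pi_mate2_def
    F.S.tri_cat F.D.tri_cat F.F_sel(1) G.F_sel(1)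
  by (rule F.D.coherent_unique, (rule t_coherent_rules refl | (simp; fail))+)

lemmas t_val1_rules = F.val1_rules G.natcell_chi natcell_alpha

text \<open>Composition with the invertible \<open>Ru\<close> strips the unitors from
  \<open>cs\<close>, and the comparison of values becomes the tensor condition on
  \<open>s\<close>.\<close>

lemma Pi_mod:
  assumes [simp]: "X \<in> Ob B" "Y \<in> Ob B"
  shows "dd_trans_data.Pi_mod T T' F.F G.F t X Y"
proof -
  let ?U = "Unt B'" and ?XY = "X \<otimes>\<^bsub>B\<^esub> Y" and ?i = "Idn B'"
  let ?hX = "FO H X" and ?hY = "FO H Y" and ?kX = "FO K X" and ?kY = "FO K Y"
  \<comment> \<open>\<open>?l\<close> and \<open>?r\<close> are the values, up to identities, that
    the rules assign to the two pastings.\<close>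
  let ?l = "cs ?XY \<cdot> ((?i ?U \<oplus> FP H X Y) \<cdot> As B' ?U ?hX ?hY)"
  let ?r = "(FP K X Y \<oplus> ?i ?U) \<cdot> (iinv B' (As B' ?kX ?kY ?U) \<cdot>
     ((?i ?kX \<oplus> cs Y) \<cdot> (As B' ?kX ?U ?hY \<cdot> (cs X \<oplus> ?i ?hY))))"
  let ?R = "Ru B' (FO K ?XY)"
  have "?R \<cdot> ?l = (?R \<cdot> cs ?XY) \<cdot> ((?i ?U \<oplus> FP H X Y) \<cdot> As B' ?U ?hX ?hY)"
    by simp
  also have "\<dots> = s ?XY \<cdot> (FP H X Y \<cdot> (Lu B' (?hX \<otimes> ?hY) \<cdot> As B' ?U ?hX ?hY))"
    by (simp add: F.D.ru_coh_nat s_hom F.D.precomp[OF F.D.lu_nat])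
  also have "\<dots> = (s ?XY \<cdot> FP H X Y) \<cdot> (Lu B' ?hX \<oplus> ?i ?hY)"
    by (simp add: F.D.lu_tens)
  finally have l: "?R \<cdot> ?l = (s ?XY \<cdot> FP H X Y) \<cdot> (Lu B' ?hX \<oplus> ?i ?hY)" .
  \<comment> \<open>\<open>ru_tens\<close> with its associator moved across; it removes the inverse
    associator contributed by the dual of \<open>a\<close>.\<close>
  have e: "Ru B' (?kX \<otimes> ?kY) \<cdot> iinv B' (As B' ?kX ?kY ?U) = ?i ?kX \<oplus> Ru B' ?kY"
    by (simp add: F.D.ru_tens[symmetric])
  have "?R \<cdot> ?r = FP K X Y \<cdot> ((Ru B' (?kX \<otimes> ?kY) \<cdot> iinv B' (As B' ?kX ?kY ?U)) \<cdot>
     ((?i ?kX \<oplus> cs Y) \<cdot> (As B' ?kX ?U ?hY \<cdot> (cs X \<oplus> ?i ?hY))))"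
    by (simp add: F.D.precomp[OF F.D.ru_nat])
  also have "\<dots> = FP K X Y \<cdot> ((?i ?kX \<oplus> s Y) \<cdot> (((?i ?kX \<oplus> Lu B' ?hY) \<cdot> As B' ?kX ?U ?hY) \<cdot> (cs X \<oplus> ?i ?hY)))"
    unfolding e by (simp add: F.D.xchg_assoc F.D.ru_coh_nat s_hom)
  also have "\<dots> = (FP K X Y \<cdot> (s X \<oplus> s Y)) \<cdot> (Lu B' ?hX \<oplus> ?i ?hY)"
    by (simp add: F.D.triangle' F.D.xchg F.D.ru_coh_nat s_hom)
  finally have "?R \<cdot> ?l = ?R \<cdot> ?r"
    unfolding l s_tensor[OF assms] by simp
  then have lr: "?l = ?r"
    by (rule F.D.cancel_left) simp_all
  show ?thesis
    unfolding dd_trans_data.Pi_mod_def F.S.tri_cat F.D.tri_cat F.F_sel(1) G.F_sel(1)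
    by (rule F.D.val1_eqI, (rule t_val1_rules t_coherent_rules refl | (simp; fail))+)
      (use lr in simp)
qed

end

lemma lax_transformation_iff: "lax_transformation T T' F.F G.F t \<longleftrightarrow> mon_trans B B' H K s"
proof
  assume "lax_transformation T T' F.F G.F t"
  then show "mon_trans B B' H K s"
    using t_lax_trans_iff by (simp add: lax_transformation_def Let_def)
next
  assume m: "mon_trans B B' H K s"
  show "lax_transformation T T' F.F G.F t"
    using t_lax_trans_iff m Pi_mod[OF m] M_mod[OF m] trans_lunit[OF m] trans_runit[OF m] trans_assoc[OF m]
      coherent_t_constraints(1,2)[THEN F.D.coherent_iso_cell]
    by (simp add: lax_transformation_def Let_def)
qed

end

section \<open>Braided functors and their composites\<close>

context canonical_functor_data
begin

lemma HH_FP: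
  "\<lbrakk>X \<in> Ob B; X' \<in> Ob B; Y \<in> Ob B; Y' \<in> Ob B\<rbrakk> \<Longrightarrow> FP HH (X, X') (Y, Y')
     = (FP H X Y \<oplus> FP H X' Y') \<cdot> D.ic (FO H X) (FO H X') (FO H Y) (FO H Y')"
  by (simp add: D.box_fun_FP[OF Hfst Hsnd]) (simp add: comp_fun_def fst_fun_def snd_fun_def)

lemma HH_FU: "FU HH = (FU H \<oplus> FU H) \<cdot> iinv B' (Lu B' (Unt B'))"
  by (simp add: D.box_fun_FU[OF Hfst Hsnd] D.ic0_eq) (simp add: comp_fun_def fst_fun_def snd_fun_def)

lemma HH_ar: "\<lbrakk>f \<in> hom B X Y; f' \<in> hom B X' Y'\<rbrakk> \<Longrightarrow> FA HH (f, f') = FA H f \<oplus> FA H f'"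
  by (subst D.box_fun_ar[OF Hfst Hsnd, of _ "(X, X')" "(Y, Y')"])
    (auto simp: hom_prod_cat comp_fun_def fst_fun_def snd_fun_def hom_def)

lemma Hb_FP: "\<lbrakk>X \<in> Ob B; X' \<in> Ob B; Y \<in> Ob B; Y' \<in> Ob B\<rbrakk> \<Longrightarrow> FP Hb (X, X') (Y, Y')
     = FA H (S.ic X X' Y Y') \<cdot> FP H (X \<otimes>\<^bsub>B\<^esub> X') (Y \<otimes>\<^bsub>B\<^esub> Y')"
  by (simp add: comp_fun_def S.ic_def)

lemma Hb_FU: "FU Hb = FA H (iinv B (Lu B (Unt B))) \<cdot> FU H"
  by (simp add: comp_fun_def S.ic0_eq[symmetric] S.ic0_def)

lemma Hb_ar: "\<lbrakk>f \<in> Ar B; f' \<in> Ar B\<rbrakk> \<Longrightarrow> FA Hb (f, f') = FA H (f \<oplus>\<^bsub>B\<^esub> f')"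
  by (simp add: comp_fun_def)

text \<open>Naturality and the unit clause follow from the monoidal functor laws; the tensor clause,
  written out, is the condition that remains.\<close>

lemma braided_iff: "braided T T' H \<longleftrightarrow>
   (\<forall>X \<in> Ob B. \<forall>X' \<in> Ob B. \<forall>Y \<in> Ob B. \<forall>Y' \<in> Ob B.
      FA H (S.ic X X' Y Y') \<cdot> (FP H (X \<otimes>\<^bsub>B\<^esub> X') (Y \<otimes>\<^bsub>B\<^esub> Y') \<cdot> (FP H X X' \<oplus> FP H Y Y'))
    = FP H (X \<otimes>\<^bsub>B\<^esub> Y) (X' \<otimes>\<^bsub>B\<^esub> Y') \<cdot> ((FP H X Y \<oplus> FP H X' Y') \<cdot>
        D.ic (FO H X) (FO H X') (FO H Y) (FO H Y')))"
proof -
  have n: "FA Hb f \<cdot> (case X of (X, Y) \<Rightarrow> FP H X Y) = (case Y of (X, Y) \<Rightarrow> FP H X Y) \<cdot> FA HH f"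
    if "f \<in> hom B2 X Y" for f X Y
  proof -
    obtain g g' X1 X2 Y1 Y2 where [simp]: "f = (g, g')" "X = (X1, X2)" "Y = (Y1, Y2)" by (cases f; cases X; cases Y)
    have g: "g \<in> hom B X1 Y1" "g' \<in> hom B X2 Y2" using that by (auto simp: hom_prod_cat)
    then show ?thesis
      using FP_nat[of g g' Y1 Y2] by (simp add: HH_ar[OF g] Hb_ar S.hom_iff)
  qed
  \<comment> \<open>The unit clause is compared after composing with the image of
    \<open>Lu U\<close>, so that the left unit law of \<open>H\<close> applies.\<close>
  have "FA H (Lu B (Unt B)) \<cdot> (FP H (Unt B) (Unt B) \<cdot> FU HH)
      = FA H (Lu B (Unt B)) \<cdot> FU Hb"
    by (simp add: D.precomp[OF FP_lunit] HH_FU Hb_FU FA_iinv D.xchg_assoc D.precomp[OF D.lu_nat])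
  then have u: "FP H (Unt B) (Unt B) \<cdot> FU HH = FU Hb"
    by (rule D.cancel_left) (simp_all add: HH_FU Hb_FU)
  have "mon_trans B2 B' HH Hb (\<lambda>(X, Y). FP H X Y) \<longleftrightarrow>
     (\<forall>X \<in> Ob B2. \<forall>Y \<in> Ob B2. FP Hb X Y \<cdot> ((case X of (X, Y) \<Rightarrow> FP H X Y) \<oplus> (case Y of (X, Y) \<Rightarrow> FP H X Y))
        = (case X \<otimes>\<^bsub>B2\<^esub> Y of (X, Y) \<Rightarrow> FP H X Y) \<cdot> FP HH X Y)"
    unfolding mon_trans_def using n u by (auto simp: HH_ob Hb_ob D.hom_iff)
  also have "\<dots> \<longleftrightarrow> (\<forall>X \<in> Ob B. \<forall>X' \<in> Ob B. \<forall>Y \<in> Ob B. \<forall>Y' \<in> Ob B.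
      FA H (S.ic X X' Y Y') \<cdot> (FP H (X \<otimes>\<^bsub>B\<^esub> X') (Y \<otimes>\<^bsub>B\<^esub> Y') \<cdot> (FP H X X' \<oplus> FP H Y Y'))
    = FP H (X \<otimes>\<^bsub>B\<^esub> Y) (X' \<otimes>\<^bsub>B\<^esub> Y') \<cdot> ((FP H X Y \<oplus> FP H X' Y') \<cdot>
        D.ic (FO H X) (FO H X') (FO H Y) (FO H Y')))"
    by (simp add: HH_FP Hb_FP)
  finally show ?thesis
    using H.monoidal_functor_axioms by (simp add: braided_def Let_def)
qed

end

locale canonical_comp = F: canonical_functor_data B T B' T' H + G: canonical_functor_data B' T' B'' T'' K
  for B :: "('o, 'm) moncat" and T and B' :: "('p, 'n) moncat" and T' and H
    and B'' :: "('q, 'k) moncat" (structure) and T'' and K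
begin

abbreviation "KH \<equiv> comp_fun B B'' K H"

lemma KH_sel [simp]:
  "X \<in> Ob B \<Longrightarrow> FO KH X = FO K (FO H X)"
  "f \<in> Ar B \<Longrightarrow> FA KH f = FA K (FA H f)"
  "\<lbrakk>X \<in> Ob B; Y \<in> Ob B\<rbrakk> \<Longrightarrow> FP KH X Y = FA K (FP H X Y) \<cdot> FP K (FO H X) (FO H Y)"
  "FU KH = FA K (FU H) \<cdot> FU K"
  by (simp_all add: comp_fun_def)

text \<open>Naturality of \<open>FP K\<close> in the shape in which composite constraints occur:
  images under \<open>K\<close> move out of the tensor and leave the constraints of \<open>K\<close>
  behind.\<close>

lemma KH_tensor:
  assumes [simp]: "f \<in> Ar B'" "g \<in> Ar B'"
    "p \<in> Ar B''" "q \<in> Ar B''" "Cod B'' p = FO K (Dom B' f)" "Cod B'' q = FO K (Dom B' g)"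
    "Cod B' f = X" "Cod B' g = Y"
  shows "FP K X Y \<cdot> ((FA K f \<cdot> p) \<oplus> (FA K g \<cdot> q))
    = FA K (f \<oplus>\<^bsub>B'\<^esub> g) \<cdot> (FP K (Dom B' f) (Dom B' g) \<cdot> (p \<oplus> q))"
proof -
  have [simp]: "X \<in> Ob B'" "Y \<in> Ob B'" using assms(7,8) F.D.cod_ob assms(1,2) by metis+
  have "(FA K f \<cdot> p) \<oplus> (FA K g \<cdot> q) = (FA K f \<oplus> FA K g) \<cdot> (p \<oplus> q)"
    by (simp add: G.D.xchg)
  then show ?thesis
    by (simp add: G.D.precomp[OF G.FP_nat])
qed

text \<open>Each law for the composite is the law for \<open>H\<close> under \<open>FA K\<close>
  followed by the law for \<open>K\<close>; \<open>KH_tensor\<close> separates the two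
  layers.\<close>

lemma KH_monoidal: "monoidal_functor B B'' KH"
proof
  show "FO KH \<in> extensional (Ob B)" "FA KH \<in> extensional (Ar B)" "extensional2 (Ob B) (FP KH)"
    by (auto simp: comp_fun_def extensional2_def)
  show "FO KH X \<in> Ob B''" if "X \<in> Ob B" for X using that by simp
  show "FA KH f \<in> hom B'' (FO KH X) (FO KH Y)" if "f \<in> hom B X Y" for f X Y
    using that F.S.dom_ob[of f] F.S.cod_ob[of f] by (auto simp: F.S.hom_iff G.D.hom_iff)
  show "FA KH (Idn B X) = Idn B'' (FO KH X)" if "X \<in> Ob B" for X using that by simp
  show "FA KH (g \<cdot>\<^bsub>B\<^esub> f) = FA KH g \<cdot> FA KH f" if "f \<in> hom B X Y" "g \<in> hom B Y Z" for f g X Y Z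
    using that by (simp add: F.S.hom_iff F.FA_cmp G.FA_cmp)
  show "FP KH X Y \<in> iso B'' (FO KH X \<otimes> FO KH Y) (FO KH (X \<otimes>\<^bsub>B\<^esub> Y))" if "X \<in> Ob B" "Y \<in> Ob B" for X Y
    using that by (simp add: G.D.iso_iff)
  show "FU KH \<in> iso B'' (Unt B'') (FO KH (Unt B))"
    by (simp add: G.D.iso_iff)
  show "FA KH (f \<oplus>\<^bsub>B\<^esub> g) \<cdot> FP KH X Y = FP KH X' Y' \<cdot> (FA KH f \<oplus> FA KH g)"
    if "f \<in> hom B X X'" "g \<in> hom B Y Y'" for f g X Y X' Y'
  proof -
    have h: "f \<in> Ar B" "Dom B f = X" "Cod B f = X'" "g \<in> Ar B" "Dom B g = Y" "Cod B g = Y'"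
      "X \<in> Ob B" "Y \<in> Ob B" "X' \<in> Ob B" "Y' \<in> Ob B"
      using that F.S.dom_ob[of f] F.S.cod_ob[of f] F.S.dom_ob[of g] F.S.cod_ob[of g] by (auto simp: F.S.hom_iff)
    have "FP KH X' Y' \<cdot> (FA KH f \<oplus> FA KH g)
        = FA K (FP H X' Y' \<cdot>\<^bsub>B'\<^esub> (FA H f \<oplus>\<^bsub>B'\<^esub> FA H g)) \<cdot> FP K (FO H X) (FO H Y)"
      using h by (simp add: G.FP_nat G.FA_cmp)
    also have "\<dots> = FA K (FA H (f \<oplus>\<^bsub>B\<^esub> g) \<cdot>\<^bsub>B'\<^esub> FP H X Y) \<cdot> FP K (FO H X) (FO H Y)"
      using h by (simp add: F.FP_nat)
    finally show ?thesis using h by (simp add: G.FA_cmp)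
  qed
  show "FA KH (As B X Y Z) \<cdot> (FP KH (X \<otimes>\<^bsub>B\<^esub> Y) Z \<cdot> (FP KH X Y \<oplus> Idn B'' (FO KH Z)))
     = FP KH X (Y \<otimes>\<^bsub>B\<^esub> Z) \<cdot> ((Idn B'' (FO KH X) \<oplus> FP KH Y Z) \<cdot> As B'' (FO KH X) (FO KH Y) (FO KH Z))"
    if [simp]: "X \<in> Ob B" "Y \<in> Ob B" "Z \<in> Ob B" for X Y Z
  proof -
    let ?X = "FO H X" and ?Y = "FO H Y" and ?Z = "FO H Z"
    have "FP K (FO H (X \<otimes>\<^bsub>B\<^esub> Y)) ?Z \<cdot> ((FA K (FP H X Y) \<cdot> FP K ?X ?Y) \<oplus> Idn B'' (FO K ?Z))
      = FA K (FP H X Y \<oplus>\<^bsub>B'\<^esub> Idn B' ?Z) \<cdot> (FP K (?X \<otimes>\<^bsub>B'\<^esub> ?Y) ?Z \<cdot> (FP K ?X ?Y \<oplus> Idn B'' (FO K ?Z)))"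
      using KH_tensor[of "FP H X Y" "Idn B' ?Z" "FP K ?X ?Y" "Idn B'' (FO K ?Z)", OF _ _ _ _ _ _ refl refl] by simp
    then have "FA KH (As B X Y Z) \<cdot> (FP KH (X \<otimes>\<^bsub>B\<^esub> Y) Z \<cdot> (FP KH X Y \<oplus> Idn B'' (FO KH Z)))
      = FA K (FA H (As B X Y Z) \<cdot>\<^bsub>B'\<^esub> (FP H (X \<otimes>\<^bsub>B\<^esub> Y) Z \<cdot>\<^bsub>B'\<^esub> (FP H X Y \<oplus>\<^bsub>B'\<^esub> Idn B' ?Z))) \<cdot>
         (FP K (?X \<otimes>\<^bsub>B'\<^esub> ?Y) ?Z \<cdot> (FP K ?X ?Y \<oplus> Idn B'' (FO K ?Z)))"
      by (simp add: G.FA_cmp)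
    also have "\<dots> = FA K (FP H X (Y \<otimes>\<^bsub>B\<^esub> Z)) \<cdot> (FA K (Idn B' ?X \<oplus>\<^bsub>B'\<^esub> FP H Y Z) \<cdot> (FA K (As B' ?X ?Y ?Z) \<cdot>
         (FP K (?X \<otimes>\<^bsub>B'\<^esub> ?Y) ?Z \<cdot> (FP K ?X ?Y \<oplus> Idn B'' (FO K ?Z)))))"
      unfolding F.H.phi_assoc[OF that] by (simp add: G.FA_cmp)
    also have "\<dots> = FA K (FP H X (Y \<otimes>\<^bsub>B\<^esub> Z)) \<cdot> ((FA K (Idn B' ?X \<oplus>\<^bsub>B'\<^esub> FP H Y Z) \<cdot> (FP K ?X (?Y \<otimes>\<^bsub>B'\<^esub> ?Z) \<cdot>
         (Idn B'' (FO K ?X) \<oplus> FP K ?Y ?Z))) \<cdot> As B'' (FO K ?X) (FO K ?Y) (FO K ?Z))"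
      by (subst G.H.phi_assoc) simp_all
    also have "FA K (Idn B' ?X \<oplus>\<^bsub>B'\<^esub> FP H Y Z) \<cdot> (FP K ?X (?Y \<otimes>\<^bsub>B'\<^esub> ?Z) \<cdot> (Idn B'' (FO K ?X) \<oplus> FP K ?Y ?Z))
      = FP K ?X (FO H (Y \<otimes>\<^bsub>B\<^esub> Z)) \<cdot> (Idn B'' (FO K ?X) \<oplus> (FA K (FP H Y Z) \<cdot> FP K ?Y ?Z))"
      using KH_tensor[of "Idn B' ?X" "FP H Y Z" "Idn B'' (FO K ?X)" "FP K ?Y ?Z", OF _ _ _ _ _ _ refl refl] by simp
    finally show ?thesis by simp
  qed
  show "FA KH (Lu B X) \<cdot> (FP KH (Unt B) X \<cdot> (FU KH \<oplus> Idn B'' (FO KH X))) = Lu B'' (FO KH X)"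
    if [simp]: "X \<in> Ob B" for X
  proof -
    let ?X = "FO H X" and ?i = "Idn B'' (FO K (FO H X))"
    have "FP K (FO H (Unt B)) ?X \<cdot> ((FA K (FU H) \<cdot> FU K) \<oplus> ?i)
       = FA K (FU H \<oplus>\<^bsub>B'\<^esub> Idn B' ?X) \<cdot> (FP K (Unt B') ?X \<cdot> (FU K \<oplus> ?i))"
      using KH_tensor[of "FU H" "Idn B' ?X" "FU K" ?i, OF _ _ _ _ _ _ refl refl] by simp
    then have "FA KH (Lu B X) \<cdot> (FP KH (Unt B) X \<cdot> (FU KH \<oplus> Idn B'' (FO KH X)))
      = FA K (FA H (Lu B X) \<cdot>\<^bsub>B'\<^esub> (FP H (Unt B) X \<cdot>\<^bsub>B'\<^esub> (FU H \<oplus>\<^bsub>B'\<^esub> Idn B' ?X))) \<cdot>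
          (FP K (Unt B') ?X \<cdot> (FU K \<oplus> ?i))"
      by (simp add: G.FA_cmp)
    then show ?thesis
      unfolding F.H.phi_lunit[OF that] by (simp add: G.H.phi_lunit)
  qed
  show "FA KH (Ru B X) \<cdot> (FP KH X (Unt B) \<cdot> (Idn B'' (FO KH X) \<oplus> FU KH)) = Ru B'' (FO KH X)"
    if [simp]: "X \<in> Ob B" for X
  proof -
    let ?X = "FO H X" and ?i = "Idn B'' (FO K (FO H X))"
    have "FP K ?X (FO H (Unt B)) \<cdot> (?i \<oplus> (FA K (FU H) \<cdot> FU K))
       = FA K (Idn B' ?X \<oplus>\<^bsub>B'\<^esub> FU H) \<cdot> (FP K ?X (Unt B') \<cdot> (?i \<oplus> FU K))"
      using KH_tensor[of "Idn B' ?X" "FU H" ?i "FU K", OF _ _ _ _ _ _ refl refl] by simp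
    then have "FA KH (Ru B X) \<cdot> (FP KH X (Unt B) \<cdot> (Idn B'' (FO KH X) \<oplus> FU KH))
      = FA K (FA H (Ru B X) \<cdot>\<^bsub>B'\<^esub> (FP H X (Unt B) \<cdot>\<^bsub>B'\<^esub> (Idn B' ?X \<oplus>\<^bsub>B'\<^esub> FU H))) \<cdot>
          (FP K ?X (Unt B') \<cdot> (?i \<oplus> FU K))"
      by (simp add: G.FA_cmp)
    then show ?thesis
      unfolding F.H.phi_runit[OF that] by (simp add: G.H.phi_runit)
  qed
qed

sublocale KH: canonical_functor_data B T B'' T'' KH
  using KH_monoidal F.S.canonical_axioms G.D.canonical_axioms
  by (intro canonical_functor_data.intro canonical_pair.intro)

text \<open>Under \<open>FA K\<close> the condition for \<open>H\<close> produces the image of the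
  middle interchange, which the condition for \<open>K\<close> converts into the interchange of the
  target.\<close>

lemma KH_braided:
  assumes "braided T T' H" "braided T' T'' K"
  shows "braided T T'' KH"
  unfolding KH.braided_iff
proof (intro ballI)
  fix X X' Y Y' assume o [simp]: "X \<in> Ob B" "X' \<in> Ob B" "Y \<in> Ob B" "Y' \<in> Ob B"
  let ?X = "FO H X" and ?X' = "FO H X'" and ?Y = "FO H Y" and ?Y' = "FO H Y'"
  have f: "FA H (F.S.ic X X' Y Y') \<cdot>\<^bsub>B'\<^esub> (FP H (X \<otimes>\<^bsub>B\<^esub> X') (Y \<otimes>\<^bsub>B\<^esub> Y') \<cdot>\<^bsub>B'\<^esub> (FP H X X' \<oplus>\<^bsub>B'\<^esub> FP H Y Y'))
    = FP H (X \<otimes>\<^bsub>B\<^esub> Y) (X' \<otimes>\<^bsub>B\<^esub> Y') \<cdot>\<^bsub>B'\<^esub> ((FP H X Y \<oplus>\<^bsub>B'\<^esub> FP H X' Y') \<cdot>\<^bsub>B'\<^esub> F.D.ic ?X ?X' ?Y ?Y')"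
    using assms(1) unfolding F.braided_iff by simp
  have g: "FA K (F.D.ic ?X ?X' ?Y ?Y') \<cdot> (FP K (?X \<otimes>\<^bsub>B'\<^esub> ?X') (?Y \<otimes>\<^bsub>B'\<^esub> ?Y') \<cdot> (FP K ?X ?X' \<oplus> FP K ?Y ?Y'))
    = FP K (?X \<otimes>\<^bsub>B'\<^esub> ?Y) (?X' \<otimes>\<^bsub>B'\<^esub> ?Y') \<cdot> ((FP K ?X ?Y \<oplus> FP K ?X' ?Y') \<cdot>
       G.D.ic (FO K ?X) (FO K ?X') (FO K ?Y) (FO K ?Y'))"
    using assms(2) unfolding G.braided_iff by simp
  have 1: "FP K (FO H (X \<otimes>\<^bsub>B\<^esub> X')) (FO H (Y \<otimes>\<^bsub>B\<^esub> Y')) \<cdot> ((FA K (FP H X X') \<cdot> FP K ?X ?X') \<oplus> (FA K (FP H Y Y') \<cdot> FP K ?Y ?Y'))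
     = FA K (FP H X X' \<oplus>\<^bsub>B'\<^esub> FP H Y Y') \<cdot> (FP K (?X \<otimes>\<^bsub>B'\<^esub> ?X') (?Y \<otimes>\<^bsub>B'\<^esub> ?Y') \<cdot> (FP K ?X ?X' \<oplus> FP K ?Y ?Y'))"
    by (subst KH_tensor) simp_all
  have 2: "FP K (FO H (X \<otimes>\<^bsub>B\<^esub> Y)) (FO H (X' \<otimes>\<^bsub>B\<^esub> Y')) \<cdot> ((FA K (FP H X Y) \<cdot> FP K ?X ?Y) \<oplus> (FA K (FP H X' Y') \<cdot> FP K ?X' ?Y'))
     = FA K (FP H X Y \<oplus>\<^bsub>B'\<^esub> FP H X' Y') \<cdot> (FP K (?X \<otimes>\<^bsub>B'\<^esub> ?Y) (?X' \<otimes>\<^bsub>B'\<^esub> ?Y') \<cdot> (FP K ?X ?Y \<oplus> FP K ?X' ?Y'))"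
    by (subst KH_tensor) simp_all
  let ?ic = "G.D.ic (FO K ?X) (FO K ?X') (FO K ?Y) (FO K ?Y')"
  have "FA KH (F.S.ic X X' Y Y') \<cdot> (FP KH (X \<otimes>\<^bsub>B\<^esub> X') (Y \<otimes>\<^bsub>B\<^esub> Y') \<cdot> (FP KH X X' \<oplus> FP KH Y Y'))
    = FA K (FA H (F.S.ic X X' Y Y') \<cdot>\<^bsub>B'\<^esub> (FP H (X \<otimes>\<^bsub>B\<^esub> X') (Y \<otimes>\<^bsub>B\<^esub> Y') \<cdot>\<^bsub>B'\<^esub> (FP H X X' \<oplus>\<^bsub>B'\<^esub> FP H Y Y'))) \<cdot>
       (FP K (?X \<otimes>\<^bsub>B'\<^esub> ?X') (?Y \<otimes>\<^bsub>B'\<^esub> ?Y') \<cdot> (FP K ?X ?X' \<oplus> FP K ?Y ?Y'))"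
    using 1 by (simp add: G.FA_cmp)
  also have "\<dots> = FA K (FP H (X \<otimes>\<^bsub>B\<^esub> Y) (X' \<otimes>\<^bsub>B\<^esub> Y')) \<cdot> (FA K (FP H X Y \<oplus>\<^bsub>B'\<^esub> FP H X' Y') \<cdot> (FA K (F.D.ic ?X ?X' ?Y ?Y') \<cdot>
       (FP K (?X \<otimes>\<^bsub>B'\<^esub> ?X') (?Y \<otimes>\<^bsub>B'\<^esub> ?Y') \<cdot> (FP K ?X ?X' \<oplus> FP K ?Y ?Y'))))"
    unfolding f by (simp add: G.FA_cmp)
  also have "\<dots> = FA K (FP H (X \<otimes>\<^bsub>B\<^esub> Y) (X' \<otimes>\<^bsub>B\<^esub> Y')) \<cdot> ((FA K (FP H X Y \<oplus>\<^bsub>B'\<^esub> FP H X' Y') \<cdot>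
       (FP K (?X \<otimes>\<^bsub>B'\<^esub> ?Y) (?X' \<otimes>\<^bsub>B'\<^esub> ?Y') \<cdot> (FP K ?X ?Y \<oplus> FP K ?X' ?Y'))) \<cdot> ?ic)"
    unfolding g by simp
  also have "\<dots> = FP KH (X \<otimes>\<^bsub>B\<^esub> Y) (X' \<otimes>\<^bsub>B\<^esub> Y') \<cdot> ((FP KH X Y \<oplus> FP KH X' Y') \<cdot> ?ic)"
    unfolding 2[symmetric] by simp
  finally show "FA KH (F.S.ic X X' Y Y') \<cdot> (FP KH (X \<otimes>\<^bsub>B\<^esub> X') (Y \<otimes>\<^bsub>B\<^esub> Y') \<cdot> (FP KH X X' \<oplus> FP KH Y Y'))
    = FP KH (X \<otimes>\<^bsub>B\<^esub> Y) (X' \<otimes>\<^bsub>B\<^esub> Y') \<cdot> ((FP KH X Y \<oplus> FP KH X' Y') \<cdot>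
       G.D.ic (FO KH X) (FO KH X') (FO KH Y) (FO KH Y'))"
    by simp
qed

end

context canonical
begin

lemma id_sel [simp]:
  "X \<in> Ob C \<Longrightarrow> FO (id_fun C) X = X" "f \<in> Ar C \<Longrightarrow> FA (id_fun C) f = f"
  "\<lbrakk>X \<in> Ob C; Y \<in> Ob C\<rbrakk> \<Longrightarrow> FP (id_fun C) X Y = Idn C (X \<otimes> Y)"
  "FU (id_fun C) = Idn C (Unt C)"
  by (simp_all add: id_fun_def)

lemma id_monoidal: "monoidal_functor C C (id_fun C)"
proof
  show "FO (id_fun C) \<in> extensional (Ob C)" "FA (id_fun C) \<in> extensional (Ar C)" "extensional2 (Ob C) (FP (id_fun C))"
    by (auto simp: id_fun_def extensional2_def)
  show "FA (id_fun C) (f \<oplus> g) \<cdot> FP (id_fun C) X Y = FP (id_fun C) X' Y' \<cdot> (FA (id_fun C) f \<oplus> FA (id_fun C) g)"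
    if "f \<in> hom C X X'" "g \<in> hom C Y Y'" for f g X Y X' Y'
    using that dom_ob[of f] cod_ob[of f] dom_ob[of g] cod_ob[of g] by (auto simp: hom_iff)
  show "FA (id_fun C) f \<in> hom C (FO (id_fun C) X) (FO (id_fun C) Y)" if "f \<in> hom C X Y" for f X Y
    using that dom_ob[of f] cod_ob[of f] by (auto simp: hom_iff)
qed (auto simp: hom_iff iso_iff)

end

lemma (in canonical) id_functor_data: "canonical_functor_data C T C T (id_fun C)"
  using id_monoidal canonical_axioms
  by (intro canonical_functor_data.intro canonical_pair.intro)

lemma (in canonical) id_braided: "braided T T (id_fun C)"
  unfolding canonical_functor_data.braided_iff[OF id_functor_data] by simp

section \<open>1-cells and 2-cells in terms of monoidal functors and transformations\<close>

lemma canonicalI: "T \<in> T2_Ob \<Longrightarrow> canonical (tri_cat T) T"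
proof -
  assume T: "T \<in> T2_Ob"
  then have "doubly_degenerate_tricategory T" by (simp add: T2_Ob_def)
  then have "monoidal_category (tri_cat T)"
    unfolding doubly_degenerate_tricategory_def Let_def by (elim conjE)
  then show "canonical (tri_cat T) T"
    using T by (intro canonical.intro canonical_axioms.intro) simp_all
qed

lemma wf_fun_canonical [simp]: "wf_fun (canonical_functor T T' H) = H"
  by (simp add: canonical_functor_def Let_def)

lemma canonical_functor_dataI:
  "\<lbrakk>T \<in> T2_Ob; T' \<in> T2_Ob; monoidal_functor (tri_cat T) (tri_cat T') H\<rbrakk>
    \<Longrightarrow> canonical_functor_data (tri_cat T) T (tri_cat T') T' H"
  by (intro canonical_functor_data.intro canonical_pair.intro canonicalI)

lemma braided_data:
  "\<lbrakk>T \<in> T2_Ob; T' \<in> T2_Ob; braided T T' H\<rbrakk> \<Longrightarrow> canonical_functor_data (tri_cat T) T (tri_cat T') T' H"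
  by (rule canonical_functor_dataI) (simp_all add: braided_def Let_def)

lemma T2_Hom_iff:
  assumes "T \<in> T2_Ob" "T' \<in> T2_Ob"
  shows "F \<in> T2_Hom T T' \<longleftrightarrow> (\<exists>H. braided T T' H \<and> F = canonical_functor T T' H)"
proof
  assume F: "F \<in> T2_Hom T T'"
  note c = F[unfolded T2_Hom_def, THEN CollectD, THEN conjunct2] F[unfolded T2_Hom_def, THEN CollectD, THEN conjunct1]
  from c(2) have "monoidal_functor (tri_cat T) (tri_cat T') (wf_fun F)" by (simp add: weak_functor_def Let_def)
  then interpret canonical_functor_data "tri_cat T" T "tri_cat T'" T' "wf_fun F"
    using assms by (intro canonical_functor_dataI)
  have w: "weak_functor T T' (canonical_functor T T' (wf_fun F))"
    unfolding c(1)[symmetric] by (rule c(2))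
  show "\<exists>H. braided T T' H \<and> F = canonical_functor T T' H"
    using weak_functor_iff_braided w c(1) by blast
next
  assume "\<exists>H. braided T T' H \<and> F = canonical_functor T T' H"
  then obtain H where H: "braided T T' H" "F = canonical_functor T T' H" by blast
  interpret canonical_functor_data "tri_cat T" T "tri_cat T'" T' H
    using assms H(1) by (intro braided_data)
  show "F \<in> T2_Hom T T'"
    using weak_functor_iff_braided H by (simp add: T2_Hom_def)
qed

lemma canonical_trans_cong:
  "(\<And>X. X \<in> Ob (tri_cat T) \<Longrightarrow> s X = s' X) \<Longrightarrow> canonical_trans T T' F G s = canonical_trans T T' F G s'"
  by (simp add: canonical_trans_def Let_def cong: restrict_cong)

lemma (in canonical_trans_data) component_t:
  "X \<in> Ob B \<Longrightarrow> component T' F.F G.F t X = s X"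
  by (simp add: component_def Let_def) (simp add: coh_nat_def)

text \<open>Membership is spelled out because \<open>T2_Hom2\<close> makes both tricategories share
  their types. In the forward direction the family is \<open>component\<close>: the unitors it
  strips are invertible, so the natural maps are recovered, and their extensionality gives equality
  of records.\<close>

lemma (in canonical_hom) canonical_trans_iff:
  fixes t :: "('o, 'p, 'n) dd_trans"
  shows "(lax_transformation T T' F.F G.F t \<and> lt_ob t = Unt (tri_cat T') \<and>
     lt_Pi t = lt_Pi (canonical_trans T T' F.F G.F (component T' F.F G.F t)) \<and>
     lt_M t = lt_M (canonical_trans T T' F.F G.F (component T' F.F G.F t)))
   \<longleftrightarrow> (\<exists>s. mon_trans B B' H K s \<and> t = canonical_trans T T' F.F G.F s)"
proof
  assume "\<exists>s. mon_trans B B' H K s \<and> t = canonical_trans T T' F.F G.F s"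
  then obtain s where s: "mon_trans B B' H K s" "t = canonical_trans T T' F.F G.F s" by blast
  interpret canonical_trans_data B T B' T' H K s
    by unfold_locales (rule mon_transD(1)[OF s(1)])
  show "lax_transformation T T' F.F G.F t \<and> lt_ob t = Unt (tri_cat T') \<and>
     lt_Pi t = lt_Pi (canonical_trans T T' F.F G.F (component T' F.F G.F t)) \<and>
     lt_M t = lt_M (canonical_trans T T' F.F G.F (component T' F.F G.F t))"
    using lax_transformation_iff s by (simp add: canonical_trans_def Let_def)
next
  assume t: "lax_transformation T T' F.F G.F t \<and> lt_ob t = Unt (tri_cat T') \<and>
     lt_Pi t = lt_Pi (canonical_trans T T' F.F G.F (component T' F.F G.F t)) \<and>
     lt_M t = lt_M (canonical_trans T T' F.F G.F (component T' F.F G.F t))"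
  define s where "s = component T' F.F G.F t"
  have "lax_transformation T T' F.F G.F t" and u: "lt_ob t = Unt B'" using t by simp_all
  then have l: "lax_trans B B' P Q (Unt B') (lt_nat t)"
    by (simp add: lax_transformation_def Let_def)
  have n: "lt_nat t X \<in> Ar B'" "Dom B' (lt_nat t X) = Unt B' \<otimes> (Unt B' \<otimes> FO H X)"
     "Cod B' (lt_nat t X) = (FO K X \<otimes> Unt B') \<otimes> Unt B'" if "X \<in> Ob B" for X
    using lax_trans.hom[OF l that] that by (auto simp: F.D.hom_iff PQ_ob)
  have s: "s X \<in> hom B' (FO H X) (FO K X)" if "X \<in> Ob B" for X
    using n[OF that] that by (simp add: s_def component_def Let_def F.D.hom_iff)
  interpret canonical_trans_data B T B' T' H K s
    by unfold_locales (rule s)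
  have e: "lt_nat t X = coh_nat B' (Unt B' \<otimes> FO H X) (FO K X \<otimes> Unt B') (cs X)" if "X \<in> Ob B" for X
    using n[OF that] that by (simp add: coh_nat_def s_def component_def Let_def)
  have "t = canonical_trans T T' F.F G.F s"
  proof (rule dd_trans.equality)
    show "lt_nat t = lt_nat (canonical_trans T T' F.F G.F s)"
      by (rule extensionalityI[OF lax_trans.ext[OF l]]) (simp_all add: e, simp add: canonical_trans_def Let_def)
    show "lt_ob t = lt_ob (canonical_trans T T' F.F G.F s)" using u by simp
  qed (use t in \<open>simp_all add: s_def\<close>)
  then show "\<exists>s. mon_trans B B' H K s \<and> t = canonical_trans T T' F.F G.F s"
    using lax_transformation_iff t by blast
qed

lemma T2_Hom2_iff:
  assumes "T \<in> T2_Ob" "T' \<in> T2_Ob" "braided T T' H" "braided T T' K"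
  shows "t \<in> T2_Hom2 T T' (canonical_functor T T' H) (canonical_functor T T' K) \<longleftrightarrow>
    (\<exists>s. mon_trans (tri_cat T) (tri_cat T') H K s \<and>
       t = canonical_trans T T' (canonical_functor T T' H) (canonical_functor T T' K) s)"
proof -
  interpret canonical_hom "tri_cat T" T "tri_cat T'" T' H K
    using assms by (intro canonical_hom.intro braided_data)
  show ?thesis unfolding T2_Hom2_def mem_Collect_eq by (rule canonical_trans_iff)
qed

lemma component_canonical:
  assumes "T \<in> T2_Ob" "T' \<in> T2_Ob" "braided T T' H" "braided T T' K"
    "mon_trans (tri_cat T) (tri_cat T') H K s" "X \<in> Ob (tri_cat T)"
  shows "component T' (canonical_functor T T' H) (canonical_functor T T' K)
    (canonical_trans T T' (canonical_functor T T' H) (canonical_functor T T' K) s) X = s X"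
proof -
  interpret canonical_hom "tri_cat T" T "tri_cat T'" T' H K
    using assms by (intro canonical_hom.intro braided_data)
  interpret canonical_trans_data "tri_cat T" T "tri_cat T'" T' H K s
    by unfold_locales (rule mon_transD(1)[OF assms(5)])
  show ?thesis by (rule component_t) fact
qed

section \<open>Identities and composites of monoidal transformations\<close>

lemma (in canonical_functor_data) mon_trans_id: "mon_trans B B' H H (\<lambda>X. Idn B' (FO H X))"
  unfolding mon_trans_def
proof (intro conjI ballI allI)
  fix X Y f assume f: "f \<in> hom B X Y"
  then show "FA H f \<cdot> Idn B' (FO H X) = Idn B' (FO H Y) \<cdot> FA H f"
    using S.dom_ob[of f] S.cod_ob[of f] by (auto simp: S.hom_iff)
qed (simp_all add: D.hom_iff)

lemma mon_trans_vcomp: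
  fixes B' :: "('p, 'n) moncat" (structure)
  assumes "canonical_functor_data B T B' T' H" "canonical_functor_data B T B' T' K"
    "canonical_functor_data B T B' T' L" "mon_trans B B' H K s" "mon_trans B B' K L r"
  shows "mon_trans B B' H L (\<lambda>X. r X \<cdot> s X)"
proof -
  interpret F: canonical_functor_data B T B' T' H by fact
  interpret G: canonical_functor_data B T B' T' K by fact
  interpret L: canonical_functor_data B T B' T' L by fact
  have s: "s X \<in> Ar B'" "Dom B' (s X) = FO H X" "Cod B' (s X) = FO K X"
    "r X \<in> Ar B'" "Dom B' (r X) = FO K X" "Cod B' (r X) = FO L X" if "X \<in> Ob B" for X
    using mon_transD(1)[OF assms(4) that] mon_transD(1)[OF assms(5) that] by (auto simp: F.D.hom_iff)
  show ?thesis
    unfolding mon_trans_def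
  proof (intro conjI ballI allI)
    show "r X \<cdot> s X \<in> hom B' (FO H X) (FO L X)" if "X \<in> Ob B" for X
      using s[OF that] by (simp add: F.D.hom_iff)
    fix X Y f assume f: "f \<in> hom B X Y"
    then have [simp]: "X \<in> Ob B" "Y \<in> Ob B" "f \<in> Ar B" "Dom B f = X" "Cod B f = Y"
      using F.S.dom_ob[of f] F.S.cod_ob[of f] by (auto simp: F.S.hom_iff)
    have e: "FA K f \<cdot> s X = s Y \<cdot> FA H f" "FA L f \<cdot> r X = r Y \<cdot> FA K f"
      using mon_transD(2)[OF assms(4) f] mon_transD(2)[OF assms(5) f] by auto
    have "FA L f \<cdot> (r X \<cdot> s X) = r Y \<cdot> (FA K f \<cdot> s X)"
      using F.D.precomp[OF e(2), of "s X"] by (simp add: s)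
    then show "FA L f \<cdot> (r X \<cdot> s X) = (r Y \<cdot> s Y) \<cdot> FA H f"
      by (simp add: e(1) s)
  next
    fix X Y assume [simp]: "X \<in> Ob B" "Y \<in> Ob B"
    have e: "FP K X Y \<cdot> (s X \<oplus> s Y) = s (X \<otimes>\<^bsub>B\<^esub> Y) \<cdot> FP H X Y"
      "FP L X Y \<cdot> (r X \<oplus> r Y) = r (X \<otimes>\<^bsub>B\<^esub> Y) \<cdot> FP K X Y"
      by (auto intro: mon_transD(3)[OF assms(4)] mon_transD(3)[OF assms(5)])
    have "FP L X Y \<cdot> ((r X \<cdot> s X) \<oplus> (r Y \<cdot> s Y)) = FP L X Y \<cdot> ((r X \<oplus> r Y) \<cdot> (s X \<oplus> s Y))"
      by (simp add: F.D.xchg s)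
    also have "\<dots> = r (X \<otimes>\<^bsub>B\<^esub> Y) \<cdot> (FP K X Y \<cdot> (s X \<oplus> s Y))"
      using F.D.precomp[OF e(2), of "s X \<oplus> s Y"] by (simp add: s)
    finally show "FP L X Y \<cdot> ((r X \<cdot> s X) \<oplus> (r Y \<cdot> s Y)) = (r (X \<otimes>\<^bsub>B\<^esub> Y) \<cdot> s (X \<otimes>\<^bsub>B\<^esub> Y)) \<cdot> FP H X Y"
      by (simp add: e(1) s)
  next
    have e: "s (Unt B) \<cdot> FU H = FU K" "r (Unt B) \<cdot> FU K = FU L"
      using mon_transD(4)[OF assms(4)] mon_transD(4)[OF assms(5)] by auto
    show "(r (Unt B) \<cdot> s (Unt B)) \<cdot> FU H = FU L"
      by (simp add: e s)
  qed
qed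

text \<open>The composite passes through \<open>K\<close> after \<open>H'\<close>: first
  \<open>s\<close> under \<open>K\<close>, then \<open>r\<close> at \<open>H' X\<close>. Each clause
  combines that of \<open>s\<close> under \<open>FA K\<close> with that of \<open>r\<close>,
  exchanged by naturality of \<open>r\<close> at the structure maps of \<open>H'\<close>.\<close>

lemma mon_trans_hcomp:
  fixes B'' :: "('q, 'k) moncat" (structure)
  assumes "canonical_functor_data B T B' T' H" "canonical_functor_data B T B' T' H'"
    "canonical_functor_data B' T' B'' T'' K" "canonical_functor_data B' T' B'' T'' K'"
    "mon_trans B B' H H' s" "mon_trans B' B'' K K' r"
  shows "mon_trans B B'' (comp_fun B B'' K H) (comp_fun B B'' K' H') (\<lambda>X. r (FO H' X) \<cdot> FA K (s X))"
proof -
  interpret H: canonical_functor_data B T B' T' H by fact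
  interpret H': canonical_functor_data B T B' T' H' by fact
  interpret K: canonical_functor_data B' T' B'' T'' K by fact
  interpret K': canonical_functor_data B' T' B'' T'' K' by fact
  interpret KH: canonical_comp B T B' T' H B'' T'' K ..
  interpret KH': canonical_comp B T B' T' H' B'' T'' K' ..
  have s: "s X \<in> Ar B'" "Dom B' (s X) = FO H X" "Cod B' (s X) = FO H' X" if "X \<in> Ob B" for X
    using mon_transD(1)[OF assms(5) that] by (auto simp: H.D.hom_iff)
  have r: "r X \<in> Ar B''" "Dom B'' (r X) = FO K X" "Cod B'' (r X) = FO K' X" if "X \<in> Ob B'" for X
    using mon_transD(1)[OF assms(6) that] by (auto simp: K.D.hom_iff)
  note [simp] = s r
  have rn: "FA K' f \<cdot> r (Dom B' f) = r (Cod B' f) \<cdot> FA K f" if "f \<in> Ar B'" for f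
    using mon_transD(2)[OF assms(6), of f "Dom B' f" "Cod B' f"] that by (simp add: H.D.hom_iff)
  have rt: "FP K' X Y \<cdot> (r X \<oplus> r Y) = r (X \<otimes>\<^bsub>B'\<^esub> Y) \<cdot> FP K X Y" if "X \<in> Ob B'" "Y \<in> Ob B'" for X Y
    using mon_transD(3)[OF assms(6) that] .
  show ?thesis
    unfolding mon_trans_def
  proof (intro conjI ballI allI)
    show "r (FO H' X) \<cdot> FA K (s X) \<in> hom B'' (FO KH.KH X) (FO KH'.KH X)" if "X \<in> Ob B" for X
      using that by (simp add: K.D.hom_iff)
    fix X Y f assume f: "f \<in> hom B X Y"
    then have [simp]: "X \<in> Ob B" "Y \<in> Ob B" "f \<in> Ar B" "Dom B f = X" "Cod B f = Y"
      using H.S.dom_ob[of f] H.S.cod_ob[of f] by (auto simp: H.S.hom_iff)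
    have e: "FA H' f \<cdot>\<^bsub>B'\<^esub> s X = s Y \<cdot>\<^bsub>B'\<^esub> FA H f" by (rule mon_transD(2)[OF assms(5) f])
    have "FA KH'.KH f \<cdot> (r (FO H' X) \<cdot> FA K (s X)) = r (FO H' Y) \<cdot> FA K (FA H' f \<cdot>\<^bsub>B'\<^esub> s X)"
      using K.D.precomp[OF rn[of "FA H' f"], of "FA K (s X)"] by (simp add: K.FA_cmp)
    then show "FA KH'.KH f \<cdot> (r (FO H' X) \<cdot> FA K (s X)) = (r (FO H' Y) \<cdot> FA K (s Y)) \<cdot> FA KH.KH f"
      unfolding e by (simp add: K.FA_cmp)
  next
    fix X Y assume [simp]: "X \<in> Ob B" "Y \<in> Ob B"
    let ?X = "FO H X" and ?Y = "FO H Y" and ?X' = "FO H' X" and ?Y' = "FO H' Y"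
    have e: "FP H' X Y \<cdot>\<^bsub>B'\<^esub> (s X \<oplus>\<^bsub>B'\<^esub> s Y) = s (X \<otimes>\<^bsub>B\<^esub> Y) \<cdot>\<^bsub>B'\<^esub> FP H X Y"
      by (rule mon_transD(3)[OF assms(5)]) simp_all
    have n: "FA K' (FP H' X Y) \<cdot> r (?X' \<otimes>\<^bsub>B'\<^esub> ?Y') = r (FO H' (X \<otimes>\<^bsub>B\<^esub> Y)) \<cdot> FA K (FP H' X Y)"
      using rn[of "FP H' X Y"] by simp
    have "FP KH'.KH X Y \<cdot> ((r ?X' \<cdot> FA K (s X)) \<oplus> (r ?Y' \<cdot> FA K (s Y)))
       = FA K' (FP H' X Y) \<cdot> ((FP K' ?X' ?Y' \<cdot> (r ?X' \<oplus> r ?Y')) \<cdot> (FA K (s X) \<oplus> FA K (s Y)))"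
      by (simp add: K.D.xchg)
    also have "\<dots> = (FA K' (FP H' X Y) \<cdot> r (?X' \<otimes>\<^bsub>B'\<^esub> ?Y')) \<cdot> (FP K ?X' ?Y' \<cdot> (FA K (s X) \<oplus> FA K (s Y)))"
      unfolding rt[OF H'.FO_ob[OF \<open>X \<in> Ob B\<close>] H'.FO_ob[OF \<open>Y \<in> Ob B\<close>]] by simp
    also have "\<dots> = r (FO H' (X \<otimes>\<^bsub>B\<^esub> Y)) \<cdot> (FA K (FP H' X Y \<cdot>\<^bsub>B'\<^esub> (s X \<oplus>\<^bsub>B'\<^esub> s Y)) \<cdot> FP K ?X ?Y)"
      unfolding n by (simp add: K.FP_nat K.FA_cmp)
    also have "\<dots> = (r (FO H' (X \<otimes>\<^bsub>B\<^esub> Y)) \<cdot> FA K (s (X \<otimes>\<^bsub>B\<^esub> Y))) \<cdot> FP KH.KH X Y"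
      unfolding e by (simp add: K.FA_cmp)
    finally show "FP KH'.KH X Y \<cdot> ((r ?X' \<cdot> FA K (s X)) \<oplus> (r ?Y' \<cdot> FA K (s Y)))
       = (r (FO H' (X \<otimes>\<^bsub>B\<^esub> Y)) \<cdot> FA K (s (X \<otimes>\<^bsub>B\<^esub> Y))) \<cdot> FP KH.KH X Y" .
  next
    have e: "s (Unt B) \<cdot>\<^bsub>B'\<^esub> FU H = FU H'" "r (Unt B') \<cdot> FU K = FU K'"
      using mon_transD(4)[OF assms(5)] mon_transD(4)[OF assms(6)] by auto
    have n: "FA K' (FU H') \<cdot> r (Unt B') = r (FO H' (Unt B)) \<cdot> FA K (FU H')"
      using rn[of "FU H'"] by simp
    have "(r (FO H' (Unt B)) \<cdot> FA K (s (Unt B))) \<cdot> FU KH.KH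
       = r (FO H' (Unt B)) \<cdot> (FA K (s (Unt B) \<cdot>\<^bsub>B'\<^esub> FU H) \<cdot> FU K)"
      by (simp add: K.FA_cmp)
    also have "\<dots> = (FA K' (FU H') \<cdot> r (Unt B')) \<cdot> FU K"
      unfolding e n by simp
    also have "\<dots> = FU KH'.KH"
      by (simp add: e(2))
    finally show "(r (FO H' (Unt B)) \<cdot> FA K (s (Unt B))) \<cdot> FU KH.KH = FU KH'.KH" .
  qed
qed

text \<open>The extensionality clauses turn agreement on the source into equality of records; this
  is why the laws for composing 1-cells hold strictly.\<close>

lemma monfun_eqI:
  assumes "monoidal_functor C D F" "monoidal_functor C D G"
    "\<And>X. X \<in> Ob C \<Longrightarrow> FO F X = FO G X" "\<And>f. f \<in> Ar C \<Longrightarrow> FA F f = FA G f"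
    "\<And>X Y. \<lbrakk>X \<in> Ob C; Y \<in> Ob C\<rbrakk> \<Longrightarrow> FP F X Y = FP G X Y" "FU F = FU G"
  shows "F = G"
proof -
  note e = monoidal_functor.ext[OF assms(1)] monoidal_functor.ext[OF assms(2)]
  show ?thesis
  proof (rule monfun.equality)
    show "FO F = FO G" "FA F = FA G"
      using e assms(3,4) by (auto intro: extensionalityI)
    show "FP F = FP G"
      using e(3,6) assms(5) unfolding extensional2_def by (intro ext) metis
  qed (use assms(6) in simp_all)
qed

lemma comp_fun_id:
  assumes "canonical_functor_data B T B' T' H"
  shows "comp_fun B B' H (id_fun B) = H" "comp_fun B B' (id_fun B') H = H"
proof -
  interpret canonical_functor_data B T B' T' H by fact
  interpret L: canonical_comp B T B T "id_fun B" B' T' H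
    by (intro canonical_comp.intro S.id_functor_data assms)
  interpret R: canonical_comp B T B' T' H B' T' "id_fun B'"
    by (intro canonical_comp.intro D.id_functor_data assms)
  show "comp_fun B B' H (id_fun B) = H"
    by (rule monfun_eqI[OF L.KH_monoidal H.monoidal_functor_axioms]) simp_all
  show "comp_fun B B' (id_fun B') H = H"
    by (rule monfun_eqI[OF R.KH_monoidal H.monoidal_functor_axioms]) simp_all
qed

text \<open>Only the constraints need attention, and they agree because \<open>L\<close> preserves
  composition.\<close>

lemma comp_fun_assoc:
  assumes "canonical_functor_data A S B T H" "canonical_functor_data B T B' T' K" "canonical_functor_data B' T' B'' T'' L"
  shows "comp_fun A B'' (comp_fun B B'' L K) H = comp_fun A B'' L (comp_fun A B' K H)"
proof -
  interpret H: canonical_functor_data A S B T H by fact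
  interpret K: canonical_functor_data B T B' T' K by fact
  interpret L: canonical_functor_data B' T' B'' T'' L by fact
  interpret KH: canonical_comp A S B T H B' T' K ..
  interpret LK: canonical_comp B T B' T' K B'' T'' L ..
  interpret l: canonical_comp A S B T H B'' T'' LK.KH ..
  interpret r: canonical_comp A S B' T' KH.KH B'' T'' L ..
  show ?thesis
    by (rule monfun_eqI[OF l.KH_monoidal r.KH_monoidal]) (simp_all add: L.FA_cmp)
qed

section \<open>Composition operations on canonical data\<close>

lemma comp1_canonical [simp]:
  "T2_comp1 T T' T'' (canonical_functor T' T'' K) (canonical_functor T T' H)
    = canonical_functor T T'' (comp_fun (tri_cat T) (tri_cat T'') K H)"
  by (simp add: T2_comp1_def)

lemma id2_canonical [simp]:
  "T2_id2 T T' (canonical_functor T T' H)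
    = canonical_trans T T' (canonical_functor T T' H) (canonical_functor T T' H) (\<lambda>X. Idn (tri_cat T') (FO H X))"
  by (simp add: T2_id2_def)

text \<open>\<open>component\<close> recovers a family on objects of the source, which is all that
  \<open>canonical_trans\<close> keeps of it.\<close>

lemma vcomp_canonical:
  assumes "T \<in> T2_Ob" "T' \<in> T2_Ob" "braided T T' H" "braided T T' K" "braided T T' L"
    "mon_trans (tri_cat T) (tri_cat T') H K s" "mon_trans (tri_cat T) (tri_cat T') K L r"
  shows "T2_vcomp T T' (canonical_functor T T' H) (canonical_functor T T' K) (canonical_functor T T' L)
      (canonical_trans T T' (canonical_functor T T' K) (canonical_functor T T' L) r)
      (canonical_trans T T' (canonical_functor T T' H) (canonical_functor T T' K) s)
    = canonical_trans T T' (canonical_functor T T' H) (canonical_functor T T' L) (\<lambda>X. r X \<cdot>\<^bsub>tri_cat T'\<^esub> s X)"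
  unfolding T2_vcomp_def
  by (rule canonical_trans_cong)
    (simp only: component_canonical[OF assms(1-4,6)] component_canonical[OF assms(1,2,4,5,7)])

lemma hcomp_canonical:
  assumes "T \<in> T2_Ob" "T' \<in> T2_Ob" "T'' \<in> T2_Ob" "braided T T' H" "braided T T' H'" "braided T' T'' K" "braided T' T'' K'"
    "mon_trans (tri_cat T) (tri_cat T') H H' s" "mon_trans (tri_cat T') (tri_cat T'') K K' r"
  shows "T2_hcomp T T' T'' (canonical_functor T T' H) (canonical_functor T T' H')
      (canonical_functor T' T'' K) (canonical_functor T' T'' K')
      (canonical_trans T' T'' (canonical_functor T' T'' K) (canonical_functor T' T'' K') r)
      (canonical_trans T T' (canonical_functor T T' H) (canonical_functor T T' H') s)
    = canonical_trans T T'' (canonical_functor T T'' (comp_fun (tri_cat T) (tri_cat T'') K H))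
       (canonical_functor T T'' (comp_fun (tri_cat T) (tri_cat T'') K' H'))
       (\<lambda>X. r (FO H' X) \<cdot>\<^bsub>tri_cat T''\<^esub> FA K (s X))"
proof -
  \<comment> \<open>\<open>component_canonical\<close> for \<open>r\<close> applies at objects of
    the middle category, and \<open>r\<close> is used at \<open>FO H' X\<close>.\<close>
  have "FO H' X \<in> Ob (tri_cat T')" if "X \<in> Ob (tri_cat T)" for X
    using canonical_functor_data.FO_ob[OF braided_data[OF assms(1,2,5)] that] .
  then show ?thesis
    unfolding T2_hcomp_def wf_fun_canonical comp1_canonical
    by (intro canonical_trans_cong)
      (simp only: component_canonical[OF assms(1,2,4,5,8)] component_canonical[OF assms(2,3,6,7,9)])
qed

lemma braided_comp:
  assumes "T \<in> T2_Ob" "T' \<in> T2_Ob" "T'' \<in> T2_Ob" "braided T T' H" "braided T' T'' K"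
  shows "braided T T'' (comp_fun (tri_cat T) (tri_cat T'') K H)"
proof -
  interpret canonical_comp "tri_cat T" T "tri_cat T'" T' H "tri_cat T''" T'' K
    using assms by (intro canonical_comp.intro braided_data)
  show ?thesis by (rule KH_braided[OF assms(4,5)])
qed

lemma braided_id: "T \<in> T2_Ob \<Longrightarrow> braided T T (id_fun (tri_cat T))"
  by (rule canonical.id_braided[OF canonicalI])

lemma mon_trans_id2:
  "\<lbrakk>T \<in> T2_Ob; T' \<in> T2_Ob; braided T T' H\<rbrakk>
    \<Longrightarrow> mon_trans (tri_cat T) (tri_cat T') H H (\<lambda>X. Idn (tri_cat T') (FO H X))"
  by (rule canonical_functor_data.mon_trans_id[OF braided_data])

lemma tri_cat_monoidal: "T \<in> T2_Ob \<Longrightarrow> monoidal_category (tri_cat T)"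
  by (rule canonical.axioms(1)[OF canonicalI])

lemma mon_trans_idn:
  assumes "monoidal_category D" "mon_trans C D F G s" "X \<in> Ob C"
  shows "s X \<cdot>\<^bsub>D\<^esub> Idn D (FO F X) = s X" "Idn D (FO G X) \<cdot>\<^bsub>D\<^esub> s X = s X"
  using monoidal_category.cmp_idn[OF assms(1) mon_transD(1)[OF assms(2,3)]] by auto

lemma mon_trans_assoc:
  assumes "monoidal_category D" "mon_trans C D F G s" "mon_trans C D G H t" "mon_trans C D H K u" "X \<in> Ob C"
  shows "(u X \<cdot>\<^bsub>D\<^esub> t X) \<cdot>\<^bsub>D\<^esub> s X = u X \<cdot>\<^bsub>D\<^esub> (t X \<cdot>\<^bsub>D\<^esub> s X)"
  using monoidal_category.cmp_assoc[OF assms(1) mon_transD(1)[OF assms(2,5)] mon_transD(1)[OF assms(3,5)]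
      mon_transD(1)[OF assms(4,5)]] .

lemma hcomp_idn:
  fixes B'' :: "('q, 'k) moncat" (structure)
  assumes "canonical_functor_data B T B' T' F" "canonical_functor_data B' T' B'' T'' G" "X \<in> Ob B"
  shows "Idn B'' (FO G (FO F X)) \<cdot> FA G (Idn B' (FO F X)) = Idn B'' (FO (comp_fun B B'' G F) X)"
proof -
  interpret F: canonical_functor_data B T B' T' F by fact
  interpret G: canonical_functor_data B' T' B'' T'' G by fact
  interpret canonical_comp B T B' T' F B'' T'' G ..
  show ?thesis using assms(3) by simp
qed

lemma hcomp_id_fun:
  fixes B' :: "('p, 'n) moncat" (structure)
  assumes "canonical_functor_data B T B' T' F" "canonical_functor_data B T B' T' G"
    "mon_trans B B' F G s" "X \<in> Ob B"
  shows "s (FO (id_fun B) X) \<cdot> FA F (Idn B (FO (id_fun B) X)) = s X"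
    "Idn B' (FO (id_fun B') (FO G X)) \<cdot> FA (id_fun B') (s X) = s X"
proof -
  interpret F: canonical_functor_data B T B' T' F by fact
  interpret G: canonical_functor_data B T B' T' G by fact
  have "s X \<in> Ar B'" "Dom B' (s X) = FO F X" "Cod B' (s X) = FO G X"
    using mon_transD(1)[OF assms(3,4)] by (auto simp: F.D.hom_iff)
  then show "s (FO (id_fun B) X) \<cdot> FA F (Idn B (FO (id_fun B) X)) = s X"
    "Idn B' (FO (id_fun B') (FO G X)) \<cdot> FA (id_fun B') (s X) = s X"
    using assms(4) by simp_all
qed

text \<open>Functoriality of \<open>G\<close> splits the image of the composite; naturality of
  \<open>t\<close> at \<open>s' X\<close> then exchanges \<open>t\<close> with
  \<open>s'\<close>.\<close>

lemma hcomp_interchange: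
  fixes B'' :: "('q, 'k) moncat" (structure)
  assumes "canonical_functor_data B T B' T' F" "canonical_functor_data B T B' T' F'" "canonical_functor_data B T B' T' F''"
    "canonical_functor_data B' T' B'' T'' G" "canonical_functor_data B' T' B'' T'' G'" "canonical_functor_data B' T' B'' T'' G''"
    "mon_trans B B' F F' s" "mon_trans B B' F' F'' s'" "mon_trans B' B'' G G' t" "mon_trans B' B'' G' G'' t'"
    "X \<in> Ob B"
  shows "(t' (FO F'' X) \<cdot> t (FO F'' X)) \<cdot> FA G (s' X \<cdot>\<^bsub>B'\<^esub> s X)
    = (t' (FO F'' X) \<cdot> FA G' (s' X)) \<cdot> (t (FO F' X) \<cdot> FA G (s X))"
proof -
  interpret F: canonical_functor_data B T B' T' F by fact
  interpret F': canonical_functor_data B T B' T' F' by fact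
  interpret F'': canonical_functor_data B T B' T' F'' by fact
  interpret G: canonical_functor_data B' T' B'' T'' G by fact
  interpret G': canonical_functor_data B' T' B'' T'' G' by fact
  interpret G'': canonical_functor_data B' T' B'' T'' G'' by fact
  have s: "s X \<in> Ar B'" "Dom B' (s X) = FO F X" "Cod B' (s X) = FO F' X"
    "s' X \<in> Ar B'" "Dom B' (s' X) = FO F' X" "Cod B' (s' X) = FO F'' X"
    using mon_transD(1)[OF assms(7,11)] mon_transD(1)[OF assms(8,11)] by (auto simp: F.D.hom_iff)
  have t: "t Y \<in> Ar B''" "Dom B'' (t Y) = FO G Y" "Cod B'' (t Y) = FO G' Y"
    "t' Y \<in> Ar B''" "Dom B'' (t' Y) = FO G' Y" "Cod B'' (t' Y) = FO G'' Y" if "Y \<in> Ob B'" for Y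
    using mon_transD(1)[OF assms(9) that] mon_transD(1)[OF assms(10) that] by (auto simp: G.D.hom_iff)
  note [simp] = s t assms(11)
  have n: "FA G' (s' X) \<cdot> t (FO F' X) = t (FO F'' X) \<cdot> FA G (s' X)"
    by (rule mon_transD(2)[OF assms(9)]) (simp add: F.D.hom_iff)
  have "FA G' (s' X) \<cdot> (t (FO F' X) \<cdot> FA G (s X)) = t (FO F'' X) \<cdot> (FA G (s' X) \<cdot> FA G (s X))"
    by (rule G.D.precomp[OF n]) simp_all
  then show ?thesis by (simp add: G.FA_cmp)
qed

text \<open>Both sides apply \<open>s\<close> under \<open>H G\<close>, then \<open>t\<close> under
  \<open>H\<close>, then \<open>u\<close>; they agree because \<open>H\<close> preserves
  composition.\<close>

lemma hcomp_assoc_components: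
  fixes B'' :: "('q, 'k) moncat" (structure)
  assumes "canonical_functor_data A S B T F" "canonical_functor_data A S B T F'"
    "canonical_functor_data B T B' T' G" "canonical_functor_data B T B' T' G'"
    "canonical_functor_data B' T' B'' T'' H" "canonical_functor_data B' T' B'' T'' H'"
    "mon_trans A B F F' s" "mon_trans B B' G G' t" "mon_trans B' B'' H H' u" "X \<in> Ob A"
  shows "(u (FO G' (FO F' X)) \<cdot> FA H (t (FO F' X))) \<cdot> FA (comp_fun B B'' H G) (s X)
    = u (FO (comp_fun A B' G' F') X) \<cdot> FA H (t (FO F' X) \<cdot>\<^bsub>B'\<^esub> FA G (s X))"
proof -
  interpret F: canonical_functor_data A S B T F by fact
  interpret F': canonical_functor_data A S B T F' by fact
  interpret G: canonical_functor_data B T B' T' G by fact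
  interpret G': canonical_functor_data B T B' T' G' by fact
  interpret H: canonical_functor_data B' T' B'' T'' H by fact
  interpret H': canonical_functor_data B' T' B'' T'' H' by fact
  interpret GF: canonical_comp A S B T F' B' T' G' ..
  interpret HG: canonical_comp B T B' T' G B'' T'' H ..
  have s: "s X \<in> Ar B" "Dom B (s X) = FO F X" "Cod B (s X) = FO F' X"
    using mon_transD(1)[OF assms(7,10)] by (auto simp: F.D.hom_iff)
  have t: "t Y \<in> Ar B'" "Dom B' (t Y) = FO G Y" "Cod B' (t Y) = FO G' Y" if "Y \<in> Ob B" for Y
    using mon_transD(1)[OF assms(8) that] by (auto simp: G.D.hom_iff)
  have u: "u Y \<in> Ar B''" "Dom B'' (u Y) = FO H Y" "Cod B'' (u Y) = FO H' Y" if "Y \<in> Ob B'" for Y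
    using mon_transD(1)[OF assms(9) that] by (auto simp: H.D.hom_iff)
  show ?thesis using s t u assms(10) by (simp add: H.FA_cmp)
qed

section \<open>The 2-category\<close>

lemma T2_HomE:
  assumes "f \<in> T2_Hom T T'" "T \<in> T2_Ob" "T' \<in> T2_Ob"
  obtains H where "f = canonical_functor T T' H" "braided T T' H"
  using assms T2_Hom_iff[OF assms(2,3)] by blast

lemma T2_Hom2E:
  assumes "t \<in> T2_Hom2 T T' f g" "f = canonical_functor T T' H" "braided T T' H"
    "g = canonical_functor T T' K" "braided T T' K" "T \<in> T2_Ob" "T' \<in> T2_Ob"
  obtains s where "t = canonical_trans T T' f g s" "mon_trans (tri_cat T) (tri_cat T') H K s"
  using T2_Hom2_iff[OF assms(6,7,3,5)] assms(1) unfolding assms(2,4) by blast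

text \<open>By \<open>T2_Hom_iff\<close> and \<open>T2_Hom2_iff\<close> the cells are braided
  monoidal functors and monoidal transformations in disguise. Each clause is proved by exchanging
  cells for these and comparing functors or families of components.\<close>

theorem theorem2p18:
  shows "two_category
    (T2_Ob :: ('o, 'm) dd_tricat set) T2_Hom T2_Hom2 T2_id1 T2_comp1 T2_id2 T2_vcomp T2_hcomp"
proof
  fix A :: "('o, 'm) dd_tricat" assume A: "A \<in> T2_Ob"
  show "T2_id1 A \<in> T2_Hom A A"
    using T2_Hom_iff[OF A A] braided_id[OF A] by (auto simp: T2_id1_def)
next
  fix A B C :: "('o, 'm) dd_tricat" and f g
  assume o: "A \<in> T2_Ob" "B \<in> T2_Ob" "C \<in> T2_Ob" and "f \<in> T2_Hom A B" "g \<in> T2_Hom B C"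
  then obtain F G where "f = canonical_functor A B F" "braided A B F" "g = canonical_functor B C G" "braided B C G"
    using T2_Hom_iff by metis
  then show "T2_comp1 A B C g f \<in> T2_Hom A C"
    unfolding T2_Hom_iff[OF o(1,3)] using braided_comp[OF o] comp1_canonical by metis
next
  fix A B :: "('o, 'm) dd_tricat" and f
  assume o: "A \<in> T2_Ob" "B \<in> T2_Ob" and "f \<in> T2_Hom A B"
  then obtain F where f: "f = canonical_functor A B F" "braided A B F"
    using T2_Hom_iff by metis
  then show "T2_comp1 A A B f (T2_id1 A) = f \<and> T2_comp1 A B B (T2_id1 B) f = f"
    using comp_fun_id[OF braided_data[OF o f(2)]] by (simp add: T2_id1_def)
next
  fix A B C D :: "('o, 'm) dd_tricat" and f g h
  assume o: "A \<in> T2_Ob" "B \<in> T2_Ob" "C \<in> T2_Ob" "D \<in> T2_Ob" and "f \<in> T2_Hom A B" "g \<in> T2_Hom B C" "h \<in> T2_Hom C D"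
  then obtain F G H where f: "f = canonical_functor A B F" "braided A B F" "g = canonical_functor B C G" "braided B C G"
      "h = canonical_functor C D H" "braided C D H"
    using T2_Hom_iff by metis
  then show "T2_comp1 A B D (T2_comp1 B C D h g) f = T2_comp1 A C D h (T2_comp1 A B C g f)"
    using comp_fun_assoc[OF braided_data[OF o(1,2) f(2)] braided_data[OF o(2,3) f(4)] braided_data[OF o(3,4) f(6)]]
    by simp
next
  fix A B :: "('o, 'm) dd_tricat" and f
  assume o: "A \<in> T2_Ob" "B \<in> T2_Ob" and "f \<in> T2_Hom A B"
  then obtain F where f: "f = canonical_functor A B F" "braided A B F"
    using T2_Hom_iff by metis
  then show "T2_id2 A B f \<in> T2_Hom2 A B f f"
    using T2_Hom2_iff[OF o f(2,2)] canonical_functor_data.mon_trans_id[OF braided_data[OF o f(2)]] by auto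
next
  fix A B :: "('o, 'm) dd_tricat" and f g h s t
  assume o: "A \<in> T2_Ob" "B \<in> T2_Ob" and h: "f \<in> T2_Hom A B" "g \<in> T2_Hom A B" "h \<in> T2_Hom A B"
    and st: "s \<in> T2_Hom2 A B f g" "t \<in> T2_Hom2 A B g h"
  from h(1) o obtain F where F: "f = canonical_functor A B F" "braided A B F" by (rule T2_HomE)
  from h(2) o obtain G where G: "g = canonical_functor A B G" "braided A B G" by (rule T2_HomE)
  from h(3) o obtain H where H: "h = canonical_functor A B H" "braided A B H" by (rule T2_HomE)
  note f = F G H
  from st(1) F G o obtain s' where s1: "s = canonical_trans A B f g s'"
    "mon_trans (tri_cat A) (tri_cat B) F G s'" by (rule T2_Hom2E)
  from st(2) G H o obtain t' where s2: "t = canonical_trans A B g h t'"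
    "mon_trans (tri_cat A) (tri_cat B) G H t'" by (rule T2_Hom2E)
  note s = s1 s2
  \<comment> \<open>With functors and families named, \<open>vcomp_canonical\<close> presents the
    composite as canonical data on the composed family, so monoidality of that family
    suffices.\<close>
  show "T2_vcomp A B f g h t s \<in> T2_Hom2 A B f h"
    unfolding s(1,3) f(1,3,5) vcomp_canonical[OF o f(2,4,6) s(2,4)] T2_Hom2_iff[OF o f(2,6)]
    using mon_trans_vcomp[OF braided_data[OF o f(2)] braided_data[OF o f(4)] braided_data[OF o f(6)] s(2,4)]
    by blast
next
  fix A B :: "('o, 'm) dd_tricat" and f g s
  assume o: "A \<in> T2_Ob" "B \<in> T2_Ob" and h: "f \<in> T2_Hom A B" "g \<in> T2_Hom A B" and st: "s \<in> T2_Hom2 A B f g"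
  from h(1) o obtain F where F: "f = canonical_functor A B F" "braided A B F" by (rule T2_HomE)
  from h(2) o obtain G where G: "g = canonical_functor A B G" "braided A B G" by (rule T2_HomE)
  note f = F G
  from st F G o obtain s' where s: "s = canonical_trans A B f g s'"
    "mon_trans (tri_cat A) (tri_cat B) F G s'" by (rule T2_Hom2E)
  show "T2_vcomp A B f f g s (T2_id2 A B f) = s \<and> T2_vcomp A B f g g (T2_id2 A B g) s = s"
    unfolding s(1) f(1,3) id2_canonical vcomp_canonical[OF o f(2,2,4) mon_trans_id2[OF o f(2)] s(2)]
      vcomp_canonical[OF o f(2,4,4) s(2) mon_trans_id2[OF o f(4)]]
    by (intro conjI canonical_trans_cong mon_trans_idn[OF tri_cat_monoidal[OF o(2)] s(2)])
next
  fix A B :: "('o, 'm) dd_tricat" and f g h k s t u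
  assume o: "A \<in> T2_Ob" "B \<in> T2_Ob" and h: "f \<in> T2_Hom A B" "g \<in> T2_Hom A B" "h \<in> T2_Hom A B" "k \<in> T2_Hom A B"
    and st: "s \<in> T2_Hom2 A B f g" "t \<in> T2_Hom2 A B g h" "u \<in> T2_Hom2 A B h k"
  from h(1) o obtain F where F: "f = canonical_functor A B F" "braided A B F" by (rule T2_HomE)
  from h(2) o obtain G where G: "g = canonical_functor A B G" "braided A B G" by (rule T2_HomE)
  from h(3) o obtain H where H: "h = canonical_functor A B H" "braided A B H" by (rule T2_HomE)
  from h(4) o obtain K where K: "k = canonical_functor A B K" "braided A B K" by (rule T2_HomE)
  note f = F G H K
  from st(1) F G o obtain s' where s1: "s = canonical_trans A B f g s'"
    "mon_trans (tri_cat A) (tri_cat B) F G s'" by (rule T2_Hom2E)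
  from st(2) G H o obtain t' where s2: "t = canonical_trans A B g h t'"
    "mon_trans (tri_cat A) (tri_cat B) G H t'" by (rule T2_Hom2E)
  from st(3) H K o obtain u' where s3: "u = canonical_trans A B h k u'"
    "mon_trans (tri_cat A) (tri_cat B) H K u'" by (rule T2_Hom2E)
  note s = s1 s2 s3
  note d = braided_data[OF o f(2)] braided_data[OF o f(4)] braided_data[OF o f(6)] braided_data[OF o f(8)]
  show "T2_vcomp A B f g k (T2_vcomp A B g h k u t) s = T2_vcomp A B f h k u (T2_vcomp A B f g h t s)"
    unfolding s(1,3,5) f(1,3,5,7) vcomp_canonical[OF o f(4,6,8) s(4,6)] vcomp_canonical[OF o f(2,4,6) s(2,4)]
      vcomp_canonical[OF o f(2,4,8) s(2) mon_trans_vcomp[OF d(2-4) s(4,6)]]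
      vcomp_canonical[OF o f(2,6,8) mon_trans_vcomp[OF d(1-3) s(2,4)] s(6)]
    by (intro canonical_trans_cong mon_trans_assoc[OF tri_cat_monoidal[OF o(2)] s(2,4,6)])
next
  fix A B C :: "('o, 'm) dd_tricat" and f f' g g' s t
  assume o: "A \<in> T2_Ob" "B \<in> T2_Ob" "C \<in> T2_Ob" and h: "f \<in> T2_Hom A B" "f' \<in> T2_Hom A B" "g \<in> T2_Hom B C" "g' \<in> T2_Hom B C"
    and st: "s \<in> T2_Hom2 A B f f'" "t \<in> T2_Hom2 B C g g'"
  from h(1) o(1,2) obtain F where F: "f = canonical_functor A B F" "braided A B F" by (rule T2_HomE)
  from h(2) o(1,2) obtain F' where F': "f' = canonical_functor A B F'" "braided A B F'" by (rule T2_HomE)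
  from h(3) o(2,3) obtain G where G: "g = canonical_functor B C G" "braided B C G" by (rule T2_HomE)
  from h(4) o(2,3) obtain G' where G': "g' = canonical_functor B C G'" "braided B C G'" by (rule T2_HomE)
  note f = F F' G G'
  from st(1) F F' o(1,2) obtain s' where s1: "s = canonical_trans A B f f' s'"
    "mon_trans (tri_cat A) (tri_cat B) F F' s'" by (rule T2_Hom2E)
  from st(2) G G' o(2,3) obtain t' where s2: "t = canonical_trans B C g g' t'"
    "mon_trans (tri_cat B) (tri_cat C) G G' t'" by (rule T2_Hom2E)
  note s = s1 s2
  show "T2_hcomp A B C f f' g g' t s \<in> T2_Hom2 A C (T2_comp1 A B C g f) (T2_comp1 A B C g' f')"
    unfolding s(1,3) f(1,3,5,7) hcomp_canonical[OF o f(2,4,6,8) s(2,4)] comp1_canonical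
      T2_Hom2_iff[OF o(1,3) braided_comp[OF o f(2,6)] braided_comp[OF o f(4,8)]]
    using mon_trans_hcomp[OF braided_data[OF o(1,2) f(2)] braided_data[OF o(1,2) f(4)]
        braided_data[OF o(2,3) f(6)] braided_data[OF o(2,3) f(8)] s(2,4)]
    by blast
next
  fix A B C :: "('o, 'm) dd_tricat" and f g
  assume o: "A \<in> T2_Ob" "B \<in> T2_Ob" "C \<in> T2_Ob" and "f \<in> T2_Hom A B" "g \<in> T2_Hom B C"
  then obtain F G where f: "f = canonical_functor A B F" "braided A B F" "g = canonical_functor B C G" "braided B C G"
    using T2_Hom_iff by metis
  show "T2_hcomp A B C f f g g (T2_id2 B C g) (T2_id2 A B f) = T2_id2 A C (T2_comp1 A B C g f)"
    unfolding f(1,3) id2_canonical comp1_canonical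
      hcomp_canonical[OF o f(2,2,4,4) mon_trans_id2[OF o(1,2) f(2)] mon_trans_id2[OF o(2,3) f(4)]]
    by (intro canonical_trans_cong hcomp_idn[OF braided_data[OF o(1,2) f(2)] braided_data[OF o(2,3) f(4)]])
next
  fix A B C :: "('o, 'm) dd_tricat" and f f' f'' g g' g'' s s1 t t1
  assume o: "A \<in> T2_Ob" "B \<in> T2_Ob" "C \<in> T2_Ob"
    and h: "f \<in> T2_Hom A B" "f' \<in> T2_Hom A B" "f'' \<in> T2_Hom A B" "g \<in> T2_Hom B C" "g' \<in> T2_Hom B C" "g'' \<in> T2_Hom B C"
    and st: "s \<in> T2_Hom2 A B f f'" "s1 \<in> T2_Hom2 A B f' f''" "t \<in> T2_Hom2 B C g g'" "t1 \<in> T2_Hom2 B C g' g''"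
  from h(1) o(1,2) obtain F where F: "f = canonical_functor A B F" "braided A B F" by (rule T2_HomE)
  from h(2) o(1,2) obtain F' where F': "f' = canonical_functor A B F'" "braided A B F'" by (rule T2_HomE)
  from h(3) o(1,2) obtain F'' where F'': "f'' = canonical_functor A B F''" "braided A B F''" by (rule T2_HomE)
  from h(4) o(2,3) obtain G where G: "g = canonical_functor B C G" "braided B C G" by (rule T2_HomE)
  from h(5) o(2,3) obtain G' where G': "g' = canonical_functor B C G'" "braided B C G'" by (rule T2_HomE)
  from h(6) o(2,3) obtain G'' where G'': "g'' = canonical_functor B C G''" "braided B C G''" by (rule T2_HomE)
  note f = F F' F'' and g = G G' G''
  from st(1) F F' o(1,2) obtain s' where sa: "s = canonical_trans A B f f' s'"
    "mon_trans (tri_cat A) (tri_cat B) F F' s'" by (rule T2_Hom2E)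
  from st(2) F' F'' o(1,2) obtain s1' where sb: "s1 = canonical_trans A B f' f'' s1'"
    "mon_trans (tri_cat A) (tri_cat B) F' F'' s1'" by (rule T2_Hom2E)
  from st(3) G G' o(2,3) obtain t' where ta: "t = canonical_trans B C g g' t'"
    "mon_trans (tri_cat B) (tri_cat C) G G' t'" by (rule T2_Hom2E)
  from st(4) G' G'' o(2,3) obtain t1' where tb: "t1 = canonical_trans B C g' g'' t1'"
    "mon_trans (tri_cat B) (tri_cat C) G' G'' t1'" by (rule T2_Hom2E)
  note s = sa sb and t = ta tb
  note d = braided_data[OF o(1,2) f(2)] braided_data[OF o(1,2) f(4)] braided_data[OF o(1,2) f(6)]
    and d' = braided_data[OF o(2,3) g(2)] braided_data[OF o(2,3) g(4)] braided_data[OF o(2,3) g(6)]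
  \<comment> \<open>Both sides unfold to canonical data between the same two functors, so the
    families can be compared object by object.\<close>
  show "T2_hcomp A B C f f'' g g'' (T2_vcomp B C g g' g'' t1 t) (T2_vcomp A B f f' f'' s1 s)
          = T2_vcomp A C (T2_comp1 A B C g f) (T2_comp1 A B C g' f') (T2_comp1 A B C g'' f'')
              (T2_hcomp A B C f' f'' g' g'' t1 s1) (T2_hcomp A B C f f' g g' t s)"
    unfolding s(1,3) t(1,3) f(1,3,5) g(1,3,5)
      vcomp_canonical[OF o(1,2) f(2,4,6) s(2,4)] vcomp_canonical[OF o(2,3) g(2,4,6) t(2,4)]
      hcomp_canonical[OF o f(2,6) g(2,6) mon_trans_vcomp[OF d s(2,4)] mon_trans_vcomp[OF d' t(2,4)]]
      hcomp_canonical[OF o f(2,4) g(2,4) s(2) t(2)] hcomp_canonical[OF o f(4,6) g(4,6) s(4) t(4)] comp1_canonical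
      vcomp_canonical[OF o(1,3) braided_comp[OF o f(2) g(2)] braided_comp[OF o f(4) g(4)] braided_comp[OF o f(6) g(6)]
        mon_trans_hcomp[OF d(1,2) d'(1,2) s(2) t(2)] mon_trans_hcomp[OF d(2,3) d'(2,3) s(4) t(4)]]
    by (intro canonical_trans_cong hcomp_interchange[OF d d' s(2,4) t(2,4)])
next
  fix A B :: "('o, 'm) dd_tricat" and f f' s
  assume o: "A \<in> T2_Ob" "B \<in> T2_Ob" and h: "f \<in> T2_Hom A B" "f' \<in> T2_Hom A B" and st: "s \<in> T2_Hom2 A B f f'"
  from h(1) o obtain F where F: "f = canonical_functor A B F" "braided A B F" by (rule T2_HomE)
  from h(2) o obtain G where G: "f' = canonical_functor A B G" "braided A B G" by (rule T2_HomE)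
  note f = F G
  from st F G o obtain s' where s: "s = canonical_trans A B f f' s'"
    "mon_trans (tri_cat A) (tri_cat B) F G s'" by (rule T2_Hom2E)
  note d = braided_data[OF o f(2)] braided_data[OF o f(4)]
  note i = braided_id[OF o(1)] braided_id[OF o(2)]
  show "T2_hcomp A A B (T2_id1 A) (T2_id1 A) f f' s (T2_id2 A A (T2_id1 A)) = s
      \<and> T2_hcomp A B B f f' (T2_id1 B) (T2_id1 B) (T2_id2 B B (T2_id1 B)) s = s"
    unfolding T2_id1_def s(1) f(1,3) id2_canonical
      hcomp_canonical[OF o(1,1,2) i(1,1) f(2,4) mon_trans_id2[OF o(1,1) i(1)] s(2)]
      hcomp_canonical[OF o(1,2,2) f(2,4) i(2,2) s(2) mon_trans_id2[OF o(2,2) i(2)]]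
      comp_fun_id[OF d(1)] comp_fun_id[OF d(2)]
    by (intro conjI canonical_trans_cong hcomp_id_fun[OF d s(2)])
next
  fix A B C D :: "('o, 'm) dd_tricat" and f f' g g' h h' s t u
  assume o: "A \<in> T2_Ob" "B \<in> T2_Ob" "C \<in> T2_Ob" "D \<in> T2_Ob"
    and h: "f \<in> T2_Hom A B" "f' \<in> T2_Hom A B" "g \<in> T2_Hom B C" "g' \<in> T2_Hom B C" "h \<in> T2_Hom C D" "h' \<in> T2_Hom C D"
    and st: "s \<in> T2_Hom2 A B f f'" "t \<in> T2_Hom2 B C g g'" "u \<in> T2_Hom2 C D h h'"
  from h(1) o(1,2) obtain F where F: "f = canonical_functor A B F" "braided A B F" by (rule T2_HomE)
  from h(2) o(1,2) obtain F' where F': "f' = canonical_functor A B F'" "braided A B F'" by (rule T2_HomE)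
  from h(3) o(2,3) obtain G where G: "g = canonical_functor B C G" "braided B C G" by (rule T2_HomE)
  from h(4) o(2,3) obtain G' where G': "g' = canonical_functor B C G'" "braided B C G'" by (rule T2_HomE)
  from h(5) o(3,4) obtain H where H: "h = canonical_functor C D H" "braided C D H" by (rule T2_HomE)
  from h(6) o(3,4) obtain H' where H': "h' = canonical_functor C D H'" "braided C D H'" by (rule T2_HomE)
  note f = F F' and g = G G' and hh = H H'
  from st(1) F F' o(1,2) obtain s' where s: "s = canonical_trans A B f f' s'"
    "mon_trans (tri_cat A) (tri_cat B) F F' s'" by (rule T2_Hom2E)
  from st(2) G G' o(2,3) obtain t' where t: "t = canonical_trans B C g g' t'"
    "mon_trans (tri_cat B) (tri_cat C) G G' t'" by (rule T2_Hom2E)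
  from st(3) H H' o(3,4) obtain u' where u: "u = canonical_trans C D h h' u'"
    "mon_trans (tri_cat C) (tri_cat D) H H' u'" by (rule T2_Hom2E)
  note d = braided_data[OF o(1,2) f(2)] braided_data[OF o(1,2) f(4)]
    and d' = braided_data[OF o(2,3) g(2)] braided_data[OF o(2,3) g(4)]
    and d'' = braided_data[OF o(3,4) hh(2)] braided_data[OF o(3,4) hh(4)]
  \<comment> \<open>The two sides run between functors bracketed differently;
    \<open>comp_fun_assoc\<close> identifies these before the families are compared.\<close>
  show "T2_hcomp A B D f f' (T2_comp1 B C D h g) (T2_comp1 B C D h' g') (T2_hcomp B C D g g' h h' u t) s
      = T2_hcomp A C D (T2_comp1 A B C g f) (T2_comp1 A B C g' f') h h' u (T2_hcomp A B C f f' g g' t s)"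
    unfolding s(1) t(1) u(1) f(1,3) g(1,3) hh(1,3) comp1_canonical
      hcomp_canonical[OF o(2-4) g(2,4) hh(2,4) t(2) u(2)] hcomp_canonical[OF o(1-3) f(2,4) g(2,4) s(2) t(2)]
      hcomp_canonical[OF o(1,2,4) f(2,4) braided_comp[OF o(2-4) g(2) hh(2)] braided_comp[OF o(2-4) g(4) hh(4)]
        s(2) mon_trans_hcomp[OF d' d'' t(2) u(2)]]
      hcomp_canonical[OF o(1,3,4) braided_comp[OF o(1-3) f(2) g(2)] braided_comp[OF o(1-3) f(4) g(4)] hh(2,4)
        mon_trans_hcomp[OF d d' s(2) t(2)] u(2)]
      comp_fun_assoc[OF d(1) d'(1) d''(1)] comp_fun_assoc[OF d(2) d'(2) d''(2)]
    by (intro canonical_trans_cong hcomp_assoc_components[OF d d' d'' s(2) t(2) u(2)])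
qed

end
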